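(* Let $N \geq 2$ and $s>0$, and write $m=\lfloor s\rfloor+1$ and $\{s\}=s-\lfloor s\rfloor$. Then, for all $u \in C_{0}^{\infty}(\mathbb{R}^{N})$, $$\left(\int_{\mathbb{R}^{N}}\left|(-\Delta)^{s/2}u\right|^{2}dx\right)^{\frac{1}{2}}\left(\int_{\mathbb{R}^{N}}|x|^{2}|u|^{2}\,dx\right)^{\frac{1}{2}}-\frac{N+s-1}{2}\int_{\mathbb{R}^{N}}\left|(-\Delta)^{\frac{s-1}{4}}u\right|^{2}dx\ \geq\ \sum_{j=0}^{m-1}d_{s}^{2}\left(u,\mathcal{G}_{j}^{s}\right)+\{s\}\,d_{s}^{2}\left(u,\mathcal{G}_{m}^{s}\right)+\left(1-\{s\}\right)d_{s}^{2}\left(u,\mathcal{G}_{m+1}^{s}\right),$$ where $$d_{s}^{2}(u,\mathcal{G}):=\inf_{w \in \mathcal{G}}\int_{\mathbb{R}^{N}}\left|(-\Delta)^{\frac{s-1}{4}}(u-w)\right|^{2}dx.$$ In particular, when $s$ is an integer, the right-hand side consists of exactly $s+2$ terms, and all of its constants are equal to $1$. In general, the constants on the right-hand side add up to $\lfloor s\rfloor+2$, and they cannot be improved, with the possible exception of the constant $\{s\}$ of the $m$-th term (the term involving $\mathcal{G}_m^s$), which vanishes when $s$ is an integer.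
   Context: Functions may be complex-valued. The Fourier transform is $\mathcal{F}(f)(\xi)=\widehat f(\xi)=\int_{\mathbb{R}^N} f(x)e^{-2\pi i x\cdot\xi}\,dx$, with inverse $\mathcal{F}^{-1}$. For $\kappa\in\mathbb{R}$, $(-\Delta)^{\kappa/2}$ is defined by $\mathcal{F}((-\Delta)^{\kappa/2}u)(\xi)=(2\pi|\xi|)^{\kappa}\widehat u(\xi)$, so that $\int_{\mathbb{R}^N}|(-\Delta)^{\kappa/2}u|^2dx=(2\pi)^{2\kappa}\int_{\mathbb{R}^N}|\xi|^{2\kappa}|\widehat u(\xi)|^2d\xi$. For $j\ge 0$, $\mathcal{Y}_j$ is the space of harmonic polynomials on $\mathbb{R}^N$ of degree at most $j$ with complex coefficients. With $\sigma:=1+s$, set $$\mathcal{G}_{j}^{s}:=\left\{\mathcal{F}^{-1}\left(P\,e^{-\lambda|\xi|^{\sigma}/\sigma}\right):\ P \in \mathcal{Y}_{j},\ \lambda>0\right\},\qquad j=0,1,\ldots,m,$$ $$\mathcal{G}_{m+1}^{s}:=\left\{\mathcal{F}^{-1}\left(\left(P+d|\xi|^{\sigma}\right)e^{-\lambda|\xi|^{\sigma}/\sigma}\right):\ P \in \mathcal{Y}_{m},\ d \in \mathbb{C},\ \lambda>0\right\}.$$ "A constant cannot be improved" means that it cannot be increased, for the inequality to hold for all $u$, when the other constants are kept fixed. *)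

theory Defs
  imports "HOL-Analysis.Analysis"
begin

definition partial :: "'n::finite \<Rightarrow> (real^'n \<Rightarrow> complex) \<Rightarrow> real^'n \<Rightarrow> complex" where
  "partial i f x = vector_derivative (\<lambda>t. f (x + t *\<^sub>R axis i 1)) (at 0)"

(* f is C-infinity: every iterated partial derivative is (Frechet) differentiable everywhere,
   hence in particular exists and is continuous. *)
definition smooth :: "(real^'n::finite \<Rightarrow> complex) \<Rightarrow> bool" where
  "smooth f \<longleftrightarrow> (\<forall>is x. foldr partial is f differentiable (at x))"

definition test_functions :: "(real^'n::finite \<Rightarrow> complex) set" where
  "test_functions = {f. smooth f \<and> compact (closure {x. f x \<noteq> 0})}"

definition fourier :: "(real^'n::finite \<Rightarrow> complex) \<Rightarrow> real^'n \<Rightarrow> complex" where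
  "fourier f \<xi> = (LINT x|lborel. f x * cis (- (2 * pi * (x \<bullet> \<xi>))))"

definition inv_fourier :: "(real^'n::finite \<Rightarrow> complex) \<Rightarrow> real^'n \<Rightarrow> complex" where
  "inv_fourier g x = (LINT \<xi>|lborel. g \<xi> * cis (2 * pi * (x \<bullet> \<xi>)))"

(* frac_laplacian a is the Fourier multiplier (-Laplacian)^a with symbol (2 pi |xi|)^(2 a), so
   (-Laplacian)^(kappa/2) is frac_laplacian (kappa/2).  The value 0 powr b = 0 only affects the
   null set {0}.  Both Fourier transforms are absolutely convergent integrals for all functions to
   which this operator is applied below: test functions and elements of extremals are integrable,
   and the exponents 2 a that occur are greater than -1/2, whereas the dimension is at least 2. *)
definition frac_laplacian :: "real \<Rightarrow> (real^'n::finite \<Rightarrow> complex) \<Rightarrow> real^'n \<Rightarrow> complex" where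
  "frac_laplacian a u =
     inv_fourier (\<lambda>\<xi>. complex_of_real ((2 * pi * norm \<xi>) powr (2 * a)) * fourier u \<xi>)"

(* Complex polynomial functions of total degree at most j; the multi-indices are the
   functions \<alpha> :: 'n \<Rightarrow> nat. *)
definition polynomials :: "nat \<Rightarrow> (real^'n::finite \<Rightarrow> complex) set" where
  "polynomials j =
     {P. \<exists>c :: ('n \<Rightarrow> nat) \<Rightarrow> complex. \<forall>x.
        P x = (\<Sum>\<alpha> | (\<Sum>i\<in>UNIV. \<alpha> i) \<le> j. c \<alpha> * complex_of_real (\<Prod>i\<in>UNIV. (x $ i) ^ \<alpha> i))}"

definition laplacian :: "(real^'n::finite \<Rightarrow> complex) \<Rightarrow> real^'n \<Rightarrow> complex" where
  "laplacian f x = (\<Sum>i\<in>UNIV. partial i (partial i f) x)"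

definition harmonic_polynomials :: "nat \<Rightarrow> (real^'n::finite \<Rightarrow> complex) set" where
  "harmonic_polynomials j = {P \<in> polynomials j. \<forall>x. laplacian P x = 0}"

(* The families G_j^s: the first case is j = 0, ..., m with m = floor s + 1; the second is
   meant for j = m + 1 only. *)
definition extremals :: "real \<Rightarrow> nat \<Rightarrow> (real^'n::finite \<Rightarrow> complex) set" where
  "extremals s j =
     (let m = nat \<lfloor>s\<rfloor> + 1; \<sigma> = 1 + s in
      if j \<le> m then
        {inv_fourier (\<lambda>\<xi>. P \<xi> * complex_of_real (exp (- \<tau> * norm \<xi> powr \<sigma> / \<sigma>))) | P \<tau>.
           P \<in> harmonic_polynomials j \<and> \<tau> > 0}
      else
        {inv_fourier (\<lambda>\<xi>. (P \<xi> + d * complex_of_real (norm \<xi> powr \<sigma>))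
             * complex_of_real (exp (- \<tau> * norm \<xi> powr \<sigma> / \<sigma>))) | P d \<tau>.
           P \<in> harmonic_polynomials m \<and> \<tau> > 0})"

definition dist_sq ::
    "real \<Rightarrow> (real^'n::finite \<Rightarrow> complex) \<Rightarrow> (real^'n \<Rightarrow> complex) set \<Rightarrow> real" where
  "dist_sq s u G =
     (INF w\<in>G. LINT x|lborel. (cmod (frac_laplacian ((s - 1) / 4) (\<lambda>y. u y - w y) x))\<^sup>2)"

definition deficit :: "real \<Rightarrow> (real^'n::finite \<Rightarrow> complex) \<Rightarrow> real" where
  "deficit s u =
     sqrt (LINT x|lborel. (cmod (frac_laplacian (s / 2) u x))\<^sup>2)
       * sqrt (LINT x|lborel. (norm x)\<^sup>2 * (cmod (u x))\<^sup>2)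
     - (real CARD('n) + s - 1) / 2
       * (LINT x|lborel. (cmod (frac_laplacian ((s - 1) / 4) u x))\<^sup>2)"

definition stability_const :: "real \<Rightarrow> nat \<Rightarrow> real" where
  "stability_const s j =
     (let m = nat \<lfloor>s\<rfloor> + 1 in if j < m then 1 else if j = m then frac s else 1 - frac s)"

end

theory Submission
  imports Defs "HOL-Probability.Characteristic_Functions"
begin

text \<open>
  Let \<open>f\<close> be the Fourier transform of \<open>u\<close>, \<open>\<sigma> = 1 + s\<close>, and let \<open>M\<close>, \<open>A\<close>, \<open>B\<close> be the integrals of
  \<open>|\<xi>|^(s - 1) |f|^2\<close>, \<open>|\<xi>|^(2 s) |f|^2\<close> and \<open>|\<nabla>f|^2\<close>. Up to a constant factor the deficit is
  \<open>sqrt A sqrt B - (N + s - 1) / 2 M\<close>, that is, the infimum over \<open>\<tau> > 0\<close> of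
  \<open>(B / \<tau> + \<tau> A) / 2 - (N + s - 1) / 2 M\<close>, and integration by parts turns this quadratic form into
  \<open>1 / (2 \<tau>)\<close> times the integral of \<open>|\<nabla>f + \<tau> |\<xi>|^(s - 1) \<xi> f|^2\<close>. Relative to the weight \<open>|\<xi>|^(s - 1)\<close>
  its eigenvalues are \<open>k + n \<sigma>\<close>; the eigenfunctions are a harmonic polynomial of degree \<open>k\<close> times a
  polynomial of degree \<open>n\<close> in \<open>|\<xi>|^\<sigma>\<close> times \<open>exp (- \<tau> |\<xi>|^\<sigma> / \<sigma>)\<close>, and they are complete. For \<open>j \<le> m\<close> the
  family \<open>G_j\<close> contains all eigenfunctions with eigenvalue at most \<open>j\<close> (for \<open>j = m + 1\<close>: at most \<open>\<sigma>\<close>;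
  for integral \<open>s\<close> the case \<open>j = m\<close>, whose constant then vanishes, is to be excluded),
  so a component of eigenvalue \<open>\<nu>\<close> enters only those distances whose constants add up to at most \<open>\<nu>\<close>.

  For the sharpness take the eigenfunction \<open>(\<xi>_1 + i \<xi>_2)^l exp (- |\<xi>|^\<sigma> / \<sigma>)\<close> of eigenvalue \<open>l\<close>. Cutting off
  its inverse Fourier transform by a radial bump function gives test functions whose deficit is
  asymptotically at most \<open>l\<close> times their squared norm and which still transform by \<open>cis (l \<theta>)\<close> under
  rotations of the first two coordinates, hence stay orthogonal to polynomials of degree less than \<open>l\<close>.
\<close>

section \<open>Lebesgue measure under affine and orthogonal maps\<close>

text \<open>The origin is the main obstacle: the weight \<open>|\<xi>|^(s - 1)\<close> is singular
  there for \<open>s < 1\<close>, and \<open>|\<xi>|^\<sigma>\<close> is in general not smooth. All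
  functions are therefore handled off the origin, with an exponent recording their size near it;
  integration by parts survives because in dimension at least 2 almost every line of a given
  direction misses the origin. The limited smoothness also limits the decay of the members of
  \<open>G_j\<close>, whose integrability has to be proved before Fourier inversion identifies their
  transforms. The parameter \<open>\<tau>\<close> is not optimized against the distances: each
  family contains all \<open>\<tau> > 0\<close>, so the bound holds for every form, and the infimum
  is taken at the end. Completeness comes from splitting polynomials into harmonic ones times powers
  of the norm, which leaves Laguerre approximation in \<open>|\<xi>|^\<sigma>\<close>. For sharpness
  an upper bound of the gradient of the truncated functions is enough.\<close>

lemma lborel_integral_affine:
  fixes f :: "'a::euclidean_space \<Rightarrow> 'b::{banach, second_countable_topology}"
  assumes "c \<noteq> 0" and [measurable]: "f \<in> borel_measurable borel"
  shows "(LINT x|lborel. f x) = \<bar>c\<bar> ^ DIM('a) *\<^sub>R (LINT x|lborel. f (t + c *\<^sub>R x))"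
  by (subst lborel_affine[OF assms(1), of t]) (simp add: integral_density integral_distr)

lemma lborel_integrable_affine:
  fixes f :: "'a::euclidean_space \<Rightarrow> 'b::{banach, second_countable_topology}"
  assumes "c \<noteq> 0" and f: "integrable lborel f"
  shows "integrable lborel (\<lambda>x. f (t + c *\<^sub>R x))"
proof -
  have [measurable]: "f \<in> borel_measurable borel" using f by auto
  have "integrable (density (distr lborel borel (\<lambda>x. t + c *\<^sub>R x)) (\<lambda>_. ennreal (\<bar>c\<bar> ^ DIM('a)))) f"
    using f lborel_affine[OF assms(1), of t] by (metis ennreal_power abs_ge_zero)
  then have "integrable lborel (\<lambda>x. \<bar>c\<bar> ^ DIM('a) *\<^sub>R f (t + c *\<^sub>R x))"
    by (simp add: integrable_density integrable_distr_eq)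
  from integrable_scaleR_right[OF this, of "inverse (\<bar>c\<bar> ^ DIM('a))"] show ?thesis using assms(1)
    by simp
qed

lemma lborel_integral_translation:
  fixes f :: "'a::euclidean_space \<Rightarrow> 'b::{banach, second_countable_topology}"
  assumes [measurable]: "f \<in> borel_measurable borel"
  shows "(LINT x|lborel. f (x + t)) = (LINT x|lborel. f x)"
  using lborel_integral_affine[of 1 f t] by (simp add: add.commute)

lemma lborel_integral_uminus:
  fixes f :: "'a::euclidean_space \<Rightarrow> 'b::{banach, second_countable_topology}"
  assumes [measurable]: "f \<in> borel_measurable borel"
  shows "(LINT x|lborel. f (- x)) = (LINT x|lborel. f x)"
  using lborel_integral_affine[of "-1" f 0] by simp

lemma nn_integral_lborel_translation:
  fixes f :: "'a::euclidean_space \<Rightarrow> ennreal"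
  assumes [measurable]: "f \<in> borel_measurable borel"
  shows "(\<integral>\<^sup>+x. f (x + t) \<partial>lborel) = (\<integral>\<^sup>+x. f x \<partial>lborel)"
  by (subst (2) lborel_distr_plus[of t, symmetric]) (simp add: nn_integral_distr add.commute)

lemma integrable_pair_bound:
  fixes F :: "'a::euclidean_space \<times> 'b::euclidean_space \<Rightarrow> 'c::{banach, second_countable_topology}"
  assumes [measurable]: "F \<in> borel_measurable (lborel \<Otimes>\<^sub>M lborel)"
    and u: "integrable lborel u" and v: "integrable lborel v"
    and b: "\<And>x y. norm (F (x, y)) \<le> u x * v y"
  shows "integrable (lborel \<Otimes>\<^sub>M lborel) F"
proof -
  have [measurable]: "u \<in> borel_measurable borel" "v \<in> borel_measurable borel" using u v by auto
  have "(\<integral>\<^sup>+z. norm (F z) \<partial>(lborel \<Otimes>\<^sub>M lborel)) \<le> (\<integral>\<^sup>+z. ennreal (norm (u (fst z))) * ennreal (norm (v (snd z))) \<partial>(lborel \<Otimes>\<^sub>M lborel))"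
  proof (rule nn_integral_mono)
    fix z :: "'a \<times> 'b"
    \<comment> \<open>Only the product \<open>u x * v y\<close> is known to be nonnegative; both
      factors may be negative, so absolute values are taken.\<close>
    have "norm (F z) \<le> norm (u (fst z)) * norm (v (snd z))"
      using b[of "fst z" "snd z"] by (simp add: abs_mult[symmetric])
    then show "ennreal (norm (F z)) \<le> ennreal (norm (u (fst z))) * ennreal (norm (v (snd z)))"
      by (simp add: ennreal_mult[symmetric] ennreal_leI)
  qed
  also have "\<dots> = (\<integral>\<^sup>+x. \<integral>\<^sup>+y. ennreal (norm (u x)) * ennreal (norm (v y)) \<partial>lborel \<partial>lborel)"
    by (subst lborel.nn_integral_fst[symmetric]) auto
  also have "\<dots> = (\<integral>\<^sup>+x. ennreal (norm (u x)) \<partial>lborel) * (\<integral>\<^sup>+y. ennreal (norm (v y)) \<partial>lborel)"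
    by (simp add: nn_integral_cmult nn_integral_multc)
  also have "\<dots> < \<infinity>"
    using u v by (simp add: integrable_iff_bounded ennreal_mult_less_top)
  finally show ?thesis by (simp add: integrable_iff_bounded)
qed

text \<open>Uniqueness of Haar measure takes the place of determinants: the image measure
  \<open>M\<close> is translation invariant, so Fubini applied to \<open>g y * f (x + y)\<close>
  gives \<open>M A * vol (ball) = vol A * M (ball)\<close>, and \<open>R\<close> maps the unit ball
  onto itself.\<close>

lemma lborel_distr_orthogonal:
  fixes R :: "'a::euclidean_space \<Rightarrow> 'a"
  assumes R: "orthogonal_transformation R"
  shows "distr lborel borel R = lborel"
proof -
  interpret R: bounded_linear R
    using R by (simp add: orthogonal_transformation_linear linear_conv_bounded_linear[symmetric])
  have Rm[measurable]: "R \<in> borel_measurable borel"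
    using R.continuous_on[OF continuous_on_id] by (intro borel_measurable_continuous_onI) simp
  define M where "M = distr lborel borel R"
  have [simp]: "sets M = sets borel" "space M = UNIV" by (auto simp: M_def)
  have Minv: "(\<integral>\<^sup>+x. g (x + t) \<partial>M) = (\<integral>\<^sup>+x. g x \<partial>M)" if [measurable]: "g \<in> borel_measurable borel" for g t
  proof -
    obtain r where r: "t = R r" using orthogonal_transformation_surj[OF R] by (metis surjD)
    have "(\<integral>\<^sup>+x. g (x + t) \<partial>M) = (\<integral>\<^sup>+x. g (R (x + r)) \<partial>lborel)"
      by (simp add: M_def nn_integral_distr R.add r)
    also have "\<dots> = (\<integral>\<^sup>+x. g (R x) \<partial>lborel)" by (rule nn_integral_lborel_translation) simp
    finally show ?thesis by (simp add: M_def nn_integral_distr)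
  qed
  have ball: "R -` ball 0 r = ball 0 r" for r
    using orthogonal_transformation_norm[OF R] by auto
  have Mball: "emeasure M (ball 0 r) = emeasure lborel (ball (0::'a) r)" for r
    by (simp add: M_def emeasure_distr ball)
  interpret M: sigma_finite_measure M
  proof
    show "\<exists>A. countable A \<and> A \<subseteq> sets M \<and> \<Union> A = space M \<and> (\<forall>a\<in>A. emeasure M a \<noteq> \<infinity>)"
    proof (intro exI[of _ "range (\<lambda>n::nat. ball 0 (real n))"] conjI)
      show "\<Union> (range (\<lambda>n::nat. ball (0::'a) (real n))) = space M"
        by (auto simp: reals_Archimedean2)
      show "\<forall>a\<in>range (\<lambda>n::nat. ball (0::'a) (real n)). emeasure M a \<noteq> \<infinity>"
        by (auto simp: Mball emeasure_ball)
    qed auto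
  qed
  interpret P: pair_sigma_finite M lborel ..
  have "emeasure M A = emeasure lborel A" if A[measurable]: "A \<in> sets borel" for A
  proof -
    define f :: "'a \<Rightarrow> ennreal" where "f = indicator A"
    \<comment> \<open>The unit ball is chosen because \<open>R\<close> preserves it and because it
      is symmetric, which turns \<open>g (y - x)\<close> into \<open>g (x - y)\<close>
      below.\<close>
    define g :: "'a \<Rightarrow> ennreal" where "g = indicator (ball 0 1)"
    have [measurable]: "f \<in> borel_measurable borel" "g \<in> borel_measurable borel" unfolding f_def g_def by (auto intro!: borel_measurable_indicator)
    have Mset[measurable_cong]: "sets M = sets borel" by simp
    have "(\<integral>\<^sup>+x. f x \<partial>M) * (\<integral>\<^sup>+y. g y \<partial>lborel) = (\<integral>\<^sup>+y. g y * (\<integral>\<^sup>+x. f (x + y) \<partial>M) \<partial>lborel)"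
      by (subst Minv) (auto simp: nn_integral_multc mult.commute)
    also have "\<dots> = (\<integral>\<^sup>+y. (\<integral>\<^sup>+x. g y * f (x + y) \<partial>M) \<partial>lborel)"
      by (simp add: nn_integral_cmult)
    also have "\<dots> = (\<integral>\<^sup>+x. (\<integral>\<^sup>+y. g y * f (x + y) \<partial>lborel) \<partial>M)"
      by (rule P.Fubini') measurable
    also have "\<dots> = (\<integral>\<^sup>+x. (\<integral>\<^sup>+y. g (y - x) * f y \<partial>lborel) \<partial>M)"
    proof (rule nn_integral_cong)
      fix x show "(\<integral>\<^sup>+y. g y * f (x + y) \<partial>lborel) = (\<integral>\<^sup>+y. g (y - x) * f y \<partial>lborel)"
        using nn_integral_lborel_translation[of "\<lambda>y. g (y - x) * f y" x] by (simp add: add.commute)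
    qed
    also have "\<dots> = (\<integral>\<^sup>+y. (\<integral>\<^sup>+x. g (y - x) * f y \<partial>M) \<partial>lborel)"
      by (rule P.Fubini'[symmetric]) measurable
    also have "\<dots> = (\<integral>\<^sup>+y. (\<integral>\<^sup>+x. g x \<partial>M) * f y \<partial>lborel)"
    proof (rule nn_integral_cong)
      fix y
      have "(\<integral>\<^sup>+x. g (y - x) * f y \<partial>M) = (\<integral>\<^sup>+x. g (y - x) \<partial>M) * f y" by (simp add: nn_integral_multc)
      also have "(\<integral>\<^sup>+x. g (y - x) \<partial>M) = (\<integral>\<^sup>+x. g (x + (- y)) \<partial>M)"
        by (intro nn_integral_cong) (simp add: g_def indicator_def norm_minus_commute)
      also have "\<dots> = (\<integral>\<^sup>+x. g x \<partial>M)" by (rule Minv) simp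
      finally show "(\<integral>\<^sup>+x. g (y - x) * f y \<partial>M) = (\<integral>\<^sup>+x. g x \<partial>M) * f y" .
    qed
    also have "\<dots> = (\<integral>\<^sup>+x. g x \<partial>M) * (\<integral>\<^sup>+y. f y \<partial>lborel)" by (simp add: nn_integral_cmult)
    finally have "emeasure M A * emeasure lborel (ball (0::'a) 1) = emeasure lborel A * emeasure lborel (ball (0::'a) 1)"
      by (simp add: f_def g_def Mball mult.commute)
    moreover have "emeasure lborel (ball (0::'a) 1) \<noteq> 0" "emeasure lborel (ball (0::'a) 1) \<noteq> \<infinity>"
      by (auto simp: emeasure_ball unit_ball_vol_pos less_imp_neq[symmetric])
    ultimately show ?thesis
      by (metis mult_divide_eq_ennreal infinity_ennreal_def)
  qed
  then show ?thesis by (intro measure_eqI) (auto simp: M_def)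
qed

lemma lborel_integral_orthogonal:
  fixes R :: "'a::euclidean_space \<Rightarrow> 'a" and f :: "'a \<Rightarrow> 'b::{banach, second_countable_topology}"
  assumes R: "orthogonal_transformation R" and [measurable]: "f \<in> borel_measurable borel"
  shows "(LINT x|lborel. f (R x)) = (LINT x|lborel. f x)"
proof -
  have [measurable]: "R \<in> borel_measurable borel"
    using R by (intro borel_measurable_continuous_onI linear_continuous_on)
      (simp add: orthogonal_transformation_linear linear_conv_bounded_linear[symmetric])
  show ?thesis
    by (subst (2) lborel_distr_orthogonal[OF R, symmetric]) (simp add: integral_distr)
qed

section \<open>Products over the coordinates and Gaussian integrals\<close>

lemma integral_prod_Basis:
  fixes f :: "'a::euclidean_space \<Rightarrow> real \<Rightarrow> complex"
  assumes "\<And>b. b \<in> Basis \<Longrightarrow> integrable lborel (f b)"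
  shows "(LINT x|lborel. (\<Prod>b\<in>Basis. f b (x \<bullet> b))) = (\<Prod>b\<in>Basis. (LINT t|lborel. f b t))"
    and "integrable lborel (\<lambda>x. (\<Prod>b\<in>Basis. f b (x \<bullet> b)))"
proof -
  interpret product_sigma_finite "\<lambda>_::'a. lborel :: real measure" ..
  have [measurable]: "b \<in> Basis \<Longrightarrow> f b \<in> borel_measurable borel" for b using assms[of b] by auto
  have [measurable]: "(\<lambda>x. (\<Prod>b\<in>Basis. f b (x \<bullet> b))) \<in> borel_measurable borel" by measurable
  show "(LINT x|lborel. (\<Prod>b\<in>Basis. f b (x \<bullet> b))) = (\<Prod>b\<in>Basis. (LINT t|lborel. f b t))"
    by (subst lborel_eq, subst integral_distr)
       (auto simp: product_integral_prod[OF _ assms, symmetric] intro!: Bochner_Integration.integral_cong prod.cong)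
  have "integrable (\<Pi>\<^sub>M b\<in>Basis. lborel) (\<lambda>x. (\<Prod>b\<in>Basis. f b (x b)))"
    by (intro product_integrable_prod assms) auto
  then have "integrable (\<Pi>\<^sub>M b\<in>Basis. lborel) (\<lambda>x. (\<Prod>b\<in>Basis. f b ((\<Sum>b\<in>Basis. x b *\<^sub>R b) \<bullet> b)))"
    by (subst Bochner_Integration.integrable_cong[OF refl]) (auto intro!: prod.cong)
  then show "integrable lborel (\<lambda>x. (\<Prod>b\<in>Basis. f b (x \<bullet> b)))"
    by (subst lborel_eq, subst integrable_distr_eq) auto
qed

text \<open>Up to the factor \<open>sqrt (2 * pi)\<close> this is the characteristic function of the
  standard normal distribution.\<close>

lemma gauss_cis_real:
  "(LINT x|lborel. complex_of_real (exp (- x\<^sup>2 / 2)) * cis (t * x)) = of_real (sqrt (2 * pi)) * of_real (exp (- t\<^sup>2 / 2))"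
  "integrable lborel (\<lambda>x. complex_of_real (exp (- x\<^sup>2 / 2)) * cis (t * x))"
proof -
  have e: "exp (- x\<^sup>2 / 2) = sqrt (2 * pi) * std_normal_density x" for x by (simp add: std_normal_density_def)
  have "char std_normal_distribution t = (LINT x|lborel. std_normal_density x *\<^sub>R iexp (t * x))"
    unfolding char_def by (subst integral_density) (auto simp: normal_density_nonneg)
  then have c: "(LINT x|lborel. std_normal_density x *\<^sub>R iexp (t * x)) = of_real (exp (- t\<^sup>2 / 2))"
    by (simp add: char_std_normal_distribution)
  have eq: "(\<lambda>x. complex_of_real (exp (- x\<^sup>2 / 2)) * cis (t * x)) = (\<lambda>x. of_real (sqrt (2 * pi)) * (std_normal_density x *\<^sub>R iexp (t * x)))"
    by (intro ext) (simp only: e of_real_mult scaleR_conv_of_real cis_conv_exp mult.assoc)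
  show "(LINT x|lborel. complex_of_real (exp (- x\<^sup>2 / 2)) * cis (t * x)) = of_real (sqrt (2 * pi)) * of_real (exp (- t\<^sup>2 / 2))"
    unfolding eq by (subst integral_mult_right_zero) (simp only: c)
  have "integrable lborel (\<lambda>x. std_normal_density x *\<^sub>R iexp (t * x))"
    by (rule Bochner_Integration.integrable_bound[of _ "\<lambda>x. std_normal_density x"]) (auto intro: integrable_normal_density)
  then show "integrable lborel (\<lambda>x. complex_of_real (exp (- x\<^sup>2 / 2)) * cis (t * x))"
    unfolding eq by (rule integrable_mult_right)
qed

lemma cis_sum: "finite S \<Longrightarrow> cis (\<Sum>i\<in>S. f i) = (\<Prod>i\<in>S. cis (f i))"
  by (induction S rule: finite_induct) (auto simp: cis_mult[symmetric])

text \<open>Both the Gaussian and the character factor over the coordinates.\<close>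

lemma gauss_cis:
  fixes \<xi> :: "'a::euclidean_space"
  shows "(LINT x|lborel. complex_of_real (exp (- (norm x)\<^sup>2 / 2)) * cis (x \<bullet> \<xi>)) = of_real (sqrt (2 * pi) ^ DIM('a) * exp (- (norm \<xi>)\<^sup>2 / 2))"
    and "integrable lborel (\<lambda>x::'a. exp (- (norm x)\<^sup>2 / 2))"
proof -
  have n: "(norm x)\<^sup>2 = (\<Sum>b\<in>Basis. (x \<bullet> b)\<^sup>2)" for x :: 'a
    by (subst power2_norm_eq_inner, subst euclidean_inner) (simp add: power2_eq_square)
  have "exp (- (norm x)\<^sup>2 / 2) = (\<Prod>b\<in>Basis. exp (- (x \<bullet> b)\<^sup>2 / 2))" for x :: 'a
    by (subst exp_sum[symmetric]) (auto simp: n sum_negf sum_divide_distrib)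
  then have e: "complex_of_real (exp (- (norm x)\<^sup>2 / 2)) = (\<Prod>b\<in>Basis. of_real (exp (- (x \<bullet> b)\<^sup>2 / 2)))" for x :: 'a
    by (simp only: of_real_prod)
  have eq: "complex_of_real (exp (- (norm x)\<^sup>2 / 2)) * cis (x \<bullet> \<xi>) = (\<Prod>b\<in>Basis. of_real (exp (- (x \<bullet> b)\<^sup>2 / 2)) * cis ((\<xi> \<bullet> b) * (x \<bullet> b)))" for x \<xi> :: 'a
    by (simp only: e prod.distrib cis_sum[OF finite_Basis, symmetric] euclidean_inner[of x \<xi>]) (simp add: mult.commute)
  show "(LINT x|lborel. complex_of_real (exp (- (norm x)\<^sup>2 / 2)) * cis (x \<bullet> \<xi>)) = of_real (sqrt (2 * pi) ^ DIM('a) * exp (- (norm \<xi>)\<^sup>2 / 2))"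
    unfolding eq
    by (subst integral_prod_Basis(1)[OF gauss_cis_real(2)])
       (simp only: gauss_cis_real(1) prod.distrib of_real_mult e prod_constant of_real_power)
  have "integrable lborel (\<lambda>x::'a. complex_of_real (exp (- (norm x)\<^sup>2 / 2)) * cis (x \<bullet> 0))"
    unfolding eq by (rule integral_prod_Basis(2)[OF gauss_cis_real(2)])
  then have "integrable lborel (\<lambda>x::'a. complex_of_real (exp (- (norm x)\<^sup>2 / 2)))" by simp
  from integrable_Re[OF this] show "integrable lborel (\<lambda>x::'a. exp (- (norm x)\<^sup>2 / 2))"
    by (simp only: Re_complex_of_real)
qed

section \<open>Rapidly decreasing functions that may be singular at the origin\<close>

text \<open>The exponent \<open>a\<close> measures the size at the origin, singular for
  \<open>a < 0\<close>, while every polynomial decay rate is demanded at infinity. The value at the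
  origin itself is left free, which agrees with the convention \<open>0 powr b = 0\<close> and means
  that functions are only considered up to the null set {0}.\<close>

definition rapid :: "real \<Rightarrow> ('a::euclidean_space \<Rightarrow> 'b::real_normed_vector) \<Rightarrow> bool" where
  "rapid a f \<longleftrightarrow> continuous_on (- {0}) f \<and>
     (\<forall>K::nat. \<exists>C. \<forall>x. x \<noteq> 0 \<longrightarrow> norm (f x) \<le> C * (norm x powr a / (1 + norm x) ^ K))"

lemma rapid_cont: "rapid a f \<Longrightarrow> continuous_on (- {0}) f"
  by (simp add: rapid_def)

lemma rapid_boundE:
  assumes "rapid a f"
  obtains C where "C > 0" "\<And>x. x \<noteq> 0 \<Longrightarrow> norm (f x) \<le> C * (norm x powr a / (1 + norm x) ^ K)"
proof -
  obtain C where C: "\<And>x. x \<noteq> 0 \<Longrightarrow> norm (f x) \<le> C * (norm x powr a / (1 + norm x) ^ K)"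
    using assms unfolding rapid_def by metis
  have "norm (f x) \<le> (\<bar>C\<bar> + 1) * (norm x powr a / (1 + norm x) ^ K)" if "x \<noteq> 0" for x
    using C[OF that] by (rule order_trans) (intro mult_right_mono, auto)
  then show ?thesis by (intro that[of "\<bar>C\<bar> + 1"]) auto
qed

lemma rapid_measurable: 
  fixes f :: "'a::euclidean_space \<Rightarrow> 'b::real_normed_vector"
  assumes "rapid a f" shows "f \<in> borel_measurable borel"
  using borel_measurable_continuous_countable_exceptions[of "{0}" f] rapid_cont[OF assms] by simp

text \<open>A polynomial factor costs nothing, because the bound for \<open>f\<close> may be used
  with \<open>K + L\<close> in place of \<open>K\<close>. Most closure properties below are
  instances of this comparison.\<close>

lemma rapid_bound:
  fixes f :: "'a::euclidean_space \<Rightarrow> 'b::real_normed_vector" and h :: "'a \<Rightarrow> 'c::real_normed_vector"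
  assumes f: "rapid a f" and h: "continuous_on (- {0}) h"
    and b: "\<And>x. x \<noteq> 0 \<Longrightarrow> norm (h x) \<le> B * norm x powr b * (1 + norm x) ^ L * norm (f x)"
  shows "rapid (a + b) h"
  unfolding rapid_def
proof (intro conjI h allI)
  fix K
  obtain C where C: "C > 0" "\<And>x. x \<noteq> 0 \<Longrightarrow> norm (f x) \<le> C * (norm x powr a / (1 + norm x) ^ (K + L))"
    using rapid_boundE[OF f] by metis
  show "\<exists>C. \<forall>x. x \<noteq> 0 \<longrightarrow> norm (h x) \<le> C * (norm x powr (a + b) / (1 + norm x) ^ K)"
  proof (intro exI[of _ "\<bar>B\<bar> * C"] allI impI)
    fix x :: 'a assume x: "x \<noteq> 0"
    have p: "(1 + norm x) > 0" by (smt (verit) norm_ge_zero)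
    have "norm (h x) \<le> \<bar>B\<bar> * norm x powr b * (1 + norm x) ^ L * norm (f x)"
      using b[OF x] by (rule order_trans) (intro mult_right_mono, use p in auto)
    also have "\<dots> \<le> \<bar>B\<bar> * norm x powr b * (1 + norm x) ^ L * (C * (norm x powr a / (1 + norm x) ^ (K + L)))"
      by (intro mult_left_mono C(2) x) (use p in auto)
    also have "\<dots> = \<bar>B\<bar> * C * (norm x powr (a + b) / (1 + norm x) ^ K)"
      using p by (simp add: powr_add power_add field_simps)
    finally show "norm (h x) \<le> \<bar>B\<bar> * C * (norm x powr (a + b) / (1 + norm x) ^ K)" .
  qed
qed

text \<open>Near the origin a smaller exponent is the weaker condition; away from it the missing
  power \<open>|x|^(a - b)\<close> is at most \<open>(1 + |x|)^L\<close>, which the decay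
  absorbs.\<close>

lemma rapid_mono:
  fixes f :: "'a::euclidean_space \<Rightarrow> 'b::real_normed_vector"
  assumes f: "rapid a f" and "b \<le> a"
  shows "rapid b f"
proof -
  obtain L :: nat where L: "real L \<ge> a - b" using real_arch_simple by blast
  have "rapid (a + (b - a)) f"
  proof (rule rapid_bound[OF f rapid_cont[OF f], where B = 1 and L = L])
    fix x :: 'a assume x: "x \<noteq> 0"
    have "norm x powr (a - b) \<le> (1 + norm x) powr (a - b)"
      using assms x by (intro powr_mono2) auto
    also have "\<dots> \<le> (1 + norm x) powr real L" using L by (intro powr_mono) auto
    also have "\<dots> = (1 + norm x) ^ L" by (intro powr_realpow) (smt (verit) norm_ge_zero)
    finally have "1 \<le> norm x powr (b - a) * (1 + norm x) ^ L"
      using x by (simp add: powr_diff field_simps)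
    then show "norm (f x) \<le> 1 * norm x powr (b - a) * (1 + norm x) ^ L * norm (f x)"
      by (simp add: mult_le_cancel_right1)
  qed
  then show ?thesis by simp
qed

lemma rapid_add:
  fixes f g :: "'a::euclidean_space \<Rightarrow> 'b::real_normed_vector"
  assumes f: "rapid a f" and g: "rapid a g"
  shows "rapid a (\<lambda>x. f x + g x)"
  unfolding rapid_def
proof (intro conjI allI continuous_on_add rapid_cont[OF f] rapid_cont[OF g])
  fix K
  obtain C D where C: "\<And>x. x \<noteq> 0 \<Longrightarrow> norm (f x) \<le> C * (norm x powr a / (1 + norm x) ^ K)"
    and D: "\<And>x. x \<noteq> 0 \<Longrightarrow> norm (g x) \<le> D * (norm x powr a / (1 + norm x) ^ K)"
    using rapid_boundE[OF f] rapid_boundE[OF g] by metis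
  show "\<exists>C. \<forall>x. x \<noteq> 0 \<longrightarrow> norm (f x + g x) \<le> C * (norm x powr a / (1 + norm x) ^ K)"
  proof (intro exI[of _ "C + D"] allI impI)
    fix x :: 'a assume "x \<noteq> 0"
    show "norm (f x + g x) \<le> (C + D) * (norm x powr a / (1 + norm x) ^ K)"
      using norm_triangle_ineq[of "f x" "g x"] C[OF \<open>x \<noteq> 0\<close>] D[OF \<open>x \<noteq> 0\<close>] unfolding distrib_right by linarith
  qed
qed

lemma rapid_mult:
  fixes f g :: "'a::euclidean_space \<Rightarrow> 'b::real_normed_algebra"
  assumes f: "rapid a f" and g: "rapid b g"
  shows "rapid (a + b) (\<lambda>x. f x * g x)"
proof -
  obtain C where C: "\<And>x. x \<noteq> 0 \<Longrightarrow> norm (g x) \<le> C * (norm x powr b / (1 + norm x) ^ 0)"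
    using rapid_boundE[OF g] by metis
  show ?thesis
  proof (rule rapid_bound[OF f, where B = C and L = 0])
    fix x :: 'a assume "x \<noteq> 0"
    have "norm (f x * g x) \<le> norm (g x) * norm (f x)" using norm_mult_ineq[of "f x" "g x"] by (simp add: mult.commute)
    also have "\<dots> \<le> (C * norm x powr b) * norm (f x)"
      using C[OF \<open>x \<noteq> 0\<close>] by (intro mult_right_mono) auto
    finally show "norm (f x * g x) \<le> C * norm x powr b * (1 + norm x) ^ 0 * norm (f x)" by simp
  qed (intro continuous_on_mult rapid_cont[OF f] rapid_cont[OF g])
qed

lemma rapid_inner:
  fixes f g :: "'a::euclidean_space \<Rightarrow> 'b::real_inner"
  assumes f: "rapid a f" and g: "rapid b g"
  shows "rapid (a + b) (\<lambda>x. f x \<bullet> g x)"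
proof -
  obtain C where C: "\<And>x. x \<noteq> 0 \<Longrightarrow> norm (g x) \<le> C * (norm x powr b / (1 + norm x) ^ 0)"
    using rapid_boundE[OF g] by metis
  show ?thesis
  proof (rule rapid_bound[OF f, where B = C and L = 0])
    fix x :: 'a assume "x \<noteq> 0"
    have "norm (f x \<bullet> g x) \<le> norm (g x) * norm (f x)" using Cauchy_Schwarz_ineq2[of "f x" "g x"] by (simp add: mult.commute)
    also have "\<dots> \<le> (C * norm x powr b) * norm (f x)"
      using C[OF \<open>x \<noteq> 0\<close>] by (intro mult_right_mono) auto
    finally show "norm (f x \<bullet> g x) \<le> C * norm x powr b * (1 + norm x) ^ 0 * norm (f x)" by simp
  qed (intro continuous_on_inner rapid_cont[OF f] rapid_cont[OF g])
qed

lemma continuous_on_norm_powr: "continuous_on (- {0::'a::euclidean_space}) (\<lambda>x. norm x powr b)"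
  by (intro continuous_intros) auto

lemma rapid_norm_powr:
  fixes f :: "'a::euclidean_space \<Rightarrow> 'b::real_normed_vector"
  assumes f: "rapid a f"
  shows "rapid (a + b) (\<lambda>x. norm x powr b *\<^sub>R f x)"
  by (rule rapid_bound[OF f, where B = 1 and L = 0])
     (auto intro!: continuous_intros continuous_on_norm_powr rapid_cont[OF f])

lemma rapid_norm_powr_mult:
  fixes f :: "'a::euclidean_space \<Rightarrow> complex"
  assumes f: "rapid a f"
  shows "rapid (a + b) (\<lambda>x. complex_of_real (norm x powr b) * f x)"
  using rapid_norm_powr[OF f, of b] by (simp add: scaleR_conv_of_real)

lemma rapid_norm_powr_mult_real:
  fixes f :: "'a::euclidean_space \<Rightarrow> real"
  assumes f: "rapid a f"
  shows "rapid (a + b) (\<lambda>x. norm x powr b * f x)"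
  using rapid_norm_powr[OF f, of b] by simp

lemma rapid_mult_poly_growth:
  fixes f g :: "'a::euclidean_space \<Rightarrow> 'b::real_normed_algebra"
  assumes f: "rapid a f" and g: "continuous_on (- {0}) g" "\<And>x. x \<noteq> 0 \<Longrightarrow> norm (g x) \<le> B * (1 + norm x) ^ L"
  shows "rapid a (\<lambda>x. g x * f x)"
proof -
  have "rapid (a + 0) (\<lambda>x. g x * f x)"
  proof (rule rapid_bound[OF f, where B = B and L = L])
    fix x :: 'a assume "x \<noteq> 0"
    have "norm (g x * f x) \<le> norm (g x) * norm (f x)" by (rule norm_mult_ineq)
    also have "\<dots> \<le> (B * (1 + norm x) ^ L) * norm (f x)"
      by (intro mult_right_mono g \<open>x \<noteq> 0\<close>) auto
    finally show "norm (g x * f x) \<le> B * norm x powr 0 * (1 + norm x) ^ L * norm (f x)" using \<open>x \<noteq> 0\<close> by simp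
  qed (intro continuous_on_mult rapid_cont[OF f] g)
  then show ?thesis by simp
qed

lemma rapid_norm:
  fixes f :: "'a::euclidean_space \<Rightarrow> 'b::real_normed_vector"
  assumes "rapid a f" shows "rapid a (\<lambda>x. norm (f x))"
  using assms by (auto simp: rapid_def intro: continuous_on_norm)

lemma rapid_norm_sq:
  fixes f :: "'a::euclidean_space \<Rightarrow> 'b::real_normed_vector"
  assumes "rapid a f" shows "rapid (2 * a) (\<lambda>x. (norm (f x))\<^sup>2)"
  using rapid_mult[OF rapid_norm[OF assms] rapid_norm[OF assms]] by (simp add: power2_eq_square)

lemma rapid_cmult:
  fixes f :: "'a::euclidean_space \<Rightarrow> 'b::real_normed_algebra"
  assumes "rapid a f" shows "rapid a (\<lambda>x. c * f x)"
  by (rule rapid_mult_poly_growth[OF assms, where B = "norm c" and L = 0]) auto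

lemma rapid_zero: "rapid a (\<lambda>x. 0)"
  by (auto simp: rapid_def intro!: exI[of _ 0])

lemma rapid_uminus: "rapid a f \<Longrightarrow> rapid a (\<lambda>x. - f x)"
  by (auto simp: rapid_def intro: continuous_on_minus)

lemma rapid_diff:
  fixes f g :: "'a::euclidean_space \<Rightarrow> 'b::real_normed_vector"
  shows "rapid a f \<Longrightarrow> rapid a g \<Longrightarrow> rapid a (\<lambda>x. f x - g x)"
  using rapid_add[of a f "\<lambda>x. - g x"] rapid_uminus[of a g] by simp

lemma rapid_sum:
  fixes f :: "'i \<Rightarrow> 'a::euclidean_space \<Rightarrow> 'b::real_normed_vector"
  shows "(\<And>i. i \<in> I \<Longrightarrow> rapid a (f i)) \<Longrightarrow> rapid a (\<lambda>x. \<Sum>i\<in>I. f i x)"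
  by (induction I rule: infinite_finite_induct) (auto intro: rapid_add rapid_zero)

lemma rapid_cong:
  assumes "rapid a f" "\<And>x. x \<noteq> 0 \<Longrightarrow> f x = g x" shows "rapid a g"
proof -
  have "continuous_on (- {0}) g" using assms(2) rapid_cont[OF assms(1)] by (subst continuous_on_cong[of _ "- {0}" _ f]) auto
  then show ?thesis using assms by (simp add: rapid_def)
qed

section \<open>Integrability of powers of the norm by dyadic shells\<close>

lemma dyadic_below:
  fixes t :: real assumes "0 < t" "t < 1"
  shows "\<exists>j::nat. (1/2) ^ (j + 1) \<le> t \<and> t < (1/2) ^ j"
proof -
  define j where "j = (LEAST j. (1/2) ^ (j + 1) \<le> t)"
  have ex: "\<exists>j. (1/2) ^ (j + 1) \<le> t"
  proof -
    obtain n where "(1/2::real) ^ n < t" using real_arch_pow_inv[of t "1/2"] assms by auto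
    moreover have "(1/2::real) ^ (n + 1) \<le> (1/2) ^ n" by (intro power_decreasing) auto
    ultimately have "(1/2::real) ^ (n + 1) \<le> t" by linarith
    then show ?thesis ..
  qed
  have 1: "(1/2) ^ (j + 1) \<le> t" unfolding j_def by (rule LeastI_ex[OF ex])
  have 2: "t < (1/2) ^ j"
  proof (cases j)
    case (Suc i)
    then have "\<not> (1/2) ^ (i + 1) \<le> t" using not_less_Least[of i "\<lambda>j. (1/2) ^ (j + 1) \<le> t"] by (simp add: j_def)
    then show ?thesis using Suc by simp
  qed (use assms in simp)
  show ?thesis using 1 2 by blast
qed

lemma dyadic_above:
  fixes t :: real assumes "1 \<le> t"
  shows "\<exists>j::nat. 2 ^ j \<le> t \<and> t < 2 ^ (j + 1)"
proof (cases "t = 1")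
  case True then show ?thesis by (intro exI[of _ 0]) simp
next
  case False
  obtain n where n: "t < 2 ^ n" using real_arch_pow[of 2 t] by auto
  define j where "j = (LEAST j. t < 2 ^ (j + 1))"
  have "(2::real) ^ n \<le> 2 ^ (n + 1)" by (intro power_increasing) auto
  then have ex: "\<exists>j. t < 2 ^ (j + 1)" using n by (intro exI[of _ n]) linarith
  have 1: "t < 2 ^ (j + 1)" unfolding j_def by (rule LeastI_ex[OF ex])
  have 2: "2 ^ j \<le> t"
  proof (cases j)
    case (Suc i)
    then have "\<not> t < 2 ^ (i + 1)" using not_less_Least[of i "\<lambda>j. t < 2 ^ (j + 1)"] by (simp add: j_def)
    then show ?thesis using Suc by simp
  qed (use assms in simp)
  show ?thesis using 1 2 by blast
qed

text \<open>Takes the role of polar coordinates: a radial function is bounded by a series of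
  multiples of ball indicators, and its integral by the series of their volumes.\<close>

lemma nn_integral_balls_finite:
  fixes c r :: "nat \<Rightarrow> real"
  assumes "\<And>j. 0 \<le> c j" "\<And>j. 0 < r j" and s: "summable (\<lambda>j. c j * r j ^ DIM('a::euclidean_space))"
  shows "(\<integral>\<^sup>+(x::'a). (\<Sum>j. ennreal (c j * indicator (ball 0 (r j)) x)) \<partial>lborel) < \<infinity>"
proof -
  have [measurable]: "ball (0::'a) (r j) \<in> sets borel" for j by simp
  have "(\<integral>\<^sup>+(x::'a). (\<Sum>j. ennreal (c j * indicator (ball 0 (r j)) x)) \<partial>lborel)
     = (\<Sum>j. \<integral>\<^sup>+(x::'a). ennreal (c j * indicator (ball 0 (r j)) x) \<partial>lborel)"
    by (rule nn_integral_suminf) measurable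
  also have "\<dots> = (\<Sum>j. ennreal (unit_ball_vol (real DIM('a)) * (c j * r j ^ DIM('a))))"
  proof (rule suminf_cong)
    fix j
    have "(\<integral>\<^sup>+(x::'a). ennreal (c j * indicator (ball 0 (r j)) x) \<partial>lborel) = (\<integral>\<^sup>+(x::'a). ennreal (c j) * indicator (ball 0 (r j)) x \<partial>lborel)"
      by (intro nn_integral_cong) (auto split: split_indicator)
    also have "\<dots> = ennreal (c j) * emeasure lborel (ball (0::'a) (r j))"
      by (rule nn_integral_cmult_indicator) simp
    also have "emeasure lborel (ball (0::'a) (r j)) = ennreal (unit_ball_vol (real DIM('a)) * r j ^ DIM('a))"
      using assms(2)[of j] by (intro emeasure_ball) simp
    also have "ennreal (c j) * \<dots> = ennreal (c j * (unit_ball_vol (real DIM('a)) * r j ^ DIM('a)))"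
      using assms(2)[of j] by (intro ennreal_mult[symmetric] assms(1)) simp
    also have "c j * (unit_ball_vol (real DIM('a)) * r j ^ DIM('a)) = unit_ball_vol (real DIM('a)) * (c j * r j ^ DIM('a))"
      by (simp only: mult_ac)
    finally show "(\<integral>\<^sup>+(x::'a). ennreal (c j * indicator (ball 0 (r j)) x) \<partial>lborel) = ennreal (unit_ball_vol (real DIM('a)) * (c j * r j ^ DIM('a)))" .
  qed
  also have "\<dots> = ennreal (\<Sum>j. unit_ball_vol (real DIM('a)) * (c j * r j ^ DIM('a)))"
  proof (intro suminf_ennreal2 summable_mult s)
    fix j show "0 \<le> unit_ball_vol (real DIM('a)) * (c j * r j ^ DIM('a))"
      using assms(1,2)[of j] assms(2)[of j] by simp
  qed
  also have "\<dots> < \<infinity>" by simp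
  finally show ?thesis .
qed

lemma suminf_ennreal_ge: "ennreal (f j) \<le> (\<Sum>j. ennreal (f j))"
  using sum_le_suminf[of "\<lambda>j. ennreal (f j)" "{j}"] by simp

text \<open>On the shell where \<open>1 + |x|\<close> is of size \<open>2^j\<close> the function is
  at most \<open>2^(- j (d + 1))\<close> and the ball has volume of order \<open>2^(j d)\<close>, so
  the extra 1 in the exponent leaves a geometric series of ratio 1/2.\<close>

lemma integrable_inverse_power_norm:
  "integrable lborel (\<lambda>x::'a::euclidean_space. 1 / (1 + norm x) ^ (DIM('a) + 1))"
  unfolding integrable_iff_bounded
proof
  let ?d = "DIM('a)"
  have "(\<integral>\<^sup>+(x::'a). norm (1 / (1 + norm x) ^ (?d + 1)) \<partial>lborel)
     \<le> (\<integral>\<^sup>+(x::'a). (\<Sum>j. ennreal ((1 / 2 ^ j) ^ (?d + 1) * indicator (ball 0 (2 ^ (j + 1))) x)) \<partial>lborel)"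
  proof (rule nn_integral_mono)
    fix x :: 'a
    obtain j :: nat where j: "2 ^ j \<le> 1 + norm x" "1 + norm x < 2 ^ (j + 1)" using dyadic_above[of "1 + norm x"] by auto
    have "norm (1 / (1 + norm x) ^ (?d + 1)) \<le> (1 / 2 ^ j) ^ (?d + 1) * indicator (ball 0 (2 ^ (j + 1))) x"
    proof -
      have p: "(2 ^ j) ^ (?d + 1) \<le> (1 + norm x) ^ (?d + 1)" by (intro power_mono j) simp
      have "norm (1 / (1 + norm x) ^ (?d + 1)) = 1 / (1 + norm x) ^ (?d + 1)" by simp
      also have "\<dots> \<le> 1 / (2 ^ j) ^ (?d + 1)" by (intro divide_left_mono p) (auto intro!: mult_pos_pos zero_less_power add_pos_nonneg)
      also have "\<dots> = (1 / 2 ^ j) ^ (?d + 1) * indicator (ball 0 (2 ^ (j + 1))) x" using j by (simp add: power_divide)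
      finally show ?thesis .
    qed
    then show "ennreal (norm (1 / (1 + norm x) ^ (?d + 1))) \<le> (\<Sum>j. ennreal ((1 / 2 ^ j) ^ (?d + 1) * indicator (ball 0 (2 ^ (j + 1))) x))"
      by (intro order_trans[OF ennreal_leI suminf_ennreal_ge])
  qed
  also have "\<dots> < \<infinity>"
  proof (rule nn_integral_balls_finite)
    have "(\<lambda>j. (1 / 2 ^ j) ^ (?d + 1) * (2 ^ (j + 1)) ^ ?d) = (\<lambda>j. 2 ^ ?d * (1/2::real) ^ j)"
    proof (intro ext)
      fix j
      have "(1 / 2 ^ j) ^ (?d + 1) * (2 ^ (j + 1)) ^ ?d = ((1 / 2 ^ j) * 2 ^ (j + 1)) ^ ?d * (1 / 2 ^ j :: real)"
        by (simp only: power_mult_distrib power_add power_one_right mult_ac)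
      also have "(1 / 2 ^ j) * 2 ^ (j + 1) = (2::real)" by simp
      finally show "(1 / 2 ^ j) ^ (?d + 1) * (2 ^ (j + 1)) ^ ?d = 2 ^ ?d * (1/2::real) ^ j" by (simp add: power_divide)
    qed
    then show "summable (\<lambda>j. (1 / 2 ^ j) ^ (?d + 1) * (2 ^ (j + 1)) ^ ?d :: real)" by (simp add: summable_mult)
  qed auto
  finally show "(\<integral>\<^sup>+(x::'a). ennreal (norm (1 / (1 + norm x) ^ (?d + 1))) \<partial>lborel) < \<infinity>" .
qed measurable

text \<open>For \<open>a \<le> 0\<close> the function is largest at the inner edge of a dyadic
  shell; the resulting series is geometric with ratio \<open>2^(- (a + d))\<close>, which is below 1
  exactly for \<open>a > - d\<close>.\<close>

lemma integrable_norm_powr_ball: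
  assumes a: "- real DIM('a::euclidean_space) < a" "a \<le> 0"
  shows "integrable lborel (\<lambda>x::'a. norm x powr a * indicator (ball 0 1) x)"
  unfolding integrable_iff_bounded
proof
  let ?d = "DIM('a)"
  have [measurable]: "ball (0::'a) 1 \<in> sets borel" by simp
  show "(\<lambda>x::'a. norm x powr a * indicator (ball 0 1) x) \<in> borel_measurable lborel" by measurable
  have "(\<integral>\<^sup>+(x::'a). norm (norm x powr a * indicator (ball 0 1) x) \<partial>lborel)
     \<le> (\<integral>\<^sup>+(x::'a). (\<Sum>j. ennreal (((1/2) ^ (j + 1)) powr a * indicator (ball 0 ((1/2) ^ j)) x)) \<partial>lborel)"
  proof (rule nn_integral_mono)
    fix x :: 'a
    show "ennreal (norm (norm x powr a * indicator (ball 0 1) x)) \<le> (\<Sum>j. ennreal (((1/2) ^ (j + 1)) powr a * indicator (ball 0 ((1/2) ^ j)) x))"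
    proof (cases "x \<noteq> 0 \<and> norm x < 1")
      case True
      then obtain j :: nat where j: "(1/2) ^ (j + 1) \<le> norm x" "norm x < (1/2) ^ j" using dyadic_below[of "norm x"] by auto
      have "norm x powr a \<le> ((1/2) ^ (j + 1)) powr a" 
        using j a by (intro powr_mono2') auto
      then have "norm (norm x powr a * indicator (ball 0 1) x) \<le> ((1/2) ^ (j + 1)) powr a * indicator (ball 0 ((1/2) ^ j)) x"
        using j True by simp
      then show ?thesis by (intro order_trans[OF ennreal_leI suminf_ennreal_ge])
    next
      case False
      then have "norm x powr a * indicator (ball 0 1) x = 0" by (auto split: split_indicator)
      then show ?thesis by (simp only: norm_zero ennreal_0 zero_le)
    qed
  qed
  also have "\<dots> < \<infinity>"
  proof (rule nn_integral_balls_finite)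
    have eq: "((1/2) ^ (j + 1)) powr a * ((1/2) ^ j) ^ ?d = (1/2) powr a * ((1/2) powr (a + ?d)) ^ j" for j :: nat
    proof -
      have 0: "(1/2) ^ (j + 1) = (1/2::real) powr real (j + 1)" by (subst powr_realpow) auto
      have 1: "((1/2) ^ (j + 1)) powr a = (1/2::real) powr (a + a * j)"
        unfolding 0 powr_powr by (rule arg_cong[of _ _ "(powr) (1/2)"]) (simp add: algebra_simps)
      have 2: "((1/2::real) ^ j) ^ ?d = (1/2) powr real (j * ?d)"
        unfolding power_mult[symmetric] by (subst powr_realpow) auto
      have 3: "((1/2::real) powr (a + ?d)) ^ j = (1/2) powr ((a + ?d) * j)"
        by (subst powr_realpow[symmetric]) (simp, simp only: powr_powr)
      show ?thesis unfolding 1 2 3 powr_add[symmetric]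
        by (rule arg_cong[of _ _ "(powr) (1/2)"]) (simp add: algebra_simps)
    qed
    have "2 powr 0 < (2::real) powr (a + ?d)" using a by (intro powr_less_mono) auto
    then have "(1/2::real) powr (a + ?d) < 1" by (simp add: powr_divide)
    then show "summable (\<lambda>j. ((1/2) ^ (j + 1)) powr a * ((1/2) ^ j) ^ ?d)"
      unfolding eq by (intro summable_mult summable_geometric) simp
  qed auto
  finally show "(\<integral>\<^sup>+(x::'a). ennreal (norm (norm x powr a * indicator (ball 0 1) x)) \<partial>lborel) < \<infinity>" .
qed

lemma AE_lborel_nonzero: "AE x::'a::euclidean_space in lborel. x \<noteq> 0"
  by (rule AE_I[where N = "{0}"]) auto

lemma integrable_norm_powr_decay:
  assumes a: "a > - real DIM('a::euclidean_space)"
  shows "integrable lborel (\<lambda>x::'a. norm x powr a / (1 + norm x) ^ (DIM('a) + 1 + nat \<lceil>a\<rceil>))"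
proof -
  \<comment> \<open>Separates the two roles of \<open>a\<close>: its negative part counts near the
    origin, its positive part is growth that is compensated by \<open>nat \<lceil>a\<rceil>\<close>
    extra powers, a number that is 0 for negative \<open>a\<close>.\<close>
  define b where "b = min a 0"
  let ?d = "DIM('a) + 1"
  let ?g = "\<lambda>x::'a. norm x powr b * indicator (ball 0 1) x + 1 / (1 + norm x) ^ ?d"
  have "integrable lborel ?g"
    using a by (intro Bochner_Integration.integrable_add integrable_inverse_power_norm integrable_norm_powr_ball) (auto simp: b_def)
  then show ?thesis
  proof (rule Bochner_Integration.integrable_bound)
    show "(\<lambda>x::'a. norm x powr a / (1 + norm x) ^ (?d + nat \<lceil>a\<rceil>)) \<in> borel_measurable lborel" by measurable
    show "AE x in lborel. norm (norm x powr a / (1 + norm x) ^ (?d + nat \<lceil>a\<rceil>)) \<le> norm (?g (x::'a))"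
      using AE_lborel_nonzero
    proof eventually_elim
      fix x :: 'a assume x: "x \<noteq> 0"
      let ?y = "1 + norm x"
      have y: "?y > 0" "?y \<ge> 1" by (simp_all add: add_pos_nonneg)
      have "norm x powr a \<le> norm x powr b * ?y ^ nat \<lceil>a\<rceil>"
      proof (cases "a \<ge> 0")
        case True
        have "norm x powr a \<le> ?y powr a" using True by (intro powr_mono2) auto
        also have "\<dots> \<le> ?y powr real (nat \<lceil>a\<rceil>)" using True y by (intro powr_mono) (auto simp: of_nat_nat)
        also have "\<dots> = ?y ^ nat \<lceil>a\<rceil>" by (rule powr_realpow[OF y(1)])
        finally show ?thesis using True x by (simp add: b_def)
      qed (simp add: b_def)
      then have "norm x powr a / ?y ^ (?d + nat \<lceil>a\<rceil>) \<le> norm x powr b * ?y ^ nat \<lceil>a\<rceil> / ?y ^ (?d + nat \<lceil>a\<rceil>)"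
        using y by (intro divide_right_mono) auto
      also have "\<dots> = norm x powr b / ?y ^ ?d" using y by (simp add: power_add)
      also have "\<dots> \<le> ?g x"
      proof (cases "norm x < 1")
        case True
        have "norm x powr b / ?y ^ ?d \<le> norm x powr b / 1"
          by (intro divide_left_mono one_le_power mult_pos_pos zero_less_power y) auto
        then show ?thesis using True y by (simp add: add_increasing2)
      next
        case False
        then have "norm x powr b \<le> 1 powr b" using x by (intro powr_mono2') (auto simp: b_def)
        then show ?thesis using False y by (simp add: divide_right_mono)
      qed
      finally show "norm (norm x powr a / ?y ^ (?d + nat \<lceil>a\<rceil>)) \<le> norm (?g x)" using y by simp
    qed
  qed
qed

lemma rapid_integrable:
  fixes f :: "'a::euclidean_space \<Rightarrow> 'b::{banach, second_countable_topology}"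
  assumes f: "rapid a f" and a: "a > - real DIM('a)"
  shows "integrable lborel f"
proof -
  let ?K = "DIM('a) + 1 + nat \<lceil>a\<rceil>"
  obtain C where C: "C > 0" "\<And>x. x \<noteq> 0 \<Longrightarrow> norm (f x) \<le> C * (norm x powr a / (1 + norm x) ^ ?K)"
    using rapid_boundE[OF f] by metis
  show ?thesis
  proof (rule Bochner_Integration.integrable_bound[OF integrable_mult_right[OF integrable_norm_powr_decay[OF a]]])
    show "f \<in> borel_measurable lborel" using rapid_measurable[OF f] by simp
    show "AE x in lborel. norm (f x) \<le> norm (C * (norm x powr a / (1 + norm x) ^ ?K))"
      using AE_lborel_nonzero by eventually_elim (rule order_trans[OF C(2)], simp, simp only: real_norm_def abs_ge_self)
  qed
qed

lemma rapid_bound_everywhere: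
  assumes "rapid 0 f"
  obtains C where "C \<ge> 0" "\<And>x. norm (f x) \<le> C / (1 + norm x) ^ K"
proof -
  obtain C where C: "C > 0" "\<And>x. x \<noteq> 0 \<Longrightarrow> norm (f x) \<le> C * (norm x powr 0 / (1 + norm x) ^ K)"
    using rapid_boundE[OF assms] by blast
  \<comment> \<open>The value at 0 is not covered by \<open>rapid\<close>, so it enters through the
    maximum.\<close>
  have "norm (f x) \<le> max C (norm (f 0)) / (1 + norm x) ^ K" for x
  proof (cases "x = 0")
    case False
    have "norm (f x) \<le> C / (1 + norm x) ^ K" using C(2)[OF False] False by simp
    also have "\<dots> \<le> max C (norm (f 0)) / (1 + norm x) ^ K" by (intro divide_right_mono) auto
    finally show ?thesis .
  qed simp
  then show ?thesis using that[of "max C (norm (f 0))"] C(1) by auto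
qed

lemma rapid_compact_support:
  fixes f :: "'a::euclidean_space \<Rightarrow> complex"
  assumes f: "continuous_on UNIV f" and R: "\<And>x. norm x > R \<Longrightarrow> f x = 0"
  shows "rapid 0 f"
  unfolding rapid_def
proof (intro conjI allI)
  show "continuous_on (- {0}) f" by (rule continuous_on_subset[OF f]) auto
  fix K :: nat
  have "compact (f ` cball 0 R)" by (intro compact_continuous_image continuous_on_subset[OF f]) auto
  then obtain B where B: "\<And>x. x \<in> cball 0 R \<Longrightarrow> norm (f x) \<le> B" using compact_imp_bounded bounded_iff by (metis image_eqI)
  show "\<exists>C. \<forall>x. x \<noteq> 0 \<longrightarrow> norm (f x) \<le> C * (norm x powr 0 / (1 + norm x) ^ K)"
  proof (intro exI[of _ "\<bar>B\<bar> * (1 + \<bar>R\<bar>) ^ K"] allI impI)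
    fix x :: 'a assume x: "x \<noteq> 0"
    show "norm (f x) \<le> \<bar>B\<bar> * (1 + \<bar>R\<bar>) ^ K * (norm x powr 0 / (1 + norm x) ^ K)"
    proof (cases "norm x > R")
      case False
      have "norm (f x) * (1 + norm x) ^ K \<le> \<bar>B\<bar> * (1 + \<bar>R\<bar>) ^ K" using B[of x] False by (intro mult_mono power_mono) auto
      moreover have "(1 + norm x) ^ K > 0" by (intro zero_less_power) (simp add: add_pos_nonneg)
      ultimately show ?thesis using x by (simp add: pos_le_divide_eq)
    qed (use R in auto)
  qed
qed

section \<open>Fourier inversion\<close>

lemma fourier_eq_inv_fourier: "fourier f \<xi> = inv_fourier f (- \<xi>)"
  by (simp add: fourier_def inv_fourier_def inner_commute)

lemma integrable_mult_cis:
  fixes g :: "'a::euclidean_space \<Rightarrow> complex"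
  assumes "integrable lborel g" and [measurable]: "p \<in> borel_measurable borel"
  shows "integrable lborel (\<lambda>x. g x * cis (p x))"
proof -
  have [measurable]: "g \<in> borel_measurable borel" using assms by auto
  have [measurable]: "cis \<in> borel_measurable borel" 
    by (intro borel_measurable_continuous_onI continuous_intros)
  show ?thesis by (rule Bochner_Integration.integrable_bound[OF assms(1)]) (auto simp: norm_mult)
qed

lemma measurable_cis[measurable]: "cis \<in> borel_measurable borel"
  by (intro borel_measurable_continuous_onI continuous_intros)

lemma measurable_cnj[measurable]: "cnj \<in> borel_measurable borel"
  by (intro borel_measurable_continuous_onI continuous_intros)

lemma measurable_inv_fourier[measurable]:
  assumes [measurable]: "g \<in> borel_measurable borel"
  shows "inv_fourier g \<in> borel_measurable borel"
proof -
  have "(\<lambda>x. LINT \<xi>|lborel. g \<xi> * cis (2 * pi * (x \<bullet> \<xi>))) \<in> borel_measurable lborel"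
    by (rule lborel.borel_measurable_lebesgue_integral) measurable
  then show ?thesis by (simp add: inv_fourier_def[abs_def])
qed

lemma norm_inv_fourier_le:
  assumes g: "integrable lborel g"
  shows "norm (inv_fourier g x) \<le> (LINT x|lborel. norm (g x))"
  unfolding inv_fourier_def
  by (rule order_trans[OF integral_norm_bound]) (simp add: norm_mult)

lemma measurable_fourier[measurable]:
  assumes [measurable]: "g \<in> borel_measurable borel"
  shows "fourier g \<in> borel_measurable borel"
  unfolding fourier_eq_inv_fourier[abs_def] by measurable

text \<open>The Fourier transform of \<open>exp (- |x|^2 / 2)\<close> when the phase carries the
  factor \<open>2 * pi\<close>; a probability density.\<close>

definition heat_kernel :: "real^'n::finite \<Rightarrow> real" where
  "heat_kernel y = sqrt (2 * pi) ^ CARD('n) * exp (- (norm ((2 * pi) *\<^sub>R y))\<^sup>2 / 2)"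

lemma heat_kernel_nonneg: "heat_kernel y \<ge> 0"
  by (simp add: heat_kernel_def)

lemma measurable_heat_kernel[measurable]: "heat_kernel \<in> borel_measurable borel"
  unfolding heat_kernel_def[abs_def] by measurable

lemma heat_kernel_integral: 
  "integrable lborel (heat_kernel :: real^'n::finite \<Rightarrow> real)" "(LINT y|lborel. heat_kernel (y::real^'n)) = 1"
proof -
  let ?f = "\<lambda>x::real^'n. exp (- (norm x)\<^sup>2 / 2)"
  have "integrable lborel (\<lambda>x. ?f (0 + (2 * pi) *\<^sub>R x))"
    by (rule lborel_integrable_affine[OF _ gauss_cis(2)]) auto
  then show "integrable lborel (heat_kernel :: real^'n \<Rightarrow> real)"
    unfolding heat_kernel_def[abs_def] by (intro integrable_mult_right) simp
  have "complex_of_real (LINT x|lborel. ?f x) = (LINT x|lborel. complex_of_real (?f x) * cis (x \<bullet> 0))" by simp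
  also have "\<dots> = of_real (sqrt (2 * pi) ^ CARD('n))" by (subst gauss_cis) simp
  finally have "(LINT x|lborel. ?f x) = sqrt (2 * pi) ^ CARD('n)" by (simp only: of_real_eq_iff)
  moreover have "(LINT x|lborel. ?f x) = \<bar>2 * pi\<bar> ^ DIM(real^'n) *\<^sub>R (LINT x|lborel. ?f (0 + (2 * pi) *\<^sub>R x))"
    by (rule lborel_integral_affine) auto
  ultimately have "(2 * pi) ^ CARD('n) * (LINT x|lborel. ?f ((2 * pi) *\<^sub>R x)) = sqrt (2 * pi) ^ CARD('n)" by simp
  moreover have "(2 * pi) ^ CARD('n) = sqrt (2 * pi) ^ CARD('n) * sqrt (2 * pi) ^ CARD('n)"
    by (subst power_mult_distrib[symmetric]) simp
  ultimately have "sqrt (2 * pi) ^ CARD('n) * (LINT x|lborel. ?f ((2 * pi) *\<^sub>R x)) = 1" by simp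
  then show "(LINT y|lborel. heat_kernel (y::real^'n)) = 1"
    unfolding heat_kernel_def by (subst integral_mult_right_zero) simp
qed

text \<open>Gaussian cutoff that makes the inversion integral absolutely convergent; it increases to
  1 as \<open>\<delta> > 0\<close> decreases to 0.\<close>

definition damp :: "real \<Rightarrow> real^'n::finite \<Rightarrow> real" where
  "damp \<delta> x = exp (- (norm (\<delta> *\<^sub>R x))\<^sup>2 / 2)"

lemma measurable_damp[measurable]: "damp \<delta> \<in> borel_measurable borel"
  unfolding damp_def[abs_def] by measurable

lemma damp_nonneg: "0 \<le> damp \<delta> x" and damp_le_1: "damp \<delta> x \<le> 1"
  by (auto simp: damp_def)

lemma damp_integrable: "\<delta> > 0 \<Longrightarrow> integrable lborel (damp \<delta> :: real^'n::finite \<Rightarrow> real)"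
  using lborel_integrable_affine[OF _ gauss_cis(2), of \<delta> 0] by (simp add: damp_def[abs_def])

lemma fourier_damp:
  assumes "\<delta> > 0"
  shows "(LINT x|lborel. complex_of_real (damp \<delta> (x::real^'n::finite)) * cis (2 * pi * (x \<bullet> \<eta>)))
     = of_real (heat_kernel (\<eta> /\<^sub>R \<delta>) / \<delta> ^ CARD('n))"
proof -
  have *: "z = complex_of_real (b / a)" if "complex_of_real a * z = of_real b" "a \<noteq> 0" for a b z
    using that by (simp add: field_simps)
  let ?f = "\<lambda>x::real^'n. complex_of_real (exp (- (norm x)\<^sup>2 / 2)) * cis (x \<bullet> ((2 * pi / \<delta>) *\<^sub>R \<eta>))"
  have m: "?f \<in> borel_measurable borel" by measurable
  have "(LINT x|lborel. ?f x) = \<bar>\<delta>\<bar> ^ DIM(real^'n) *\<^sub>R (LINT x|lborel. ?f (0 + \<delta> *\<^sub>R x))"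
    using assms by (intro lborel_integral_affine m) auto
  also have "(LINT x|lborel. ?f (0 + \<delta> *\<^sub>R x)) = (LINT x|lborel. complex_of_real (damp \<delta> x) * cis (2 * pi * (x \<bullet> \<eta>)))"
    using assms by (intro Bochner_Integration.integral_cong) (auto simp: damp_def mult.assoc)
  finally have "of_real (\<delta> ^ CARD('n)) * (LINT x|lborel. complex_of_real (damp \<delta> x) * cis (2 * pi * (x \<bullet> \<eta>))) =
      of_real (sqrt (2 * pi) ^ CARD('n) * exp (- (norm ((2 * pi / \<delta>) *\<^sub>R \<eta>))\<^sup>2 / 2))"
    using assms unfolding gauss_cis(1) by (simp add: scaleR_conv_of_real)
  also have "sqrt (2 * pi) ^ CARD('n) * exp (- (norm ((2 * pi / \<delta>) *\<^sub>R \<eta>))\<^sup>2 / 2) = heat_kernel (\<eta> /\<^sub>R \<delta>)"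
    unfolding heat_kernel_def scaleR_scaleR divide_inverse ..
  finally show ?thesis
    using assms by (intro *[of "\<delta> ^ CARD('n)"]) auto
qed

text \<open>Convolution with the heat kernel of width \<delta>. The scaling is placed in the
  argument of \<open>g\<close>, so that one fixed integrable kernel dominates for all
  \<delta>.\<close>

definition mollify :: "real \<Rightarrow> (real^'n::finite \<Rightarrow> complex) \<Rightarrow> real^'n \<Rightarrow> complex" where
  "mollify \<delta> g \<xi> = (LINT y|lborel. g (\<xi> + \<delta> *\<^sub>R y) * of_real (heat_kernel y))"

lemma mollify_eq:
  assumes "\<delta> > 0" and [measurable]: "g \<in> borel_measurable borel"
  shows "mollify \<delta> g \<xi> = (LINT \<eta>|lborel. g (\<eta>::real^'n::finite) * of_real (heat_kernel ((\<eta> - \<xi>) /\<^sub>R \<delta>) / \<delta> ^ CARD('n)))"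
proof -
  let ?h = "\<lambda>\<eta>. g \<eta> * of_real (heat_kernel ((\<eta> - \<xi>) /\<^sub>R \<delta>) / \<delta> ^ CARD('n))"
  have "(LINT \<eta>|lborel. ?h \<eta>) = \<bar>\<delta>\<bar> ^ DIM(real^'n) *\<^sub>R (LINT y|lborel. ?h (\<xi> + \<delta> *\<^sub>R y))"
    using assms(1) by (intro lborel_integral_affine) auto
  also have "\<dots> = (LINT y|lborel. \<bar>\<delta>\<bar> ^ DIM(real^'n) *\<^sub>R ?h (\<xi> + \<delta> *\<^sub>R y))"
    by (rule integral_scaleR_right[symmetric]) 
  also have "\<dots> = mollify \<delta> g \<xi>"
    unfolding mollify_def
  proof (rule Bochner_Integration.integral_cong[OF refl])
    fix y :: "real^'n"
    have "(\<xi> + \<delta> *\<^sub>R y - \<xi>) /\<^sub>R \<delta> = y" using assms(1) by simp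
    then show "\<bar>\<delta>\<bar> ^ DIM(real^'n) *\<^sub>R ?h (\<xi> + \<delta> *\<^sub>R y) = g (\<xi> + \<delta> *\<^sub>R y) * of_real (heat_kernel y)"
      using assms(1) by (simp add: scaleR_conv_of_real[where 'a=complex])
  qed
  finally show ?thesis ..
qed

text \<open>By Fubini, damping on one side is mollification on the other.\<close>

lemma inv_fourier_damped:
  assumes g: "integrable lborel g" and \<delta>: "\<delta> > 0"
  shows "(LINT x|lborel. inv_fourier g (x::real^'n::finite) * of_real (damp \<delta> x) * cis (- (2 * pi * (x \<bullet> \<xi>)))) = mollify \<delta> g \<xi>"
proof -
  have [measurable]: "g \<in> borel_measurable borel" using g by auto
  let ?F = "\<lambda>(x, \<eta>). g \<eta> * cis (2 * pi * (x \<bullet> \<eta>)) * (of_real (damp \<delta> x) * cis (- (2 * pi * (x \<bullet> \<xi>))))"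
  have int: "integrable (lborel \<Otimes>\<^sub>M lborel) ?F"
    by (rule integrable_pair_bound[OF _ damp_integrable[OF \<delta>] integrable_norm[OF g]]) (auto simp: norm_mult damp_nonneg mult.commute)
  have "(LINT x|lborel. inv_fourier g x * of_real (damp \<delta> x) * cis (- (2 * pi * (x \<bullet> \<xi>)))) = (LINT x|lborel. (LINT \<eta>|lborel. ?F (x, \<eta>)))"
    unfolding inv_fourier_def by (simp add: integral_mult_left_zero[symmetric] mult.assoc)
  also have "\<dots> = (LINT \<eta>|lborel. (LINT x|lborel. ?F (x, \<eta>)))"
    using lborel_pair.Fubini_integral[OF int] by (simp only: prod.case)
  also have "\<dots> = (LINT \<eta>|lborel. g \<eta> * of_real (heat_kernel ((\<eta> - \<xi>) /\<^sub>R \<delta>) / \<delta> ^ CARD('n)))"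
  proof (rule Bochner_Integration.integral_cong[OF refl])
    fix \<eta>
    have "(LINT x|lborel. ?F (x, \<eta>)) = (LINT x|lborel. g \<eta> * (complex_of_real (damp \<delta> x) * cis (2 * pi * (x \<bullet> (\<eta> - \<xi>)))))"
      by (intro Bochner_Integration.integral_cong) (auto simp: inner_diff_right right_diff_distrib cis_mult mult_ac)
    also have "\<dots> = g \<eta> * of_real (heat_kernel ((\<eta> - \<xi>) /\<^sub>R \<delta>) / \<delta> ^ CARD('n))"
      by (subst integral_mult_right_zero, subst fourier_damp[OF \<delta>]) simp
    finally show "(LINT x|lborel. ?F (x, \<eta>)) = g \<eta> * of_real (heat_kernel ((\<eta> - \<xi>) /\<^sub>R \<delta>) / \<delta> ^ CARD('n))" .
  qed
  finally show ?thesis by (subst mollify_eq[OF \<delta>]) auto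
qed

text \<open>A second use of Fubini: one factor of the square is expanded as a conjugate integral
  over frequencies, and the remaining integral over \<open>x\<close> is the one of the preceding
  identity.\<close>

lemma inv_fourier_damped_sq:
  assumes g: "integrable lborel g" and \<delta>: "\<delta> > 0"
  shows "complex_of_real (LINT x|lborel. (norm (inv_fourier g (x::real^'n::finite)))\<^sup>2 * damp \<delta> x) = (LINT \<xi>|lborel. mollify \<delta> g \<xi> * cnj (g \<xi>))"
proof -
  have [measurable]: "g \<in> borel_measurable borel" using g by auto
  let ?F = "\<lambda>(x, \<xi>). inv_fourier g x * of_real (damp \<delta> x) * cis (- (2 * pi * (x \<bullet> \<xi>))) * cnj (g \<xi>)"
  let ?C = "LINT x|lborel. norm (g x)"
  have int: "integrable (lborel \<Otimes>\<^sub>M lborel) ?F"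
  proof (rule integrable_pair_bound[where u = "\<lambda>x. ?C * damp \<delta> x" and v = "\<lambda>\<xi>. norm (g \<xi>)"])
    fix x \<xi>
    show "norm (?F (x, \<xi>)) \<le> ?C * damp \<delta> x * norm (g \<xi>)"
      using norm_inv_fourier_le[OF g, of x] by (auto simp: norm_mult damp_nonneg intro!: mult_right_mono)
  qed (use g damp_integrable[OF \<delta>] in auto)
  have "complex_of_real (LINT x|lborel. (norm (inv_fourier g x))\<^sup>2 * damp \<delta> x) = (LINT x|lborel. complex_of_real ((norm (inv_fourier g x))\<^sup>2 * damp \<delta> x))"
    by (rule integral_complex_of_real[symmetric])
  also have "\<dots> = (LINT x|lborel. (LINT \<xi>|lborel. ?F (x, \<xi>)))"
  proof (rule Bochner_Integration.integral_cong[OF refl])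
    fix x :: "real^'n"
    have "(LINT \<xi>|lborel. ?F (x, \<xi>)) = (LINT \<xi>|lborel. (inv_fourier g x * of_real (damp \<delta> x)) * cnj (g \<xi> * cis (2 * pi * (x \<bullet> \<xi>))))"
      by (intro Bochner_Integration.integral_cong) (auto simp: cis_cnj mult_ac)
    also have "\<dots> = inv_fourier g x * of_real (damp \<delta> x) * (LINT \<xi>|lborel. cnj (g \<xi> * cis (2 * pi * (x \<bullet> \<xi>))))"
      by (rule integral_mult_right_zero)
    also have "(LINT \<xi>|lborel. cnj (g \<xi> * cis (2 * pi * (x \<bullet> \<xi>)))) = cnj (inv_fourier g x)"
      unfolding inv_fourier_def by (rule Bochner_Integration.integral_cnj)
    also have "inv_fourier g x * of_real (damp \<delta> x) * cnj (inv_fourier g x) = complex_of_real ((norm (inv_fourier g x))\<^sup>2 * damp \<delta> x)"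
      by (simp only: of_real_mult complex_norm_square mult_ac)
    finally show "complex_of_real ((norm (inv_fourier g x))\<^sup>2 * damp \<delta> x) = (LINT \<xi>|lborel. ?F (x, \<xi>))" ..
  qed
  also have "\<dots> = (LINT \<xi>|lborel. (LINT x|lborel. ?F (x, \<xi>)))"
    using lborel_pair.Fubini_integral[OF int] by (simp only: prod.case)
  also have "\<dots> = (LINT \<xi>|lborel. mollify \<delta> g \<xi> * cnj (g \<xi>))"
    using inv_fourier_damped[OF g \<delta>] by (simp add: integral_mult_left_zero)
  finally show ?thesis .
qed

lemma norm_integral_le_nn_integral:
  fixes f :: "'a \<Rightarrow> 'b::{banach, second_countable_topology}"
  shows "ennreal (norm (integral\<^sup>L M f)) \<le> (\<integral>\<^sup>+x. norm (f x) \<partial>M)"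
  by (cases "integrable M f") (auto simp: integral_norm_bound_ennreal not_integrable_integral_eq)

text \<open>Pointwise \<open>a b \<le> a^2 / 2 + b^2 / 2\<close>, then translation invariance and
  the total mass 1 of the kernel. The integrals are taken as nonnegative ones, so that their order
  may be exchanged freely.\<close>

lemma mollify_sq_le:
  assumes g: "integrable lborel g" and g2: "integrable lborel (\<lambda>x. (norm (g x))\<^sup>2)" and \<delta>: "\<delta> > 0"
  shows "norm (LINT \<xi>|lborel. mollify \<delta> g (\<xi>::real^'n::finite) * cnj (g \<xi>)) \<le> (LINT x|lborel. (norm (g x))\<^sup>2)"
proof -
  have [measurable]: "g \<in> borel_measurable borel" using g by auto
  let ?k = "\<lambda>y. ennreal (heat_kernel (y::real^'n))"
  let ?S = "\<integral>\<^sup>+x. ennreal ((norm (g x))\<^sup>2) \<partial>lborel"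
  have k1: "(\<integral>\<^sup>+y. ?k y \<partial>lborel) = 1"
    using nn_integral_eq_integral[OF heat_kernel_integral(1)[where 'n='n]] by (simp add: heat_kernel_nonneg heat_kernel_integral)
  have m: "mollify \<delta> g \<in> borel_measurable borel"
  proof -
    have "(\<lambda>\<xi>. LINT y|lborel. g (\<xi> + \<delta> *\<^sub>R y) * of_real (heat_kernel y)) \<in> borel_measurable lborel"
      by (rule lborel.borel_measurable_lebesgue_integral) measurable
    then show ?thesis by (simp add: mollify_def[abs_def])
  qed
  have "ennreal (norm (LINT \<xi>|lborel. mollify \<delta> g \<xi> * cnj (g \<xi>))) \<le> (\<integral>\<^sup>+\<xi>. norm (mollify \<delta> g \<xi> * cnj (g \<xi>)) \<partial>lborel)"
    by (rule norm_integral_le_nn_integral)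
  also have "\<dots> \<le> (\<integral>\<^sup>+\<xi>. (\<integral>\<^sup>+y. ennreal (((norm (g (\<xi> + \<delta> *\<^sub>R y)))\<^sup>2 / 2 + (norm (g \<xi>))\<^sup>2 / 2)) * ?k y \<partial>lborel) \<partial>lborel)"
  proof (rule nn_integral_mono)
    fix \<xi> :: "real^'n"
    have "ennreal (norm (mollify \<delta> g \<xi> * cnj (g \<xi>))) = ennreal (norm (LINT y|lborel. g (\<xi> + \<delta> *\<^sub>R y) * of_real (heat_kernel y) * cnj (g \<xi>)))"
      by (simp add: mollify_def)
    also have "\<dots> \<le> (\<integral>\<^sup>+y. norm (g (\<xi> + \<delta> *\<^sub>R y) * of_real (heat_kernel y) * cnj (g \<xi>)) \<partial>lborel)"
      by (rule norm_integral_le_nn_integral)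
    also have "\<dots> \<le> (\<integral>\<^sup>+y. ennreal (((norm (g (\<xi> + \<delta> *\<^sub>R y)))\<^sup>2 / 2 + (norm (g \<xi>))\<^sup>2 / 2)) * ?k y \<partial>lborel)"
    proof (rule nn_integral_mono)
      fix y
      have "norm (g (\<xi> + \<delta> *\<^sub>R y)) * norm (g \<xi>) \<le> (norm (g (\<xi> + \<delta> *\<^sub>R y)))\<^sup>2 / 2 + (norm (g \<xi>))\<^sup>2 / 2"
        using sum_squares_bound[of "norm (g (\<xi> + \<delta> *\<^sub>R y))" "norm (g \<xi>)"] by simp
      then have "norm (g (\<xi> + \<delta> *\<^sub>R y)) * norm (g \<xi>) * heat_kernel y \<le> ((norm (g (\<xi> + \<delta> *\<^sub>R y)))\<^sup>2 / 2 + (norm (g \<xi>))\<^sup>2 / 2) * heat_kernel y"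
        by (intro mult_right_mono heat_kernel_nonneg)
      then show "ennreal (norm (g (\<xi> + \<delta> *\<^sub>R y) * of_real (heat_kernel y) * cnj (g \<xi>))) \<le> ennreal (((norm (g (\<xi> + \<delta> *\<^sub>R y)))\<^sup>2 / 2 + (norm (g \<xi>))\<^sup>2 / 2)) * ?k y"
        by (subst ennreal_mult[symmetric]) (auto simp: norm_mult heat_kernel_nonneg mult_ac intro!: ennreal_leI)
    qed
    finally show "ennreal (norm (mollify \<delta> g \<xi> * cnj (g \<xi>))) \<le> (\<integral>\<^sup>+y. ennreal (((norm (g (\<xi> + \<delta> *\<^sub>R y)))\<^sup>2 / 2 + (norm (g \<xi>))\<^sup>2 / 2)) * ?k y \<partial>lborel)" .
  qed
  also have "\<dots> = (\<integral>\<^sup>+y. (\<integral>\<^sup>+\<xi>. ennreal (((norm (g (\<xi> + \<delta> *\<^sub>R y)))\<^sup>2 / 2 + (norm (g \<xi>))\<^sup>2 / 2)) * ?k y \<partial>lborel) \<partial>lborel)"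
    by (rule lborel_pair.Fubini') measurable
  also have "\<dots> = (\<integral>\<^sup>+y. ?S * ?k y \<partial>lborel)"
  proof (rule nn_integral_cong)
    fix y
    let ?h = "\<lambda>\<xi>. ennreal ((norm (g \<xi>))\<^sup>2 / 2)"
    have "(\<integral>\<^sup>+\<xi>. ennreal (((norm (g (\<xi> + \<delta> *\<^sub>R y)))\<^sup>2 / 2 + (norm (g \<xi>))\<^sup>2 / 2)) * ?k y \<partial>lborel)
       = (\<integral>\<^sup>+\<xi>. (?h (\<xi> + \<delta> *\<^sub>R y) + ?h \<xi>) \<partial>lborel) * ?k y"
      by (simp add: nn_integral_multc ennreal_plus[symmetric] del: ennreal_plus)
    also have "(\<integral>\<^sup>+\<xi>. (?h (\<xi> + \<delta> *\<^sub>R y) + ?h \<xi>) \<partial>lborel) = (\<integral>\<^sup>+\<xi>. ?h (\<xi> + \<delta> *\<^sub>R y) \<partial>lborel) + (\<integral>\<^sup>+\<xi>. ?h \<xi> \<partial>lborel)"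
      by (rule nn_integral_add) auto
    also have "(\<integral>\<^sup>+\<xi>. ?h (\<xi> + \<delta> *\<^sub>R y) \<partial>lborel) = (\<integral>\<^sup>+\<xi>. ?h \<xi> \<partial>lborel)"
      by (rule nn_integral_lborel_translation) measurable
    also have "(\<integral>\<^sup>+\<xi>. ?h \<xi> \<partial>lborel) + (\<integral>\<^sup>+\<xi>. ?h \<xi> \<partial>lborel) = (\<integral>\<^sup>+\<xi>. ?h \<xi> + ?h \<xi> \<partial>lborel)"
      by (rule nn_integral_add[symmetric]) auto
    also have "\<dots> = ?S" by (intro nn_integral_cong) (simp add: ennreal_plus[symmetric] del: ennreal_plus)
    finally show "(\<integral>\<^sup>+\<xi>. ennreal (((norm (g (\<xi> + \<delta> *\<^sub>R y)))\<^sup>2 / 2 + (norm (g \<xi>))\<^sup>2 / 2)) * ?k y \<partial>lborel) = ?S * ?k y" .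
  qed
  also have "\<dots> = ?S" by (simp add: nn_integral_cmult k1)
  also have "\<dots> = ennreal (LINT x|lborel. (norm (g x))\<^sup>2)" using g2 by (intro nn_integral_eq_integral) auto
  finally show ?thesis by (simp add: ennreal_le_iff)
qed

lemma damp_limit: "(\<lambda>n. damp (1 / real (Suc n)) x) \<longlonglongrightarrow> 1"
proof -
  have "(\<lambda>n. exp (- (norm ((1 / real (Suc n)) *\<^sub>R x))\<^sup>2 / 2)) \<longlonglongrightarrow> exp (- (norm (0 *\<^sub>R x))\<^sup>2 / 2)"
    by (intro tendsto_intros LIMSEQ_Suc[OF lim_1_over_n]) simp
  then show ?thesis by (simp add: damp_def)
qed

lemma damp_mono: "mono (\<lambda>n. damp (1 / real (Suc n)) x)"
  by (intro monoI) (auto simp: damp_def power_mult_distrib intro!: mult_right_mono power_mono frac_le)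

text \<open>The damped integrals increase to the full one and are bounded uniformly in the damping,
  so monotone convergence gives Bessel's inequality. The third claim keeps the limit, from which
  equality follows once the mollified functions converge.\<close>

lemma bessel_inv_fourier:
  assumes g: "integrable lborel g" and g2: "integrable lborel (\<lambda>x. (norm (g x))\<^sup>2)"
  shows "integrable lborel (\<lambda>x. (norm (inv_fourier g (x::real^'n::finite)))\<^sup>2)"
    and "(LINT x|lborel. (norm (inv_fourier g x))\<^sup>2) \<le> (LINT x|lborel. (norm (g x))\<^sup>2)"
    and "(\<lambda>n. LINT \<xi>|lborel. mollify (1 / real (Suc n)) g \<xi> * cnj (g \<xi>)) \<longlonglongrightarrow> complex_of_real (LINT x|lborel. (norm (inv_fourier g x))\<^sup>2)"
proof -
  have [measurable]: "g \<in> borel_measurable borel" using g by auto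
  let ?f = "\<lambda>n x. (norm (inv_fourier g x))\<^sup>2 * damp (1 / real (Suc n)) x"
  let ?C = "LINT x|lborel. norm (g x)"
  have int: "integrable lborel (?f n)" for n
  proof (rule Bochner_Integration.integrable_bound[OF integrable_mult_right[OF damp_integrable]])
    show "AE x in lborel. norm (?f n x) \<le> norm (?C\<^sup>2 * damp (1 / real (Suc n)) x)"
      using norm_inv_fourier_le[OF g] by (auto simp: abs_mult damp_nonneg intro!: mult_right_mono power_mono)
  qed (auto intro!: borel_measurable_times)
  have mono: "mono (\<lambda>n. ?f n x)" for x
    using damp_mono[of x] by (auto simp: mono_def intro!: mult_left_mono)
  have le: "(LINT x|lborel. ?f n x) \<le> (LINT x|lborel. (norm (g x))\<^sup>2)" for n
  proof -
    have "norm (complex_of_real (LINT x|lborel. ?f n x)) \<le> (LINT x|lborel. (norm (g x))\<^sup>2)"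
      by (subst inv_fourier_damped_sq[OF g]) (auto intro!: mollify_sq_le g g2)
    then show ?thesis by simp
  qed
  have "incseq (\<lambda>n. LINT x|lborel. ?f n x)"
  proof (intro incseq_SucI integral_mono int)
    fix n x show "?f n x \<le> ?f (Suc n) x" by (rule monoD[OF mono]) simp
  qed
  then obtain L where L: "(\<lambda>n. LINT x|lborel. ?f n x) \<longlonglongrightarrow> L"
    using incseq_convergent[of _ "LINT x|lborel. (norm (g x))\<^sup>2"] le by blast
  have lim: "(\<lambda>n. ?f n x) \<longlonglongrightarrow> (norm (inv_fourier g x))\<^sup>2" for x
    using tendsto_mult[OF tendsto_const damp_limit[of x], of "(norm (inv_fourier g x))\<^sup>2"] by simp
  note mc = integral_monotone_convergence_nonneg[where f = ?f and u = "\<lambda>x. (norm (inv_fourier g x))\<^sup>2" and x = L, OF int]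
  show "integrable lborel (\<lambda>x. (norm (inv_fourier g x))\<^sup>2)"
    using mono lim L by (intro mc(1)) (auto simp: damp_nonneg)
  have eq: "(LINT x|lborel. (norm (inv_fourier g x))\<^sup>2) = L"
    using mono lim L by (intro mc(2)) (auto simp: damp_nonneg)
  show "(LINT x|lborel. (norm (inv_fourier g x))\<^sup>2) \<le> (LINT x|lborel. (norm (g x))\<^sup>2)"
    unfolding eq using LIMSEQ_le_const2[OF L] le by blast
  show "(\<lambda>n. LINT \<xi>|lborel. mollify (1 / real (Suc n)) g \<xi> * cnj (g \<xi>)) \<longlonglongrightarrow> complex_of_real (LINT x|lborel. (norm (inv_fourier g x))\<^sup>2)"
    unfolding eq using tendsto_of_real[OF L, where 'a = complex] by (subst (asm) inv_fourier_damped_sq[OF g]) auto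
qed

lemma mollify_limit:
  assumes [measurable]: "g \<in> borel_measurable borel" and B: "\<And>x. norm (g x) \<le> B" and c: "isCont g \<xi>"
  shows "(\<lambda>n. mollify (1 / real (Suc n)) g (\<xi>::real^'n::finite)) \<longlonglongrightarrow> g \<xi>"
proof -
  have "(\<lambda>n. mollify (1 / real (Suc n)) g \<xi>) \<longlonglongrightarrow> (LINT y|lborel. g \<xi> * of_real (heat_kernel (y::real^'n)))"
    unfolding mollify_def
  proof (rule integral_dominated_convergence[where w = "\<lambda>y::real^'n. B * heat_kernel y" and s = "\<lambda>n y. g (\<xi> + (1 / real (Suc n)) *\<^sub>R y) * complex_of_real (heat_kernel y)" and f = "\<lambda>y. g \<xi> * complex_of_real (heat_kernel y)" and M = lborel])
    show "AE y in lborel. (\<lambda>n. g (\<xi> + (1 / real (Suc n)) *\<^sub>R y) * of_real (heat_kernel y)) \<longlonglongrightarrow> g \<xi> * of_real (heat_kernel y)"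
    proof (intro AE_I2 tendsto_intros)
      fix y :: "real^'n"
      have "(\<lambda>n. \<xi> + (1 / real (Suc n)) *\<^sub>R y) \<longlonglongrightarrow> \<xi> + 0 *\<^sub>R y"
        by (intro tendsto_intros LIMSEQ_Suc[OF lim_1_over_n])
      then show "(\<lambda>n. g (\<xi> + (1 / real (Suc n)) *\<^sub>R y)) \<longlonglongrightarrow> g \<xi>"
        using isCont_tendsto_compose[OF c] by simp
    qed
    show "AE y in lborel. norm (g (\<xi> + (1 / real (Suc n)) *\<^sub>R y) * of_real (heat_kernel y)) \<le> B * heat_kernel y" for n
      using B by (auto simp: norm_mult heat_kernel_nonneg intro!: mult_right_mono)
  qed (auto intro!: integrable_mult_right heat_kernel_integral)
  then show ?thesis by (simp add: heat_kernel_integral)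
qed

lemma mollify_bound:
  assumes [measurable]: "g \<in> borel_measurable borel" and B: "\<And>x. norm (g x) \<le> B"
  shows "norm (mollify \<delta> g (\<xi>::real^'n::finite)) \<le> B"
proof -
  have "norm (mollify \<delta> g \<xi>) \<le> (LINT y|lborel. norm (g (\<xi> + \<delta> *\<^sub>R y) * of_real (heat_kernel y)))"
    unfolding mollify_def by (rule integral_norm_bound)
  also have "\<dots> \<le> (LINT y|lborel. B * heat_kernel (y::real^'n))"
  proof (rule integral_mono)
    show le: "norm (g (\<xi> + \<delta> *\<^sub>R y) * of_real (heat_kernel y)) \<le> B * heat_kernel y" for y
      using B by (auto simp: norm_mult heat_kernel_nonneg intro!: mult_right_mono)
    show i: "integrable lborel (\<lambda>y. B * heat_kernel (y::real^'n))" by (intro integrable_mult_right heat_kernel_integral)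
    show "integrable lborel (\<lambda>y. norm (g (\<xi> + \<delta> *\<^sub>R y) * of_real (heat_kernel y)))"
      using le by (intro Bochner_Integration.integrable_bound[OF i]) (auto intro: order_trans[OF _ abs_ge_self])
  qed
  finally show ?thesis by (simp add: heat_kernel_integral)
qed

text \<open>Boundedness supplies the dominating function \<open>B * |g|\<close> that lets the
  mollified functions be replaced by their pointwise limit.\<close>

lemma plancherel_bounded:
  fixes g :: "real^'n::finite \<Rightarrow> complex"
  assumes g: "integrable lborel g" and g2: "integrable lborel (\<lambda>x. (norm (g x))\<^sup>2)"
    and B: "\<And>x. norm (g x) \<le> B" and c: "\<And>x. x \<noteq> 0 \<Longrightarrow> isCont g x"
  shows "(LINT x|lborel. (norm (inv_fourier g x))\<^sup>2) = (LINT x|lborel. (norm (g x))\<^sup>2)"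
proof -
  have [measurable]: "g \<in> borel_measurable borel" using g by auto
  have m[measurable]: "mollify \<delta> g \<in> borel_measurable borel" for \<delta>
  proof -
    have "(\<lambda>\<xi>. LINT y|lborel. g (\<xi> + \<delta> *\<^sub>R y) * of_real (heat_kernel y)) \<in> borel_measurable lborel"
      by (rule lborel.borel_measurable_lebesgue_integral) measurable
    then show ?thesis by (simp add: mollify_def[abs_def])
  qed
  have "(\<lambda>n. LINT \<xi>|lborel. mollify (1 / real (Suc n)) g \<xi> * cnj (g \<xi>)) \<longlonglongrightarrow> (LINT \<xi>|lborel. g \<xi> * cnj (g \<xi>))"
  proof (rule integral_dominated_convergence[where w = "\<lambda>\<xi>. B * norm (g \<xi>)"])
    show "AE \<xi> in lborel. (\<lambda>n. mollify (1 / real (Suc n)) g \<xi> * cnj (g \<xi>)) \<longlonglongrightarrow> g \<xi> * cnj (g \<xi>)"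
      using AE_lborel_nonzero by eventually_elim (rule tendsto_mult[OF mollify_limit[OF _ B c] tendsto_const], auto)
    show "AE \<xi> in lborel. norm (mollify (1 / real (Suc n)) g \<xi> * cnj (g \<xi>)) \<le> B * norm (g \<xi>)" for n
      using mollify_bound[of g B] B by (auto simp: norm_mult intro!: mult_right_mono)
  qed (use g in \<open>auto intro!: integrable_mult_right\<close>)
  from LIMSEQ_unique[OF this bessel_inv_fourier(3)[OF g g2]]
  have "complex_of_real (LINT x|lborel. (norm (inv_fourier g x))\<^sup>2) = (LINT \<xi>|lborel. complex_of_real ((norm (g \<xi>))\<^sup>2))"
    by (simp only: complex_norm_square)
  then show ?thesis by (simp del: of_real_power)
qed

lemma fourier_inversion:
  fixes g :: "real^'n::finite \<Rightarrow> complex"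
  assumes g: "integrable lborel g" and B: "\<And>x. norm (g x) \<le> B" and c: "isCont g \<xi>"
    and w: "integrable lborel (inv_fourier g)"
  shows "fourier (inv_fourier g) \<xi> = g \<xi>"
proof -
  have [measurable]: "g \<in> borel_measurable borel" using g by auto
  have "(\<lambda>n. LINT x|lborel. inv_fourier g x * of_real (damp (1 / real (Suc n)) x) * cis (- (2 * pi * (x \<bullet> \<xi>)))) \<longlonglongrightarrow> fourier (inv_fourier g) \<xi>"
    unfolding fourier_def
  proof (rule integral_dominated_convergence[where w = "\<lambda>x. norm (inv_fourier g x)"])
    show "AE x in lborel. (\<lambda>n. inv_fourier g x * of_real (damp (1 / real (Suc n)) x) * cis (- (2 * pi * (x \<bullet> \<xi>)))) \<longlonglongrightarrow> inv_fourier g x * cis (- (2 * pi * (x \<bullet> \<xi>)))"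
    proof (intro AE_I2)
      fix x
      have "(\<lambda>n. inv_fourier g x * of_real (damp (1 / real (Suc n)) x) * cis (- (2 * pi * (x \<bullet> \<xi>)))) \<longlonglongrightarrow> inv_fourier g x * of_real 1 * cis (- (2 * pi * (x \<bullet> \<xi>)))"
        by (intro tendsto_mult tendsto_const tendsto_of_real damp_limit)
      then show "(\<lambda>n. inv_fourier g x * of_real (damp (1 / real (Suc n)) x) * cis (- (2 * pi * (x \<bullet> \<xi>)))) \<longlonglongrightarrow> inv_fourier g x * cis (- (2 * pi * (x \<bullet> \<xi>)))" by simp
    qed
  qed (use w in \<open>auto simp: norm_mult mult_left_le damp_nonneg damp_le_1\<close>)
  moreover have "(\<lambda>n. LINT x|lborel. inv_fourier g x * of_real (damp (1 / real (Suc n)) x) * cis (- (2 * pi * (x \<bullet> \<xi>)))) \<longlonglongrightarrow> g \<xi>"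
    using mollify_limit[OF _ B c] by (subst inv_fourier_damped[OF g]) auto
  ultimately show ?thesis by (rule LIMSEQ_unique)
qed

section \<open>Plancherel identity and integration by parts\<close>

lemma inv_fourier_cong_AE:
  assumes "\<And>x. x \<noteq> 0 \<Longrightarrow> f x = g x" and [measurable]: "f \<in> borel_measurable borel" "g \<in> borel_measurable borel"
  shows "inv_fourier f y = inv_fourier g y"
  unfolding inv_fourier_def
proof (rule integral_cong_AE)
  show "AE x in lborel. f x * cis (2 * pi * (y \<bullet> x)) = g x * cis (2 * pi * (y \<bullet> x))"
    using AE_lborel_nonzero by eventually_elim (simp add: assms)
qed measurable

text \<open>The inequality \<open>(a + b)^2 \<le> (1 + e) a^2 + (1 + 1 / e) b^2\<close> serves as a
  triangle inequality for squared norms, with a factor arbitrarily close to 1 on the main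
  term.\<close>

lemma integral_norm_sq_triangle:
  fixes f g :: "'a \<Rightarrow> 'b::{second_countable_topology, banach}"
  assumes [measurable]: "f \<in> borel_measurable M" "g \<in> borel_measurable M" 
    and f: "integrable M (\<lambda>x. (norm (f x))\<^sup>2)" and g: "integrable M (\<lambda>x. (norm (g x))\<^sup>2)" and e: "0 < e"
  shows "(LINT x|M. (norm (f x))\<^sup>2) \<le> (1 + e) * (LINT x|M. (norm (g x))\<^sup>2) + (1 + 1 / e) * (LINT x|M. (norm (f x - g x))\<^sup>2)"
    and "integrable M (\<lambda>x. (norm (f x - g x))\<^sup>2)"
proof -
  have p: "(norm (f x))\<^sup>2 \<le> (1 + e) * (norm (g x))\<^sup>2 + (1 + 1 / e) * (norm (f x - g x))\<^sup>2" for x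
  proof -
    let ?a = "norm (g x)" and ?b = "norm (f x - g x)"
    have "norm (f x) \<le> ?a + ?b" using norm_triangle_ineq[of "g x" "f x - g x"] by simp
    then have "(norm (f x))\<^sup>2 \<le> (?a + ?b)\<^sup>2" by (intro power_mono) auto
    also have "\<dots> \<le> (1 + e) * ?a\<^sup>2 + (1 + 1 / e) * ?b\<^sup>2"
    proof -
      have "0 \<le> (sqrt e * ?a - ?b / sqrt e)\<^sup>2" by simp
      also have "\<dots> = e * ?a\<^sup>2 - 2 * ?a * ?b + ?b\<^sup>2 / e"
        using e by (simp add: power2_diff power_mult_distrib power_divide)
      finally show ?thesis by (simp add: power2_sum algebra_simps)
    qed
    finally show ?thesis .
  qed
  show i: "integrable M (\<lambda>x. (norm (f x - g x))\<^sup>2)"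
  proof (rule Bochner_Integration.integrable_bound[where f = "\<lambda>x. 2 * (norm (f x))\<^sup>2 + 2 * (norm (g x))\<^sup>2"])
    have "(norm (f x - g x))\<^sup>2 \<le> 2 * (norm (f x))\<^sup>2 + 2 * (norm (g x))\<^sup>2" for x
    proof -
      have "(norm (f x - g x))\<^sup>2 \<le> (norm (f x) + norm (g x))\<^sup>2" by (intro power_mono norm_triangle_ineq4) auto
      also have "\<dots> \<le> 2 * (norm (f x))\<^sup>2 + 2 * (norm (g x))\<^sup>2"
        using sum_squares_bound[of "norm (f x)" "norm (g x)"] by (simp add: power2_sum)
      finally show ?thesis .
    qed
    then show "AE x in M. norm ((norm (f x - g x))\<^sup>2) \<le> norm (2 * (norm (f x))\<^sup>2 + 2 * (norm (g x))\<^sup>2)" by auto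
  qed (use f g in auto)
  have "(LINT x|M. (norm (f x))\<^sup>2) \<le> (LINT x|M. (1 + e) * (norm (g x))\<^sup>2 + (1 + 1 / e) * (norm (f x - g x))\<^sup>2)"
    using p f g i by (intro integral_mono) auto
  then show "(LINT x|M. (norm (f x))\<^sup>2) \<le> (1 + e) * (LINT x|M. (norm (g x))\<^sup>2) + (1 + 1 / e) * (LINT x|M. (norm (f x - g x))\<^sup>2)"
    using g i by simp
qed

lemma inv_fourier_diff:
  assumes "integrable lborel f" "integrable lborel g"
  shows "inv_fourier (\<lambda>x. f x - g x) y = inv_fourier f y - inv_fourier g y"
  unfolding inv_fourier_def
  by (subst Bochner_Integration.integral_diff[symmetric]) (auto intro!: integrable_mult_cis assms Bochner_Integration.integral_cong simp: left_diff_distrib)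

text \<open>The function may be unbounded at the origin. It is truncated there to bounded functions
  \<open>h n\<close>, for which equality is known; Bessel's inequality controls the transform of
  \<open>g - h n\<close>, and this error vanishes in the limit.\<close>

theorem plancherel_rapid:
  fixes g :: "real^'n::finite \<Rightarrow> complex"
  assumes g: "rapid a g" and a: "2 * a > - real CARD('n)"
  shows "integrable lborel (\<lambda>x. (norm (inv_fourier g x))\<^sup>2)"
    and "(LINT x|lborel. (norm (inv_fourier g x))\<^sup>2) = (LINT x|lborel. (norm (g x))\<^sup>2)"
proof -
  \<comment> \<open>A strictly negative exponent makes the truncating factor below vanish at the
    origin; with -1/4 the bound \<open>2 * b > - CARD('n)\<close> persists.\<close>
  define b where "b = min a (- (1/4))"
  have b: "rapid b g" using rapid_mono[OF g] by (simp add: b_def)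
  have c1: "real CARD('n) \<ge> 1" by (simp add: Suc_le_eq)
  have b2: "2 * b > - real CARD('n)"
  proof (cases "a \<le> - (1/4)")
    case False
    then have "b = - (1/4)" by (simp add: b_def)
    then show ?thesis using c1 by linarith
  qed (use a in \<open>simp add: b_def\<close>)
  have bn: "b < 0" by (simp add: b_def)
  have [measurable]: "g \<in> borel_measurable borel" by (rule rapid_measurable[OF g])
  have ig: "integrable lborel g" using b b2 bn by (intro rapid_integrable[OF b]) auto
  have ig2: "integrable lborel (\<lambda>x. (norm (g x))\<^sup>2)" using b2 by (intro rapid_integrable[OF rapid_norm_sq[OF b]]) auto
  note bes = bessel_inv_fourier(1,2)[OF ig ig2]
  show "integrable lborel (\<lambda>x. (norm (inv_fourier g x))\<^sup>2)" by (rule bes)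
  obtain C where C: "C > 0" "\<And>x. x \<noteq> 0 \<Longrightarrow> norm (g x) \<le> C * (norm x powr b / (1 + norm x) ^ 0)"
    using rapid_boundE[OF b] by metis
  \<comment> \<open>Equal to 1 where \<open>|x|^(- b) \<ge> 1 / n\<close>, and small enough near 0
    to cancel the singularity: \<open>h n\<close> is bounded by \<open>C * n\<close>.\<close>
  define m where "m n x = min 1 (real n * norm (x::real^'n) powr (- b))" for n x
  have m01: "0 \<le> m n x" "m n x \<le> 1" for n x by (auto simp: m_def)
  define h where "h n x = of_real (m n x) * g x" for n x
  have mc: "continuous_on (- {0}) (m n)" for n
    unfolding m_def by (intro continuous_intros continuous_on_norm_powr)
  have hc: "continuous_on (- {0}) (h n)" for n
    unfolding h_def by (intro continuous_intros mc rapid_cont[OF g])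
  have m0: "m n 0 = 0" for n by (simp add: m_def)
  have [measurable]: "h n \<in> borel_measurable borel" for n
    using borel_measurable_continuous_countable_exceptions[of "{0}" "h n"] hc by simp
  have hB: "norm (h n x) \<le> C * real n" for n x
  proof (cases "x = 0")
    case True then show ?thesis using C by (simp add: h_def m0)
  next
    case False
    have "norm (h n x) = m n x * norm (g x)" using m01[of n x] by (simp add: h_def norm_mult)
    also have "\<dots> \<le> (real n * norm x powr (- b)) * (C * norm x powr b)"
      using C(2)[OF False] m01[of n x] by (intro mult_mono) (auto simp: m_def)
    also have "\<dots> = C * real n" using False by (simp add: powr_minus field_simps)
    finally show ?thesis .
  qed
  have hle: "norm (h n x) \<le> norm (g x)" for n x
    using m01[of n x] by (simp add: h_def norm_mult mult_left_le_one_le)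
  have ih: "integrable lborel (h n)" for n
    using hle by (intro Bochner_Integration.integrable_bound[OF ig]) auto
  have ih2: "integrable lborel (\<lambda>x. (norm (h n x))\<^sup>2)" for n
    using hle by (intro Bochner_Integration.integrable_bound[OF ig2]) (auto intro: power_mono)
  have ph: "(LINT x|lborel. (norm (inv_fourier (h n) x))\<^sup>2) = (LINT x|lborel. (norm (h n x))\<^sup>2)" for n
    by (rule plancherel_bounded[OF ih ih2 hB]) (use hc[of n] in \<open>auto simp: continuous_on_eq_continuous_at open_Compl\<close>)
  have mlim: "(\<lambda>n. m n x) \<longlonglongrightarrow> 1" if nz: "x \<noteq> 0" for x
  proof -
    obtain k :: nat where k: "real k * norm x powr (- b) > 1"
      using nz reals_Archimedean3[of "norm x powr (- b)", THEN spec[of _ 1]] by auto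
    have "m n x = 1" if "n \<ge> k" for n
    proof -
      have "real k * norm x powr (- b) \<le> real n * norm x powr (- b)" using that by (intro mult_right_mono) auto
      then show ?thesis using k by (simp add: m_def)
    qed
    then show ?thesis by (intro tendsto_eventually) (auto simp: eventually_sequentially)
  qed
  have l1: "(\<lambda>n. LINT x|lborel. (norm (h n x))\<^sup>2) \<longlonglongrightarrow> (LINT x|lborel. (norm (g x))\<^sup>2)"
  proof (rule integral_dominated_convergence[where w = "\<lambda>x. (norm (g x))\<^sup>2"])
    show "AE x in lborel. (\<lambda>n. (norm (h n x))\<^sup>2) \<longlonglongrightarrow> (norm (g x))\<^sup>2"
      using AE_lborel_nonzero
    proof eventually_elim
      fix x :: "real^'n" assume "x \<noteq> 0"
      have "(\<lambda>n. (norm (h n x))\<^sup>2) \<longlonglongrightarrow> (norm (of_real 1 * g x))\<^sup>2"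
        unfolding h_def by (intro tendsto_intros mlim \<open>x \<noteq> 0\<close>)
      then show "(\<lambda>n. (norm (h n x))\<^sup>2) \<longlonglongrightarrow> (norm (g x))\<^sup>2" by simp
    qed
    show "AE x in lborel. norm ((norm (h n x))\<^sup>2) \<le> (norm (g x))\<^sup>2" for n
      using hle by (auto intro: power_mono)
  qed (use ig2 in auto)
  have l2: "(\<lambda>n. LINT x|lborel. (norm (g x - h n x))\<^sup>2) \<longlonglongrightarrow> (LINT x::real^'n|lborel. 0)"
  proof (rule integral_dominated_convergence[where w = "\<lambda>x. (norm (g x))\<^sup>2"])
    show "AE x in lborel. (\<lambda>n. (norm (g x - h n x))\<^sup>2) \<longlonglongrightarrow> 0"
      using AE_lborel_nonzero
    proof eventually_elim
      fix x :: "real^'n" assume "x \<noteq> 0"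
      have "(\<lambda>n. (norm (g x - h n x))\<^sup>2) \<longlonglongrightarrow> (norm (g x - of_real 1 * g x))\<^sup>2"
        unfolding h_def by (intro tendsto_intros mlim \<open>x \<noteq> 0\<close>)
      then show "(\<lambda>n. (norm (g x - h n x))\<^sup>2) \<longlonglongrightarrow> 0" by simp
    qed
    show "AE x in lborel. norm ((norm (g x - h n x))\<^sup>2) \<le> (norm (g x))\<^sup>2" for n
    proof (intro AE_I2)
      fix x
      have "g x - h n x = of_real (1 - m n x) * g x" by (simp add: h_def algebra_simps)
      then have "norm (g x - h n x) = (1 - m n x) * norm (g x)" using m01[of n x] by (simp only: norm_mult norm_of_real)
      also have "\<dots> \<le> norm (g x)" using m01[of n x] by (intro mult_left_le_one_le) auto
      finally show "norm ((norm (g x - h n x))\<^sup>2) \<le> (norm (g x))\<^sup>2" by (auto intro: power_mono)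
    qed
  qed (use ig2 in auto)
  have key: "(LINT x|lborel. (norm (g x))\<^sup>2) \<le> (1 + e) * (LINT x|lborel. (norm (inv_fourier g x))\<^sup>2)" if e: "0 < e" for e
  proof -
    have "(LINT x|lborel. (norm (h n x))\<^sup>2) \<le> (1 + e) * (LINT x|lborel. (norm (inv_fourier g x))\<^sup>2) + (1 + 1 / e) * (LINT x|lborel. (norm (g x - h n x))\<^sup>2)" for n
    proof -
      have i: "integrable lborel (\<lambda>x. (norm (g x - h n x))\<^sup>2)"
        using integral_norm_sq_triangle(2)[of g lborel "h n" 1] ig2 ih2[of n] by simp
      have "(LINT x|lborel. (norm (h n x))\<^sup>2) = (LINT x|lborel. (norm (inv_fourier (h n) x))\<^sup>2)" by (simp add: ph)
      also have "\<dots> \<le> (1 + e) * (LINT x|lborel. (norm (inv_fourier g x))\<^sup>2) + (1 + 1 / e) * (LINT x|lborel. (norm (inv_fourier (h n) x - inv_fourier g x))\<^sup>2)"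
        by (rule integral_norm_sq_triangle) (auto intro: bes bessel_inv_fourier(1)[OF ih ih2] e)
      also have "(LINT x|lborel. (norm (inv_fourier (h n) x - inv_fourier g x))\<^sup>2) = (LINT x|lborel. (norm (inv_fourier (\<lambda>x. g x - h n x) x))\<^sup>2)"
        by (simp add: inv_fourier_diff ig ih norm_minus_commute)
      also have "\<dots> \<le> (LINT x|lborel. (norm (g x - h n x))\<^sup>2)"
        by (rule bessel_inv_fourier(2)) (use i ig ih in auto)
      finally show ?thesis using e by (simp add: mult_left_mono)
    qed
    then have "(LINT x|lborel. (norm (g x))\<^sup>2) \<le> (1 + e) * (LINT x|lborel. (norm (inv_fourier g x))\<^sup>2) + (1 + 1 / e) * (LINT x::real^'n|lborel. 0)"
      by (intro LIMSEQ_le[OF l1 tendsto_add[OF tendsto_const tendsto_mult[OF tendsto_const l2]]]) auto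
    then show ?thesis by simp
  qed
  have "(LINT x|lborel. (norm (g x))\<^sup>2) \<le> (LINT x|lborel. (norm (inv_fourier g x))\<^sup>2)"
  proof (rule field_le_epsilon)
    fix e :: real assume e: "0 < e"
    define I where "I = (LINT x|lborel. (norm (inv_fourier g x))\<^sup>2)"
    have I: "I \<ge> 0" by (simp add: I_def)
    \<comment> \<open>The parameter \<open>e / (I + 1)\<close> keeps the error
      \<open>e * I / (I + 1)\<close> below \<open>e\<close>, also when \<open>I = 0\<close>.\<close>
    have "(LINT x|lborel. (norm (g x))\<^sup>2) \<le> (1 + e / (I + 1)) * I"
      using key[OF divide_pos_pos[OF e], of "I + 1"] I unfolding I_def by linarith
    also have "\<dots> \<le> I + e" using e I by (simp add: field_simps)
    finally show "(LINT x|lborel. (norm (g x))\<^sup>2) \<le> (LINT x|lborel. (norm (inv_fourier g x))\<^sup>2) + e" by (simp add: I_def)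
  qed
  then show "(LINT x|lborel. (norm (inv_fourier g x))\<^sup>2) = (LINT x|lborel. (norm (g x))\<^sup>2)"
    using bes(2) by simp
qed

text \<open>A line is a null set in dimension at least 2; this is where the dimension enters
  integration by parts.\<close>

lemma AE_lborel_not_span:
  fixes e :: "'a::euclidean_space"
  assumes "DIM('a) \<ge> 2"
  shows "AE x in lborel. x \<notin> span {e}"
proof -
  have "dim (span {e}) \<le> card {e}" by (metis dim_span dim_le_card' finite.emptyI finite.insertI)
  then have "dim (span {e}) < DIM('a)" using assms by simp
  then have "negligible (span {e})" by (rule negligible_lowdim)
  then have "emeasure lebesgue (span {e}) = 0" by (simp add: negligible_iff_null_sets null_setsD1)
  moreover have "span {e} \<in> sets borel" using closed_subspace[OF subspace_span] by (simp add: borel_closed)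
  ultimately have "span {e} \<in> null_sets lborel" by (auto simp: null_sets_def)
  then show ?thesis by (rule AE_not_in)
qed

text \<open>Off the line spanned by \<open>e\<close>, the increment \<open>h (x + e) - h x\<close>
  is the integral of \<open>h'\<close> along a segment that avoids the origin. Integrating over
  \<open>x\<close> makes the left side 0 by translation invariance, and Fubini makes the right side
  the integral of \<open>h'\<close>.\<close>

theorem integral_partial_zero:
  fixes h h' :: "'a::euclidean_space \<Rightarrow> 'b::euclidean_space"
  assumes d: "DIM('a) \<ge> 2" and h: "integrable lborel h" and h': "integrable lborel h'" and c: "continuous_on (- {0}) h'"
    and D: "\<And>x. x \<noteq> 0 \<Longrightarrow> ((\<lambda>t. h (x + t *\<^sub>R e)) has_vector_derivative h' x) (at 0)"
  shows "(LINT x|lborel. h' x) = 0"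
proof -
  have [measurable]: "h \<in> borel_measurable borel" "h' \<in> borel_measurable borel" using h h' by auto
  let ?F = "\<lambda>(x, t). indicator {0..1::real} t *\<^sub>R h' (x + t *\<^sub>R e)"
  have int: "integrable (lborel \<Otimes>\<^sub>M lborel) ?F"
    unfolding integrable_iff_bounded
  proof
    show "?F \<in> borel_measurable (lborel \<Otimes>\<^sub>M lborel)" by measurable
    have "(\<integral>\<^sup>+z. norm (?F z) \<partial>(lborel \<Otimes>\<^sub>M lborel)) = (\<integral>\<^sup>+t. (\<integral>\<^sup>+x. norm (?F (x, t)) \<partial>lborel) \<partial>lborel)"
      by (subst lborel_pair.nn_integral_snd[symmetric]) (auto simp: split_def)
    also have "\<dots> = (\<integral>\<^sup>+t. (\<integral>\<^sup>+x. ennreal (indicator {0..1} t) * ennreal (norm (h' (x + t *\<^sub>R e))) \<partial>lborel) \<partial>lborel)"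
      by (auto intro!: nn_integral_cong simp: ennreal_mult)
    also have "\<dots> = (\<integral>\<^sup>+t. ennreal (indicator {0..1} (t::real)) * (\<integral>\<^sup>+x. ennreal (norm (h' x)) \<partial>lborel) \<partial>lborel)"
      by (intro nn_integral_cong) (subst nn_integral_cmult, auto intro!: arg_cong2[where f = "(*)"] nn_integral_lborel_translation)
    also have "\<dots> = (\<integral>\<^sup>+t. indicator {0..1} (t::real) \<partial>lborel) * (\<integral>\<^sup>+x. ennreal (norm (h' x)) \<partial>lborel)"
      by (subst nn_integral_multc) (auto simp: ennreal_indicator)
    also have "\<dots> < \<infinity>" using h' by (simp add: integrable_iff_bounded)
    finally show "(\<integral>\<^sup>+z. norm (?F z) \<partial>(lborel \<Otimes>\<^sub>M lborel)) < \<infinity>" .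
  qed
  have "(LINT x|lborel. h (x + e) - h x) = (LINT x|lborel. (LINT t|lborel. indicator {0..1::real} t *\<^sub>R h' (x + t *\<^sub>R e)))"
  proof (rule integral_cong_AE)
    show "AE x in lborel. h (x + e) - h x = (LINT t|lborel. indicator {0..1::real} t *\<^sub>R h' (x + t *\<^sub>R e))"
      using AE_lborel_not_span[OF d, of e]
    proof eventually_elim
      fix x assume x: "x \<notin> span {e}"
      have nz: "x + t *\<^sub>R e \<noteq> 0" for t
      proof
        assume "x + t *\<^sub>R e = 0"
        then have "x = (- t) *\<^sub>R e" by (simp add: eq_neg_iff_add_eq_0)
        then have "x \<in> span {e}" by (simp only: span_mul span_base insertI1)
        then show False using x by simp
      qed
      have "(LINT t|lborel. indicator {0..1} t *\<^sub>R h' (x + t *\<^sub>R e)) = h (x + 1 *\<^sub>R e) - h (x + 0 *\<^sub>R e)"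
      proof (rule integral_FTC_atLeastAtMost)
        fix t :: real
        have "((\<lambda>r. h ((x + t *\<^sub>R e) + (r - t) *\<^sub>R e)) has_vector_derivative h' (x + t *\<^sub>R e)) (at t)"
        proof -
          have "((\<lambda>r. h ((x + t *\<^sub>R e) + r *\<^sub>R e)) \<circ> (\<lambda>r. r - t) has_vector_derivative (1::real) *\<^sub>R h' (x + t *\<^sub>R e)) (at t)"
            by (rule vector_diff_chain_at) (auto intro!: derivative_eq_intros D[OF nz])
          then show ?thesis by (simp add: o_def)
        qed
        then have "((\<lambda>r. h (x + r *\<^sub>R e)) has_vector_derivative h' (x + t *\<^sub>R e)) (at t)" by (simp add: algebra_simps)
        then show "((\<lambda>r. h (x + r *\<^sub>R e)) has_vector_derivative h' (x + t *\<^sub>R e)) (at t within {0..1})"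
          by (rule has_vector_derivative_at_within)
      next
        show "continuous_on {0..1} (\<lambda>t. h' (x + t *\<^sub>R e))"
          using nz by (intro continuous_on_compose2[OF c]) (auto intro!: continuous_intros)
      qed simp
      then show "h (x + e) - h x = (LINT t|lborel. indicator {0..1} t *\<^sub>R h' (x + t *\<^sub>R e))" by simp
    qed
  qed measurable
  also have "\<dots> = (LINT t|lborel. (LINT x|lborel. indicator {0..1::real} t *\<^sub>R h' (x + t *\<^sub>R e)))"
    using lborel_pair.Fubini_integral[OF int] by simp
  also have "\<dots> = (LINT t|lborel. indicator {0..1::real} t *\<^sub>R (LINT x|lborel. h' x))"
    by (intro Bochner_Integration.integral_cong) (auto simp: lborel_integral_translation)
  also have "\<dots> = (LINT x|lborel. h' x)"
    by (subst integral_scaleR_left) auto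
  also have "(LINT x|lborel. h (x + e) - h x) = 0"
    using h lborel_integrable_affine[of 1 h e] by (subst Bochner_Integration.integral_diff) (auto simp: lborel_integral_translation add.commute)
  finally show ?thesis by simp
qed

lemma norm_cis_minus_linear_le: "norm (cis t - 1 - \<i> * of_real t) \<le> t\<^sup>2 / 2"
proof -
  have "norm (iexp t - (\<Sum>k\<le>1. (\<i> * t)^k / fact k)) \<le> \<bar>t\<bar>^(Suc 1) / fact (Suc 1)" by (rule iexp_approx1)
  then show ?thesis by (simp add: cis_conv_exp power2_eq_square abs_mult[symmetric] algebra_simps)
qed

text \<open>The remainder is bounded by \<open>|h|^2\<close> times a second moment through
  \<open>|cis t - 1 - \<i> t| \<le> t^2 / 2\<close>, which gives the full derivative at once rather
  than coordinate by coordinate.\<close>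

theorem inv_fourier_has_derivative:
  fixes g :: "real^'n::finite \<Rightarrow> complex"
  assumes g: "integrable lborel g" and g2: "integrable lborel (\<lambda>\<xi>. (1 + norm \<xi>)\<^sup>2 * norm (g \<xi>))"
  shows "(inv_fourier g has_derivative (\<lambda>h. \<Sum>i\<in>UNIV. (h $ i) *\<^sub>R inv_fourier (\<lambda>\<xi>. 2 * pi * \<i> * of_real (\<xi> $ i) * g \<xi>) x)) (at x)"
proof -
  have [measurable]: "g \<in> borel_measurable borel" using g by auto
  have bnd: "integrable lborel (\<lambda>\<xi>. p \<xi> * g \<xi>)" if [measurable]: "p \<in> borel_measurable borel" and "\<And>\<xi>. norm (p \<xi>) \<le> C * (1 + norm \<xi>)\<^sup>2" for p :: "real^'n \<Rightarrow> complex" and C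
  proof (rule Bochner_Integration.integrable_bound[OF integrable_mult_right[OF g2, of C]])
    have "norm (p \<xi> * g \<xi>) \<le> C * ((1 + norm \<xi>)\<^sup>2 * norm (g \<xi>))" for \<xi>
      unfolding norm_mult mult.assoc[symmetric] by (intro mult_right_mono that) auto
    then show "AE x in lborel. norm (p x * g x) \<le> norm (C * ((1 + norm x)\<^sup>2 * norm (g x)))"
      by (intro AE_I2) (metis abs_ge_self order_trans real_norm_def)
  qed measurable
  have comp: "norm (\<xi> $ i) \<le> (1 + norm \<xi>)\<^sup>2" for \<xi> :: "real^'n" and i
    using component_le_norm_cart[of \<xi> i] by (simp add: power2_eq_square algebra_simps) (smt (verit) mult_nonneg_nonneg norm_ge_zero)
  have ii: "integrable lborel (\<lambda>\<xi>. 2 * pi * \<i> * of_real (\<xi> $ i) * g \<xi>)" for i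
    using comp by (intro bnd[where C = "2 * pi"]) (auto simp: norm_mult)
  let ?L = "\<lambda>h. \<Sum>i\<in>UNIV. (h $ i) *\<^sub>R inv_fourier (\<lambda>\<xi>. 2 * pi * \<i> * of_real (\<xi> $ i) * g \<xi>) x"
  let ?M = "LINT \<xi>|lborel. 2 * pi\<^sup>2 * ((1 + norm \<xi>)\<^sup>2 * norm (g \<xi>))"
  let ?l = "\<lambda>h \<xi>. \<i> * of_real (2 * pi * (h \<bullet> \<xi>)) * g \<xi> * cis (2 * pi * (x \<bullet> \<xi>))"
  have Lint: "?L h = (LINT \<xi>|lborel. \<i> * of_real (2 * pi * (h \<bullet> \<xi>)) * g \<xi> * cis (2 * pi * (x \<bullet> \<xi>)))"
    and Li: "integrable lborel (?l h)" for h
  proof -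
    have eq: "(\<lambda>\<xi>. \<Sum>i\<in>UNIV. (h $ i) *\<^sub>R ((2 * pi * \<i> * of_real (\<xi> $ i) * g \<xi>) * cis (2 * pi * (x \<bullet> \<xi>)))) = ?l h"
      by (auto simp: inner_vec_def scaleR_conv_of_real sum_distrib_left sum_distrib_right mult_ac intro!: sum.cong)
    have "?L h = (\<Sum>i\<in>UNIV. LINT \<xi>|lborel. (h $ i) *\<^sub>R ((2 * pi * \<i> * of_real (\<xi> $ i) * g \<xi>) * cis (2 * pi * (x \<bullet> \<xi>))))"
      unfolding inv_fourier_def by (simp only: integral_scaleR_right)
    also have eq1: "\<dots> = (LINT \<xi>|lborel. (\<Sum>i\<in>UNIV. (h $ i) *\<^sub>R ((2 * pi * \<i> * of_real (\<xi> $ i) * g \<xi>) * cis (2 * pi * (x \<bullet> \<xi>)))))"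
      by (rule Bochner_Integration.integral_sum[symmetric]) (intro integrable_scaleR_right integrable_mult_cis ii, measurable)
    finally show "?L h = integral\<^sup>L lborel (?l h)" unfolding eq .
    show "integrable lborel (?l h)"
      unfolding eq[symmetric] by (intro Bochner_Integration.integrable_sum integrable_scaleR_right integrable_mult_cis ii, measurable)
  qed
  have rem: "norm (inv_fourier g (x + h) - inv_fourier g x - ?L h) \<le> ?M * (norm h)\<^sup>2" for h
  proof -
    have A: "integrable lborel (\<lambda>\<xi>. g \<xi> * cis (2 * pi * (x \<bullet> \<xi>)))" for x
      by (intro integrable_mult_cis g) measurable
    let ?D = "\<lambda>\<xi>. g \<xi> * cis (2 * pi * ((x + h) \<bullet> \<xi>)) - g \<xi> * cis (2 * pi * (x \<bullet> \<xi>)) - ?l h \<xi>"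
    have eqD: "inv_fourier g (x + h) - inv_fourier g x - ?L h =
      (LINT \<xi>|lborel. g \<xi> * cis (2 * pi * ((x + h) \<bullet> \<xi>)) - g \<xi> * cis (2 * pi * (x \<bullet> \<xi>)) - ?l h \<xi>)"
      unfolding Lint
      by (simp only: inv_fourier_def Bochner_Integration.integral_diff[OF Bochner_Integration.integrable_diff[OF A A] Li] Bochner_Integration.integral_diff[OF A A])
    have "norm (inv_fourier g (x + h) - inv_fourier g x - ?L h) \<le> (LINT \<xi>|lborel. norm (?D \<xi>))"
      unfolding eqD by (rule integral_norm_bound)
    also have "\<dots> \<le> (LINT \<xi>|lborel. (2 * pi\<^sup>2 * ((1 + norm \<xi>)\<^sup>2 * norm (g \<xi>))) * (norm h)\<^sup>2)"
    proof (rule integral_mono)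
      show "integrable lborel (\<lambda>\<xi>. norm (g \<xi> * cis (2 * pi * ((x + h) \<bullet> \<xi>)) - g \<xi> * cis (2 * pi * (x \<bullet> \<xi>)) - ?l h \<xi>))"
        by (intro integrable_norm Bochner_Integration.integrable_diff integrable_mult_cis g Li) measurable
      show "integrable lborel (\<lambda>\<xi>. (2 * pi\<^sup>2 * ((1 + norm \<xi>)\<^sup>2 * norm (g \<xi>))) * (norm h)\<^sup>2)"
        by (intro integrable_mult_left integrable_mult_right g2)
      fix \<xi>
      have "g \<xi> * cis (2 * pi * ((x + h) \<bullet> \<xi>)) - g \<xi> * cis (2 * pi * (x \<bullet> \<xi>)) - ?l h \<xi>
         = g \<xi> * cis (2 * pi * (x \<bullet> \<xi>)) * (cis (2 * pi * (h \<bullet> \<xi>)) - 1 - \<i> * of_real (2 * pi * (h \<bullet> \<xi>)))"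
      proof -
        have "cis (2 * pi * ((x + h) \<bullet> \<xi>)) = cis (2 * pi * (x \<bullet> \<xi>)) * cis (2 * pi * (h \<bullet> \<xi>))"
          by (simp add: cis_mult inner_add_left distrib_left)
        moreover have "u * (c * d) - u * c - \<i> * v * u * c = u * c * (d - 1 - \<i> * v)" for u c d v :: complex
          by (simp add: algebra_simps)
        ultimately show ?thesis by (simp only:)
      qed
      then have "norm (g \<xi> * cis (2 * pi * ((x + h) \<bullet> \<xi>)) - g \<xi> * cis (2 * pi * (x \<bullet> \<xi>)) - ?l h \<xi>)
         = norm (g \<xi>) * norm (cis (2 * pi * (h \<bullet> \<xi>)) - 1 - \<i> * of_real (2 * pi * (h \<bullet> \<xi>)))"
        by (simp only: norm_mult norm_cis mult_1_right)
      also have "\<dots> \<le> norm (g \<xi>) * ((2 * pi * (h \<bullet> \<xi>))\<^sup>2 / 2)"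
        by (intro mult_left_mono norm_cis_minus_linear_le) auto
      also have "(2 * pi * (h \<bullet> \<xi>))\<^sup>2 / 2 = 2 * pi\<^sup>2 * (h \<bullet> \<xi>)\<^sup>2" by (simp add: power_mult_distrib)
      also have "norm (g \<xi>) * (2 * pi\<^sup>2 * (h \<bullet> \<xi>)\<^sup>2) \<le> norm (g \<xi>) * (2 * pi\<^sup>2 * (norm h * (1 + norm \<xi>))\<^sup>2)"
      proof (intro mult_left_mono)
        have "\<bar>h \<bullet> \<xi>\<bar> \<le> norm h * (1 + norm \<xi>)"
          using Cauchy_Schwarz_ineq2[of h \<xi>] by (simp add: distrib_left add_increasing)
        then show "(h \<bullet> \<xi>)\<^sup>2 \<le> (norm h * (1 + norm \<xi>))\<^sup>2" by (metis abs_ge_zero power2_abs power_mono)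
      qed auto
      finally show "norm (g \<xi> * cis (2 * pi * ((x + h) \<bullet> \<xi>)) - g \<xi> * cis (2 * pi * (x \<bullet> \<xi>)) - ?l h \<xi>) \<le> (2 * pi\<^sup>2 * ((1 + norm \<xi>)\<^sup>2 * norm (g \<xi>))) * (norm h)\<^sup>2"
        by (simp add: power_mult_distrib mult_ac)
    qed
    also have "\<dots> = ?M * (norm h)\<^sup>2" by (rule integral_mult_left_zero)
    finally show ?thesis .
  qed
  have M0: "?M \<ge> 0" by (intro integral_nonneg_AE) auto
  show ?thesis
    unfolding has_derivative_at
  proof
    show "bounded_linear ?L"
      by (intro bounded_linear_sum bounded_linear_scaleR_left[THEN bounded_linear_compose] bounded_linear_vec_nth)
    show "(\<lambda>h. norm (inv_fourier g (x + h) - inv_fourier g x - ?L h) / norm h) \<midarrow>0\<rightarrow> 0"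
    proof (rule Lim_null_comparison[where g = "\<lambda>h. ?M * norm h"])
      show "\<forall>\<^sub>F h in at 0. norm (norm (inv_fourier g (x + h) - inv_fourier g x - ?L h) / norm h) \<le> ?M * norm h"
      proof (rule always_eventually, rule allI)
        fix h :: "real^'n"
        show "norm (norm (inv_fourier g (x + h) - inv_fourier g x - ?L h) / norm h) \<le> ?M * norm h"
        proof (cases "h = 0")
          case False
          then show ?thesis using rem[of h] by (simp add: divide_le_eq power2_eq_square mult.assoc)
        qed (use M0 in auto)
      qed
      have "((\<lambda>h::real^'n. ?M * norm h) \<longlongrightarrow> ?M * norm (0::real^'n)) (at 0)" by (intro tendsto_intros)
      then show "((\<lambda>h::real^'n. ?M * norm h) \<longlongrightarrow> 0) (at 0)" by simp
    qed
  qed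
qed

section \<open>Partial derivatives and harmonic decomposition of polynomials\<close>

text \<open>Relational counterpart of \<open>partial\<close>, whose value is meaningful only where
  the derivative exists; it also covers real-valued weights.\<close>

definition has_partial :: "'n::finite \<Rightarrow> (real^'n \<Rightarrow> 'b::real_normed_vector) \<Rightarrow> 'b \<Rightarrow> real^'n \<Rightarrow> bool" where
  "has_partial i f D x \<longleftrightarrow> ((\<lambda>t. f (x + t *\<^sub>R axis i 1)) has_vector_derivative D) (at 0)"

lemma has_partial_imp_partial: "has_partial i f D x \<Longrightarrow> partial i f x = D"
  by (simp add: has_partial_def partial_def vector_derivative_at)

lemma has_partial_differentiable:
  assumes "f differentiable (at x)"
  shows "has_partial i f (partial i f x) x"
proof -
  have "(f has_derivative frechet_derivative f (at x)) (at (x + 0 *\<^sub>R axis i 1))"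
    using assms by (simp add: frechet_derivative_works)
  moreover have "((\<lambda>t. x + t *\<^sub>R axis i (1::real)) has_vector_derivative axis i 1) (at 0)"
    by (auto intro!: derivative_eq_intros)
  ultimately have "((f \<circ> (\<lambda>t. x + t *\<^sub>R axis i 1)) has_vector_derivative frechet_derivative f (at x) (axis i 1)) (at 0)"
    using vector_derivative_diff_chain_within[of "\<lambda>t. x + t *\<^sub>R axis i (1::real)" "axis i 1" 0 UNIV f "frechet_derivative f (at x)"]
      has_derivative_at_withinI by blast
  then have "has_partial i f (frechet_derivative f (at x) (axis i 1)) x" by (simp add: has_partial_def o_def)
  then show ?thesis using has_partial_imp_partial by metis
qed

lemma has_partial_const: "has_partial i (\<lambda>x. c) 0 x"
  by (simp add: has_partial_def)

lemma has_partial_add: "has_partial i f D x \<Longrightarrow> has_partial i g E x \<Longrightarrow> has_partial i (\<lambda>x. f x + g x) (D + E) x"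
  by (simp add: has_partial_def has_vector_derivative_add)

lemma has_partial_diff: "has_partial i f D x \<Longrightarrow> has_partial i g E x \<Longrightarrow> has_partial i (\<lambda>x. f x - g x) (D - E) x"
  by (simp add: has_partial_def has_vector_derivative_diff)

lemma has_partial_mult:
  fixes f g :: "real^'n::finite \<Rightarrow> 'b::real_normed_algebra"
  shows "has_partial i f D x \<Longrightarrow> has_partial i g E x \<Longrightarrow> has_partial i (\<lambda>x. f x * g x) (f x * E + D * g x) x"
  unfolding has_partial_def by (drule (1) has_vector_derivative_mult) simp

lemma has_partial_cmult:
  fixes f :: "real^'n::finite \<Rightarrow> 'b::real_normed_algebra"
  shows "has_partial i f D x \<Longrightarrow> has_partial i (\<lambda>x. c * f x) (c * D) x"
  using has_partial_mult[OF has_partial_const] by fastforce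

lemma has_partial_scaleR:
  "has_partial i f D x \<Longrightarrow> has_partial i (\<lambda>x. c *\<^sub>R f x) (c *\<^sub>R D) x"
  unfolding has_partial_def by (rule bounded_linear.has_vector_derivative[OF bounded_linear_scaleR_right])

lemma has_partial_inner:
  fixes f g :: "real^'n::finite \<Rightarrow> 'b::real_inner"
  shows "has_partial i f D x \<Longrightarrow> has_partial i g E x \<Longrightarrow> has_partial i (\<lambda>x. f x \<bullet> g x) (f x \<bullet> E + D \<bullet> g x) x"
  unfolding has_partial_def by (drule (1) bounded_bilinear.has_vector_derivative[OF bounded_bilinear_inner]) simp

lemma has_partial_of_real:
  "has_partial i f D x \<Longrightarrow> has_partial i (\<lambda>x. of_real (f x) :: 'b::real_normed_algebra_1) (of_real D) x"
  unfolding has_partial_def by (rule bounded_linear.has_vector_derivative[OF bounded_linear_of_real])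

lemma has_partial_sum:
  "(\<And>j. j \<in> J \<Longrightarrow> has_partial i (f j) (D j) x) \<Longrightarrow> has_partial i (\<lambda>x. \<Sum>j\<in>J. f j x) (\<Sum>j\<in>J. D j) x"
  by (induction J rule: infinite_finite_induct) (auto intro: has_partial_const has_partial_add)

lemma has_partial_coord: "has_partial i (\<lambda>x. x $ j) (if i = j then 1 else 0) x"
  unfolding has_partial_def by (auto simp: axis_def intro!: derivative_eq_intros)

lemma has_partial_chain:
  fixes f :: "real^'n::finite \<Rightarrow> real"
  assumes "has_partial i f D x" "(g has_vector_derivative E) (at (f x))"
  shows "has_partial i (\<lambda>x. g (f x)) (D *\<^sub>R E) x"
proof -
  have "((\<lambda>t. f (x + t *\<^sub>R axis i 1)) has_vector_derivative D) (at 0)" using assms(1) by (simp add: has_partial_def)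
  from vector_diff_chain_at[OF this, of g E] assms(2) show ?thesis by (simp add: has_partial_def o_def)
qed

lemma has_partial_norm_sq: "has_partial i (\<lambda>x::real^'n::finite. (norm x)\<^sup>2) (2 * x $ i) x"
proof -
  have "has_partial i (\<lambda>x::real^'n. \<Sum>j\<in>UNIV. x $ j * x $ j) (\<Sum>j\<in>UNIV. x $ j * (if i = j then 1 else 0) + (if i = j then 1 else 0) * x $ j) x"
    by (intro has_partial_sum has_partial_mult has_partial_coord)
  moreover have "(\<Sum>j\<in>UNIV. x $ j * (if i = j then 1 else 0) + (if i = j then 1 else 0) * x $ j) = (\<Sum>j\<in>UNIV. if i = j then 2 * x $ i else 0)"
    by (intro sum.cong) auto
  moreover have "(\<lambda>x::real^'n. \<Sum>j\<in>UNIV. x $ j * x $ j) = (\<lambda>x. (norm x)\<^sup>2)"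
    by (auto simp: power2_norm_eq_inner inner_vec_def)
  ultimately show ?thesis by simp
qed

lemma has_partial_norm_powr:
  assumes "x \<noteq> (0::real^'n::finite)"
  shows "has_partial i (\<lambda>x. norm x powr a) (a * norm x powr (a - 2) * x $ i) x"
proof -
  \<comment> \<open>Passing to the squared norm makes the inner function a polynomial, so that only
    the outer power has to avoid 0.\<close>
  have n: "norm y powr a = ((norm y)\<^sup>2) powr (a / 2)" for y :: "real^'n"
  proof (cases "y = 0")
    case False
    then have "(norm y)\<^sup>2 = norm y powr 2" by (subst powr_numeral) auto
    then show ?thesis by (simp only: powr_powr) simp
  qed simp
  have "((\<lambda>t. t powr (a / 2)) has_vector_derivative (a / 2 * ((norm x)\<^sup>2) powr (a / 2 - 1))) (at ((norm x)\<^sup>2))"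
    unfolding has_real_derivative_iff_has_vector_derivative[symmetric]
    using assms by (intro has_real_derivative_powr) auto
  from has_partial_chain[OF has_partial_norm_sq this, of i]
  have "has_partial i (\<lambda>x. ((norm x)\<^sup>2) powr (a / 2)) ((2 * x $ i) * (a / 2 * ((norm x)\<^sup>2) powr (a / 2 - 1))) x" by simp
  moreover have "((norm x)\<^sup>2) powr (a / 2 - 1) = norm x powr (a - 2)"
  proof -
    have "(norm x)\<^sup>2 = norm x powr 2" using assms by (subst powr_numeral) auto
    then show ?thesis by (simp only: powr_powr right_diff_distrib) simp
  qed
  ultimately show ?thesis unfolding n by (simp add: mult_ac)
qed

section \<open>Homogeneous polynomials\<close>

inductive homog :: "nat \<Rightarrow> (real^'n::finite \<Rightarrow> complex) \<Rightarrow> bool" where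
  const: "homog 0 (\<lambda>x. c)"
| coord: "homog k P \<Longrightarrow> homog (Suc k) (\<lambda>x. of_real (x $ i) * P x)"
| add: "homog k P \<Longrightarrow> homog k Q \<Longrightarrow> homog k (\<lambda>x. P x + Q x)"

text \<open>The degree of a function is not unique: zero has every degree, which keeps derivatives
  and Laplacians inside \<open>homog\<close>.\<close>

lemma homog_zero: "homog k (\<lambda>x. 0)"
proof (induction k)
  case (Suc k)
  from homog.coord[OF this, of undefined] show ?case by simp
qed (rule homog.const)

lemma homog_cmult: "homog k P \<Longrightarrow> homog k (\<lambda>x. c * P x)"
proof (induction rule: homog.induct)
  case (coord k P i)
  from homog.coord[OF coord.IH, of i] show ?case by (simp add: mult_ac)
qed (auto simp: distrib_left intro: homog.intros)

lemma homog_mult: "homog k P \<Longrightarrow> homog l Q \<Longrightarrow> homog (k + l) (\<lambda>x. P x * Q x)"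
proof (induction arbitrary: l Q rule: homog.induct)
  case (coord k P i)
  from homog.coord[OF coord.IH[OF coord.prems], of i] show ?case by (simp add: mult_ac)
qed (auto simp: distrib_right intro: homog.intros homog_cmult)

lemma homog_sum: "(\<And>i. i \<in> I \<Longrightarrow> homog k (P i)) \<Longrightarrow> homog k (\<lambda>x. \<Sum>i\<in>I. P i x)"
  by (induction I rule: infinite_finite_induct) (auto intro: homog_zero homog.add)

lemma homog_coord1: "homog 1 (\<lambda>x. of_real (x $ i))"
  using homog.coord[OF homog.const[of 1], of i] by simp

lemma homog_norm_sq: "homog 2 (\<lambda>x::real^'n::finite. of_real ((norm x)\<^sup>2))"
proof -
  have "homog (1 + 1) (\<lambda>x::real^'n. \<Sum>i\<in>UNIV. of_real (x $ i) * of_real (x $ i))"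
    by (intro homog_sum homog_mult homog_coord1)
  moreover have "(\<lambda>x::real^'n. \<Sum>i\<in>UNIV. of_real (x $ i) * of_real (x $ i)) = (\<lambda>x. complex_of_real ((norm x)\<^sup>2))"
    by (auto simp: power2_norm_eq_inner inner_vec_def)
  ultimately show ?thesis by (simp add: numeral_2_eq_2)
qed

lemma homog_diff: "homog k P \<Longrightarrow> homog k Q \<Longrightarrow> homog k (\<lambda>x. P x - Q x)"
  using homog.add[of k P "\<lambda>x. (-1) * Q x"] homog_cmult[of k Q "-1"] by simp

lemma homog_power: "homog k P \<Longrightarrow> homog (k * n) (\<lambda>x. P x ^ n)"
  by (induction n) (auto intro: homog.const homog_mult)

lemma homog_differentiable: "homog k P \<Longrightarrow> P differentiable (at x)"
proof (induction rule: homog.induct)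
  case (coord k P i)
  have "(\<lambda>x. complex_of_real (x $ i)) differentiable (at x)"
    by (rule bounded_linear_imp_differentiable)
       (intro bounded_linear_compose[OF bounded_linear_of_real] bounded_linear_vec_nth)
  then show ?case using coord.IH by (rule differentiable_mult)
qed auto

lemma homog_continuous: "homog k P \<Longrightarrow> continuous_on S P"
  by (intro continuous_at_imp_continuous_on ballI differentiable_imp_continuous_within homog_differentiable)

lemma homog_bound: "homog k P \<Longrightarrow> \<exists>B\<ge>0. \<forall>x. norm (P x) \<le> B * norm x ^ k"
proof (induction rule: homog.induct)
  case (const c)
  show ?case by (intro exI[of _ "norm c"]) auto
next
  case (coord k P i)
  then obtain B where B: "B \<ge> 0" "\<And>x. norm (P x) \<le> B * norm x ^ k" by auto
  show ?case
  proof (intro exI[of _ B] conjI allI B)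
    fix x :: "real^'a"
    have "norm (of_real (x $ i) * P x) \<le> norm x * (B * norm x ^ k)"
      unfolding norm_mult using component_le_norm_cart[of x i] by (intro mult_mono B) auto
    then show "norm (of_real (x $ i) * P x) \<le> B * norm x ^ Suc k" by (simp add: mult_ac)
  qed
next
  case (add k P Q)
  then obtain B C where B: "B \<ge> 0" "\<And>x. norm (P x) \<le> B * norm x ^ k" "C \<ge> 0" "\<And>x. norm (Q x) \<le> C * norm x ^ k" by auto
  show ?case
  proof (intro exI[of _ "B + C"] conjI allI)
    fix x show "norm (P x + Q x) \<le> (B + C) * norm x ^ k"
      using norm_triangle_ineq[of "P x" "Q x"] B(2)[of x] B(4)[of x] by (simp add: distrib_right)
  qed (use B in simp)
qed

lemma has_partial_homog: "homog k P \<Longrightarrow> has_partial i P (partial i P x) x"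
  by (intro has_partial_differentiable homog_differentiable)

lemma partial_homog_add: "homog k P \<Longrightarrow> homog l Q \<Longrightarrow> partial i (\<lambda>x. P x + Q x) x = partial i P x + partial i Q x"
  by (intro has_partial_imp_partial has_partial_add has_partial_homog)

lemma partial_homog_diff: "homog k P \<Longrightarrow> homog l Q \<Longrightarrow> partial i (\<lambda>x. P x - Q x) x = partial i P x - partial i Q x"
  by (intro has_partial_imp_partial has_partial_diff has_partial_homog)

lemma partial_homog_cmult: "homog k P \<Longrightarrow> partial i (\<lambda>x. c * P x) x = c * partial i P x"
  by (intro has_partial_imp_partial has_partial_cmult has_partial_homog)

lemma partial_homog_mult: "homog k P \<Longrightarrow> homog l Q \<Longrightarrow> partial i (\<lambda>x. P x * Q x) x = P x * partial i Q x + partial i P x * Q x"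
  by (intro has_partial_imp_partial has_partial_mult has_partial_homog)

lemma partial_coord: "partial i (\<lambda>x. complex_of_real (x $ j)) x = (if i = j then 1 else 0)"
  using has_partial_imp_partial[OF has_partial_of_real[OF has_partial_coord, of i j x, where 'b = complex]] by simp

lemma partial_const: "partial i (\<lambda>x. c) = (\<lambda>x. 0)"
  by (intro ext has_partial_imp_partial has_partial_const)

text \<open>Since \<open>k - 1\<close> is truncated, the vanishing of the derivative in degree 0 is
  carried along; the product rule for a coordinate times a constant depends on it.\<close>

lemma homog_partial:
  "homog k P \<Longrightarrow> homog (k - 1) (partial i P) \<and> (k = 0 \<longrightarrow> partial i P = (\<lambda>x. 0))"
proof (induction rule: homog.induct)
  case (const c)
  show ?case by (simp add: partial_const homog_zero)
next
  case (coord k P j)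
  have eq: "partial i (\<lambda>x. of_real (x $ j) * P x) = (\<lambda>x. of_real (x $ j) * partial i P x + (if i = j then 1 else 0) * P x)"
    by (intro ext, subst partial_homog_mult[OF homog_coord1 coord.hyps]) (simp add: partial_coord)
  have "homog k (\<lambda>x. of_real (x $ j) * partial i P x)"
  proof (cases k)
    case 0
    then show ?thesis using coord.IH by (simp add: homog_zero)
  next
    case (Suc l)
    then show ?thesis using coord.IH by (auto intro: homog.coord)
  qed
  then show ?case unfolding eq using coord.hyps by (auto intro!: homog.add homog_cmult homog_zero)
next
  case (add k P Q)
  have eq: "partial i (\<lambda>x. P x + Q x) = (\<lambda>x. partial i P x + partial i Q x)"
    using partial_homog_add[OF add.hyps] by auto
  show ?case unfolding eq using add.IH by (auto intro: homog.add)
qed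

lemma homog_partial1: "homog k P \<Longrightarrow> homog (k - 1) (partial i P)"
  using homog_partial by blast

lemma homog_euler: "homog k P \<Longrightarrow> (\<Sum>i\<in>UNIV. of_real (x $ i) * partial i P x) = of_nat k * P x"
proof (induction rule: homog.induct)
  case (const c) show ?case by (simp add: partial_const)
next
  case (coord k P j)
  have "(\<Sum>i\<in>UNIV. of_real (x $ i) * partial i (\<lambda>x. of_real (x $ j) * P x) x)
     = (\<Sum>i\<in>UNIV. of_real (x $ j) * (of_real (x $ i) * partial i P x) + (if i = j then of_real (x $ i) * P x else 0))"
    by (intro sum.cong refl, subst partial_homog_mult[OF homog_coord1 coord.hyps]) (auto simp: partial_coord algebra_simps)
  also have "\<dots> = of_real (x $ j) * (of_nat k * P x) + of_real (x $ j) * P x"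
    by (simp add: sum.distrib sum_distrib_left[symmetric] coord.IH)
  finally show ?case by (simp add: algebra_simps)
next
  case (add k P Q)
  then show ?case by (simp add: partial_homog_add[OF add.hyps] distrib_left sum.distrib)
qed

lemma homog_laplacian: "homog k P \<Longrightarrow> homog (k - 2) (laplacian P)"
  unfolding laplacian_def[abs_def] 
  by (rule homog_sum) (metis homog_partial1 diff_diff_left one_add_one)

lemma partial_homog_fun:
  assumes "homog k P" "homog l Q"
  shows "partial i (\<lambda>x. P x + Q x) = (\<lambda>x. partial i P x + partial i Q x)"
    "partial i (\<lambda>x. P x - Q x) = (\<lambda>x. partial i P x - partial i Q x)"
    "partial i (\<lambda>x. P x * Q x) = (\<lambda>x. P x * partial i Q x + partial i P x * Q x)"
    "partial i (\<lambda>x. c * P x) = (\<lambda>x. c * partial i P x)"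
  using assms by (auto simp: partial_homog_add partial_homog_diff partial_homog_mult partial_homog_cmult)

lemma laplacian_homog_add: "homog k P \<Longrightarrow> homog l Q \<Longrightarrow> laplacian (\<lambda>x. P x + Q x) x = laplacian P x + laplacian Q x"
  by (simp add: laplacian_def partial_homog_fun partial_homog_add[OF homog_partial1 homog_partial1] sum.distrib)

lemma laplacian_homog_diff: "homog k P \<Longrightarrow> homog l Q \<Longrightarrow> laplacian (\<lambda>x. P x - Q x) x = laplacian P x - laplacian Q x"
  by (simp add: laplacian_def partial_homog_fun partial_homog_diff[OF homog_partial1 homog_partial1] sum_subtractf)

lemma laplacian_homog_cmult: "homog k P \<Longrightarrow> laplacian (\<lambda>x. c * P x) x = c * laplacian P x"
  by (simp add: laplacian_def partial_homog_fun(4) partial_homog_cmult[OF homog_partial1] sum_distrib_left)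

section \<open>Powers of the norm, harmonic polynomials and the Fischer decomposition\<close>

lemma laplacian_norm_sq_mult:
  fixes F :: "real^'n::finite \<Rightarrow> complex"
  assumes F: "homog d F"
  shows "laplacian (\<lambda>x. of_real ((norm x)\<^sup>2) * F x) x = of_nat (2 * CARD('n) + 4 * d) * F x + of_real ((norm x)\<^sup>2) * laplacian F x"
proof -
  have p: "partial i (\<lambda>x::real^'n. complex_of_real ((norm x)\<^sup>2)) x = 2 * of_real (x $ i)" for i x
    using has_partial_imp_partial[OF has_partial_of_real[OF has_partial_norm_sq, of i x, where 'b = complex]] by simp
  have 1: "partial i (\<lambda>x. of_real ((norm x)\<^sup>2) * F x) = (\<lambda>x. of_real ((norm x)\<^sup>2) * partial i F x + 2 * (of_real (x $ i) * F x))" for i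
    using partial_homog_fun(3)[OF homog_norm_sq F, of i] p by (simp add: mult.assoc)
  have "has_partial i (\<lambda>x. of_real ((norm x)\<^sup>2) * partial i F x + 2 * (of_real (x $ i) * F x))
      ((of_real ((norm x)\<^sup>2) * partial i (partial i F) x + of_real (2 * x $ i) * partial i F x) + 2 * (of_real (x $ i) * partial i F x + of_real 1 * F x)) x" for i
    using has_partial_coord[of i i x]
    by (intro has_partial_add has_partial_mult has_partial_cmult has_partial_of_real has_partial_norm_sq has_partial_homog[OF F] has_partial_homog[OF homog_partial1[OF F]]) simp_all
  note 2 = has_partial_imp_partial[OF this]
  have "laplacian (\<lambda>x. of_real ((norm x)\<^sup>2) * F x) x = (\<Sum>i\<in>UNIV. of_real ((norm x)\<^sup>2) * partial i (partial i F) x + 4 * (of_real (x $ i) * partial i F x) + 2 * F x)"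
    unfolding laplacian_def 1 2 by (intro sum.cong) (auto simp: algebra_simps)
  also have "\<dots> = of_real ((norm x)\<^sup>2) * laplacian F x + 4 * (of_nat d * F x) + of_nat CARD('n) * (2 * F x)"
    by (simp only: sum.distrib sum_distrib_left[symmetric] homog_euler[OF F] laplacian_def sum_constant) (simp only: mult.left_commute)
  finally show ?thesis by (simp add: algebra_simps)
qed

lemma homog_norm_power: "homog k H \<Longrightarrow> homog (k + 2 * j) (\<lambda>x. of_real (norm x ^ (2 * j)) * H x)"
  using homog_mult[OF homog_power[OF homog_norm_sq, of j], of k H] by (simp add: power_mult add.commute)

text \<open>The positivity of \<open>c\<close> is the point: the Laplacian can be inverted along the
  tower \<open>|x|^(2 j) H\<close> over a fixed harmonic \<open>H\<close>.\<close>

lemma laplacian_norm_power_mult: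
  fixes H :: "real^'n::finite \<Rightarrow> complex"
  assumes H: "homog k H" "\<And>x. laplacian H x = 0"
  shows "\<exists>c::nat. c > 0 \<and> (\<forall>x. laplacian (\<lambda>x. of_real (norm x ^ (2 * Suc j)) * H x) x = of_nat c * (of_real (norm x ^ (2 * j)) * H x))"
proof (induction j)
  case 0
  show ?case using laplacian_norm_sq_mult[OF H(1)] H(2) by (intro exI[of _ "2 * CARD('n) + 4 * k"]) auto
next
  case (Suc j)
  then obtain c where c: "c > 0" "\<And>x. laplacian (\<lambda>x. of_real (norm x ^ (2 * Suc j)) * H x) x = of_nat c * (of_real (norm x ^ (2 * j)) * H x)" by auto
  let ?F = "\<lambda>x. of_real (norm x ^ (2 * Suc j)) * H x"
  have e: "(\<lambda>x. of_real (norm x ^ (2 * Suc (Suc j))) * H x) = (\<lambda>x. of_real ((norm x)\<^sup>2) * ?F x)"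
    by (intro ext) (simp add: power2_eq_square mult_ac)
  have "laplacian (\<lambda>x. of_real ((norm x)\<^sup>2) * ?F x) x = of_nat (2 * CARD('n) + 4 * (k + 2 * Suc j) + c) * ?F x" for x
    unfolding laplacian_norm_sq_mult[OF homog_norm_power[OF H(1), of "Suc j"]] c(2)
    by (simp add: power2_eq_square algebra_simps)
  then show ?case unfolding e by (intro exI[of _ "2 * CARD('n) + 4 * (k + 2 * Suc j) + c"]) (use c in auto)
qed

text \<open>Finite sums of terms \<open>|x|^(2 j) H\<close> with \<open>H\<close> harmonic and fixed
  total degree; Fischer's theorem, proved below, is that every homogeneous polynomial has this
  form.\<close>

inductive fischer :: "nat \<Rightarrow> (real^'n::finite \<Rightarrow> complex) \<Rightarrow> bool" where
  base: "homog k H \<Longrightarrow> (\<And>x. laplacian H x = 0) \<Longrightarrow> fischer (k + 2 * j) (\<lambda>x. of_real (norm x ^ (2 * j)) * H x)"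
| add: "fischer k P \<Longrightarrow> fischer k Q \<Longrightarrow> fischer k (\<lambda>x. P x + Q x)"

lemma fischer_homog: "fischer k P \<Longrightarrow> homog k P"
  by (induction rule: fischer.induct) (auto simp del: of_real_power intro: homog_norm_power homog.add)

lemma fischer_laplacian_surj:
  "fischer k Q \<Longrightarrow> \<exists>R. fischer (k + 2) R \<and> (\<forall>x. laplacian R x = Q x)"
proof (induction rule: fischer.induct)
  case (base k H j)
  obtain c :: nat where c: "c > 0" "\<And>x. laplacian (\<lambda>x. of_real (norm x ^ (2 * Suc j)) * H x) x = of_nat c * (of_real (norm x ^ (2 * j)) * H x)"
    using laplacian_norm_power_mult[OF base] by blast
  let ?G = "\<lambda>x. (1 / of_nat c) * H x"
  have "fischer (k + 2 * Suc j) (\<lambda>x. of_real (norm x ^ (2 * Suc j)) * ?G x)"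
    by (rule fischer.base) (simp_all only: homog_cmult[OF base(1)] laplacian_homog_cmult[OF base(1)] base(2) mult_zero_right)
  moreover have "laplacian (\<lambda>x. of_real (norm x ^ (2 * Suc j)) * ?G x) x = of_real (norm x ^ (2 * j)) * H x" for x
  proof -
    have "(\<lambda>x. of_real (norm x ^ (2 * Suc j)) * ?G x) = (\<lambda>x. (1 / of_nat c) * (of_real (norm x ^ (2 * Suc j)) * H x))" by auto
    then show ?thesis using c(1) by (simp only: laplacian_homog_cmult[OF homog_norm_power[OF base(1)]] c(2)) simp
  qed
  ultimately show ?case by (intro exI[of _ "\<lambda>x. of_real (norm x ^ (2 * Suc j)) * ?G x"]) (simp del: power_Suc)
next
  case (add k P Q)
  then obtain R S where "fischer (k + 2) R" "\<And>x. laplacian R x = P x" "fischer (k + 2) S" "\<And>x. laplacian S x = Q x" by auto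
  then show ?case using laplacian_homog_add[OF fischer_homog fischer_homog, of "k + 2" R "k + 2" S]
    by (intro exI[of _ "\<lambda>x. R x + S x"]) (auto intro: fischer.add)
qed

text \<open>Induction by two degrees: decompose the Laplacian of \<open>Q\<close>, lift the
  decomposition to some \<open>R\<close> with the same Laplacian, and \<open>Q - R\<close> is
  harmonic. This replaces the usual argument with the Fischer inner product.\<close>

theorem homog_fischer: "homog k Q \<Longrightarrow> fischer k Q"
proof (induction k arbitrary: Q rule: less_induct)
  case (less k)
  show ?case
  proof (cases "k < 2")
    case True
    have "partial i (partial i Q) = (\<lambda>x. 0)" for i
    proof -
      have h: "homog 0 (partial i Q)" using homog_partial1[OF less.prems, of i] True by simp
      show ?thesis using homog_partial[OF h, of i] by simp
    qed
    then have "laplacian Q x = 0" for x by (simp add: laplacian_def)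
    from fischer.base[OF less.prems this, of 0] show ?thesis by simp
  next
    case False
    then have "fischer (k - 2) (laplacian Q)" using less.IH[of "k - 2"] homog_laplacian[OF less.prems] by simp
    then obtain R where "fischer (k - 2 + 2) R" and R2: "\<And>x. laplacian R x = laplacian Q x"
      using fischer_laplacian_surj[of "k - 2" "laplacian Q"] by blast
    moreover have "k - 2 + 2 = k" using False by simp
    ultimately have R: "fischer k R" by (simp only:)
    have h: "homog k (\<lambda>x. Q x - R x)" by (intro homog_diff less.prems fischer_homog R)
    have "laplacian (\<lambda>x. Q x - R x) x = 0" for x
      using laplacian_homog_diff[OF less.prems fischer_homog[OF R]] R2 by simp
    from fischer.add[OF fischer.base[OF h this, of 0, simplified] R] show ?thesis by simp
  qed
qed

section \<open>Polynomials of bounded degree\<close>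

inductive poly_le :: "nat \<Rightarrow> (real^'n::finite \<Rightarrow> complex) \<Rightarrow> bool" where
  homog: "homog k P \<Longrightarrow> k \<le> j \<Longrightarrow> poly_le j P"
| add: "poly_le j P \<Longrightarrow> poly_le j Q \<Longrightarrow> poly_le j (\<lambda>x. P x + Q x)"

lemma poly_le_mono: "poly_le i P \<Longrightarrow> i \<le> j \<Longrightarrow> poly_le j P"
  by (induction rule: poly_le.induct) (auto intro: poly_le.intros)

lemma poly_le_mult_homog: "poly_le i P \<Longrightarrow> homog k Q \<Longrightarrow> poly_le (i + k) (\<lambda>x. P x * Q x)"
  by (induction rule: poly_le.induct) (simp_all add: distrib_right poly_le.add poly_le.homog[OF homog_mult])

lemma poly_le_mult: "poly_le j Q \<Longrightarrow> poly_le i P \<Longrightarrow> poly_le (i + j) (\<lambda>x. P x * Q x)"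
proof (induction rule: poly_le.induct)
  case (homog k Q j)
  then show ?case using poly_le_mult_homog[of i P k Q] by (auto intro: poly_le_mono)
qed (simp add: distrib_left poly_le.add)

lemma poly_le_zero: "poly_le j (\<lambda>x. 0)"
  by (rule poly_le.homog[OF homog_zero[of 0]]) simp

lemma poly_le_sum: "(\<And>i. i \<in> I \<Longrightarrow> poly_le j (P i)) \<Longrightarrow> poly_le j (\<lambda>x. \<Sum>i\<in>I. P i x)"
proof (induction I rule: infinite_finite_induct)
  case (insert i I)
  then have "poly_le j (\<lambda>x. P i x + (\<Sum>i\<in>I. P i x))" by (intro poly_le.add) simp_all
  then show ?case using insert by simp
qed (simp_all add: poly_le_zero)

lemma finite_multi_indices: "finite {\<alpha> :: 'n::finite \<Rightarrow> nat. (\<Sum>i\<in>UNIV. \<alpha> i) \<le> j}"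
proof (rule finite_subset)
  show "{\<alpha> :: 'n \<Rightarrow> nat. (\<Sum>i\<in>UNIV. \<alpha> i) \<le> j} \<subseteq> Pi UNIV (\<lambda>_. {..j})"
  proof (intro subsetI Pi_I)
    fix \<alpha> :: "'n \<Rightarrow> nat" and i assume "\<alpha> \<in> {\<alpha>. (\<Sum>i\<in>UNIV. \<alpha> i) \<le> j}"
    then show "\<alpha> i \<in> {..j}" using member_le_sum[of i UNIV \<alpha>] by simp
  qed
  have "finite (PiE (UNIV::'n set) (\<lambda>_. {..j}))" by (intro finite_PiE) auto
  then show "finite (Pi (UNIV::'n set) (\<lambda>_. {..j}))" by (simp add: PiE_def)
qed

lemma polynomials_add:
  assumes "P \<in> polynomials j" "Q \<in> polynomials j" shows "(\<lambda>x. P x + Q x) \<in> polynomials j"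
proof -
  obtain c d where "\<And>x. P x = (\<Sum>\<alpha> | (\<Sum>i\<in>UNIV. \<alpha> i) \<le> j. c \<alpha> * complex_of_real (\<Prod>i\<in>UNIV. (x $ i) ^ \<alpha> i))"
    "\<And>x. Q x = (\<Sum>\<alpha> | (\<Sum>i\<in>UNIV. \<alpha> i) \<le> j. d \<alpha> * complex_of_real (\<Prod>i\<in>UNIV. (x $ i) ^ \<alpha> i))"
    using assms unfolding polynomials_def by blast
  then show ?thesis unfolding polynomials_def
    by (intro CollectI exI[of _ "\<lambda>\<alpha>. c \<alpha> + d \<alpha>"]) (simp add: distrib_right sum.distrib)
qed

lemma homog_polynomials: "homog k P \<Longrightarrow> k \<le> j \<Longrightarrow> P \<in> polynomials j"
proof (induction arbitrary: j rule: homog.induct)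
  case (const c)
  have "(\<Sum>\<alpha> | (\<Sum>i\<in>UNIV. \<alpha> i) \<le> j. (if \<alpha> = (\<lambda>_. 0) then c else 0) * complex_of_real (\<Prod>i\<in>UNIV. (x $ i) ^ \<alpha> i)) = c" for x :: "real^'a"
  proof -
    have "(\<Sum>\<alpha> | (\<Sum>i\<in>UNIV. \<alpha> i) \<le> j. (if \<alpha> = (\<lambda>_. 0) then c else 0) * complex_of_real (\<Prod>i\<in>UNIV. (x $ i) ^ \<alpha> i))
      = (\<Sum>\<alpha> | (\<Sum>i\<in>UNIV. \<alpha> i) \<le> j. (if \<alpha> = (\<lambda>_::'a. 0) then c else 0))"
      by (intro sum.cong) auto
    also have "\<dots> = c" using finite_multi_indices[of j, where 'n = 'a] by (simp add: sum.delta)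
    finally show ?thesis .
  qed
  then show ?case unfolding polynomials_def
    by (intro CollectI exI[of _ "\<lambda>\<alpha>. if \<alpha> = (\<lambda>_. 0) then c else 0"]) simp
next
  case (coord k P i)
  then obtain l where j: "j = Suc l" "k \<le> l" by (cases j) auto
  then obtain c where c: "\<And>x. P x = (\<Sum>\<alpha> | (\<Sum>i\<in>UNIV. \<alpha> i) \<le> l. c \<alpha> * complex_of_real (\<Prod>i\<in>UNIV. (x $ i) ^ \<alpha> i))"
    using coord.IH[of l] unfolding polynomials_def by blast
  \<comment> \<open>Multiplication by coordinate \<open>i\<close> raises the \<open>i\<close>-th
    index by one; multi-indices with \<open>\<beta> i = 0\<close> are not reached and get
    coefficient 0.\<close>
  define c' where "c' \<beta> = (if \<beta> i > 0 then c (\<beta>(i := \<beta> i - 1)) else 0)" for \<beta>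
  have up: "(\<Sum>m\<in>UNIV. (\<alpha>(i := Suc (\<alpha> i))) m) = Suc (\<Sum>m\<in>UNIV. \<alpha> m)" for \<alpha> :: "'a \<Rightarrow> nat"
  proof -
    have "(\<Sum>m\<in>UNIV. (\<alpha>(i := Suc (\<alpha> i))) m) = (\<Sum>m\<in>UNIV. \<alpha> m + (if m = i then 1 else 0))" by (intro sum.cong) auto
    then show ?thesis by (simp add: sum.distrib)
  qed
  have up2: "(\<Prod>m\<in>UNIV. (x $ m) ^ (\<alpha>(i := Suc (\<alpha> i))) m) = x $ i * (\<Prod>m\<in>UNIV. (x $ m) ^ \<alpha> m)" for \<alpha> :: "'a \<Rightarrow> nat" and x :: "real^'a"
  proof -
    have "(\<Prod>m\<in>UNIV. (x $ m) ^ (\<alpha>(i := Suc (\<alpha> i))) m) = (\<Prod>m\<in>UNIV. (x $ m) ^ \<alpha> m * (if m = i then x $ i else 1))" by (intro prod.cong) auto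
    then show ?thesis by (simp add: prod.distrib)
  qed
  have "of_real (x $ i) * P x = (\<Sum>\<beta> | (\<Sum>i\<in>UNIV. \<beta> i) \<le> j. c' \<beta> * complex_of_real (\<Prod>i\<in>UNIV. (x $ i) ^ \<beta> i))" for x
  proof -
    have "of_real (x $ i) * P x = (\<Sum>\<alpha> | (\<Sum>i\<in>UNIV. \<alpha> i) \<le> l. c \<alpha> * complex_of_real (\<Prod>m\<in>UNIV. (x $ m) ^ (\<alpha>(i := Suc (\<alpha> i))) m))"
      unfolding c sum_distrib_left up2 by (intro sum.cong) auto
    also have "\<dots> = (\<Sum>\<beta> | (\<Sum>i\<in>UNIV. \<beta> i) \<le> j. c' \<beta> * complex_of_real (\<Prod>i\<in>UNIV. (x $ i) ^ \<beta> i))"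
    proof (rule sum.reindex_bij_witness_not_neutral[where S' = "{}" and T' = "{\<beta>::'a \<Rightarrow> nat. (\<Sum>i\<in>UNIV. \<beta> i) \<le> j \<and> \<beta> i = 0}"
          and i = "\<lambda>\<beta>::'a \<Rightarrow> nat. \<beta>(i := \<beta> i - 1)" and j = "\<lambda>\<alpha>::'a \<Rightarrow> nat. \<alpha>(i := Suc (\<alpha> i))"])
      show "finite {\<beta>::'a \<Rightarrow> nat. (\<Sum>i\<in>UNIV. \<beta> i) \<le> j \<and> \<beta> i = 0}"
        by (rule finite_subset[OF _ finite_multi_indices[of j]]) auto
      fix \<alpha> :: "'a \<Rightarrow> nat" assume "\<alpha> \<in> {\<alpha>. (\<Sum>i\<in>UNIV. \<alpha> i) \<le> l} - {}"
      then show "\<alpha>(i := Suc (\<alpha> i)) \<in> {\<beta>. (\<Sum>i\<in>UNIV. \<beta> i) \<le> j} - {\<beta>. (\<Sum>i\<in>UNIV. \<beta> i) \<le> j \<and> \<beta> i = 0}"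
        using j up[of \<alpha>] by (auto simp del: fun_upd_apply) simp
    next
      fix \<beta> :: "'a \<Rightarrow> nat" assume b: "\<beta> \<in> {\<beta>. (\<Sum>i\<in>UNIV. \<beta> i) \<le> j} - {\<beta>. (\<Sum>i\<in>UNIV. \<beta> i) \<le> j \<and> \<beta> i = 0}"
      then have "(\<beta>(i := \<beta> i - 1))(i := Suc ((\<beta>(i := \<beta> i - 1)) i)) = \<beta>" by auto
      with b up[of "\<beta>(i := \<beta> i - 1)"] show "\<beta>(i := \<beta> i - 1) \<in> {\<alpha>. (\<Sum>i\<in>UNIV. \<alpha> i) \<le> l} - {}"
        using j by (simp del: fun_upd_apply fun_upd_upd)
      show "(\<beta>(i := \<beta> i - 1))(i := Suc ((\<beta>(i := \<beta> i - 1)) i)) = \<beta>" by fact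
    qed (auto simp: c'_def)
    finally show ?thesis .
  qed
  then show ?case unfolding polynomials_def by blast
qed (auto intro: polynomials_add)

lemma polynomials_poly_le:
  assumes "P \<in> polynomials j" shows "poly_le j P"
proof -
  obtain c where "\<And>x. P x = (\<Sum>\<alpha> | (\<Sum>i\<in>UNIV. \<alpha> i) \<le> j. c \<alpha> * complex_of_real (\<Prod>i\<in>UNIV. (x $ i) ^ \<alpha> i))"
    using assms unfolding polynomials_def by blast
  then have P: "P = (\<lambda>x. \<Sum>\<alpha> | (\<Sum>i\<in>UNIV. \<alpha> i) \<le> j. c \<alpha> * complex_of_real (\<Prod>i\<in>UNIV. (x $ i) ^ \<alpha> i))" by auto
  have "homog (\<Sum>i\<in>S. \<alpha> i) (\<lambda>x::real^'a. of_real (\<Prod>i\<in>S. (x $ i) ^ \<alpha> i))" if "finite S" for S and \<alpha> :: "'a \<Rightarrow> nat"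
    using that
  proof (induction S rule: finite_induct)
    case (insert i S)
    have "homog (1 * \<alpha> i + (\<Sum>i\<in>S. \<alpha> i)) (\<lambda>x::real^'a. of_real (x $ i) ^ \<alpha> i * of_real (\<Prod>i\<in>S. (x $ i) ^ \<alpha> i))"
      by (intro homog_mult homog_power homog_coord1 insert.IH)
    then show ?case using insert.hyps by simp
  qed (simp add: homog.const)
  then have "poly_le j (\<lambda>x. c \<alpha> * complex_of_real (\<Prod>i\<in>UNIV. (x $ i) ^ \<alpha> i))" if "(\<Sum>i\<in>UNIV. \<alpha> i) \<le> j" for \<alpha>
    using that by (intro poly_le.homog[OF homog_cmult]) auto
  then show ?thesis unfolding P by (intro poly_le_sum) auto
qed

text \<open>Brings the output of the Stone-Weierstrass theorem into the class on which the harmonic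
  decomposition acts.\<close>

lemma poly_le_real_polynomial_function:
  assumes "real_polynomial_function f" shows "\<exists>j. poly_le j (\<lambda>x::real^'n::finite. complex_of_real (f x))"
  using assms
proof (induction rule: real_polynomial_function.induct)
  case (linear f)
  then interpret bounded_linear f .
  have f: "f x = (\<Sum>i\<in>UNIV. x $ i * f (axis i 1))" for x
  proof -
    have "f x = f (\<Sum>i\<in>UNIV. (x $ i) *\<^sub>R axis i 1)" using basis_expansion[of x] by (simp only: scalar_mult_eq_scaleR)
    then show ?thesis by (simp add: sum scaleR)
  qed
  have "poly_le 1 (\<lambda>x. \<Sum>i\<in>UNIV. of_real (f (axis i 1)) * of_real (x $ i))"
    by (intro poly_le_sum poly_le.homog[OF homog_cmult[OF homog_coord1]]) simp
  moreover have "(\<lambda>x. \<Sum>i\<in>UNIV. of_real (f (axis i 1)) * of_real (x $ i)) = (\<lambda>x. complex_of_real (f x))"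
    by (subst f) (auto simp: mult.commute)
  ultimately show ?case by auto
next
  case (const c)
  then show ?case using poly_le.homog[OF homog.const[of "of_real c"]] by auto
next
  case (add f g)
  then obtain i j where "poly_le i (\<lambda>x. complex_of_real (f x))" "poly_le j (\<lambda>x. complex_of_real (g x))" by auto
  then have "poly_le (max i j) (\<lambda>x. complex_of_real (f x) + complex_of_real (g x))" by (intro poly_le.add) (auto elim: poly_le_mono)
  then show ?case by auto
next
  case (mult f g)
  then show ?case using poly_le_mult by fastforce
qed

lemma poly_le_differentiable: "poly_le j P \<Longrightarrow> P differentiable (at x)"
  by (induction rule: poly_le.induct) (auto intro: homog_differentiable)

lemma poly_le_partial: "poly_le j P \<Longrightarrow> poly_le j (partial i P)"
proof (induction rule: poly_le.induct)
  case (add j P Q)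
  have "partial i (\<lambda>x. P x + Q x) = (\<lambda>x. partial i P x + partial i Q x)"
    by (intro ext has_partial_imp_partial has_partial_add has_partial_differentiable poly_le_differentiable[OF add.hyps(1)] poly_le_differentiable[OF add.hyps(2)])
  then show ?case using add.IH by (auto intro: poly_le.add)
qed (auto intro: poly_le.homog[OF homog_partial1])

lemma laplacian_poly_le_add:
  assumes "poly_le j P" "poly_le j Q" shows "laplacian (\<lambda>x. P x + Q x) x = laplacian P x + laplacian Q x"
proof -
  have *: "partial i (\<lambda>x. P x + Q x) = (\<lambda>x. partial i P x + partial i Q x)" if "poly_le j P" "poly_le j Q" for i P Q
    by (intro ext has_partial_imp_partial has_partial_add has_partial_differentiable poly_le_differentiable[OF that(1)] poly_le_differentiable[OF that(2)])
  show ?thesis unfolding laplacian_def *[OF assms] *[OF poly_le_partial[OF assms(1)] poly_le_partial[OF assms(2)]] by (simp add: sum.distrib)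
qed

lemma harmonic_polynomials_add:
  assumes "P \<in> harmonic_polynomials j" "Q \<in> harmonic_polynomials j"
  shows "(\<lambda>x. P x + Q x) \<in> harmonic_polynomials j"
  using assms laplacian_poly_le_add[OF polynomials_poly_le polynomials_poly_le, of P j Q]
  by (auto simp: harmonic_polynomials_def intro: polynomials_add)

lemma homog_harmonic_polynomials:
  "homog k P \<Longrightarrow> k \<le> j \<Longrightarrow> (\<And>x. laplacian P x = 0) \<Longrightarrow> P \<in> harmonic_polynomials j"
  by (auto simp: harmonic_polynomials_def intro: homog_polynomials)

lemma zero_harmonic_polynomials: "(\<lambda>x. 0) \<in> harmonic_polynomials j"
  by (rule homog_harmonic_polynomials[OF homog.const]) (auto simp: laplacian_def partial_const)

lemma harmonic_polynomials_sum:
  "(\<And>i. i \<in> I \<Longrightarrow> P i \<in> harmonic_polynomials j) \<Longrightarrow> (\<lambda>x. \<Sum>i\<in>I. P i x) \<in> harmonic_polynomials j"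
  by (induction I rule: infinite_finite_induct) (auto intro: zero_harmonic_polynomials harmonic_polynomials_add)

section \<open>Test functions and their Fourier transforms\<close>

text \<open>Acts as coinduction for \<open>smooth\<close>: each smoothness proof reduces to
  exhibiting a family stable under differentiation.\<close>

lemma smooth_class:
  assumes "\<And>f. f \<in> S \<Longrightarrow> (\<forall>x. f differentiable (at x)) \<and> (\<forall>i. partial i f \<in> S)" and "f \<in> S"
  shows "smooth f"
proof -
  have "foldr partial is f \<in> S" for "is" by (induction "is") (use assms in auto)
  then show ?thesis using assms(1) by (auto simp: smooth_def)
qed

lemma smooth_differentiable: "smooth f \<Longrightarrow> f differentiable (at x)"
  unfolding smooth_def by (metis foldr.simps(1) id_apply)

lemma smooth_partial: "smooth f \<Longrightarrow> smooth (partial i f)"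
  unfolding smooth_def
proof (intro allI)
  fix "is" x assume *: "\<forall>is x. foldr partial is f differentiable (at x)"
  show "foldr partial is (partial i f) differentiable (at x)" using *[THEN spec[of _ "is @ [i]"]] by simp
qed

text \<open>The Leibniz rule leaves the set of products of two smooth functions, but not the set of
  their finite sums.\<close>

inductive_set products :: "(real^'n::finite \<Rightarrow> complex) set" where
  mult: "smooth f \<Longrightarrow> smooth g \<Longrightarrow> (\<lambda>x. f x * g x) \<in> products"
| add: "f \<in> products \<Longrightarrow> g \<in> products \<Longrightarrow> (\<lambda>x. f x + g x) \<in> products"

lemma smooth_mult: 
  assumes "smooth f" "smooth g" shows "smooth (\<lambda>x. f x * g x)"
proof (rule smooth_class[where S = products])
  fix h :: "real^'a \<Rightarrow> complex" assume "h \<in> products"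
  then show "(\<forall>x. h differentiable (at x)) \<and> (\<forall>i. partial i h \<in> products)"
  proof (induction rule: products.induct)
    case (mult f g)
    have "partial i (\<lambda>x. f x * g x) = (\<lambda>x. f x * partial i g x + partial i f x * g x)" for i
      by (intro ext has_partial_imp_partial has_partial_mult has_partial_differentiable smooth_differentiable mult)
    moreover have "(\<lambda>x. f x * partial i g x + partial i f x * g x) \<in> products" for i
      by (rule products.add; rule products.mult) (auto intro: smooth_partial mult)
    ultimately show ?case using smooth_differentiable[OF mult(1)] smooth_differentiable[OF mult(2)] by simp
  next
    case (add f g)
    have "partial i (\<lambda>x. f x + g x) = (\<lambda>x. partial i f x + partial i g x)" for i
      by (intro ext has_partial_imp_partial has_partial_add has_partial_differentiable) (use add.IH in auto)
    moreover have "(\<lambda>x. partial i f x + partial i g x) \<in> products" for i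
      by (rule products.add) (use add.IH in auto)
    ultimately show ?case using add.IH by simp
  qed
qed (intro products.mult assms)

lemma smooth_homog: "homog k P \<Longrightarrow> smooth P"
  by (rule smooth_class[where S = "{P. \<exists>k. homog k P}"]) (auto intro: homog_differentiable homog_partial1)

lemma test_functionsD:
  assumes "u \<in> test_functions"
  shows "smooth u" "\<exists>R>0. \<forall>x. norm x > R \<longrightarrow> u x = 0"
proof -
  show "smooth u" using assms by (simp add: test_functions_def)
  have "bounded (closure {x. u x \<noteq> 0})" using assms by (simp add: test_functions_def compact_imp_bounded)
  then obtain R where R: "\<And>x. x \<in> closure {x. u x \<noteq> 0} \<Longrightarrow> norm x \<le> R" by (auto simp: bounded_iff)
  have "u x = 0" if "norm x > max R 1" for x
    using R[of x] closure_subset[of "{x. u x \<noteq> 0}"] that by force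
  then show "\<exists>R>0. \<forall>x. norm x > R \<longrightarrow> u x = 0" by (intro exI[of _ "max R 1"]) auto
qed

lemma test_functionsI:
  assumes "smooth u" and R: "\<And>x. norm x > R \<Longrightarrow> u x = 0"
  shows "u \<in> test_functions"
proof -
  have "{x. u x \<noteq> 0} \<subseteq> cball 0 R" using R by force
  then have "bounded {x. u x \<noteq> 0}" by (rule bounded_subset[OF bounded_cball])
  then show ?thesis using assms(1) by (simp add: test_functions_def compact_closure)
qed

lemma test_continuous: "u \<in> test_functions \<Longrightarrow> continuous_on S u"
  by (intro continuous_at_imp_continuous_on ballI differentiable_imp_continuous_within smooth_differentiable test_functionsD)

lemma test_rapid:
  fixes u :: "real^'n::finite \<Rightarrow> complex"
  assumes u: "u \<in> test_functions" shows "rapid 0 u"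
proof -
  obtain R where R: "\<And>x. norm x > R \<Longrightarrow> u x = 0" using test_functionsD(2)[OF u] by auto
  show ?thesis by (rule rapid_compact_support[OF test_continuous[OF u] R])
qed

lemma test_partial: 
  assumes u: "u \<in> test_functions" shows "partial i u \<in> test_functions"
proof -
  obtain R where R: "\<And>x. norm x > R \<Longrightarrow> u x = 0" using test_functionsD(2)[OF u] by auto
  have "partial i u x = 0" if "norm x > R" for x
  proof (rule has_partial_imp_partial)
    have "((\<lambda>t. norm (x + t *\<^sub>R axis i 1)) \<longlongrightarrow> norm (x + 0 *\<^sub>R axis i 1)) (at 0)" by (intro tendsto_intros)
    then have "\<forall>\<^sub>F t in at 0. norm (x + t *\<^sub>R axis i 1) > R" using that by (intro order_tendstoD(1)) auto
    then have ev: "\<forall>\<^sub>F t in at 0. 0 = u (x + t *\<^sub>R axis i 1)" by eventually_elim (simp add: R)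
    have d: "((\<lambda>t. 0) has_derivative (\<lambda>x. x *\<^sub>R (0::complex))) (at (0::real))" by simp
    show "has_partial i u 0 x" unfolding has_partial_def has_vector_derivative_def
      by (rule has_derivative_transform_eventually[OF d ev]) (simp_all add: R[OF that])
  qed
  then show ?thesis by (rule test_functionsI[OF smooth_partial[OF test_functionsD(1)[OF u]]])
qed

lemma test_mult_smooth:
  assumes u: "u \<in> test_functions" and g: "smooth g" shows "(\<lambda>x. g x * u x) \<in> test_functions"
proof -
  obtain R where R: "\<And>x. norm x > R \<Longrightarrow> u x = 0" using test_functionsD(2)[OF u] by auto
  show ?thesis by (rule test_functionsI[where R = R]) (auto intro: smooth_mult g test_functionsD(1)[OF u] simp: R)
qed

lemma test_mult_coord: "u \<in> test_functions \<Longrightarrow> (\<lambda>x. c * of_real (x $ i) * u x) \<in> test_functions"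
  by (intro test_mult_smooth smooth_homog[OF homog_cmult[OF homog_coord1]])

lemma has_partial_cis:
  assumes "has_partial i f D x" shows "has_partial i (\<lambda>x. cis (f x)) (\<i> * of_real D * cis (f x)) x"
proof -
  have "(cis has_vector_derivative \<i> * cis t) (at t)" for t
    unfolding cis_conv_exp[abs_def]
    by (auto intro!: derivative_eq_intros has_vector_derivative_real_field)
  from has_partial_chain[OF assms this] show ?thesis by (simp add: scaleR_conv_of_real mult_ac)
qed

lemma has_partial_inner_left: "has_partial i (\<lambda>x. c * (x \<bullet> \<xi>)) (c * \<xi> $ i) x"
proof -
  have "has_partial i (\<lambda>x. \<Sum>j\<in>UNIV. x $ j * \<xi> $ j) (\<Sum>j\<in>UNIV. x $ j * 0 + (if i = j then 1 else 0) * \<xi> $ j) x"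
    by (intro has_partial_sum has_partial_mult has_partial_coord has_partial_const)
  moreover have "(\<Sum>j\<in>UNIV. x $ j * 0 + (if i = j then 1 else 0) * \<xi> $ j) = (\<Sum>j\<in>UNIV. if i = j then \<xi> $ i else 0)"
    by (intro sum.cong) auto
  ultimately show ?thesis by (intro has_partial_cmult) (simp add: inner_vec_def)
qed

text \<open>The derivative of \<open>f\<close> times the character integrates to 0, also for
  \<open>f\<close> singular at the origin, and the product rule splits it into the two
  transforms.\<close>

lemma inv_fourier_partial:
  fixes f f' :: "real^'n::finite \<Rightarrow> complex"
  assumes N: "CARD('n) \<ge> 2" and f: "rapid a f" "a > - real CARD('n)" and f': "rapid b f'" "b > - real CARD('n)"
    and D: "\<And>\<xi>. \<xi> \<noteq> 0 \<Longrightarrow> has_partial i f (f' \<xi>) \<xi>"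
  shows "inv_fourier f' x = - (2 * pi * \<i> * of_real (x $ i)) * inv_fourier f x"
proof -
  let ?e = "\<lambda>\<xi>. cis (2 * pi * (x \<bullet> \<xi>))"
  have i1: "integrable lborel (\<lambda>\<xi>. f \<xi> * ?e \<xi>)" and i2: "integrable lborel (\<lambda>\<xi>. f' \<xi> * ?e \<xi>)"
    using f(2) f'(2) by (auto intro!: integrable_mult_cis rapid_integrable[OF f(1)] rapid_integrable[OF f'(1)])
  have "(LINT \<xi>|lborel. f \<xi> * (\<i> * of_real (2 * pi * x $ i) * ?e \<xi>) + f' \<xi> * ?e \<xi>) = 0"
  proof (rule integral_partial_zero[where e = "axis i 1" and h = "\<lambda>\<xi>. f \<xi> * ?e \<xi>"])
    show "integrable lborel (\<lambda>\<xi>. f \<xi> * (\<i> * of_real (2 * pi * x $ i) * ?e \<xi>) + f' \<xi> * ?e \<xi>)"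
      using integrable_mult_left[OF i1, of "\<i> * of_real (2 * pi * x $ i)"] i2
      by (intro Bochner_Integration.integrable_add) (simp_all add: mult_ac)
    show "continuous_on (- {0}) (\<lambda>\<xi>. f \<xi> * (\<i> * of_real (2 * pi * x $ i) * ?e \<xi>) + f' \<xi> * ?e \<xi>)"
      by (intro continuous_intros rapid_cont[OF f(1)] rapid_cont[OF f'(1)])
    fix \<xi> :: "real^'n" assume "\<xi> \<noteq> 0"
    from has_partial_mult[OF D[OF this] has_partial_cis[OF has_partial_inner_left[of i "2 * pi" x \<xi>]]]
    show "((\<lambda>t. f (\<xi> + t *\<^sub>R axis i 1) * ?e (\<xi> + t *\<^sub>R axis i 1)) has_vector_derivative
       f \<xi> * (\<i> * of_real (2 * pi * x $ i) * ?e \<xi>) + f' \<xi> * ?e \<xi>) (at 0)"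
      by (simp add: has_partial_def inner_commute)
  qed (use N i1 in auto)
  moreover have "(LINT \<xi>|lborel. f \<xi> * (\<i> * of_real (2 * pi * x $ i) * ?e \<xi>) + f' \<xi> * ?e \<xi>)
    = (LINT \<xi>|lborel. (\<i> * of_real (2 * pi * x $ i)) * (f \<xi> * ?e \<xi>)) + (LINT \<xi>|lborel. f' \<xi> * ?e \<xi>)"
    using integrable_mult_right[OF i1, of "\<i> * of_real (2 * pi * x $ i)"] i2
    by (subst Bochner_Integration.integral_add[symmetric]) (auto simp: mult_ac)
  ultimately have "\<i> * of_real (2 * pi * x $ i) * inv_fourier f x + inv_fourier f' x = 0"
    unfolding inv_fourier_def by (simp only: integral_mult_right_zero)
  then have "inv_fourier f' x = - (\<i> * of_real (2 * pi * x $ i) * inv_fourier f x)" by (simp only: add_eq_0_iff)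
  then show ?thesis by (simp add: mult_ac)
qed

lemma fourier_partial_test:
  fixes u :: "real^'n::finite \<Rightarrow> complex"
  assumes "CARD('n) \<ge> 2" and u: "u \<in> test_functions"
  shows "fourier (partial i u) \<xi> = 2 * pi * \<i> * of_real (\<xi> $ i) * fourier u \<xi>"
  unfolding fourier_eq_inv_fourier
  by (subst inv_fourier_partial[OF assms(1) test_rapid[OF u] _ test_rapid[OF test_partial[OF u]]])
     (auto intro: has_partial_differentiable smooth_differentiable[OF test_functionsD(1)[OF u]])

lemma one_plus_norm_le: "1 + norm (x::real^'n::finite) \<le> 1 + (\<Sum>i\<in>UNIV. \<bar>x $ i\<bar>)"
  using norm_le_l1_cart[of x] by simp

text \<open>One factor \<open>1 + |\<xi>|\<close> is bounded by 1 plus the sum of the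
  \<open>|\<xi>_i|\<close>, and each \<open>|\<xi>_i|\<close> is traded for a derivative of
  \<open>u\<close>; this is why the induction runs over all test functions at once.\<close>

lemma fourier_test_decay:
  fixes u :: "real^'n::finite \<Rightarrow> complex"
  assumes N: "CARD('n) \<ge> 2" and "u \<in> test_functions"
  shows "\<exists>C. \<forall>\<xi>. norm (fourier u \<xi>) * (1 + norm \<xi>) ^ K \<le> C"
  using assms(2)
proof (induction K arbitrary: u)
  case 0
  have "integrable lborel u" by (rule rapid_integrable[OF test_rapid[OF 0]]) simp
  then show ?case using norm_inv_fourier_le[of u] by (intro exI[of _ "LINT x|lborel. norm (u x)"]) (simp add: fourier_eq_inv_fourier)
next
  case (Suc K)
  obtain C where C: "\<And>\<xi>. norm (fourier u \<xi>) * (1 + norm \<xi>) ^ K \<le> C" using Suc by blast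
  obtain D where D: "\<And>i \<xi>. norm (fourier (partial i u) \<xi>) * (1 + norm \<xi>) ^ K \<le> D i" 
    using Suc.IH[OF test_partial[OF Suc.prems]] by metis
  show ?case
  proof (intro exI[of _ "C + (\<Sum>i\<in>UNIV. D i)"] allI)
    fix \<xi> :: "real^'n"
    have "norm (fourier u \<xi>) * (1 + norm \<xi>) ^ Suc K = (1 + norm \<xi>) * (norm (fourier u \<xi>) * (1 + norm \<xi>) ^ K)" by simp
    also have "\<dots> \<le> (1 + (\<Sum>i\<in>UNIV. \<bar>\<xi> $ i\<bar>)) * (norm (fourier u \<xi>) * (1 + norm \<xi>) ^ K)"
      by (intro mult_right_mono one_plus_norm_le) auto
    also have "\<dots> = norm (fourier u \<xi>) * (1 + norm \<xi>) ^ K + (\<Sum>i\<in>UNIV. \<bar>\<xi> $ i\<bar> * norm (fourier u \<xi>) * (1 + norm \<xi>) ^ K)"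
      by (simp add: distrib_right sum_distrib_right mult.assoc)
    also have "\<dots> \<le> C + (\<Sum>i\<in>UNIV. D i)"
    proof (intro add_mono C sum_mono)
      fix i
      have "\<bar>\<xi> $ i\<bar> * norm (fourier u \<xi>) \<le> norm (fourier (partial i u) \<xi>)"
      proof -
        have "1 \<le> 2 * pi" using pi_gt3 by simp
        then have "1 * (\<bar>\<xi> $ i\<bar> * norm (fourier u \<xi>)) \<le> (2 * pi) * (\<bar>\<xi> $ i\<bar> * norm (fourier u \<xi>))" by (intro mult_right_mono) auto
        then show ?thesis unfolding fourier_partial_test[OF N Suc.prems] by (simp add: norm_mult mult_ac)
      qed
      then have "\<bar>\<xi> $ i\<bar> * norm (fourier u \<xi>) * (1 + norm \<xi>) ^ K \<le> norm (fourier (partial i u) \<xi>) * (1 + norm \<xi>) ^ K"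
        by (intro mult_right_mono) auto
      then show "\<bar>\<xi> $ i\<bar> * norm (fourier u \<xi>) * (1 + norm \<xi>) ^ K \<le> D i" using D order_trans by blast
    qed
    finally show "norm (fourier u \<xi>) * (1 + norm \<xi>) ^ Suc K \<le> C + (\<Sum>i\<in>UNIV. D i)" .
  qed
qed

lemma rapid_moment:
  fixes g :: "real^'n::finite \<Rightarrow> complex"
  assumes g: "rapid a g" and a: "a > - real CARD('n)"
  shows "integrable lborel (\<lambda>\<xi>. (1 + norm \<xi>)\<^sup>2 * norm (g \<xi>))"
proof -
  have "rapid a (\<lambda>\<xi>. (1 + norm \<xi>)\<^sup>2 * norm (g \<xi>))"
    by (rule rapid_mult_poly_growth[OF rapid_norm[OF g], where B = 1 and L = 2]) (auto intro!: continuous_intros)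
  then show ?thesis using a by (intro rapid_integrable) auto
qed

lemma inv_fourier_rapid_has_derivative:
  fixes g :: "real^'n::finite \<Rightarrow> complex"
  assumes g: "rapid a g" and a: "a > - real CARD('n)"
  shows "(inv_fourier g has_derivative (\<lambda>h. \<Sum>i\<in>UNIV. (h $ i) *\<^sub>R inv_fourier (\<lambda>\<xi>. 2 * pi * \<i> * of_real (\<xi> $ i) * g \<xi>) x)) (at x)"
  by (intro inv_fourier_has_derivative rapid_moment[OF g a] rapid_integrable[OF g]) (use a in auto)

lemma inv_fourier_rapid_partial:
  fixes g :: "real^'n::finite \<Rightarrow> complex"
  assumes g: "rapid a g" and a: "a > - real CARD('n)"
  shows "partial i (inv_fourier g) = inv_fourier (\<lambda>\<xi>. 2 * pi * \<i> * of_real (\<xi> $ i) * g \<xi>)"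
proof (rule ext)
  fix x
  let ?h = "inv_fourier (\<lambda>\<xi>. 2 * pi * \<i> * of_real (\<xi> $ i) * g \<xi>) x"
  note d = inv_fourier_rapid_has_derivative[OF g a, of x]
  have "partial i (inv_fourier g) x = frechet_derivative (inv_fourier g) (at x) (axis i 1)"
  proof (rule has_partial_imp_partial)
    have "((\<lambda>t. x + t *\<^sub>R axis i (1::real)) has_vector_derivative axis i 1) (at 0)"
      by (auto intro!: derivative_eq_intros)
    then show "has_partial i (inv_fourier g) (frechet_derivative (inv_fourier g) (at x) (axis i 1)) x"
      using vector_derivative_diff_chain_within[of "\<lambda>t. x + t *\<^sub>R axis i (1::real)" "axis i 1" 0 UNIV "inv_fourier g" "frechet_derivative (inv_fourier g) (at x)"]
        d has_derivative_at_withinI[of "inv_fourier g" _ x] frechet_derivative_at[OF d]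
      by (simp add: has_partial_def o_def)
  qed
  then have 1: "partial i (inv_fourier g) x = (\<Sum>j\<in>UNIV. (axis i 1 $ j) *\<^sub>R inv_fourier (\<lambda>\<xi>. 2 * pi * \<i> * of_real (\<xi> $ j) * g \<xi>) x)"
    unfolding frechet_derivative_at[OF d, symmetric] .
  have "(axis i 1 $ j) *\<^sub>R inv_fourier (\<lambda>\<xi>. 2 * pi * \<i> * of_real (\<xi> $ j) * g \<xi>) x = (if i = j then ?h else 0)" for j
    by (cases "i = j") (simp_all add: axis_def)
  then show "partial i (inv_fourier g) x = ?h" unfolding 1 by simp
qed

lemma rapid_mult_coord:
  fixes g :: "real^'n::finite \<Rightarrow> complex"
  assumes g: "rapid a g" shows "rapid a (\<lambda>\<xi>. c * of_real (\<xi> $ i) * g \<xi>)"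
proof (rule rapid_mult_poly_growth[OF g, where B = "norm c" and L = 1])
  fix \<xi> :: "real^'n"
  have "\<bar>\<xi> $ i\<bar> \<le> 1 + norm \<xi>" using component_le_norm_cart[of \<xi> i] by simp
  then show "norm (c * of_real (\<xi> $ i)) \<le> norm c * (1 + norm \<xi>) ^ 1" by (simp add: norm_mult mult_left_mono)
qed (intro continuous_intros)

text \<open>Multiplying by a coordinate keeps the exponent \<open>a\<close>, so the inverse
  transforms of functions in \<open>rapid a\<close> form a family stable under
  differentiation.\<close>

lemma smooth_inv_fourier:
  fixes g :: "real^'n::finite \<Rightarrow> complex"
  assumes g: "rapid a g" and a: "a > - real CARD('n)"
  shows "smooth (inv_fourier g)"
proof (rule smooth_class[where S = "{inv_fourier g | g. rapid a g}"])
  fix f :: "real^'n \<Rightarrow> complex" assume "f \<in> {inv_fourier g | g. rapid a g}"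
  then obtain g where f: "f = inv_fourier g" "rapid a g" by auto
  show "(\<forall>x. f differentiable (at x)) \<and> (\<forall>i. partial i f \<in> {inv_fourier g | g. rapid a g})"
    using inv_fourier_rapid_has_derivative[OF f(2) a] inv_fourier_rapid_partial[OF f(2) a] rapid_mult_coord[OF f(2)]
    unfolding f(1) differentiable_def by blast
qed (use g in auto)

lemma fourier_test_has_partial:
  fixes u :: "real^'n::finite \<Rightarrow> complex"
  assumes u: "u \<in> test_functions"
  shows "fourier u differentiable (at \<xi>)" 
    and "has_partial i (fourier u) (fourier (\<lambda>x. - (2 * pi * \<i>) * of_real (x $ i) * u x) \<xi>) \<xi>"
proof -
  have ue: "fourier u = inv_fourier u \<circ> uminus" by (auto simp: fourier_eq_inv_fourier)
  have s: "smooth (inv_fourier u)" by (rule smooth_inv_fourier[OF test_rapid[OF u]]) simp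
  show d: "fourier u differentiable (at \<xi>)"
    unfolding ue by (intro differentiable_chain_at smooth_differentiable[OF s]) simp
  have "has_partial i (inv_fourier u) (inv_fourier (\<lambda>x. 2 * pi * \<i> * of_real (x $ i) * u x) (- \<xi>)) (- \<xi>)"
    using has_partial_differentiable[OF smooth_differentiable[OF s], of i "- \<xi>"] inv_fourier_rapid_partial[OF test_rapid[OF u], of i] by simp
  then have 1: "((\<lambda>t. inv_fourier u (- \<xi> + t *\<^sub>R axis i 1)) has_vector_derivative inv_fourier (\<lambda>x. 2 * pi * \<i> * of_real (x $ i) * u x) (- \<xi>)) (at (- 0))"
    by (simp add: has_partial_def)
  have 2: "(uminus has_vector_derivative - 1) (at (0::real))" by (auto intro!: derivative_eq_intros)
  have "((\<lambda>t. fourier u (\<xi> + t *\<^sub>R axis i 1)) has_vector_derivative - inv_fourier (\<lambda>x. 2 * pi * \<i> * of_real (x $ i) * u x) (- \<xi>)) (at 0)"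
    using vector_diff_chain_at[OF 2 1] unfolding o_def fourier_eq_inv_fourier by (simp add: add.commute)
  moreover have "- inv_fourier (\<lambda>x. 2 * pi * \<i> * of_real (x $ i) * u x) (- \<xi>) = fourier (\<lambda>x. - (2 * pi * \<i>) * of_real (x $ i) * u x) \<xi>"
    unfolding fourier_eq_inv_fourier inv_fourier_def by (simp add: Bochner_Integration.integral_minus[symmetric] del: Bochner_Integration.integral_minus)
  ultimately show "has_partial i (fourier u) (fourier (\<lambda>x. - (2 * pi * \<i>) * of_real (x $ i) * u x) \<xi>) \<xi>"
    by (simp add: has_partial_def)
qed

lemma fourier_test_continuous: "u \<in> test_functions \<Longrightarrow> continuous_on S (fourier u)"
  by (intro continuous_at_imp_continuous_on ballI differentiable_imp_continuous_within fourier_test_has_partial)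

lemma fourier_test_rapid:
  fixes u :: "real^'n::finite \<Rightarrow> complex"
  assumes N: "CARD('n) \<ge> 2" and u: "u \<in> test_functions"
  shows "rapid 0 (fourier u)"
  unfolding rapid_def
proof (intro conjI allI fourier_test_continuous[OF u])
  fix K
  obtain C where C: "\<And>\<xi>. norm (fourier u \<xi>) * (1 + norm \<xi>) ^ K \<le> C" using fourier_test_decay[OF assms] by blast
  show "\<exists>C. \<forall>x. x \<noteq> 0 \<longrightarrow> norm (fourier u x) \<le> C * (norm x powr 0 / (1 + norm x) ^ K)"
  proof (intro exI[of _ C] allI impI)
    fix x :: "real^'n" assume "x \<noteq> 0"
    moreover have "(1 + norm x) ^ K > 0" by (intro zero_less_power) (smt (verit) norm_ge_zero)
    ultimately show "norm (fourier u x) \<le> C * (norm x powr 0 / (1 + norm x) ^ K)" using C[of x] by (simp add: pos_le_divide_eq)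
  qed
qed

lemma plancherel_test:
  fixes u :: "real^'n::finite \<Rightarrow> complex"
  assumes u: "u \<in> test_functions"
  shows "(LINT \<xi>|lborel. (norm (fourier u \<xi>))\<^sup>2) = (LINT x|lborel. (norm (u x))\<^sup>2)"
proof -
  have [measurable]: "u \<in> borel_measurable borel" by (rule rapid_measurable[OF test_rapid[OF u]])
  have "(LINT \<xi>|lborel. (norm (fourier u \<xi>))\<^sup>2) = (LINT \<xi>|lborel. (norm (inv_fourier u \<xi>))\<^sup>2)"
    unfolding fourier_eq_inv_fourier by (intro lborel_integral_uminus[of "\<lambda>\<xi>. (norm (inv_fourier u \<xi>))\<^sup>2"]) measurable
  also have "\<dots> = (LINT x|lborel. (norm (u x))\<^sup>2)" by (rule plancherel_rapid(2)[OF test_rapid[OF u]]) simp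
  finally show ?thesis .
qed

lemma moment_eq_gradient:
  fixes u :: "real^'n::finite \<Rightarrow> complex"
  assumes N: "CARD('n) \<ge> 2" and u: "u \<in> test_functions"
  shows "(LINT x|lborel. (norm x)\<^sup>2 * (norm (u x))\<^sup>2) = (\<Sum>i\<in>UNIV. LINT \<xi>|lborel. (norm (partial i (fourier u) \<xi>))\<^sup>2) / (2 * pi)\<^sup>2"
proof -
  let ?v = "\<lambda>i x. - (2 * pi * \<i>) * of_real (x $ i) * u x"
  have v: "?v i \<in> test_functions" for i by (rule test_mult_coord[OF u])
  have p: "partial i (fourier u) \<xi> = fourier (?v i) \<xi>" for i \<xi>
    by (rule has_partial_imp_partial[OF fourier_test_has_partial(2)[OF u]])
  have vi: "integrable lborel (\<lambda>x. (norm (?v i x))\<^sup>2)" for i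
    by (rule rapid_integrable[OF rapid_norm_sq[OF test_rapid[OF v]]]) simp
  have "(\<Sum>i\<in>UNIV. LINT \<xi>|lborel. (norm (partial i (fourier u) \<xi>))\<^sup>2) = (\<Sum>i\<in>UNIV. LINT x|lborel. (norm (?v i x))\<^sup>2)"
    unfolding p plancherel_test[OF v] ..
  also have "\<dots> = (LINT x|lborel. (\<Sum>i\<in>UNIV. (norm (?v i x))\<^sup>2))"
    by (rule Bochner_Integration.integral_sum[symmetric]) (rule vi)
  also have "\<dots> = (LINT x|lborel. (2 * pi)\<^sup>2 * ((norm x)\<^sup>2 * (norm (u x))\<^sup>2))"
  proof (rule Bochner_Integration.integral_cong[OF refl])
    fix x :: "real^'n"
    have "(\<Sum>i\<in>UNIV. (norm (?v i x))\<^sup>2) = (\<Sum>i\<in>UNIV. (2 * pi)\<^sup>2 * (norm (u x))\<^sup>2 * (x $ i)\<^sup>2)"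
      by (intro sum.cong) (auto simp: norm_mult power_mult_distrib)
    also have "\<dots> = (2 * pi)\<^sup>2 * (norm (u x))\<^sup>2 * (norm x)\<^sup>2"
      by (simp only: sum_distrib_left[symmetric] power2_norm_eq_inner) (simp add: inner_vec_def power2_eq_square)
    finally show "(\<Sum>i\<in>UNIV. (norm (?v i x))\<^sup>2) = (2 * pi)\<^sup>2 * ((norm x)\<^sup>2 * (norm (u x))\<^sup>2)" by (simp only: mult_ac)
  qed
  also have "\<dots> = (2 * pi)\<^sup>2 * (LINT x|lborel. (norm x)\<^sup>2 * (norm (u x))\<^sup>2)" by (rule integral_mult_right_zero)
  finally show ?thesis by (simp add: field_simps)
qed

section \<open>Homogeneous polynomials times stretched exponentials\<close>

definition gexp :: "real \<Rightarrow> real \<Rightarrow> real^'n::finite \<Rightarrow> real" where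
  "gexp \<sigma> \<tau> \<xi> = exp (- \<tau> * norm \<xi> powr \<sigma> / \<sigma>)"

lemma gexp_pos: "gexp \<sigma> \<tau> \<xi> > 0"
  by (simp add: gexp_def)

lemma continuous_on_gexp: "\<sigma> \<noteq> 0 \<Longrightarrow> continuous_on (- {0}) (gexp \<sigma> \<tau> :: real^'n::finite \<Rightarrow> real)"
  unfolding gexp_def[abs_def] by (intro continuous_intros continuous_on_norm_powr) auto

lemma power_le_fact_exp: "0 \<le> x \<Longrightarrow> x ^ n \<le> fact n * exp (x::real)"
proof -
  assume x: "0 \<le> x"
  have "x ^ n /\<^sub>R fact n \<le> (\<Sum>n. x ^ n /\<^sub>R fact n)"
    using sum_le_suminf[OF summable_exp_generic[of x], of "{n}"] x by simp
  then show ?thesis by (simp add: exp_def field_simps)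
qed

text \<open>The bound \<open>exp (- y) \<le> n! / y^n\<close>, with \<open>y\<close> a multiple of
  \<open>|x|^\<sigma>\<close>, beats the power \<open>|x|^K\<close> once
  \<open>n \<sigma> > K\<close>.\<close>

lemma rapid_gexp:
  assumes "\<tau> > 0" "\<sigma> > 0"
  shows "rapid 0 (gexp \<sigma> \<tau> :: real^'n::finite \<Rightarrow> real)"
  unfolding rapid_def
proof (intro conjI allI)
  show "continuous_on (- {0}) (gexp \<sigma> \<tau> :: real^'n \<Rightarrow> real)"
    by (rule continuous_on_gexp) (use assms in auto)
  fix K :: nat
  obtain n :: nat where n: "real n * \<sigma> > real K" using reals_Archimedean3[OF assms(2)] by blast
  \<comment> \<open>\<open>(1 + r)^K\<close> is at most \<open>2^K\<close> for
    \<open>r \<le> 1\<close> and at most \<open>2^K r^K\<close> beyond; the two summands serve these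
    two cases.\<close>
  define C where "C = 2 ^ K * (1 + fact n * (\<sigma> / \<tau>) ^ n)"
  show "\<exists>C. \<forall>x::real^'n. x \<noteq> 0 \<longrightarrow> norm (gexp \<sigma> \<tau> x) \<le> C * (norm x powr 0 / (1 + norm x) ^ K)"
  proof (intro exI[of _ C] allI impI)
    fix x :: "real^'n" assume x: "x \<noteq> 0"
    define r where "r = norm x"
    have r: "r > 0" using x by (simp add: r_def)
    have E1: "gexp \<sigma> \<tau> x \<le> 1" using assms by (simp add: gexp_def)
    have "gexp \<sigma> \<tau> x * (1 + r) ^ K \<le> C"
    proof (cases "r \<le> 1")
      case True
      have "gexp \<sigma> \<tau> x * (1 + r) ^ K \<le> 1 * 2 ^ K" using True r E1 gexp_pos[of \<sigma> \<tau> x] by (intro mult_mono power_mono) auto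
      also have "\<dots> \<le> C" using assms unfolding C_def by (simp add: distrib_left)
      finally show ?thesis .
    next
      case False
      let ?y = "\<tau> * r powr \<sigma> / \<sigma>"
      have y: "?y > 0" using assms r by simp
      have "?y ^ n = (\<tau> / \<sigma>) ^ n * r powr (real n * \<sigma>)"
        using r by (simp add: power_mult_distrib power_divide powr_powr powr_realpow[symmetric] mult.commute)
      moreover have "r ^ K \<le> r powr (real n * \<sigma>)"
        using n False r by (simp add: powr_realpow[symmetric] powr_mono)
      ultimately have "(\<tau> / \<sigma>) ^ n * r ^ K \<le> ?y ^ n" using assms by (simp add: mult_left_mono)
      also have "\<dots> \<le> fact n * exp ?y" using y by (intro power_le_fact_exp) auto
      finally have "(\<tau> / \<sigma>) ^ n * r ^ K \<le> fact n * exp ?y" .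
      then have "(\<sigma> / \<tau>) ^ n * ((\<tau> / \<sigma>) ^ n * r ^ K) \<le> (\<sigma> / \<tau>) ^ n * (fact n * exp ?y)"
        using assms by (intro mult_left_mono) auto
      moreover have "(\<sigma> / \<tau>) ^ n * (\<tau> / \<sigma>) ^ n = 1"
        using assms by (simp add: power_mult_distrib[symmetric])
      ultimately have "r ^ K \<le> (\<sigma> / \<tau>) ^ n * (fact n * exp ?y)" by (simp only: mult.assoc[symmetric] mult_1_left)
      then have rK: "r ^ K \<le> fact n * (\<sigma> / \<tau>) ^ n * exp ?y" by (simp only: mult_ac)
      have "(1 + r) ^ K \<le> (2 * r) ^ K" using False by (intro power_mono) auto
      also have "\<dots> \<le> 2 ^ K * (fact n * (\<sigma> / \<tau>) ^ n * exp ?y)" unfolding power_mult_distrib by (intro mult_left_mono rK) auto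
      finally have "gexp \<sigma> \<tau> x * (1 + r) ^ K \<le> exp (- ?y) * (2 ^ K * (fact n * (\<sigma> / \<tau>) ^ n * exp ?y))"
        by (simp add: gexp_def r_def mult_left_mono)
      also have "\<dots> = 2 ^ K * (fact n * (\<sigma> / \<tau>) ^ n)" by (simp add: exp_minus)
      also have "\<dots> \<le> C" unfolding C_def by (intro mult_left_mono) auto
      finally show ?thesis .
    qed
    moreover have "(1 + r) ^ K > 0" using r by (intro zero_less_power) auto
    ultimately show "norm (gexp \<sigma> \<tau> x) \<le> C * (norm x powr 0 / (1 + norm x) ^ K)"
      using x gexp_pos[of \<sigma> \<tau> x] by (simp add: pos_le_divide_eq r_def)
  qed
qed

text \<open>Since \<open>0 powr 0 = 0\<close>, the value at the origin is \<open>0\<close> even for \<open>a = 0\<close>.\<close>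

definition hterm :: "real \<Rightarrow> real \<Rightarrow> (real^'n::finite \<Rightarrow> complex) \<Rightarrow> real \<Rightarrow> real^'n \<Rightarrow> complex" where
  "hterm \<sigma> \<tau> Q a \<xi> = Q \<xi> * of_real (norm \<xi> powr a * gexp \<sigma> \<tau> \<xi>)"

lemma rapid_hterm:
  assumes "homog q Q" "\<tau> > 0" "\<sigma> > 0" "b \<le> real q + a"
  shows "rapid b (hterm \<sigma> \<tau> Q a)"
proof -
  obtain B where B: "B \<ge> 0" "\<And>x. norm (Q x) \<le> B * norm x ^ q" using homog_bound[OF assms(1)] by blast
  have "rapid (0 + a) (\<lambda>x::real^'a. norm x powr a * gexp \<sigma> \<tau> x)"
    by (rule rapid_norm_powr_mult_real[OF rapid_gexp[OF assms(2,3)]])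
  then have "rapid (0 + a + real q) (hterm \<sigma> \<tau> Q a)"
  proof (rule rapid_bound[where B = B and L = 0])
    show "continuous_on (- {0}) (hterm \<sigma> \<tau> Q a)"
      unfolding hterm_def by (intro continuous_intros homog_continuous[OF assms(1)] continuous_on_norm_powr continuous_on_gexp) (use assms in auto)
    fix x :: "real^'a" assume "x \<noteq> 0"
    then show "norm (hterm \<sigma> \<tau> Q a x) \<le> B * norm x powr real q * (1 + norm x) ^ 0 * norm (norm x powr a * gexp \<sigma> \<tau> x)"
      using B(2)[of x] unfolding hterm_def norm_mult using gexp_pos[of \<sigma> \<tau> x] by (simp add: powr_realpow norm_mult mult_right_mono)
  qed
  then show ?thesis by (rule rapid_mono) (use assms in simp)
qed

lemma has_partial_gexp:
  assumes x: "x \<noteq> (0::real^'n::finite)" and "\<sigma> > 0"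
  shows "has_partial i (gexp \<sigma> \<tau>) (- (\<tau> * norm x powr (\<sigma> - 2) * x $ i * gexp \<sigma> \<tau> x)) x"
proof -
  have 1: "has_partial i (\<lambda>x. (- \<tau> / \<sigma>) * norm x powr \<sigma>) ((- \<tau> / \<sigma>) * (\<sigma> * norm x powr (\<sigma> - 2) * x $ i)) x"
    by (intro has_partial_cmult has_partial_norm_powr x)
  have 2: "(exp has_vector_derivative exp t) (at t)" for t :: real
    unfolding has_real_derivative_iff_has_vector_derivative[symmetric] by (rule DERIV_exp)
  have "has_partial i (\<lambda>x. exp ((- \<tau> / \<sigma>) * norm x powr \<sigma>)) (((- \<tau> / \<sigma>) * (\<sigma> * norm x powr (\<sigma> - 2) * x $ i)) *\<^sub>R exp ((- \<tau> / \<sigma>) * norm x powr \<sigma>)) x"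
    by (rule has_partial_chain[OF 1 2])
  then show ?thesis using assms by (simp add: gexp_def[abs_def] mult.assoc)
qed

lemma has_partial_hterm:
  assumes Q: "homog q Q" and x: "x \<noteq> (0::real^'n::finite)" and "\<sigma> > 0"
  shows "has_partial i (hterm \<sigma> \<tau> Q a)
    (hterm \<sigma> \<tau> (partial i Q) a x + hterm \<sigma> \<tau> (\<lambda>x. of_real a * (of_real (x $ i) * Q x)) (a - 2) x
      + hterm \<sigma> \<tau> (\<lambda>x. - of_real \<tau> * (of_real (x $ i) * Q x)) (a + \<sigma> - 2) x) x"
proof -
  have p: "norm x powr a * norm x powr (\<sigma> - 2) = norm x powr (a + \<sigma> - 2)"
    by (simp add: powr_add[symmetric] algebra_simps)
  have "has_partial i (hterm \<sigma> \<tau> Q a) (Q x * of_real (norm x powr a * - (\<tau> * norm x powr (\<sigma> - 2) * x $ i * gexp \<sigma> \<tau> x)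
     + a * norm x powr (a - 2) * x $ i * gexp \<sigma> \<tau> x) + partial i Q x * of_real (norm x powr a * gexp \<sigma> \<tau> x)) x"
    unfolding hterm_def[abs_def]
    by (intro has_partial_mult has_partial_homog[OF Q] has_partial_of_real has_partial_norm_powr has_partial_gexp assms)
  moreover have "norm x powr a * - (\<tau> * norm x powr (\<sigma> - 2) * x $ i * gexp \<sigma> \<tau> x) = - \<tau> * x $ i * norm x powr (a + \<sigma> - 2) * gexp \<sigma> \<tau> x"
    unfolding p[symmetric] by (simp add: mult_ac)
  then have "Q x * of_real (norm x powr a * - (\<tau> * norm x powr (\<sigma> - 2) * x $ i * gexp \<sigma> \<tau> x)
     + a * norm x powr (a - 2) * x $ i * gexp \<sigma> \<tau> x) + partial i Q x * of_real (norm x powr a * gexp \<sigma> \<tau> x)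
    = hterm \<sigma> \<tau> (partial i Q) a x + hterm \<sigma> \<tau> (\<lambda>x. of_real a * (of_real (x $ i) * Q x)) (a - 2) x
      + hterm \<sigma> \<tau> (\<lambda>x. - of_real \<tau> * (of_real (x $ i) * Q x)) (a + \<sigma> - 2) x"
    unfolding hterm_def by (simp only:) (simp add: algebra_simps)
  ultimately show ?thesis by (simp only:)
qed

text \<open>Bookkeeping of the regularity at the origin after \<open>j\<close> derivatives: a term
  either carries no power of the norm besides the exponential, or its total homogeneity is at least
  \<open>\<sigma> - j\<close>. Differentiating the exponential in a term with \<open>a = 0\<close>
  produces homogeneity \<open>q + \<sigma> - 1\<close>, which fits \<open>j + 1\<close>.\<close>

inductive hsum :: "real \<Rightarrow> real \<Rightarrow> nat \<Rightarrow> (real^'n::finite \<Rightarrow> complex) \<Rightarrow> bool" for \<sigma> \<tau> where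
  base: "homog q Q \<Longrightarrow> a = 0 \<or> real q + a \<ge> \<sigma> - real j \<Longrightarrow> hsum \<sigma> \<tau> j (hterm \<sigma> \<tau> Q a)"
| add: "hsum \<sigma> \<tau> j F \<Longrightarrow> hsum \<sigma> \<tau> j G \<Longrightarrow> hsum \<sigma> \<tau> j (\<lambda>x. F x + G x)"

lemma hsum_rapid:
  assumes "\<tau> > 0" "\<sigma> > 0"
  shows "hsum \<sigma> \<tau> j F \<Longrightarrow> rapid (min 0 (\<sigma> - real j)) F"
proof (induction rule: hsum.induct)
  case (base q Q a j)
  show ?case by (rule rapid_hterm[OF base(1) assms]) (use base(2) in auto)
qed (rule rapid_add)

lemma hsum_partial:
  assumes "\<sigma> > 0"
  shows "hsum \<sigma> \<tau> j F \<Longrightarrow> \<exists>F'. hsum \<sigma> \<tau> (Suc j) F' \<and> (\<forall>x. x \<noteq> 0 \<longrightarrow> has_partial i F (F' x) x)"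
proof (induction rule: hsum.induct)
  case (base q Q a j)
  have 1: "hsum \<sigma> \<tau> (Suc j) (hterm \<sigma> \<tau> (partial i Q) a)"
  proof (cases "q = 0")
    case True
    then have "partial i Q = (\<lambda>x. 0)" using homog_partial[OF base(1)] by auto
    then have "hterm \<sigma> \<tau> (partial i Q) a = hterm \<sigma> \<tau> (\<lambda>x. 0) 0" by (auto simp: hterm_def)
    then show ?thesis using hsum.base[OF homog_zero[of 0], of 0] by simp
  next
    case False
    then show ?thesis using base by (intro hsum.base[OF homog_partial1[OF base(1)]]) (auto simp: of_nat_diff)
  qed
  \<comment> \<open>For \<open>a = 0\<close> the coefficient vanishes; otherwise a power -2 of the
    norm would leave the class.\<close>
  have 2: "hsum \<sigma> \<tau> (Suc j) (hterm \<sigma> \<tau> (\<lambda>x. of_real a * (of_real (x $ i) * Q x)) (a - 2))"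
  proof (cases "a = 0")
    case True
    then have "hterm \<sigma> \<tau> (\<lambda>x. of_real a * (of_real (x $ i) * Q x)) (a - 2) = hterm \<sigma> \<tau> (\<lambda>x. 0) 0" by (auto simp: hterm_def)
    then show ?thesis using hsum.base[OF homog_zero[of 0], of 0] by simp
  next
    case False
    then show ?thesis using base by (intro hsum.base[OF homog_cmult[OF homog.coord[OF base(1)]]]) auto
  qed
  have 3: "hsum \<sigma> \<tau> (Suc j) (hterm \<sigma> \<tau> (\<lambda>x. - of_real \<tau> * (of_real (x $ i) * Q x)) (a + \<sigma> - 2))"
    using base assms by (intro hsum.base[OF homog_cmult[OF homog.coord[OF base(1)]]]) auto
  show ?case using hsum.add[OF hsum.add[OF 1 2] 3] has_partial_hterm[OF base(1) _ assms] by blast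
next
  case (add j F G)
  then obtain F' G' where "hsum \<sigma> \<tau> (Suc j) F'" "\<forall>x. x \<noteq> 0 \<longrightarrow> has_partial i F (F' x) x" "hsum \<sigma> \<tau> (Suc j) G'" "\<forall>x. x \<noteq> 0 \<longrightarrow> has_partial i G (G' x) x" by blast
  then show ?case by (intro exI[of _ "\<lambda>x. F' x + G' x"]) (auto intro: hsum.add has_partial_add)
qed

text \<open>Each multiplication by \<open>x $ i\<close> is a derivative on the frequency side,
  available as long as the exponent lost at the origin stays integrable.\<close>

lemma hsum_inv_fourier_power:
  fixes F :: "real^'n::finite \<Rightarrow> complex"
  assumes N: "CARD('n) \<ge> 2" and \<tau>: "\<tau> > 0" "\<sigma> > 0"
  shows "hsum \<sigma> \<tau> j F \<Longrightarrow> \<sigma> - real (j + k) > - real CARD('n) \<Longrightarrow>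
    \<exists>F'. hsum \<sigma> \<tau> (j + k) F' \<and> (\<forall>x. inv_fourier F' x = (- (2 * pi * \<i> * of_real (x $ i))) ^ k * inv_fourier F x)"
proof (induction k)
  case (Suc k)
  then obtain F' where F': "hsum \<sigma> \<tau> (j + k) F'" "\<And>x. inv_fourier F' x = (- (2 * pi * \<i> * of_real (x $ i))) ^ k * inv_fourier F x" by auto
  obtain F'' where F'': "hsum \<sigma> \<tau> (Suc (j + k)) F''" "\<And>x. x \<noteq> 0 \<Longrightarrow> has_partial i F' (F'' x) x"
    using hsum_partial[OF \<tau>(2) F'(1)] by blast
  have "inv_fourier F'' x = - (2 * pi * \<i> * of_real (x $ i)) * inv_fourier F' x" for x
    by (rule inv_fourier_partial[OF N hsum_rapid[OF \<tau> F'(1)] _ hsum_rapid[OF \<tau> F''(1)] _ F''(2)]) (use Suc.prems N in auto)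
  then show ?case using F'' by (intro exI[of _ F'']) (simp add: F'(2))
qed auto

lemma one_plus_norm_power_le:
  fixes x :: "real^'n::finite"
  shows "(1 + norm x) ^ (2 * k) \<le> (1 + real CARD('n)) ^ (2 * k) * (1 + (\<Sum>i\<in>UNIV. \<bar>x $ i\<bar> ^ (2 * k)))"
proof -
  define M where "M = Max (insert 1 (range (\<lambda>i. \<bar>x $ i\<bar>)))"
  have M1: "1 \<le> M" unfolding M_def by (rule Max_ge) auto
  have Mi: "\<bar>x $ i\<bar> \<le> M" for i unfolding M_def by (rule Max_ge) auto
  have "(\<Sum>i\<in>UNIV. \<bar>x $ i\<bar>) \<le> (\<Sum>i\<in>(UNIV::'n set). M)" by (intro sum_mono Mi)
  then have "1 + norm x \<le> M + real CARD('n) * M" using one_plus_norm_le[of x] M1 by simp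
  then have "(1 + norm x) ^ (2 * k) \<le> ((1 + real CARD('n)) * M) ^ (2 * k)" by (intro power_mono) (auto simp: distrib_right)
  also have "\<dots> = (1 + real CARD('n)) ^ (2 * k) * M ^ (2 * k)" by (simp add: power_mult_distrib)
  also have "M ^ (2 * k) \<le> 1 + (\<Sum>i\<in>UNIV. \<bar>x $ i\<bar> ^ (2 * k))"
  proof -
    have "M \<in> insert 1 (range (\<lambda>i. \<bar>x $ i\<bar>))" unfolding M_def by (rule Max_in) auto
    then consider "M = 1" | i where "M = \<bar>x $ i\<bar>" by auto
    then show ?thesis
    proof cases
      case 1 then show ?thesis by (simp add: sum_nonneg)
    next
      case (2 i)
      have "\<bar>x $ i\<bar> ^ (2 * k) \<le> (\<Sum>i\<in>UNIV. \<bar>x $ i\<bar> ^ (2 * k))" by (rule member_le_sum) auto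
      then show ?thesis using 2 by simp
    qed
  qed
  finally show ?thesis by (simp add: mult_left_mono)
qed

text \<open>More than half the dimension of derivatives of \<open>F\<close> are square integrable, hence
  by Bessel's inequality \<open>inv_fourier F\<close> is square integrable against a weight with integrable inverse.\<close>

theorem hsum_inv_fourier_integrable:
  fixes F :: "real^'n::finite \<Rightarrow> complex"
  assumes N: "CARD('n) \<ge> 2" and \<tau>: "\<tau> > 0" and \<sigma>: "\<sigma> > 1" and F: "hsum \<sigma> \<tau> 0 F"
  shows "integrable lborel (inv_fourier F)"
proof -
  have \<sigma>0: "\<sigma> > 0" using \<sigma> by simp
  have [measurable]: "F \<in> borel_measurable borel" by (rule rapid_measurable[OF hsum_rapid[OF \<tau> \<sigma>0 F]])
  \<comment> \<open>From \<open>2 * k \<ge> CARD('n) + 1\<close> the weight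
    \<open>(1 + |x|)^(2 k)\<close> has an integrable inverse; from
    \<open>2 * k \<le> CARD('n) + 2\<close> and \<open>\<sigma> > 1\<close> the exponent
    \<open>\<sigma> - k\<close> is square integrable at the origin.\<close>
  define k where "k = CARD('n) div 2 + 1"
  have "2 * k \<le> CARD('n) + 2" and k2: "2 * k \<ge> CARD('n) + 1" unfolding k_def by presburger+
  then have k1: "2 * real k \<le> real CARD('n) + 2" by linarith
  let ?w = "inv_fourier F"
  have sq: "integrable lborel (\<lambda>x. (norm (inv_fourier G x))\<^sup>2)" if "hsum \<sigma> \<tau> j G" "2 * (\<sigma> - real j) > - real CARD('n)" for j and G :: "real^'n \<Rightarrow> complex"
  proof -
    have r: "rapid (min 0 (\<sigma> - real j)) G" by (rule hsum_rapid[OF \<tau> \<sigma>0 that(1)])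
    have i1: "integrable lborel G" by (rule rapid_integrable[OF r]) (use that N in auto)
    have i2: "integrable lborel (\<lambda>x. (norm (G x))\<^sup>2)" by (rule rapid_integrable[OF rapid_norm_sq[OF r]]) (use that N in \<open>auto simp: min_def\<close>)
    show ?thesis by (rule bessel_inv_fourier(1)[OF i1 i2])
  qed
  have w2: "integrable lborel (\<lambda>x. (norm (?w x))\<^sup>2)" by (rule sq[OF F]) (use \<sigma> in simp)
  have xw2: "integrable lborel (\<lambda>x. \<bar>x $ i\<bar> ^ (2 * k) * (norm (?w x))\<^sup>2)" for i
  proof -
    have g: "2 * (\<sigma> - real k) > - real CARD('n)" using k1 \<sigma> by simp
    then have "\<sigma> - real (0 + k) > - real CARD('n)" using N by simp
    then obtain F' where F': "hsum \<sigma> \<tau> k F'" "\<And>x. inv_fourier F' x = (- (2 * pi * \<i> * of_real (x $ i))) ^ k * ?w x"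
      using hsum_inv_fourier_power[OF N \<tau> \<sigma>0 F, of k i] by auto
    have "integrable lborel (\<lambda>x. (1 / (2 * pi) ^ (2 * k)) * (norm (inv_fourier F' x))\<^sup>2)"
      by (intro integrable_mult_right sq[OF F'(1) g])
    moreover have "(1 / (2 * pi) ^ (2 * k)) * (norm (inv_fourier F' x))\<^sup>2 = \<bar>x $ i\<bar> ^ (2 * k) * (norm (?w x))\<^sup>2" for x
    proof -
      have "norm (inv_fourier F' x) = (2 * pi) ^ k * (\<bar>x $ i\<bar> ^ k * norm (?w x))"
        unfolding F'(2) by (simp add: norm_mult norm_power power_mult_distrib)
      then have "(norm (inv_fourier F' x))\<^sup>2 = (2 * pi) ^ (2 * k) * (\<bar>x $ i\<bar> ^ (2 * k) * (norm (?w x))\<^sup>2)"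
        by (simp only: power_mult_distrib power_mult[symmetric] mult.commute[of k 2])
      then show ?thesis by simp
    qed
    ultimately show ?thesis by simp
  qed
  have le: "1 / b \<le> c * (1 / a)" if "0 < a" "0 < b" "a \<le> c * b" for a b c :: real
    using that by (simp add: field_simps)
  let ?S = "\<lambda>x::real^'n. 1 + (\<Sum>i\<in>UNIV. \<bar>x $ i\<bar> ^ (2 * k))"
  have S1: "?S x \<ge> 1" for x by (simp add: sum_nonneg)
  have iS: "integrable lborel (\<lambda>x. ?S x * (norm (?w x))\<^sup>2)"
    unfolding distrib_right sum_distrib_right mult_1_left by (intro Bochner_Integration.integrable_add Bochner_Integration.integrable_sum w2 xw2)
  let ?c = "(1 + real CARD('n)) ^ (2 * k)"
  show ?thesis
  proof (rule Bochner_Integration.integrable_bound[where f = "\<lambda>x. ?S x * (norm (?w x))\<^sup>2 + ?c * (1 / (1 + norm x) ^ (DIM(real^'n) + 1))"])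
    show "integrable lborel (\<lambda>x::real^'n. ?S x * (norm (?w x))\<^sup>2 + ?c * (1 / (1 + norm x) ^ (DIM(real^'n) + 1)))"
      by (intro Bochner_Integration.integrable_add integrable_mult_right iS integrable_inverse_power_norm)
    show "AE x in lborel. norm (?w x) \<le> norm (?S x * (norm (?w x))\<^sup>2 + ?c * (1 / (1 + norm x) ^ (DIM(real^'n) + 1)))"
    proof (rule AE_I2)
      fix x :: "real^'n"
      have p0: "(1 + norm x) ^ (CARD('n) + 1) > 0" by (intro zero_less_power) (smt (verit) norm_ge_zero)
      have "(1 + norm x) ^ (CARD('n) + 1) \<le> (1 + norm x) ^ (2 * k)" using k2 by (intro power_increasing) auto
      also have "\<dots> \<le> ?c * ?S x" by (rule one_plus_norm_power_le)
      finally have b: "1 / ?S x \<le> ?c * (1 / (1 + norm x) ^ (CARD('n) + 1))"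
        using S1[of x] p0 by (intro le) auto
      let ?n = "norm (?w x)"
      \<comment> \<open>The arithmetic-geometric mean inequality has the effect of Cauchy-Schwarz: a
        weighted square plus the inverse weight.\<close>
      have "2 * ?n \<le> ?S x * ?n\<^sup>2 + 1 / ?S x"
      proof -
        have s: "?S x > 0" using S1[of x] by linarith
        have "0 \<le> (?S x * ?n - 1)\<^sup>2" by simp
        then have "2 * ?n * ?S x \<le> ?S x * (?S x * ?n\<^sup>2) + 1" by (simp add: power2_eq_square algebra_simps)
        then have "2 * ?n * ?S x / ?S x \<le> (?S x * (?S x * ?n\<^sup>2) + 1) / ?S x" using s by (intro divide_right_mono) auto
        then show ?thesis using s by (simp add: add_divide_distrib)
      qed
      then have "?n \<le> ?S x * ?n\<^sup>2 + ?c * (1 / (1 + norm x) ^ (DIM(real^'n) + 1))"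
        using b norm_ge_zero[of "?w x"] by (simp only: DIM_cart DIM_real mult_1_right)
      then show "norm (?w x) \<le> norm (?S x * (norm (?w x))\<^sup>2 + ?c * (1 / (1 + norm x) ^ (DIM(real^'n) + 1)))" by simp
    qed
  qed measurable
qed

section \<open>Approximation by polynomials times exponentials\<close>

text \<open>Membership in the uniform closure, on the half-line, of the Laguerre functions of rate
  \<open>b\<close>.\<close>

definition laguerre_approx :: "real \<Rightarrow> (real \<Rightarrow> real) \<Rightarrow> bool" where
  "laguerre_approx b g \<longleftrightarrow> (\<forall>\<epsilon>>0. \<exists>q::real poly. \<forall>t\<ge>0. \<bar>g t - poly q t * exp (- b * t)\<bar> \<le> \<epsilon>)"

lemma laguerre_approx_add:
  assumes "laguerre_approx b f" "laguerre_approx b g"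
  shows "laguerre_approx b (\<lambda>t. f t + g t)"
  unfolding laguerre_approx_def
proof (intro allI impI)
  fix \<epsilon> :: real assume "\<epsilon> > 0"
  then obtain p q where p: "\<And>t. t \<ge> 0 \<Longrightarrow> \<bar>f t - poly p t * exp (- b * t)\<bar> \<le> \<epsilon> / 2" and q: "\<And>t. t \<ge> 0 \<Longrightarrow> \<bar>g t - poly q t * exp (- b * t)\<bar> \<le> \<epsilon> / 2"
    using assms unfolding laguerre_approx_def by (meson half_gt_zero)
  show "\<exists>q. \<forall>t\<ge>0. \<bar>f t + g t - poly q t * exp (- b * t)\<bar> \<le> \<epsilon>"
  proof (intro exI[of _ "p + q"] allI impI)
    fix t :: real assume "t \<ge> 0"
    show "\<bar>f t + g t - poly (p + q) t * exp (- b * t)\<bar> \<le> \<epsilon>" unfolding poly_add distrib_right using p[OF \<open>t \<ge> 0\<close>] q[OF \<open>t \<ge> 0\<close>] by linarith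
  qed
qed

lemma laguerre_approx_cmult:
  assumes "laguerre_approx b f" shows "laguerre_approx b (\<lambda>t. c * f t)"
  unfolding laguerre_approx_def
proof (intro allI impI)
  fix \<epsilon> :: real assume e: "\<epsilon> > 0"
  have "\<epsilon> / (\<bar>c\<bar> + 1) > 0" using e by simp
  then obtain p where p: "\<And>t. t \<ge> 0 \<Longrightarrow> \<bar>f t - poly p t * exp (- b * t)\<bar> \<le> \<epsilon> / (\<bar>c\<bar> + 1)"
    using assms unfolding laguerre_approx_def by blast
  show "\<exists>q. \<forall>t\<ge>0. \<bar>c * f t - poly q t * exp (- b * t)\<bar> \<le> \<epsilon>"
  proof (intro exI[of _ "smult c p"] allI impI)
    fix t :: real assume t: "t \<ge> 0"
    have "c * f t - poly (smult c p) t * exp (- b * t) = c * (f t - poly p t * exp (- b * t))" by (simp add: right_diff_distrib)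
    then have "\<bar>c * f t - poly (smult c p) t * exp (- b * t)\<bar> \<le> \<bar>c\<bar> * (\<epsilon> / (\<bar>c\<bar> + 1))"
      using p[OF t] by (simp only: abs_mult mult_left_mono abs_ge_zero)
    also have "\<dots> \<le> \<epsilon>" using e by (simp add: field_simps)
    finally show "\<bar>c * f t - poly (smult c p) t * exp (- b * t)\<bar> \<le> \<epsilon>" .
  qed
qed

lemma laguerre_approx_zero: "laguerre_approx b (\<lambda>t. 0)"
  unfolding laguerre_approx_def by (intro allI impI exI[of _ 0]) auto

lemma laguerre_approx_sum:
  "(\<And>i. i \<in> I \<Longrightarrow> laguerre_approx b (f i)) \<Longrightarrow> laguerre_approx b (\<lambda>t. \<Sum>i\<in>I. f i t)"
  by (induction I rule: infinite_finite_induct) (auto intro: laguerre_approx_add laguerre_approx_zero)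

lemma laguerre_approx_limit:
  assumes "\<And>\<epsilon>. \<epsilon> > 0 \<Longrightarrow> \<exists>g. laguerre_approx b g \<and> (\<forall>t\<ge>0. \<bar>f t - g t\<bar> \<le> \<epsilon>)"
  shows "laguerre_approx b f"
  unfolding laguerre_approx_def
proof (intro allI impI)
  fix \<epsilon> :: real assume "\<epsilon> > 0"
  then obtain g where g: "laguerre_approx b g" "\<And>t. t \<ge> 0 \<Longrightarrow> \<bar>f t - g t\<bar> \<le> \<epsilon> / 2" using assms[of "\<epsilon> / 2"] by auto
  obtain q where q: "\<And>t. t \<ge> 0 \<Longrightarrow> \<bar>g t - poly q t * exp (- b * t)\<bar> \<le> \<epsilon> / 2"
    using g(1) \<open>\<epsilon> > 0\<close> unfolding laguerre_approx_def by (meson half_gt_zero)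
  show "\<exists>q. \<forall>t\<ge>0. \<bar>f t - poly q t * exp (- b * t)\<bar> \<le> \<epsilon>"
  proof (intro exI[of _ q] allI impI)
    fix t :: real assume "t \<ge> 0"
    then show "\<bar>f t - poly q t * exp (- b * t)\<bar> \<le> \<epsilon>" using g(2)[of t] q[of t] by linarith
  qed
qed

lemma power_exp_bound:
  fixes c t :: real
  assumes "c > 0" "t \<ge> 0" shows "t ^ i * exp (- c * t) \<le> fact i / c ^ i"
proof -
  have "(c * t) ^ i \<le> fact i * exp (c * t)" using assms by (intro power_le_fact_exp) simp
  then have "c ^ i * t ^ i * exp (- (c * t)) \<le> fact i * exp (c * t) * exp (- (c * t))"
    unfolding power_mult_distrib by (intro mult_right_mono) auto
  also have "\<dots> = fact i" by (simp add: exp_minus)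
  finally show ?thesis using assms by (simp add: field_simps)
qed

text \<open>The Taylor expansion of \<open>exp (- d * t)\<close> converges in the weight \<open>exp (- b * t)\<close> only for
  small \<open>d\<close>, so larger exponents are reached by iterating the next two lemmas.\<close>

lemma laguerre_approx_power_exp:
  assumes b: "b > 0" and d: "0 \<le> d" "d \<le> b / 4"
  shows "laguerre_approx b (\<lambda>t. t ^ i * exp (- (b + d) * t))"
  unfolding laguerre_approx_def
proof (intro allI impI)
  fix \<epsilon> :: real assume e: "\<epsilon> > 0"
  \<comment> \<open>Bounds \<open>t^i exp (- (b / 4) t)\<close>, which is what is left of the weight
    after the remainder estimate.\<close>
  define M where "M = fact i / (b / 4) ^ i"
  have M: "M > 0" using b by (simp add: M_def)
  obtain n where n: "(1 / 2 :: real) ^ n < \<epsilon> / M" using real_arch_pow_inv[of "\<epsilon> / M" "1 / 2"] e M by auto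
  define q where "q = monom 1 i * (\<Sum>m<n. monom ((- d) ^ m / fact m) m)"
  show "\<exists>q. \<forall>t\<ge>0. \<bar>t ^ i * exp (- (b + d) * t) - poly q t * exp (- b * t)\<bar> \<le> \<epsilon>"
  proof (intro exI[of _ q] allI impI)
    fix t :: real assume t: "t \<ge> 0"
    obtain s where s: "\<bar>s\<bar> \<le> \<bar>- d * t\<bar>" "exp (- d * t) = (\<Sum>m<n. (- d * t) ^ m / fact m) + exp s / fact n * (- d * t) ^ n"
      using Maclaurin_exp_le[of "- d * t" n] by blast
    have q: "poly q t = t ^ i * (\<Sum>m<n. (- d * t) ^ m / fact m)"
      by (simp add: q_def poly_sum poly_monom power_mult_distrib[symmetric])
    have "t ^ i * exp (- (b + d) * t) - poly q t * exp (- b * t) = t ^ i * exp (- b * t) * (exp s / fact n * (- d * t) ^ n)"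
    proof -
      have "exp (- (b + d) * t) = exp (- b * t) * exp (- d * t)" by (simp add: exp_add[symmetric] algebra_simps)
      then show ?thesis unfolding q s(2) by (simp add: algebra_simps)
    qed
    then have "\<bar>t ^ i * exp (- (b + d) * t) - poly q t * exp (- b * t)\<bar> = t ^ i * exp (- b * t) * (exp s / fact n * (d * t) ^ n)"
      using t d by (simp add: abs_mult power_abs)
    \<comment> \<open>Of the decay \<open>exp (- b t)\<close> a quarter pays for
      \<open>exp s\<close>, since \<open>|s| \<le> d t\<close>, and a half for
      \<open>(d t)^n / n!\<close>, where \<open>d \<le> b / 4\<close> leaves the factor
      \<open>2^(- n)\<close>.\<close>
    also have "\<dots> \<le> t ^ i * exp (- b * t) * (exp (b / 4 * t) * ((1 / 2) ^ n * exp (b / 2 * t)))"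
    proof (intro mult_left_mono)
      have "s \<le> b / 4 * t" using s(1) d t mult_right_mono[OF d(2) t] by (simp add: abs_mult)
      then have 1: "exp s \<le> exp (b / 4 * t)" by simp
      have "(d * t) ^ n \<le> ((1 / 2) * (b / 2 * t)) ^ n" using d t mult_right_mono[OF d(2) t] by (intro power_mono) auto
      also have "\<dots> = (1 / 2) ^ n * (b / 2 * t) ^ n" by (rule power_mult_distrib)
      also have "\<dots> \<le> (1 / 2) ^ n * (fact n * exp (b / 2 * t))" using b t by (intro mult_left_mono power_le_fact_exp) auto
      finally have 2: "(d * t) ^ n / fact n \<le> (1 / 2) ^ n * exp (b / 2 * t)" by (simp add: field_simps)
      have "exp s * ((d * t) ^ n / fact n) \<le> exp (b / 4 * t) * ((1 / 2) ^ n * exp (b / 2 * t))"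
        using d t by (intro mult_mono 1 2) auto
      then show "exp s / fact n * (d * t) ^ n \<le> exp (b / 4 * t) * ((1 / 2) ^ n * exp (b / 2 * t))" by simp
    qed (use t in auto)
    also have "\<dots> = (1 / 2) ^ n * (t ^ i * exp (- (b / 4) * t))"
    proof -
      have "exp (- b * t) * (exp (b / 4 * t) * exp (b / 2 * t)) = exp (- (b / 4) * t)" by (simp add: exp_add[symmetric])
      moreover have "t ^ i * A * (B * ((1 / 2) ^ n * D)) = (1 / 2) ^ n * (t ^ i * (A * (B * D)))" for A B D :: real
        by (simp only: mult_ac)
      ultimately show ?thesis by (simp only:)
    qed
    also have "\<dots> \<le> (1 / 2) ^ n * M" unfolding M_def using power_exp_bound[of "b / 4" t i] b t by (intro mult_left_mono) auto
    also have "\<dots> \<le> \<epsilon>" using n M by (simp add: field_simps)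
    finally show "\<bar>t ^ i * exp (- (b + d) * t) - poly q t * exp (- b * t)\<bar> \<le> \<epsilon>" .
  qed
qed

lemma laguerre_approx_step:
  assumes b: "b > 0" "b \<le> b'" "b' \<le> 5 / 4 * b" and g: "laguerre_approx b' g"
  shows "laguerre_approx b g"
proof (rule laguerre_approx_limit)
  fix \<epsilon> :: real assume "\<epsilon> > 0"
  then obtain q where q: "\<And>t. t \<ge> 0 \<Longrightarrow> \<bar>g t - poly q t * exp (- b' * t)\<bar> \<le> \<epsilon>" using g unfolding laguerre_approx_def by blast
  have "laguerre_approx b (\<lambda>t. \<Sum>i\<le>degree q. coeff q i * (t ^ i * exp (- (b + (b' - b)) * t)))"
    using b by (intro laguerre_approx_sum laguerre_approx_cmult laguerre_approx_power_exp) auto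
  moreover have "(\<lambda>t. \<Sum>i\<le>degree q. coeff q i * (t ^ i * exp (- (b + (b' - b)) * t))) = (\<lambda>t. poly q t * exp (- b' * t))"
    by (intro ext) (simp add: poly_altdef sum_distrib_right mult.assoc)
  ultimately show "\<exists>h. laguerre_approx b h \<and> (\<forall>t\<ge>0. \<bar>g t - h t\<bar> \<le> \<epsilon>)" using q by auto
qed

text \<open>The gap between \<open>b\<close> and \<open>b'\<close> is bridged in finitely many steps
  of ratio at most 5/4, the range given by \<open>d \<le> b / 4\<close>.\<close>

lemma laguerre_approx_mono:
  assumes b: "b > 0" "b \<le> b'" and g: "laguerre_approx b' g"
  shows "laguerre_approx b g"
proof -
  have "laguerre_approx b g" if "b > 0" "b \<le> b'" "b' \<le> (5 / 4) ^ n * b" for n b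
    using that
  proof (induction n arbitrary: b)
    case (Suc n)
    show ?case
    proof (cases "b' \<le> 5 / 4 * b")
      case False
      then have "laguerre_approx (5 / 4 * b) g" using Suc.prems by (intro Suc.IH) (auto simp: mult_ac)
      then show ?thesis using Suc.prems by (intro laguerre_approx_step[of b "5 / 4 * b"]) auto
    qed (use Suc.prems laguerre_approx_step[OF _ _ _ g] in auto)
  qed (use g in auto)
  moreover obtain n where "b' / b < (5 / 4) ^ n" using real_arch_pow[of "5 / 4" "b' / b"] by auto
  ultimately show ?thesis using b by (simp add: field_simps) (metis less_imp_le)
qed

lemma laguerre_approx_exp: 
  assumes "b > 0" "n \<ge> 1" shows "laguerre_approx b (\<lambda>t. exp (- (real n * b) * t))"
proof (rule laguerre_approx_mono[OF assms(1)])
  show "laguerre_approx (real n * b) (\<lambda>t. exp (- (real n * b) * t))"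
    unfolding laguerre_approx_def by (intro allI impI exI[of _ 1]) simp
  show "b \<le> real n * b" using assms mult_right_mono[of 1 "real n" b] by simp
qed

text \<open>In the variable \<open>y = exp (- b t)\<close> the half-line becomes (0, 1], where
  Weierstrass approximation applies. Writing \<open>h t = y * H y\<close> removes the constant term:
  the powers \<open>y^(i + 1)\<close> are exponentials of rate at least \<open>b\<close>, each of
  which is approximable.\<close>

lemma laguerre_approx_continuous:
  assumes b: "b > 0" and h: "continuous_on {0..} h" and R: "R > 0" "\<And>t. t \<ge> R \<Longrightarrow> h t = 0"
  shows "laguerre_approx b h"
proof (rule laguerre_approx_limit)
  fix \<epsilon> :: real assume e: "\<epsilon> > 0"
  define y0 where "y0 = exp (- b * R)"
  have y0: "0 < y0" "y0 \<le> 1" using b R by (auto simp: y0_def)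
  \<comment> \<open>The maximum with \<open>y0\<close> keeps the logarithm away from 0; below
    \<open>y0\<close> the value is \<open>h R / y0 = 0\<close>, as it should be because
    \<open>h\<close> vanishes from \<open>R\<close> on.\<close>
  define H where "H y = h (- ln (max y y0) / b) / max y y0" for y
  have pos: "0 < max y y0" for y using y0 by (simp add: less_max_iff_disj)
  have cH: "continuous_on {0..1} H"
    unfolding H_def
  proof (intro continuous_intros continuous_on_compose2[OF h])
    show "(\<lambda>y. - ln (max y y0) / b) ` {0..1} \<subseteq> {0..}"
    proof (intro image_subsetI)
      fix y :: real assume "y \<in> {0..1}"
      then have "ln (max y y0) \<le> 0" using y0 pos[of y] by simp
      then show "- ln (max y y0) / b \<in> {0..}" using b by (simp add: divide_le_0_iff)
    qed
  qed (use pos b in \<open>auto simp: less_imp_neq[symmetric] dest: less_imp_neq\<close>)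
  obtain p where p: "real_polynomial_function p" "\<And>y. y \<in> {0..1} \<Longrightarrow> \<bar>H y - p y\<bar> < \<epsilon>"
    using Stone_Weierstrass_real_polynomial_function[OF compact_Icc cH e] by blast
  obtain a n where a: "p = (\<lambda>x. \<Sum>i\<le>n. a i * x ^ i)" using p(1) unfolding real_polynomial_function_iff_sum by blast
  have "laguerre_approx b (\<lambda>t. \<Sum>i\<le>n. a i * exp (- (real (Suc i) * b) * t))"
    using b by (intro laguerre_approx_sum laguerre_approx_cmult laguerre_approx_exp) auto
  moreover have "\<bar>h t - (\<Sum>i\<le>n. a i * exp (- (real (Suc i) * b) * t))\<bar> \<le> \<epsilon>" if t: "t \<ge> 0" for t
  proof -
    define y where "y = exp (- b * t)"
    have y: "0 < y" "y \<le> 1" using b t by (auto simp: y_def)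
    have "h t = y * H y"
    proof (cases "t \<ge> R")
      case True
      then have "y \<le> y0" using b by (simp add: y_def y0_def)
      then have "H y = h R / y0" using b by (simp add: H_def max_def y0_def)
      then show ?thesis using R True by simp
    next
      case False
      then have "y0 \<le> y" using b by (simp add: y_def y0_def)
      then show ?thesis using b y by (simp add: H_def max_def y_def)
    qed
    moreover have "(\<Sum>i\<le>n. a i * exp (- (real (Suc i) * b) * t)) = y * p y"
    proof -
      have "exp (- (real (Suc i) * b) * t) = y * y ^ i" for i
      proof -
        have "y * y ^ i = exp (real (Suc i) * (- b * t))" unfolding y_def exp_of_nat_mult power_Suc ..
        then show ?thesis by (simp add: mult.assoc)
      qed
      then show ?thesis unfolding a by (simp add: sum_distrib_left mult_ac)
    qed
    ultimately have "\<bar>h t - (\<Sum>i\<le>n. a i * exp (- (real (Suc i) * b) * t))\<bar> = y * \<bar>H y - p y\<bar>"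
      using y by (simp add: right_diff_distrib[symmetric] abs_mult)
    also have "\<dots> \<le> 1 * \<epsilon>" using y p(2)[of y] by (intro mult_mono) auto
    finally show ?thesis by simp
  qed
  ultimately show "\<exists>g. laguerre_approx b g \<and> (\<forall>t\<ge>0. \<bar>h t - g t\<bar> \<le> \<epsilon>)" by blast
qed

text \<open>Uniform approximation at rate \<open>b / 2\<close> is applied to
  \<open>h t * exp (b / 2 * t)\<close>, so that the error keeps an exponential factor and stays
  integrable against powers of \<open>t\<close>.\<close>

theorem laguerre_dense:
  fixes b \<epsilon> R :: real and h :: "real \<Rightarrow> real"
  assumes b: "b > 0" and h: "continuous_on {0..} h" and R: "R > 0" "\<And>t. t \<ge> R \<Longrightarrow> h t = 0" and e: "\<epsilon> > 0"
  shows "\<exists>q. \<forall>t\<ge>0. \<bar>h t - poly q t * exp (- b * t)\<bar> \<le> \<epsilon> * exp (- (b / 2) * t)"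
proof -
  have "laguerre_approx (b / 2) (\<lambda>t. h t * exp (b / 2 * t))"
    using b R by (intro laguerre_approx_continuous[of _ _ R]) (auto intro!: continuous_intros h)
  then obtain q where q: "\<And>t. t \<ge> 0 \<Longrightarrow> \<bar>h t * exp (b / 2 * t) - poly q t * exp (- (b / 2) * t)\<bar> \<le> \<epsilon>"
    using e unfolding laguerre_approx_def by blast
  show ?thesis
  proof (intro exI[of _ q] allI impI)
    fix t :: real assume t: "t \<ge> 0"
    have e1: "exp (b / 2 * t) * exp (- (b / 2) * t) = 1" "exp (- (b / 2) * t) * exp (- (b / 2) * t) = exp (- b * t)"
      by (simp_all add: exp_add[symmetric])
    have "h t - poly q t * exp (- b * t) = (h t * exp (b / 2 * t) - poly q t * exp (- (b / 2) * t)) * exp (- (b / 2) * t)"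
      unfolding left_diff_distrib mult.assoc e1 by simp
    then show "\<bar>h t - poly q t * exp (- b * t)\<bar> \<le> \<epsilon> * exp (- (b / 2) * t)"
      using q[OF t] by (simp only: abs_mult abs_exp_cancel mult_right_mono exp_ge_zero)
  qed
qed

section \<open>An abstract spectral inequality\<close>

text \<open>Complex functions are treated as a real vector space with a real form that may be
  degenerate, as functions differing on a null set have distance 0.\<close>

locale semi_inner =
  fixes X :: "('a \<Rightarrow> 'b::real_vector) set" and q :: "('a \<Rightarrow> 'b) \<Rightarrow> ('a \<Rightarrow> 'b) \<Rightarrow> real"
  assumes X_zero: "(\<lambda>x. 0) \<in> X"
    and X_add: "f \<in> X \<Longrightarrow> g \<in> X \<Longrightarrow> (\<lambda>x. f x + g x) \<in> X"
    and X_scale: "f \<in> X \<Longrightarrow> (\<lambda>x. c *\<^sub>R f x) \<in> X"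
    and q_sym: "f \<in> X \<Longrightarrow> g \<in> X \<Longrightarrow> q f g = q g f"
    and q_add: "f \<in> X \<Longrightarrow> g \<in> X \<Longrightarrow> h \<in> X \<Longrightarrow> q (\<lambda>x. f x + g x) h = q f h + q g h"
    and q_scale: "f \<in> X \<Longrightarrow> h \<in> X \<Longrightarrow> q (\<lambda>x. c *\<^sub>R f x) h = c * q f h"
    and q_nonneg: "f \<in> X \<Longrightarrow> 0 \<le> q f f"
begin

lemma X_diff: "f \<in> X \<Longrightarrow> g \<in> X \<Longrightarrow> (\<lambda>x. f x - g x) \<in> X"
  using X_add[of f "\<lambda>x. (-1) *\<^sub>R g x"] X_scale[of g "-1"] by simp

lemma X_sum: "(\<And>i. i \<in> I \<Longrightarrow> b i \<in> X) \<Longrightarrow> (\<lambda>x. \<Sum>i\<in>I. \<alpha> i *\<^sub>R b i x) \<in> X"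
proof (induction I rule: infinite_finite_induct)
  case (insert i I)
  have "(\<lambda>x. \<alpha> i *\<^sub>R b i x + (\<Sum>i\<in>I. \<alpha> i *\<^sub>R b i x)) \<in> X"
    by (rule X_add[OF X_scale insert.IH]) (use insert.prems in auto)
  then show ?case using insert.hyps by simp
qed (simp_all add: X_zero)

lemma q_zero: "h \<in> X \<Longrightarrow> q (\<lambda>x. 0) h = 0"
  using q_scale[OF X_zero, of h 0] by simp

lemma q_diff: "f \<in> X \<Longrightarrow> g \<in> X \<Longrightarrow> h \<in> X \<Longrightarrow> q (\<lambda>x. f x - g x) h = q f h - q g h"
  using q_add[of f "\<lambda>x. (-1) *\<^sub>R g x" h] X_scale[of g "-1"] q_scale[of g h "-1"] by simp

lemma q_add_right: "f \<in> X \<Longrightarrow> g \<in> X \<Longrightarrow> h \<in> X \<Longrightarrow> q h (\<lambda>x. f x + g x) = q h f + q h g"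
  by (simp add: q_sym[of h] q_add X_add)

lemma q_diff_right: "f \<in> X \<Longrightarrow> g \<in> X \<Longrightarrow> h \<in> X \<Longrightarrow> q h (\<lambda>x. f x - g x) = q h f - q h g"
  by (simp add: q_sym[of h] q_diff X_diff)

lemma q_sum:
  assumes "h \<in> X" shows "(\<And>i. i \<in> I \<Longrightarrow> b i \<in> X) \<Longrightarrow> q (\<lambda>x. \<Sum>i\<in>I. \<alpha> i *\<^sub>R b i x) h = (\<Sum>i\<in>I. \<alpha> i * q (b i) h)"
proof (induction I rule: infinite_finite_induct)
  case (insert i I)
  then show ?case using assms by (simp add: q_add[OF X_scale X_sum] q_scale)
qed (use assms q_zero in auto)

lemma q_sum_right:
  assumes "h \<in> X" shows "(\<And>i. i \<in> I \<Longrightarrow> b i \<in> X) \<Longrightarrow> q h (\<lambda>x. \<Sum>i\<in>I. \<alpha> i *\<^sub>R b i x) = (\<Sum>i\<in>I. \<alpha> i * q h (b i))"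
  by (simp add: q_sym[OF assms] X_sum q_sum[OF assms])

text \<open>Degenerate case of Cauchy-Schwarz: along \<open>g + t e\<close> the form is affine in
  \<open>t\<close>, so it can stay nonnegative only if its slope is 0.\<close>

lemma q_null:
  assumes e: "e \<in> X" "q e e = 0" and g: "g \<in> X" shows "q g e = 0"
proof (rule ccontr)
  assume "q g e \<noteq> 0"
  define t where "t = - (q g g + 1) / (2 * q g e)"
  have "0 \<le> q (\<lambda>x. g x + t *\<^sub>R e x) (\<lambda>x. g x + t *\<^sub>R e x)" by (intro q_nonneg X_add X_scale g e)
  also have "\<dots> = q g g + 2 * t * q g e + t * (t * q e e)"
    using g e by (simp add: q_add q_add_right X_add X_scale q_scale q_sym[of e g] q_sym[of _ "\<lambda>x. t *\<^sub>R e x"] algebra_simps)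
  also have "\<dots> = - 1" using \<open>q g e \<noteq> 0\<close> e by (simp add: t_def field_simps)
  finally show False by simp
qed

text \<open>Gram-Schmidt by induction on the index set, valid for linearly dependent and for null
  vectors.\<close>

lemma projection_exists:
  assumes "finite I" "\<And>i. i \<in> I \<Longrightarrow> b i \<in> X" "f \<in> X"
  shows "\<exists>\<alpha>. \<forall>j\<in>I. q (\<lambda>x. f x - (\<Sum>i\<in>I. \<alpha> i *\<^sub>R b i x)) (b j) = 0"
  using assms
proof (induction I arbitrary: f rule: finite_induct)
  case (insert k I)
  have bI: "\<And>i. i \<in> I \<Longrightarrow> b i \<in> X" and bk: "b k \<in> X" using insert.prems by auto
  obtain \<beta> where \<beta>: "\<And>j. j \<in> I \<Longrightarrow> q (\<lambda>x. b k x - (\<Sum>i\<in>I. \<beta> i *\<^sub>R b i x)) (b j) = 0" using insert.IH[OF bI bk] by blast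
  obtain \<gamma> where \<gamma>: "\<And>j. j \<in> I \<Longrightarrow> q (\<lambda>x. f x - (\<Sum>i\<in>I. \<gamma> i *\<^sub>R b i x)) (b j) = 0" using insert.IH[OF bI insert.prems(2)] by blast
  define e where "e = (\<lambda>x. b k x - (\<Sum>i\<in>I. \<beta> i *\<^sub>R b i x))"
  define g where "g = (\<lambda>x. f x - (\<Sum>i\<in>I. \<gamma> i *\<^sub>R b i x))"
  have e: "e \<in> X" and g: "g \<in> X" unfolding e_def g_def
    by (rule X_diff[OF bk X_sum[OF bI]], simp) (rule X_diff[OF insert.prems(2) X_sum[OF bI]], simp)
  \<comment> \<open>If \<open>q e e = 0\<close> the quotient is 0 by convention, and then
    \<open>q g e = 0\<close> by \<open>q_null\<close>, so \<open>r\<close> is orthogonal to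
    \<open>e\<close> in both cases.\<close>
  define c where "c = q g e / q e e"
  define r where "r = (\<lambda>x. g x - c *\<^sub>R e x)"
  have r: "r \<in> X" unfolding r_def by (intro X_diff X_scale e g)
  have rj: "q r (b j) = 0" if "j \<in> I" for j
    using \<beta>[OF that] \<gamma>[OF that] e g bI[OF that] unfolding r_def by (simp add: q_diff X_scale q_scale e_def[symmetric] g_def[symmetric])
  have re: "q r e = 0"
    using e g q_null[OF e _ g] unfolding r_def c_def by (cases "q e e = 0") (simp_all add: q_diff X_scale q_scale)
  have bk_eq: "(\<lambda>x. e x + (\<Sum>i\<in>I. \<beta> i *\<^sub>R b i x)) = b k" by (simp add: e_def)
  have "q r (\<lambda>x. e x + (\<Sum>i\<in>I. \<beta> i *\<^sub>R b i x)) = q r e + q r (\<lambda>x. \<Sum>i\<in>I. \<beta> i *\<^sub>R b i x)"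
    by (rule q_add_right[OF e X_sum[OF bI] r])
  also have "q r (\<lambda>x. \<Sum>i\<in>I. \<beta> i *\<^sub>R b i x) = (\<Sum>i\<in>I. \<beta> i * q r (b i))" by (rule q_sum_right[OF r bI])
  also have "q r e + \<dots> = 0" using rj re by simp
  finally have rk: "q r (b k) = 0" unfolding bk_eq .
  have "r = (\<lambda>x. f x - (\<Sum>i\<in>insert k I. (if i = k then c else \<gamma> i - c * \<beta> i) *\<^sub>R b i x))"
  proof
    fix x
    have "(\<Sum>i\<in>I. (if i = k then c else \<gamma> i - c * \<beta> i) *\<^sub>R b i x) = (\<Sum>i\<in>I. \<gamma> i *\<^sub>R b i x - c *\<^sub>R (\<beta> i *\<^sub>R b i x))"
      using insert.hyps by (intro sum.cong) (auto simp: scaleR_left_diff_distrib)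
    then show "r x = f x - (\<Sum>i\<in>insert k I. (if i = k then c else \<gamma> i - c * \<beta> i) *\<^sub>R b i x)"
      using insert.hyps by (simp add: r_def e_def g_def sum_subtractf scaleR_sum_right scaleR_right_diff_distrib)
  qed
  then show ?case using rj rk by (intro exI[of _ "\<lambda>i. if i = k then c else \<gamma> i - c * \<beta> i"]) auto
qed auto

lemma projection_orthogonal:
  assumes I: "\<And>i. i \<in> I \<Longrightarrow> b i \<in> X" and r: "r \<in> X" and orth: "\<And>i. i \<in> I \<Longrightarrow> q r (b i) = 0" and "K \<subseteq> I"
  shows "q (\<lambda>x. r x + (\<Sum>i\<in>K. \<alpha> i *\<^sub>R b i x)) (\<lambda>x. r x + (\<Sum>i\<in>K. \<alpha> i *\<^sub>R b i x))
    = q r r + q (\<lambda>x. \<Sum>i\<in>K. \<alpha> i *\<^sub>R b i x) (\<lambda>x. \<Sum>i\<in>K. \<alpha> i *\<^sub>R b i x)"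
proof -
  have p: "(\<lambda>x. \<Sum>i\<in>K. \<alpha> i *\<^sub>R b i x) \<in> X" using assms by (intro X_sum) auto
  have "q r (\<lambda>x. \<Sum>i\<in>K. \<alpha> i *\<^sub>R b i x) = 0" using assms by (subst q_sum_right) (auto intro!: sum.neutral)
  then show ?thesis using r p by (simp add: q_add q_add_right X_add q_sym[OF p r])
qed

end

text \<open>The eigenvalue equation is weak, tested against all of \<open>X\<close>, so that it
  makes sense for two forms without reference to an operator.\<close>

locale eigen_forms = q: semi_inner X q + a: semi_inner X a
  for X :: "('a \<Rightarrow> 'b::real_vector) set" and q a +
  fixes I :: "'i set" and b :: "'i \<Rightarrow> 'a \<Rightarrow> 'b" and \<nu> :: "'i \<Rightarrow> real"
  assumes fin: "finite I" and bX: "i \<in> I \<Longrightarrow> b i \<in> X"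
    and eig: "i \<in> I \<Longrightarrow> f \<in> X \<Longrightarrow> a f (b i) = \<nu> i * q f (b i)"
begin

lemma eigen_orthogonal:
  assumes "i \<in> I" "j \<in> I" "\<nu> i \<noteq> \<nu> j" shows "q (b i) (b j) = 0"
proof -
  have "\<nu> j * q (b i) (b j) = \<nu> i * q (b i) (b j)"
    using eig[OF assms(2) bX[OF assms(1)]] eig[OF assms(1) bX[OF assms(2)]] a.q_sym[OF bX bX] q.q_sym[OF bX bX] assms by metis
  then show ?thesis using assms(3) by simp
qed

text \<open>Vectors \<open>b i\<close> with the same eigenvalue may fail to be orthogonal, so the
  double sums are grouped by eigenvalue and \<open>p {v}\<close> is kept as one component.\<close>

lemma combination_forms:
  fixes \<alpha> :: "'i \<Rightarrow> real" and S :: "real set"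
  defines "p A \<equiv> (\<lambda>x. \<Sum>i\<in>{i\<in>I. \<nu> i \<in> A}. \<alpha> i *\<^sub>R b i x)"
  shows "q (p S) (p S) = (\<Sum>v\<in>\<nu> ` I \<inter> S. q (p {v}) (p {v}))"
    and "a (p S) (p S) = (\<Sum>v\<in>\<nu> ` I \<inter> S. v * q (p {v}) (p {v}))"
proof -
  have qe: "q (p A) (p A) = (\<Sum>i | i \<in> I \<and> \<nu> i \<in> A. \<Sum>j | j \<in> I \<and> \<nu> j \<in> A. \<alpha> i * (\<alpha> j * q (b i) (b j)))" for A
  proof -
    let ?K = "{i \<in> I. \<nu> i \<in> A}"
    have K: "\<And>i. i \<in> ?K \<Longrightarrow> b i \<in> X" by (auto intro: bX)
    have "q (b i) (p A) = (\<Sum>j\<in>?K. \<alpha> j * q (b i) (b j))" if "i \<in> ?K" for i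
      unfolding p_def by (rule q.q_sum_right[OF K[OF that] K])
    moreover have "q (p A) (p A) = (\<Sum>i\<in>?K. \<alpha> i * q (b i) (p A))"
      unfolding p_def by (rule q.q_sum[OF q.X_sum[OF K] K])
    ultimately show ?thesis by (simp add: sum_distrib_left)
  qed
  have ae: "a (p A) (p A) = (\<Sum>i | i \<in> I \<and> \<nu> i \<in> A. \<Sum>j | j \<in> I \<and> \<nu> j \<in> A. \<nu> i * (\<alpha> i * (\<alpha> j * q (b i) (b j))))" for A
  proof -
    let ?K = "{i \<in> I. \<nu> i \<in> A}"
    have K: "\<And>i. i \<in> ?K \<Longrightarrow> b i \<in> X" by (auto intro: bX)
    have pX: "p A \<in> X" unfolding p_def by (rule q.X_sum[OF K])
    have "a (b i) (p A) = \<nu> i * (\<Sum>j\<in>?K. \<alpha> j * q (b i) (b j))" if "i \<in> ?K" for i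
    proof -
      have "a (b i) (p A) = a (p A) (b i)" by (rule a.q_sym[OF K[OF that] pX])
      also have "\<dots> = \<nu> i * q (p A) (b i)" using that by (intro eig pX) auto
      also have "q (p A) (b i) = q (b i) (p A)" by (rule q.q_sym[OF pX K[OF that]])
      also have "\<dots> = (\<Sum>j\<in>?K. \<alpha> j * q (b i) (b j))" unfolding p_def by (rule q.q_sum_right[OF K[OF that] K])
      finally show ?thesis .
    qed
    moreover have "a (p A) (p A) = (\<Sum>i\<in>?K. \<alpha> i * a (b i) (p A))"
      unfolding p_def by (rule a.q_sum[OF q.X_sum[OF K] K])
    ultimately show ?thesis by (simp add: sum_distrib_left mult.left_commute)
  qed
  \<comment> \<open>With \<open>w = 1\<close> this is the claim for \<open>q\<close>, with
    \<open>w v = v\<close> the one for \<open>a\<close>.\<close>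
  have grp: "(\<Sum>i | i \<in> I \<and> \<nu> i \<in> S. \<Sum>j | j \<in> I \<and> \<nu> j \<in> S. w (\<nu> i) * (\<alpha> i * (\<alpha> j * q (b i) (b j))))
     = (\<Sum>v\<in>\<nu> ` I \<inter> S. w v * q (p {v}) (p {v}))" for w :: "real \<Rightarrow> real"
  proof -
    have "(\<Sum>i | i \<in> I \<and> \<nu> i \<in> S. \<Sum>j | j \<in> I \<and> \<nu> j \<in> S. w (\<nu> i) * (\<alpha> i * (\<alpha> j * q (b i) (b j))))
      = (\<Sum>i | i \<in> I \<and> \<nu> i \<in> S. \<Sum>j | j \<in> I \<and> \<nu> j = \<nu> i. w (\<nu> i) * (\<alpha> i * (\<alpha> j * q (b i) (b j))))"
    proof (rule sum.cong[OF refl])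
      fix i assume i: "i \<in> {i. i \<in> I \<and> \<nu> i \<in> S}"
      have z: "w (\<nu> i) * (\<alpha> i * (\<alpha> j * q (b i) (b j))) = 0" if "j \<in> I" "\<nu> j \<noteq> \<nu> i" for j
        using eigen_orthogonal[of i j] i that by auto
      show "(\<Sum>j | j \<in> I \<and> \<nu> j \<in> S. w (\<nu> i) * (\<alpha> i * (\<alpha> j * q (b i) (b j)))) = (\<Sum>j | j \<in> I \<and> \<nu> j = \<nu> i. w (\<nu> i) * (\<alpha> i * (\<alpha> j * q (b i) (b j))))"
      proof (rule sum.mono_neutral_right)
        show "\<forall>j\<in>{j \<in> I. \<nu> j \<in> S} - {j \<in> I. \<nu> j = \<nu> i}. w (\<nu> i) * (\<alpha> i * (\<alpha> j * q (b i) (b j))) = 0"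
          by (intro ballI z) auto
      qed (use fin i in auto)
    qed
    also have "\<dots> = (\<Sum>v\<in>\<nu> ` I \<inter> S. \<Sum>i | i \<in> {i. i \<in> I \<and> \<nu> i \<in> S} \<and> \<nu> i = v. \<Sum>j | j \<in> I \<and> \<nu> j = \<nu> i. w (\<nu> i) * (\<alpha> i * (\<alpha> j * q (b i) (b j))))"
      using fin by (intro sum.group[symmetric]) auto
    also have "\<dots> = (\<Sum>v\<in>\<nu> ` I \<inter> S. w v * q (p {v}) (p {v}))"
    proof (rule sum.cong[OF refl])
      fix v assume v: "v \<in> \<nu> ` I \<inter> S"
      have "{i. i \<in> {i. i \<in> I \<and> \<nu> i \<in> S} \<and> \<nu> i = v} = {i. i \<in> I \<and> \<nu> i \<in> {v}}" using v by auto
      then show "(\<Sum>i | i \<in> {i. i \<in> I \<and> \<nu> i \<in> S} \<and> \<nu> i = v. \<Sum>j | j \<in> I \<and> \<nu> j = \<nu> i. w (\<nu> i) * (\<alpha> i * (\<alpha> j * q (b i) (b j)))) = w v * q (p {v}) (p {v})"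
        unfolding qe sum_distrib_left by (auto intro!: sum.cong)
    qed
    finally show ?thesis .
  qed
  show "q (p S) (p S) = (\<Sum>v\<in>\<nu> ` I \<inter> S. q (p {v}) (p {v}))" using grp[of "\<lambda>_. 1"] unfolding qe[of S] by simp
  show "a (p S) (p S) = (\<Sum>v\<in>\<nu> ` I \<inter> S. v * q (p {v}) (p {v}))" using grp[of "\<lambda>v. v"] unfolding ae[of S] by simp
qed

text \<open>Let \<open>r\<close> be the part of \<open>f\<close> orthogonal to all
  \<open>b i\<close>, and \<open>n v\<close> the squared norm of the component of eigenvalue
  \<open>v\<close>. The left side is the sum of all \<open>c j\<close> times \<open>q r r\<close>,
  plus the sum over \<open>v\<close> of \<open>n v\<close> times those \<open>c j\<close> with
  \<open>v \<notin> S j\<close>, which is at most \<open>v * n v\<close>. The energy of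
  \<open>f\<close> is at least the sum of the \<open>v * n v\<close>, because \<open>r\<close> is
  orthogonal for \<open>a\<close> as well and \<open>a r r \<ge> 0\<close>. The free coefficients
  \<beta> let any approximation of \<open>f\<close> bound \<open>q r r\<close>.\<close>

theorem spectral_inequality:
  fixes c :: "'j \<Rightarrow> real"
  assumes f: "f \<in> X" and J: "finite J" and c: "\<And>j. j \<in> J \<Longrightarrow> 0 \<le> c j"
    and S: "\<And>i. i \<in> I \<Longrightarrow> (\<Sum>j\<in>{j\<in>J. \<nu> i \<notin> S j}. c j) \<le> \<nu> i"
  obtains \<alpha> where
    "(\<Sum>j\<in>J. c j * q (\<lambda>x. f x - (\<Sum>i\<in>{i\<in>I. \<nu> i \<in> S j}. \<alpha> i *\<^sub>R b i x)) (\<lambda>x. f x - (\<Sum>i\<in>{i\<in>I. \<nu> i \<in> S j}. \<alpha> i *\<^sub>R b i x)))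
       \<le> a f f + (\<Sum>j\<in>J. c j) * q (\<lambda>x. f x - (\<Sum>i\<in>I. \<beta> i *\<^sub>R b i x)) (\<lambda>x. f x - (\<Sum>i\<in>I. \<beta> i *\<^sub>R b i x))"
proof -
  obtain \<alpha> where \<alpha>: "\<And>j. j \<in> I \<Longrightarrow> q (\<lambda>x. f x - (\<Sum>i\<in>I. \<alpha> i *\<^sub>R b i x)) (b j) = 0"
    using q.projection_exists[where I = I and b = b, OF fin bX f] by blast
  define r where "r = (\<lambda>x. f x - (\<Sum>i\<in>I. \<alpha> i *\<^sub>R b i x))"
  have r: "r \<in> X" unfolding r_def by (intro q.X_diff q.X_sum f bX)
  have r0: "q r (b j) = 0" if "j \<in> I" for j using \<alpha>[OF that] by (simp add: r_def)
  define p where "p A = (\<lambda>x. \<Sum>i\<in>{i\<in>I. \<nu> i \<in> A}. \<alpha> i *\<^sub>R b i x)" for A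
  define n where "n v = q (p {v}) (p {v})" for v
  have pX: "p A \<in> X" for A unfolding p_def by (intro q.X_sum bX) auto
  have n0: "n v \<ge> 0" for v unfolding n_def by (intro q.q_nonneg pX)
  have split: "(\<lambda>x. f x - p A x) = (\<lambda>x. r x + p (- A) x)" for A
  proof
    fix x
    have "(\<Sum>i\<in>I. \<alpha> i *\<^sub>R b i x) = p A x + p (- A) x"
      unfolding p_def using fin by (subst sum.union_disjoint[symmetric]) (auto intro!: sum.cong)
    then show "f x - p A x = r x + p (- A) x" by (simp add: r_def)
  qed
  have qs: "q (\<lambda>x. f x - p A x) (\<lambda>x. f x - p A x) = q r r + (\<Sum>v\<in>\<nu> ` I - A. n v)" for A
  proof -
    have "q (\<lambda>x. r x + p (- A) x) (\<lambda>x. r x + p (- A) x) = q r r + q (p (- A)) (p (- A))"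
      unfolding p_def by (rule q.projection_orthogonal[where I = I and b = b, OF bX r r0]) auto
    moreover have "q (p (- A)) (p (- A)) = (\<Sum>v\<in>\<nu> ` I \<inter> - A. n v)"
      unfolding n_def p_def by (rule combination_forms(1))
    ultimately show ?thesis unfolding split by (simp only: Diff_eq)
  qed
  have "a r (b i) = 0" if "i \<in> I" for i using eig[OF that r] r0[OF that] by simp
  from a.projection_orthogonal[where I = I and b = b, OF bX r this, where K = I and \<alpha> = \<alpha>]
  have "a f f = a r r + a (p UNIV) (p UNIV)" by (simp add: p_def r_def)
  then have af: "(\<Sum>v\<in>\<nu> ` I. v * n v) \<le> a f f"
    using combination_forms(2)[of \<alpha> UNIV] a.q_nonneg[OF r] by (simp add: p_def n_def)
  have best: "q r r \<le> q (\<lambda>x. f x - (\<Sum>i\<in>I. \<beta> i *\<^sub>R b i x)) (\<lambda>x. f x - (\<Sum>i\<in>I. \<beta> i *\<^sub>R b i x))"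
  proof -
    have "(\<lambda>x. f x - (\<Sum>i\<in>I. \<beta> i *\<^sub>R b i x)) = (\<lambda>x. r x + (\<Sum>i\<in>I. (\<alpha> i - \<beta> i) *\<^sub>R b i x))"
      by (simp add: r_def scaleR_left_diff_distrib sum_subtractf)
    moreover have "(\<lambda>x. \<Sum>i\<in>I. (\<alpha> i - \<beta> i) *\<^sub>R b i x) \<in> X" by (intro q.X_sum bX)
    ultimately show ?thesis using q.projection_orthogonal[where I = I and b = b, OF bX r r0, where K = I and \<alpha> = "\<lambda>i. \<alpha> i - \<beta> i"] q.q_nonneg by simp
  qed
  show thesis
  proof (rule that[of \<alpha>])
    have "(\<Sum>j\<in>J. c j * q (\<lambda>x. f x - p (S j) x) (\<lambda>x. f x - p (S j) x)) = (\<Sum>j\<in>J. c j) * q r r + (\<Sum>j\<in>J. c j * (\<Sum>v\<in>\<nu> ` I - S j. n v))"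
      unfolding qs by (simp add: distrib_left sum.distrib sum_distrib_right)
    also have "(\<Sum>j\<in>J. c j * (\<Sum>v\<in>\<nu> ` I - S j. n v)) = (\<Sum>j\<in>J. \<Sum>v\<in>\<nu> ` I. if v \<in> S j then 0 else c j * n v)"
    proof (intro sum.cong refl)
      fix j
      have "(\<Sum>v\<in>\<nu> ` I. if v \<in> S j then 0 else c j * n v) = (\<Sum>v\<in>\<nu> ` I - S j. c j * n v)"
        using fin by (intro sum.mono_neutral_cong_right) auto
      then show "c j * (\<Sum>v\<in>\<nu> ` I - S j. n v) = (\<Sum>v\<in>\<nu> ` I. if v \<in> S j then 0 else c j * n v)" by (simp add: sum_distrib_left)
    qed
    also have "\<dots> = (\<Sum>v\<in>\<nu> ` I. \<Sum>j\<in>J. if v \<in> S j then 0 else c j * n v)" by (rule sum.swap)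
    also have "\<dots> \<le> (\<Sum>v\<in>\<nu> ` I. v * n v)"
    proof (intro sum_mono)
      fix v assume "v \<in> \<nu> ` I"
      then have le: "(\<Sum>j\<in>{j\<in>J. v \<notin> S j}. c j) \<le> v" using S by auto
      have "(\<Sum>j\<in>J. if v \<in> S j then 0 else c j * n v) = (\<Sum>j\<in>{j\<in>J. v \<notin> S j}. c j * n v)"
        using J by (intro sum.mono_neutral_cong_right) auto
      also have "\<dots> = (\<Sum>j\<in>{j\<in>J. v \<notin> S j}. c j) * n v" by (simp add: sum_distrib_right)
      also have "\<dots> \<le> v * n v" by (intro mult_right_mono le n0)
      finally show "(\<Sum>j\<in>J. if v \<in> S j then 0 else c j * n v) \<le> v * n v" .
    qed
    finally have "(\<Sum>j\<in>J. c j * q (\<lambda>x. f x - p (S j) x) (\<lambda>x. f x - p (S j) x)) \<le> (\<Sum>j\<in>J. c j) * q r r + a f f"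
      using af by simp
    also have "(\<Sum>j\<in>J. c j) * q r r \<le> (\<Sum>j\<in>J. c j) * q (\<lambda>x. f x - (\<Sum>i\<in>I. \<beta> i *\<^sub>R b i x)) (\<lambda>x. f x - (\<Sum>i\<in>I. \<beta> i *\<^sub>R b i x))"
      by (intro mult_left_mono best sum_nonneg c)
    finally show "(\<Sum>j\<in>J. c j * q (\<lambda>x. f x - (\<Sum>i\<in>{i\<in>I. \<nu> i \<in> S j}. \<alpha> i *\<^sub>R b i x)) (\<lambda>x. f x - (\<Sum>i\<in>{i\<in>I. \<nu> i \<in> S j}. \<alpha> i *\<^sub>R b i x)))
         \<le> a f f + (\<Sum>j\<in>J. c j) * q (\<lambda>x. f x - (\<Sum>i\<in>I. \<beta> i *\<^sub>R b i x)) (\<lambda>x. f x - (\<Sum>i\<in>I. \<beta> i *\<^sub>R b i x))"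
      by (simp add: p_def)
  qed
qed

end

section \<open>The energy form\<close>

text \<open>Contains the transforms of test functions and all eigenfunctions. The origin is left out
  because the latter may be discontinuous there, through the value 0 that \<open>hterm\<close>
  takes.\<close>

definition energy_class :: "(real^'n::finite \<Rightarrow> complex) set" where
  "energy_class = {f. rapid 0 f \<and> (\<forall>i. rapid 0 (partial i f)) \<and> (\<forall>i x. x \<noteq> 0 \<longrightarrow> has_partial i f (partial i f x) x)}"

lemma energy_classI:
  assumes "rapid 0 f" "\<And>i. rapid 0 (D i)" "\<And>i x. x \<noteq> 0 \<Longrightarrow> has_partial i f (D i x) x"
  shows "f \<in> energy_class"
proof -
  have p: "partial i f x = D i x" if "x \<noteq> 0" for i x by (rule has_partial_imp_partial[OF assms(3)[OF that]])
  have "rapid 0 (partial i f)" for i by (rule rapid_cong[OF assms(2)]) (simp add: p)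
  then show ?thesis using assms p by (simp add: energy_class_def)
qed

lemma energy_classD:
  assumes "f \<in> energy_class"
  shows "rapid 0 f" "rapid 0 (partial i f)" "x \<noteq> 0 \<Longrightarrow> has_partial i f (partial i f x) x"
  using assms by (auto simp: energy_class_def)

text \<open>The inner product of complex numbers is the real part of the Hermitian one, so this is a
  real bilinear form.\<close>

definition weight_form :: "real \<Rightarrow> (real^'n::finite \<Rightarrow> complex) \<Rightarrow> (real^'n \<Rightarrow> complex) \<Rightarrow> real" where
  "weight_form s f g = (LINT \<xi>|lborel. norm \<xi> powr (s - 1) * (f \<xi> \<bullet> g \<xi>))"

abbreviation weight_sq :: "real \<Rightarrow> (real^'n::finite \<Rightarrow> complex) \<Rightarrow> real" where
  "weight_sq s f \<equiv> weight_form s f f"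

text \<open>The gradient, twisted so that it annihilates
  \<open>exp (- \<tau> |\<xi>|^\<sigma> / \<sigma>)\<close> with
  \<open>\<sigma> = 1 + s\<close>.\<close>

definition twisted_partial :: "real \<Rightarrow> real \<Rightarrow> 'n::finite \<Rightarrow> (real^'n \<Rightarrow> complex) \<Rightarrow> real^'n \<Rightarrow> complex" where
  "twisted_partial s \<tau> i f \<xi> = partial i f \<xi> + (\<tau> * norm \<xi> powr (s - 1) * \<xi> $ i) *\<^sub>R f \<xi>"

text \<open>The factor \<open>1 / (2 * \<tau>)\<close> makes the eigenvalues independent of
  \<tau>.\<close>

definition energy_form :: "real \<Rightarrow> real \<Rightarrow> (real^'n::finite \<Rightarrow> complex) \<Rightarrow> (real^'n \<Rightarrow> complex) \<Rightarrow> real" where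
  "energy_form s \<tau> f g = (\<Sum>i\<in>UNIV. LINT \<xi>|lborel. twisted_partial s \<tau> i f \<xi> \<bullet> twisted_partial s \<tau> i g \<xi>) / (2 * \<tau>)"

lemma energy_class_zero: "(\<lambda>x. 0) \<in> energy_class"
  by (rule energy_classI[of _ "\<lambda>i x. 0"]) (auto intro: rapid_zero has_partial_const)

lemma energy_class_add: "f \<in> energy_class \<Longrightarrow> g \<in> energy_class \<Longrightarrow> (\<lambda>x. f x + g x) \<in> energy_class"
  by (rule energy_classI[of _ "\<lambda>i x. partial i f x + partial i g x"]) (simp_all add: energy_classD rapid_add has_partial_add)

lemma rapid_scaleR: "rapid a f \<Longrightarrow> rapid a (\<lambda>x. c *\<^sub>R f x :: complex)"
  by (simp add: scaleR_conv_of_real rapid_cmult)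

lemma energy_class_scaleR: "f \<in> energy_class \<Longrightarrow> (\<lambda>x. c *\<^sub>R f x) \<in> energy_class"
  by (rule energy_classI[of _ "\<lambda>i x. c *\<^sub>R partial i f x"]) (simp_all add: energy_classD rapid_scaleR has_partial_scaleR)

lemma partial_energy_add:
  "f \<in> energy_class \<Longrightarrow> g \<in> energy_class \<Longrightarrow> x \<noteq> 0 \<Longrightarrow> partial i (\<lambda>x. f x + g x) x = partial i f x + partial i g x"
  by (intro has_partial_imp_partial has_partial_add energy_classD)

lemma partial_energy_scaleR:
  "f \<in> energy_class \<Longrightarrow> x \<noteq> 0 \<Longrightarrow> partial i (\<lambda>x. c *\<^sub>R f x) x = c *\<^sub>R partial i f x"
  by (intro has_partial_imp_partial has_partial_scaleR energy_classD)

lemma rapid_twist: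
  fixes f :: "real^'n::finite \<Rightarrow> complex"
  assumes f: "rapid a f" shows "rapid (a + s) (\<lambda>\<xi>. (\<tau> * norm \<xi> powr (s - 1) * \<xi> $ i) *\<^sub>R f \<xi>)"
proof (rule rapid_bound[OF f, where B = "\<bar>\<tau>\<bar>" and L = 0])
  show "continuous_on (- {0}) (\<lambda>\<xi>. (\<tau> * norm \<xi> powr (s - 1) * \<xi> $ i) *\<^sub>R f \<xi>)"
    by (intro continuous_intros continuous_on_norm_powr rapid_cont[OF f])
  fix x :: "real^'n" assume x: "x \<noteq> 0"
  have "\<bar>norm x powr (s - 1) * x $ i\<bar> \<le> norm x powr (s - 1) * norm x powr 1"
    using component_le_norm_cart[of x i] x by (simp add: abs_mult mult_left_mono)
  also have "\<dots> = norm x powr s" unfolding powr_add[symmetric] by simp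
  finally have "\<bar>norm x powr (s - 1) * x $ i\<bar> \<le> norm x powr s" .
  then have "\<bar>\<tau>\<bar> * \<bar>norm x powr (s - 1) * x $ i\<bar> * norm (f x) \<le> \<bar>\<tau>\<bar> * norm x powr s * norm (f x)"
    by (intro mult_right_mono mult_left_mono) auto
  then show "norm ((\<tau> * norm x powr (s - 1) * x $ i) *\<^sub>R f x) \<le> \<bar>\<tau>\<bar> * norm x powr s * (1 + norm x) ^ 0 * norm (f x)"
    by (simp add: abs_mult mult.assoc)
qed

lemma rapid_twisted_partial:
  assumes "f \<in> energy_class" "s > 0" shows "rapid 0 (twisted_partial s \<tau> i f)"
  unfolding twisted_partial_def[abs_def]
  by (rule rapid_add[OF energy_classD(2)[OF assms(1)] rapid_mono[OF rapid_twist[OF energy_classD(1)[OF assms(1)]]]])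
     (use assms in simp)

lemma integrable_weight_form:
  fixes f g :: "real^'n::finite \<Rightarrow> complex"
  assumes "rapid 0 f" "rapid 0 g" "s > 0"
  shows "integrable lborel (\<lambda>\<xi>. norm \<xi> powr (s - 1) * (f \<xi> \<bullet> g \<xi>))"
proof (rule rapid_integrable[OF rapid_norm_powr_mult_real[OF rapid_inner[OF assms(1,2)]]])
  have "CARD('n) \<ge> 1" by (simp add: Suc_le_eq)
  then show "- real DIM(real^'n) < 0 + 0 + (s - 1)"
    using assms(3) unfolding DIM_cart DIM_real by linarith
qed

lemma integrable_inner_rapid:
  fixes f g :: "real^'n::finite \<Rightarrow> complex"
  assumes "rapid a f" "rapid b g" "a + b > - real CARD('n)"
  shows "integrable lborel (\<lambda>\<xi>. f \<xi> \<bullet> g \<xi>)"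
  by (intro rapid_integrable[OF rapid_inner[OF assms(1,2)]]) (use assms in simp)

lemma integrable_energy_form:
  fixes f g :: "real^'n::finite \<Rightarrow> complex"
  assumes "f \<in> energy_class" "g \<in> energy_class" "s > 0"
  shows "integrable lborel (\<lambda>\<xi>. twisted_partial s \<tau> i f \<xi> \<bullet> twisted_partial s \<tau> i g \<xi>)"
  by (intro integrable_inner_rapid[OF rapid_twisted_partial rapid_twisted_partial] assms) simp

lemma semi_inner_weight_form:
  assumes "s > 0" shows "semi_inner energy_class (weight_form s :: (real^'n::finite \<Rightarrow> complex) \<Rightarrow> _)"
proof
  show "(\<lambda>x::real^'n. 0::complex) \<in> energy_class" by (rule energy_class_zero)
  fix f g h :: "real^'n \<Rightarrow> complex" and c :: real
  assume f: "f \<in> energy_class"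
  show "(\<lambda>x. c *\<^sub>R f x) \<in> energy_class" by (rule energy_class_scaleR[OF f])
  show "0 \<le> weight_form s f f" unfolding weight_form_def by (intro integral_nonneg_AE) auto
  assume g: "g \<in> energy_class"
  show "(\<lambda>x. f x + g x) \<in> energy_class" by (rule energy_class_add[OF f g])
  show "weight_form s f g = weight_form s g f" by (simp add: weight_form_def inner_commute)
  show "weight_form s (\<lambda>x. c *\<^sub>R f x) g = c * weight_form s f g"
    unfolding weight_form_def by (subst integral_mult_right_zero[symmetric]) (simp add: mult.left_commute)
  assume h: "h \<in> energy_class"
  show "weight_form s (\<lambda>x. f x + g x) h = weight_form s f h + weight_form s g h"
    unfolding weight_form_def inner_add_left distrib_left
    by (intro Bochner_Integration.integral_add integrable_weight_form energy_classD f g h assms)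
qed

lemma measurable_twisted_partial:
  assumes "f \<in> energy_class" "s > 0" shows "twisted_partial s \<tau> i f \<in> borel_measurable borel"
  by (rule rapid_measurable[OF rapid_twisted_partial[OF assms]])

lemma semi_inner_energy_form:
  assumes s: "s > 0" and \<tau>: "\<tau> > 0" shows "semi_inner energy_class (energy_form s \<tau> :: (real^'n::finite \<Rightarrow> complex) \<Rightarrow> _)"
proof
  show "(\<lambda>x::real^'n. 0::complex) \<in> energy_class" by (rule energy_class_zero)
  fix f g h :: "real^'n \<Rightarrow> complex" and c :: real
  assume f: "f \<in> energy_class"
  show c: "(\<lambda>x. c *\<^sub>R f x) \<in> energy_class" by (rule energy_class_scaleR[OF f])
  show "0 \<le> energy_form s \<tau> f f" unfolding energy_form_def
    using \<tau> by (intro divide_nonneg_pos sum_nonneg integral_nonneg_AE) auto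
  assume g: "g \<in> energy_class"
  show a: "(\<lambda>x. f x + g x) \<in> energy_class" by (rule energy_class_add[OF f g])
  show "energy_form s \<tau> f g = energy_form s \<tau> g f" by (simp add: energy_form_def inner_commute)
  have "(LINT \<xi>|lborel. twisted_partial s \<tau> i (\<lambda>x. c *\<^sub>R f x) \<xi> \<bullet> twisted_partial s \<tau> i g \<xi>) = c * (LINT \<xi>|lborel. twisted_partial s \<tau> i f \<xi> \<bullet> twisted_partial s \<tau> i g \<xi>)" for i
  proof -
    have "(LINT \<xi>|lborel. twisted_partial s \<tau> i (\<lambda>x. c *\<^sub>R f x) \<xi> \<bullet> twisted_partial s \<tau> i g \<xi>) = (LINT \<xi>|lborel. c * (twisted_partial s \<tau> i f \<xi> \<bullet> twisted_partial s \<tau> i g \<xi>))"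
    proof (rule integral_cong_AE)
      show "AE \<xi> in lborel. twisted_partial s \<tau> i (\<lambda>x. c *\<^sub>R f x) \<xi> \<bullet> twisted_partial s \<tau> i g \<xi> = c * (twisted_partial s \<tau> i f \<xi> \<bullet> twisted_partial s \<tau> i g \<xi>)"
        using AE_lborel_nonzero
        by eventually_elim (simp add: twisted_partial_def partial_energy_scaleR[OF f] inner_add_left algebra_simps)
    qed (use measurable_twisted_partial[OF c s] measurable_twisted_partial[OF f s] measurable_twisted_partial[OF g s] in measurable)
    then show ?thesis by simp
  qed
  then show "energy_form s \<tau> (\<lambda>x. c *\<^sub>R f x) g = c * energy_form s \<tau> f g"
    unfolding energy_form_def by (simp add: sum_distrib_left[symmetric])
  assume h: "h \<in> energy_class"
  have "(LINT \<xi>|lborel. twisted_partial s \<tau> i (\<lambda>x. f x + g x) \<xi> \<bullet> twisted_partial s \<tau> i h \<xi>)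
     = (LINT \<xi>|lborel. twisted_partial s \<tau> i f \<xi> \<bullet> twisted_partial s \<tau> i h \<xi>) + (LINT \<xi>|lborel. twisted_partial s \<tau> i g \<xi> \<bullet> twisted_partial s \<tau> i h \<xi>)" for i
  proof -
    have "(LINT \<xi>|lborel. twisted_partial s \<tau> i (\<lambda>x. f x + g x) \<xi> \<bullet> twisted_partial s \<tau> i h \<xi>)
     = (LINT \<xi>|lborel. twisted_partial s \<tau> i f \<xi> \<bullet> twisted_partial s \<tau> i h \<xi> + twisted_partial s \<tau> i g \<xi> \<bullet> twisted_partial s \<tau> i h \<xi>)"
    proof (rule integral_cong_AE)
      show "AE \<xi> in lborel. twisted_partial s \<tau> i (\<lambda>x. f x + g x) \<xi> \<bullet> twisted_partial s \<tau> i h \<xi> = twisted_partial s \<tau> i f \<xi> \<bullet> twisted_partial s \<tau> i h \<xi> + twisted_partial s \<tau> i g \<xi> \<bullet> twisted_partial s \<tau> i h \<xi>"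
        using AE_lborel_nonzero
        by eventually_elim (simp add: twisted_partial_def partial_energy_add[OF f g] inner_add_left algebra_simps)
    qed (use measurable_twisted_partial[OF a s] measurable_twisted_partial[OF f s] measurable_twisted_partial[OF g s] measurable_twisted_partial[OF h s] in measurable)
    then show ?thesis by (simp add: Bochner_Integration.integral_add integrable_energy_form f g h s)
  qed
  then show "energy_form s \<tau> (\<lambda>x. f x + g x) h = energy_form s \<tau> f h + energy_form s \<tau> g h"
    unfolding energy_form_def by (simp add: sum.distrib add_divide_distrib)
qed

lemma integral_partial_zero_rapid:
  fixes h h' :: "real^'n::finite \<Rightarrow> real"
  assumes N: "CARD('n) \<ge> 2" and h: "rapid a h" "a > - real CARD('n)" and h': "rapid b h'" "b > - real CARD('n)"
    and D: "\<And>\<xi>. \<xi> \<noteq> 0 \<Longrightarrow> has_partial i h (h' \<xi>) \<xi>"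
  shows "(LINT \<xi>|lborel. h' \<xi>) = 0"
proof (rule integral_partial_zero[where e = "axis i 1" and h = h])
  show "integrable lborel h" "integrable lborel h'" using h h' by (auto intro: rapid_integrable[OF h(1)] rapid_integrable[OF h'(1)])
qed (use D N rapid_cont[OF h'(1)] in \<open>auto simp: has_partial_def\<close>)

lemma norm_powr_sum_sq:
  fixes x :: "real^'n::finite"
  assumes "x \<noteq> 0" shows "norm x powr (a - 2) * (\<Sum>i\<in>UNIV. (x $ i)\<^sup>2) = norm x powr a"
proof -
  have "(\<Sum>i\<in>UNIV. (x $ i)\<^sup>2) = (norm x)\<^sup>2"
    by (subst power2_norm_eq_inner) (simp add: inner_vec_def power2_eq_square)
  also have "\<dots> = norm x powr 2" using assms by (simp add: powr_numeral)
  finally show ?thesis by (simp only: powr_add[symmetric]) simp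
qed

text \<open>Expanding the square leaves a cross term, which pairs the vector field
  \<open>|\<xi>|^(s - 1) \<xi>\<close> with half the gradient of \<open>|f|^2\<close>. Integration
  by parts moves the derivative to the field, whose divergence is
  \<open>(N + s - 1) |\<xi>|^(s - 1)\<close>.\<close>

theorem energy_form_self:
  fixes f :: "real^'n::finite \<Rightarrow> complex"
  assumes N: "CARD('n) \<ge> 2" and f: "f \<in> energy_class" and s: "s > 0" and \<tau>: "\<tau> > 0"
  shows "energy_form s \<tau> f f = ((\<Sum>i\<in>UNIV. LINT \<xi>|lborel. (norm (partial i f \<xi>))\<^sup>2) / \<tau> + \<tau> * (LINT \<xi>|lborel. norm \<xi> powr (2 * s) * (norm (f \<xi>))\<^sup>2)) / 2
     - (real CARD('n) + s - 1) / 2 * (LINT \<xi>|lborel. norm \<xi> powr (s - 1) * (norm (f \<xi>))\<^sup>2)"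
proof -
  note r = energy_classD(1)[OF f] and rp = energy_classD(2)[OF f] and hp = energy_classD(3)[OF f]
  have N1: "real CARD('n) \<ge> 2" using N by simp
  let ?w = "\<lambda>i \<xi>. (1 * norm \<xi> powr (s - 1) * \<xi> $ i) *\<^sub>R f \<xi>"
  have rw: "rapid 0 (?w i)" for i by (rule rapid_mono[OF rapid_twist[OF r]]) (use s in simp)
  have rf2: "rapid 0 (\<lambda>\<xi>. f \<xi> \<bullet> f \<xi>)" using rapid_inner[OF r r] by simp
  have ipp: "integrable lborel (\<lambda>\<xi>. (norm (partial i f \<xi>))\<^sup>2)" for i
    using integrable_inner_rapid[OF rp rp, of i i] by (simp add: power2_norm_eq_inner)
  have iwp: "integrable lborel (\<lambda>\<xi>. ?w i \<xi> \<bullet> partial i f \<xi>)" for i using integrable_inner_rapid[OF rw rp, of i i] by simp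
  have iww: "integrable lborel (\<lambda>\<xi>. (norm (?w i \<xi>))\<^sup>2)" for i
    unfolding power2_norm_eq_inner using integrable_inner_rapid[OF rw rw, of i i] by simp
  have iM: "integrable lborel (\<lambda>\<xi>. norm \<xi> powr (s - 1) * (norm (f \<xi>))\<^sup>2)"
    using integrable_weight_form[OF r r s] by (simp add: power2_norm_eq_inner)
  have sq: "(LINT \<xi>|lborel. twisted_partial s \<tau> i f \<xi> \<bullet> twisted_partial s \<tau> i f \<xi>)
     = (LINT \<xi>|lborel. (norm (partial i f \<xi>))\<^sup>2) + 2 * \<tau> * (LINT \<xi>|lborel. ?w i \<xi> \<bullet> partial i f \<xi>) + \<tau>\<^sup>2 * (LINT \<xi>|lborel. (norm (?w i \<xi>))\<^sup>2)" for i
  proof -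
    have "twisted_partial s \<tau> i f \<xi> \<bullet> twisted_partial s \<tau> i f \<xi> = (norm (partial i f \<xi>))\<^sup>2 + 2 * \<tau> * (?w i \<xi> \<bullet> partial i f \<xi>) + \<tau>\<^sup>2 * (norm (?w i \<xi>))\<^sup>2" for \<xi>
    proof -
      have "twisted_partial s \<tau> i f \<xi> = partial i f \<xi> + \<tau> *\<^sub>R ?w i \<xi>" by (simp add: twisted_partial_def mult.assoc)
      then show ?thesis unfolding power2_norm_eq_inner
        by (simp add: inner_add_left inner_add_right inner_commute power2_eq_square algebra_simps)
    qed
    then show ?thesis using ipp iwp iww by simp
  qed
  have S1: "(\<Sum>i\<in>UNIV. LINT \<xi>|lborel. (norm (?w i \<xi>))\<^sup>2) = (LINT \<xi>|lborel. norm \<xi> powr (2 * s) * (norm (f \<xi>))\<^sup>2)"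
  proof -
    have "(\<Sum>i\<in>UNIV. LINT \<xi>|lborel. (norm (?w i \<xi>))\<^sup>2) = (LINT \<xi>|lborel. (\<Sum>i\<in>UNIV. (norm (?w i \<xi>))\<^sup>2))"
      using iww by (intro Bochner_Integration.integral_sum[symmetric])
    also have "\<dots> = (LINT \<xi>|lborel. norm \<xi> powr (2 * s) * (norm (f \<xi>))\<^sup>2)"
    proof (rule integral_cong_AE)
      show "AE \<xi> in lborel. (\<Sum>i\<in>UNIV. (norm (?w i \<xi>))\<^sup>2) = norm \<xi> powr (2 * s) * (norm (f \<xi>))\<^sup>2"
        using AE_lborel_nonzero
      proof eventually_elim
        fix \<xi> :: "real^'n" assume x: "\<xi> \<noteq> 0"
        have "(norm (?w i \<xi>))\<^sup>2 = norm \<xi> powr (2 * s - 2) * (norm (f \<xi>))\<^sup>2 * (\<xi> $ i)\<^sup>2" for i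
        proof -
          have "(norm \<xi> powr (s - 1))\<^sup>2 = norm \<xi> powr (2 * s - 2)" using x by (simp add: power2_eq_square powr_add[symmetric])
          then show ?thesis by (simp add: power_mult_distrib mult_ac)
        qed
        then have "(\<Sum>i\<in>UNIV. (norm (?w i \<xi>))\<^sup>2) = norm \<xi> powr (2 * s - 2) * (norm (f \<xi>))\<^sup>2 * (\<Sum>i\<in>UNIV. (\<xi> $ i)\<^sup>2)"
          by (simp only: sum_distrib_left)
        also have "\<dots> = (norm \<xi> powr (2 * s - 2) * (\<Sum>i\<in>UNIV. (\<xi> $ i)\<^sup>2)) * (norm (f \<xi>))\<^sup>2" by (simp only: mult_ac)
        finally show "(\<Sum>i\<in>UNIV. (norm (?w i \<xi>))\<^sup>2) = norm \<xi> powr (2 * s) * (norm (f \<xi>))\<^sup>2" unfolding norm_powr_sum_sq[OF x] .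
      qed
      show "(\<lambda>\<xi>. \<Sum>i\<in>UNIV. (norm (?w i \<xi>))\<^sup>2) \<in> borel_measurable lborel"
        using rapid_measurable[OF rw] by measurable
      show "(\<lambda>\<xi>. norm \<xi> powr (2 * s) * (norm (f \<xi>))\<^sup>2) \<in> borel_measurable lborel"
        using rapid_measurable[OF r] by measurable
    qed
    finally show ?thesis .
  qed
  have S2: "2 * (\<Sum>i\<in>UNIV. LINT \<xi>|lborel. ?w i \<xi> \<bullet> partial i f \<xi>) = - (real CARD('n) + s - 1) * (LINT \<xi>|lborel. norm \<xi> powr (s - 1) * (norm (f \<xi>))\<^sup>2)"
  proof -
    \<comment> \<open>Comes from differentiating the weight \<open>|\<xi>|^(s - 1)\<close>; summed
      over \<open>i\<close> it contributes \<open>(s - 1) |\<xi>|^(s - 1) |f|^2\<close>. The term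
      \<open>?M\<close> comes from differentiating \<open>\<xi> $ i\<close> and is counted once for
      each coordinate.\<close>
    let ?A = "\<lambda>i \<xi>. (s - 1) * norm \<xi> powr (s - 3) * (\<xi> $ i)\<^sup>2 * (f \<xi> \<bullet> f \<xi>)"
    let ?M = "\<lambda>\<xi>. norm \<xi> powr (s - 1) * (norm (f \<xi>))\<^sup>2"
    have rA: "rapid (s - 1) (?A i)" for i
    proof -
      have "rapid (0 + (s - 1)) (?A i)"
      proof (rule rapid_bound[OF rf2, where B = "\<bar>s - 1\<bar>" and L = 0])
        show "continuous_on (- {0}) (?A i)" by (intro continuous_intros continuous_on_norm_powr rapid_cont[OF r])
        fix x :: "real^'n" assume x: "x \<noteq> 0"
        have "(x $ i)\<^sup>2 \<le> (norm x)\<^sup>2" using component_le_norm_cart[of x i] by (metis abs_ge_zero power2_abs power_mono)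
        then have "norm x powr (s - 3) * (x $ i)\<^sup>2 \<le> norm x powr (s - 3) * norm x powr 2" using x by (intro mult_left_mono) (auto simp: powr_numeral)
        also have "\<dots> = norm x powr (s - 1)" unfolding powr_add[symmetric] by simp
        finally have le: "norm x powr (s - 3) * (x $ i)\<^sup>2 \<le> norm x powr (s - 1)" .
        have "norm (?A i x) = \<bar>s - 1\<bar> * (norm x powr (s - 3) * (x $ i)\<^sup>2) * (f x \<bullet> f x)" by (simp add: abs_mult)
        also have "\<dots> \<le> \<bar>s - 1\<bar> * norm x powr (s - 1) * (f x \<bullet> f x)" by (intro mult_right_mono mult_left_mono le) auto
        finally show "norm (?A i x) \<le> \<bar>s - 1\<bar> * norm x powr (s - 1) * (1 + norm x) ^ 0 * norm (f x \<bullet> f x)" by simp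
      qed
      then show ?thesis by simp
    qed
    have iA: "integrable lborel (?A i)" for i by (rule rapid_integrable[OF rA]) (use s N1 in simp)
    have z: "(LINT \<xi>|lborel. ?A i \<xi>) + (LINT \<xi>|lborel. ?M \<xi>) + 2 * (LINT \<xi>|lborel. ?w i \<xi> \<bullet> partial i f \<xi>) = 0" for i
    proof -
      have "(LINT \<xi>|lborel. ?A i \<xi> + ?M \<xi> + 2 * (?w i \<xi> \<bullet> partial i f \<xi>)) = 0"
      proof (rule integral_partial_zero_rapid[OF N, where h = "\<lambda>\<xi>. ?w i \<xi> \<bullet> f \<xi>"])
        show "rapid (0 + 0) (\<lambda>\<xi>. ?w i \<xi> \<bullet> f \<xi>)" by (rule rapid_inner[OF rw r])
        have m: "rapid (0 + (s - 1)) ?M" using rapid_norm_powr_mult_real[OF rf2, of "s - 1"] by (simp add: power2_norm_eq_inner)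
        \<comment> \<open>For \<open>s < 1\<close> the divergence terms are singular at the origin
          with exponent \<open>s - 1 > -1\<close>, which is still integrable.\<close>
        show "rapid (min 0 (s - 1)) (\<lambda>\<xi>. ?A i \<xi> + ?M \<xi> + 2 * (?w i \<xi> \<bullet> partial i f \<xi>))"
          by (intro rapid_add rapid_cmult rapid_mono[OF rA] rapid_mono[OF m] rapid_mono[OF rapid_inner[OF rw rp]]) auto
        fix \<xi> :: "real^'n" assume x: "\<xi> \<noteq> 0"
        have "has_partial i (\<lambda>\<xi>. (norm \<xi> powr (s - 1) * \<xi> $ i) * (f \<xi> \<bullet> f \<xi>))
          ((norm \<xi> powr (s - 1) * \<xi> $ i) * (f \<xi> \<bullet> partial i f \<xi> + partial i f \<xi> \<bullet> f \<xi>)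
           + (norm \<xi> powr (s - 1) * 1 + (s - 1) * norm \<xi> powr (s - 1 - 2) * \<xi> $ i * \<xi> $ i) * (f \<xi> \<bullet> f \<xi>)) \<xi>"
          using has_partial_coord[of i i \<xi>] by (intro has_partial_mult has_partial_inner hp x has_partial_norm_powr) simp_all
        then show "has_partial i (\<lambda>\<xi>. ?w i \<xi> \<bullet> f \<xi>) (?A i \<xi> + ?M \<xi> + 2 * (?w i \<xi> \<bullet> partial i f \<xi>)) \<xi>"
          unfolding power2_norm_eq_inner by (simp add: inner_commute power2_eq_square algebra_simps)
      qed (use s N1 in auto)
      then show ?thesis using iA[of i] iM iwp[of i] by simp
    qed
    have "(\<Sum>i\<in>UNIV. LINT \<xi>|lborel. ?A i \<xi>) = (LINT \<xi>|lborel. (\<Sum>i\<in>UNIV. ?A i \<xi>))"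
      using iA by (intro Bochner_Integration.integral_sum[symmetric])
    also have "\<dots> = (LINT \<xi>|lborel. (s - 1) * ?M \<xi>)"
    proof (rule integral_cong_AE)
      show "AE \<xi> in lborel. (\<Sum>i\<in>UNIV. ?A i \<xi>) = (s - 1) * ?M \<xi>"
        using AE_lborel_nonzero
      proof eventually_elim
        fix \<xi> :: "real^'n" assume x: "\<xi> \<noteq> 0"
        have "(\<Sum>i\<in>UNIV. ?A i \<xi>) = (s - 1) * (norm \<xi> powr (s - 1 - 2) * (\<Sum>i\<in>UNIV. (\<xi> $ i)\<^sup>2)) * (norm (f \<xi>))\<^sup>2"
          by (simp add: sum_distrib_left sum_distrib_right power2_norm_eq_inner mult_ac)
        then show "(\<Sum>i\<in>UNIV. ?A i \<xi>) = (s - 1) * ?M \<xi>" unfolding norm_powr_sum_sq[OF x] by (simp only: mult.assoc)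
      qed
      show "(\<lambda>\<xi>. \<Sum>i\<in>UNIV. ?A i \<xi>) \<in> borel_measurable lborel" using rapid_measurable[OF rA] by measurable
      show "(\<lambda>\<xi>. (s - 1) * ?M \<xi>) \<in> borel_measurable lborel" using rapid_measurable[OF r] by measurable
    qed
    finally have SA: "(\<Sum>i\<in>UNIV. LINT \<xi>|lborel. ?A i \<xi>) = (s - 1) * (LINT \<xi>|lborel. ?M \<xi>)" by simp
    have "(\<Sum>i\<in>UNIV. (LINT \<xi>|lborel. ?A i \<xi>) + (LINT \<xi>|lborel. ?M \<xi>) + 2 * (LINT \<xi>|lborel. ?w i \<xi> \<bullet> partial i f \<xi>)) = 0"
      using z by simp
    then have "(s - 1) * (LINT \<xi>|lborel. ?M \<xi>) + real CARD('n) * (LINT \<xi>|lborel. ?M \<xi>) + 2 * (\<Sum>i\<in>UNIV. LINT \<xi>|lborel. ?w i \<xi> \<bullet> partial i f \<xi>) = 0"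
      by (simp only: sum.distrib SA sum_distrib_left[symmetric] sum_constant)
    then show ?thesis by (simp add: algebra_simps)
  qed
  have "energy_form s \<tau> f f = ((\<Sum>i\<in>UNIV. LINT \<xi>|lborel. (norm (partial i f \<xi>))\<^sup>2) + \<tau> * (2 * (\<Sum>i\<in>UNIV. LINT \<xi>|lborel. ?w i \<xi> \<bullet> partial i f \<xi>)) + \<tau>\<^sup>2 * (\<Sum>i\<in>UNIV. LINT \<xi>|lborel. (norm (?w i \<xi>))\<^sup>2)) / (2 * \<tau>)"
    unfolding energy_form_def sq sum.distrib sum_distrib_left[symmetric] by (simp only: mult_ac)
  also have "\<dots> = ((\<Sum>i\<in>UNIV. LINT \<xi>|lborel. (norm (partial i f \<xi>))\<^sup>2) / \<tau> + \<tau> * (LINT \<xi>|lborel. norm \<xi> powr (2 * s) * (norm (f \<xi>))\<^sup>2)) / 2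
     - (real CARD('n) + s - 1) / 2 * (LINT \<xi>|lborel. norm \<xi> powr (s - 1) * (norm (f \<xi>))\<^sup>2)"
  proof -
    have "(B + \<tau> * (- c * M) + \<tau>\<^sup>2 * A) / (2 * \<tau>) = (B / \<tau> + \<tau> * A) / 2 - c / 2 * M" for A B M c
      using \<tau> by (simp add: field_simps power2_eq_square)
    then show ?thesis unfolding S1 S2 .
  qed
  finally show ?thesis .
qed

lemma hterm_energy_class:
  fixes P :: "real^'n::finite \<Rightarrow> complex"
  assumes P: "homog k P" and \<tau>: "\<tau> > 0" and \<sigma>: "\<sigma> > 1" and a: "a = 0 \<or> a \<ge> \<sigma>"
  shows "hterm \<sigma> \<tau> P a \<in> energy_class" "hsum \<sigma> \<tau> 0 (hterm \<sigma> \<tau> P a)"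
proof -
  have \<sigma>0: "\<sigma> > 0" using \<sigma> by simp
  show h: "hsum \<sigma> \<tau> 0 (hterm \<sigma> \<tau> P a)" using a by (intro hsum.base[OF P]) auto
  obtain D where D: "\<And>i. hsum \<sigma> \<tau> (Suc 0) (D i)" "\<And>i x. x \<noteq> 0 \<Longrightarrow> has_partial i (hterm \<sigma> \<tau> P a) (D i x) x"
    using hsum_partial[OF \<sigma>0 h] by metis
  show "hterm \<sigma> \<tau> P a \<in> energy_class"
  proof (rule energy_classI[OF _ _ D(2)])
    show "rapid 0 (hterm \<sigma> \<tau> P a)" by (rule rapid_mono[OF hsum_rapid[OF \<tau> \<sigma>0 h]]) (use \<sigma> in simp)
    show "rapid 0 (D i)" for i by (rule rapid_mono[OF hsum_rapid[OF \<tau> \<sigma>0 D(1)]]) (use \<sigma> in simp)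
  qed
qed

text \<open>The eigenvalue relation: for a harmonic \<open>P\<close> of degree \<open>k\<close>, the operator behind
  \<open>energy_form\<close> acts triangularly on \<open>P |\<xi>|^(\<sigma> n) exp (- \<tau> |\<xi>|^\<sigma> / \<sigma>)\<close>, with diagonal entries \<open>k + n \<sigma>\<close>.\<close>

theorem energy_form_hterm:
  fixes P f :: "real^'n::finite \<Rightarrow> complex"
  assumes N: "CARD('n) \<ge> 2" and f: "f \<in> energy_class" and s: "s > 0" and \<tau>: "\<tau> > 0"
    and P: "homog k P" "\<And>x. laplacian P x = 0" and \<sigma>: "\<sigma> = 1 + s" and a: "a = 0 \<or> a \<ge> \<sigma>"
  shows "energy_form s \<tau> f (hterm \<sigma> \<tau> P a) = (real k + a) * weight_form s f (hterm \<sigma> \<tau> P a)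
     - a * (a + real CARD('n) - 2 + 2 * real k) / (2 * \<tau>) * weight_form s f (hterm \<sigma> \<tau> P (a - \<sigma>))"
proof -
  have \<sigma>1: "\<sigma> > 1" and \<sigma>0: "\<sigma> > 0" and s1: "s - 1 = \<sigma> - 2" using s \<sigma> by auto
  have N1: "real CARD('n) \<ge> 2" using N by simp
  note r = energy_classD(1)[OF f] and rp = energy_classD(2)[OF f] and hp = energy_classD(3)[OF f]
  let ?F = "hterm \<sigma> \<tau> P a"
  let ?Q = "\<lambda>i x. complex_of_real a * (of_real (x $ i) * P x)"
  note F = hterm_energy_class[OF P(1) \<tau> \<sigma>1 a]
  \<comment> \<open>The twisted derivative of \<open>?F\<close>: the term from differentiating the
    exponential is cancelled by the twist, and only the derivatives of \<open>P\<close> and of the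
    power of the norm remain.\<close>
  define G where "G i x = hterm \<sigma> \<tau> (partial i P) a x + hterm \<sigma> \<tau> (?Q i) (a - 2) x" for i x
  have h1: "hsum \<sigma> \<tau> (Suc 0) (hterm \<sigma> \<tau> (partial i P) a)" for i
    using a by (intro hsum.base[OF homog_partial1[OF P(1)]]) auto
  have h2: "hsum \<sigma> \<tau> (Suc 0) (hterm \<sigma> \<tau> (?Q i) (a - 2))" for i
  proof (cases "a = 0")
    case True
    then have "hterm \<sigma> \<tau> (?Q i) (a - 2) = hterm \<sigma> \<tau> (\<lambda>x. 0) 0" by (auto simp: hterm_def)
    then show ?thesis using hsum.base[OF homog_zero[of 0], of 0] by simp
  next
    case False
    then show ?thesis using a by (intro hsum.base[OF homog_cmult[OF homog.coord[OF P(1)]]]) auto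
  qed
  have hG: "hsum \<sigma> \<tau> (Suc 0) (G i)" for i unfolding G_def[abs_def] by (rule hsum.add[OF h1 h2])
  have "\<forall>i. \<exists>F'. hsum \<sigma> \<tau> (Suc (Suc 0)) F' \<and> (\<forall>x. x \<noteq> 0 \<longrightarrow> has_partial i (G i) (F' x) x)"
    using hsum_partial[OF \<sigma>0 hG] by blast
  from choice[OF this] obtain G' where G': "\<And>i. hsum \<sigma> \<tau> (Suc (Suc 0)) (G' i)" "\<And>i x. x \<noteq> 0 \<Longrightarrow> has_partial i (G i) (G' i x) x"
    by blast
  have rG: "rapid 0 (G i)" for i by (rule rapid_mono[OF hsum_rapid[OF \<tau> \<sigma>0 hG]]) (use \<sigma>1 in simp)
  have rG': "rapid (min 0 (s - 1)) (G' i)" for i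
  proof -
    have "\<sigma> - real (Suc (Suc 0)) = s - 1" using \<sigma> by simp
    then show ?thesis using hsum_rapid[OF \<tau> \<sigma>0 G'(1)[of i]] by (simp only:)
  qed
  have qP: "homog (Suc k) (?Q i)" for i by (rule homog_cmult[OF homog.coord[OF P(1)]])
  have pQ: "partial i (?Q i) x = of_real a * (of_real (x $ i) * partial i P x + P x)" for i x
    using has_partial_imp_partial[OF has_partial_cmult[OF has_partial_mult[OF has_partial_of_real[OF has_partial_coord] has_partial_homog[OF P(1)]]], of i "of_real a" i x]
    by simp
  have twF: "twisted_partial s \<tau> i ?F x = G i x" if "x \<noteq> 0" for i x
  proof -
    have "partial i ?F x = hterm \<sigma> \<tau> (partial i P) a x + hterm \<sigma> \<tau> (?Q i) (a - 2) x + hterm \<sigma> \<tau> (\<lambda>x. - of_real \<tau> * (of_real (x $ i) * P x)) (a + \<sigma> - 2) x"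
      by (rule has_partial_imp_partial[OF has_partial_hterm[OF P(1) that \<sigma>0]])
    moreover have "hterm \<sigma> \<tau> (\<lambda>x. - of_real \<tau> * (of_real (x $ i) * P x)) (a + \<sigma> - 2) x = - (\<tau> * norm x powr (s - 1) * x $ i) *\<^sub>R ?F x"
    proof -
      have "norm x powr (a + \<sigma> - 2) = norm x powr (s - 1) * norm x powr a" unfolding s1 by (simp add: powr_add[symmetric] algebra_simps)
      then show ?thesis by (simp add: hterm_def scaleR_conv_of_real mult_ac)
    qed
    ultimately show ?thesis by (simp add: twisted_partial_def G_def)
  qed
  \<comment> \<open>The Laplacian of \<open>|x|^a P\<close> away from the origin is
    \<open>?c |x|^(a - 2) P\<close>, and \<open>a - 2 = (s - 1) + (a - \<sigma>)\<close>.\<close>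
  let ?c = "a * (a + real CARD('n) - 2 + 2 * real k)"
  \<comment> \<open>The formal adjoint of the twisted gradient, applied to \<open>G\<close>. Euler's
    relation turns the radial derivative of \<open>P\<close> into the factor \<open>k\<close>, and
    harmonicity removes the second derivatives of \<open>P\<close>.\<close>
  have key: "(\<Sum>i\<in>UNIV. (\<tau> * norm x powr (s - 1) * x $ i) *\<^sub>R G i x - G' i x)
     = norm x powr (s - 1) *\<^sub>R ((2 * \<tau> * (real k + a)) *\<^sub>R ?F x - ?c *\<^sub>R hterm \<sigma> \<tau> P (a - \<sigma>) x)" if x: "x \<noteq> 0" for x
  proof -
    let ?r = "\<lambda>b. complex_of_real (norm x powr b * gexp \<sigma> \<tau> x)"
    let ?x = "\<lambda>i. complex_of_real (x $ i)"
    have G'x: "G' i x = (partial i (partial i P) x * ?r a + of_real a * (?x i * partial i P x) * ?r (a - 2) - of_real \<tau> * (?x i * partial i P x) * ?r (a + \<sigma> - 2))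
      + (of_real a * (?x i * partial i P x + P x) * ?r (a - 2) + of_real (a * (a - 2)) * ((?x i)\<^sup>2 * P x) * ?r (a - 4)
         - of_real (\<tau> * a) * ((?x i)\<^sup>2 * P x) * ?r (a + \<sigma> - 4))" for i
    proof -
      have 1: "has_partial i (hterm \<sigma> \<tau> (partial i P) a) (hterm \<sigma> \<tau> (partial i (partial i P)) a x + hterm \<sigma> \<tau> (\<lambda>x. of_real a * (of_real (x $ i) * partial i P x)) (a - 2) x
      + hterm \<sigma> \<tau> (\<lambda>x. - of_real \<tau> * (of_real (x $ i) * partial i P x)) (a + \<sigma> - 2) x) x"
        by (rule has_partial_hterm[OF homog_partial1[OF P(1)] x \<sigma>0])
      have 2: "has_partial i (hterm \<sigma> \<tau> (?Q i) (a - 2)) (hterm \<sigma> \<tau> (partial i (?Q i)) (a - 2) x + hterm \<sigma> \<tau> (\<lambda>x. of_real (a - 2) * (of_real (x $ i) * ?Q i x)) (a - 2 - 2) x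
      + hterm \<sigma> \<tau> (\<lambda>x. - of_real \<tau> * (of_real (x $ i) * ?Q i x)) (a - 2 + \<sigma> - 2) x) x"
        by (rule has_partial_hterm[OF qP x \<sigma>0])
      have e: "a - 2 - 2 = a - 4" "a - 2 + \<sigma> - 2 = a + \<sigma> - 4" by auto
      have "G' i x = partial i (G i) x" by (rule has_partial_imp_partial[OF G'(2)[OF x], symmetric])
      also have "\<dots> = (hterm \<sigma> \<tau> (partial i (partial i P)) a x + hterm \<sigma> \<tau> (\<lambda>x. of_real a * (of_real (x $ i) * partial i P x)) (a - 2) x
      + hterm \<sigma> \<tau> (\<lambda>x. - of_real \<tau> * (of_real (x $ i) * partial i P x)) (a + \<sigma> - 2) x) + (hterm \<sigma> \<tau> (partial i (?Q i)) (a - 2) x + hterm \<sigma> \<tau> (\<lambda>x. of_real (a - 2) * (of_real (x $ i) * ?Q i x)) (a - 2 - 2) x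
      + hterm \<sigma> \<tau> (\<lambda>x. - of_real \<tau> * (of_real (x $ i) * ?Q i x)) (a - 2 + \<sigma> - 2) x)"
        unfolding G_def[abs_def] by (rule has_partial_imp_partial[OF has_partial_add[OF 1 2]])
      finally show ?thesis unfolding e hterm_def pQ by (simp add: power2_eq_square algebra_simps)
    qed
    have Gx: "(\<tau> * norm x powr (s - 1) * x $ i) *\<^sub>R G i x = of_real \<tau> * (?x i * partial i P x) * ?r (a + \<sigma> - 2) + of_real (\<tau> * a) * ((?x i)\<^sup>2 * P x) * ?r (a + \<sigma> - 4)" for i
    proof -
      have rr: "?r (a + \<sigma> - 2) = of_real (norm x powr (s - 1)) * ?r a" "?r (a + \<sigma> - 4) = of_real (norm x powr (s - 1)) * ?r (a - 2)"
        unfolding s1 of_real_mult[symmetric] mult.assoc[symmetric] powr_add[symmetric] by (simp_all add: algebra_simps)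
      show ?thesis unfolding G_def hterm_def scaleR_conv_of_real rr by (simp add: power2_eq_square algebra_simps)
    qed
    have sx: "(\<Sum>i\<in>UNIV. (?x i)\<^sup>2) * ?r (b - 2) = ?r b" for b
    proof -
      have "(\<Sum>i\<in>UNIV. (?x i)\<^sup>2) * ?r (b - 2) = complex_of_real (norm x powr (b - 2) * (\<Sum>i\<in>UNIV. (x $ i)\<^sup>2) * gexp \<sigma> \<tau> x)"
        by (simp add: mult_ac)
      then show ?thesis unfolding norm_powr_sum_sq[OF x] .
    qed
    have sx2: "(\<Sum>i\<in>UNIV. (?x i)\<^sup>2) * ?r (a - 4) = ?r (a - 2)" "(\<Sum>i\<in>UNIV. (?x i)\<^sup>2) * ?r (a + \<sigma> - 4) = ?r (a + \<sigma> - 2)"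
      using sx[of "a - 2"] sx[of "a + \<sigma> - 2"] by (simp_all add: algebra_simps)
    have eu: "(\<Sum>i\<in>UNIV. ?x i * partial i P x) = of_nat k * P x" by (rule homog_euler[OF P(1)])
    have lap: "(\<Sum>i\<in>UNIV. partial i (partial i P) x) = 0" using P(2)[of x] by (simp add: laplacian_def)
    let ?S = "\<Sum>i\<in>UNIV. (?x i)\<^sup>2"
    have "(\<tau> * norm x powr (s - 1) * x $ i) *\<^sub>R G i x - G' i x =
       - (?r a * partial i (partial i P) x) + (2 * of_real \<tau> * ?r (a + \<sigma> - 2) - 2 * of_real a * ?r (a - 2)) * (?x i * partial i P x)
       + (2 * of_real (\<tau> * a) * P x * ?r (a + \<sigma> - 4) - of_real (a * (a - 2)) * P x * ?r (a - 4)) * (?x i)\<^sup>2 - of_real a * P x * ?r (a - 2)" for i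
      unfolding Gx G'x by (simp add: algebra_simps)
    moreover have "(\<Sum>i\<in>(UNIV::'n set). - (A * X i) + B * Y i + C * Z i - D) = - (A * (\<Sum>i\<in>UNIV. X i)) + B * (\<Sum>i\<in>UNIV. Y i) + C * (\<Sum>i\<in>UNIV. Z i) - of_nat CARD('n) * D"
      for A B C D :: complex and X Y Z
      by (simp add: sum.distrib sum_subtractf sum_negf sum_distrib_left)
    ultimately have "(\<Sum>i\<in>UNIV. (\<tau> * norm x powr (s - 1) * x $ i) *\<^sub>R G i x - G' i x) =
       - (?r a * 0) + (2 * of_real \<tau> * ?r (a + \<sigma> - 2) - 2 * of_real a * ?r (a - 2)) * (of_nat k * P x)
       + (2 * of_real (\<tau> * a) * P x * ?r (a + \<sigma> - 4) - of_real (a * (a - 2)) * P x * ?r (a - 4)) * ?S - of_nat CARD('n) * (of_real a * P x * ?r (a - 2))"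
      by (simp only: eu lap)
    also have "\<dots> = (2 * of_real \<tau> * ?r (a + \<sigma> - 2) - 2 * of_real a * ?r (a - 2)) * (of_nat k * P x)
       + 2 * of_real (\<tau> * a) * P x * (?S * ?r (a + \<sigma> - 4)) - of_real (a * (a - 2)) * P x * (?S * ?r (a - 4)) - of_nat CARD('n) * (of_real a * P x * ?r (a - 2))"
    proof -
      have "(A * p * u - B * p * v) * S = A * p * (S * u) - B * p * (S * v)" for A B p u v S :: complex
        by (simp add: algebra_simps)
      then show ?thesis by (simp only: mult_zero_right minus_zero add_0_left add_diff_eq)
    qed
    also have "\<dots> = of_real (2 * \<tau> * (real k + a)) * (P x * ?r (a + \<sigma> - 2)) - of_real ?c * (P x * ?r (a - 2))"
      unfolding sx2 by (simp add: algebra_simps)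
    also have "?r (a + \<sigma> - 2) = of_real (norm x powr (s - 1)) * ?r a"
      unfolding s1 of_real_mult[symmetric] mult.assoc[symmetric] powr_add[symmetric] by (simp add: algebra_simps)
    also have "?r (a - 2) = of_real (norm x powr (s - 1)) * ?r (a - \<sigma>)"
      unfolding s1 of_real_mult[symmetric] mult.assoc[symmetric] powr_add[symmetric] by (simp add: algebra_simps)
    finally show ?thesis unfolding hterm_def scaleR_conv_of_real by (simp add: algebra_simps)
  qed
  have rH: "rapid 0 ?F" by (rule energy_classD(1)[OF F(1)])
  have ibp: "(LINT x|lborel. partial i f x \<bullet> G i x) = - (LINT x|lborel. f x \<bullet> G' i x)" for i
  proof -
    have i1: "integrable lborel (\<lambda>x. f x \<bullet> G' i x)" by (rule integrable_inner_rapid[OF r rG']) (use s N1 in auto)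
    have i2: "integrable lborel (\<lambda>x. partial i f x \<bullet> G i x)" by (rule integrable_inner_rapid[OF rp rG]) simp
    have "(LINT x|lborel. f x \<bullet> G' i x + partial i f x \<bullet> G i x) = 0"
    proof (rule integral_partial_zero_rapid[OF N rapid_inner[OF r rG]])
      show "rapid (min 0 (s - 1)) (\<lambda>x. f x \<bullet> G' i x + partial i f x \<bullet> G i x)"
        by (rule rapid_add, rule rapid_mono[OF rapid_inner[OF r rG']], simp, rule rapid_mono[OF rapid_inner[OF rp rG]], simp)
      show "has_partial i (\<lambda>x. f x \<bullet> G i x) (f x \<bullet> G' i x + partial i f x \<bullet> G i x) x" if "x \<noteq> 0" for x
        by (intro has_partial_inner hp G'(2) that)
    qed (use s N1 in auto)
    then show ?thesis using i1 i2 by simp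
  qed
  have main: "(LINT x|lborel. twisted_partial s \<tau> i f x \<bullet> twisted_partial s \<tau> i ?F x) = (LINT x|lborel. f x \<bullet> ((\<tau> * norm x powr (s - 1) * x $ i) *\<^sub>R G i x - G' i x))"
    and imain: "integrable lborel (\<lambda>x. f x \<bullet> ((\<tau> * norm x powr (s - 1) * x $ i) *\<^sub>R G i x - G' i x))" for i
  proof -
    have i1: "integrable lborel (\<lambda>x. f x \<bullet> G' i x)" by (rule integrable_inner_rapid[OF r rG']) (use s N1 in auto)
    have i2: "integrable lborel (\<lambda>x. partial i f x \<bullet> G i x)" by (rule integrable_inner_rapid[OF rp rG]) simp
    have i3: "integrable lborel (\<lambda>x. f x \<bullet> ((\<tau> * norm x powr (s - 1) * x $ i) *\<^sub>R G i x))"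
      by (rule integrable_inner_rapid[OF r rapid_twist[OF rG]]) (use s in simp)
    show "integrable lborel (\<lambda>x. f x \<bullet> ((\<tau> * norm x powr (s - 1) * x $ i) *\<^sub>R G i x - G' i x))"
      unfolding inner_diff_right by (rule Bochner_Integration.integrable_diff[OF i3 i1])
    have "(LINT x|lborel. twisted_partial s \<tau> i f x \<bullet> twisted_partial s \<tau> i ?F x) = (LINT x|lborel. partial i f x \<bullet> G i x + f x \<bullet> ((\<tau> * norm x powr (s - 1) * x $ i) *\<^sub>R G i x))"
    proof (rule integral_cong_AE)
      show "AE x in lborel. twisted_partial s \<tau> i f x \<bullet> twisted_partial s \<tau> i ?F x = partial i f x \<bullet> G i x + f x \<bullet> ((\<tau> * norm x powr (s - 1) * x $ i) *\<^sub>R G i x)"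
        using AE_lborel_nonzero by eventually_elim (simp add: twF twisted_partial_def[of s \<tau> i f] inner_add_left)
    qed (use integrable_energy_form[OF f F(1) s] i2 i3 in auto)
    also have "\<dots> = (LINT x|lborel. f x \<bullet> ((\<tau> * norm x powr (s - 1) * x $ i) *\<^sub>R G i x - G' i x))"
      unfolding inner_diff_right using i1 i2 i3 ibp[of i] by (simp only: Bochner_Integration.integral_add Bochner_Integration.integral_diff)
    finally show "(LINT x|lborel. twisted_partial s \<tau> i f x \<bullet> twisted_partial s \<tau> i ?F x) = (LINT x|lborel. f x \<bullet> ((\<tau> * norm x powr (s - 1) * x $ i) *\<^sub>R G i x - G' i x))" .
  qed
  let ?H = "hterm \<sigma> \<tau> P (a - \<sigma>)"
  have iF: "integrable lborel (\<lambda>x. norm x powr (s - 1) * (f x \<bullet> ?F x))" by (rule integrable_weight_form[OF r rH s])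
  \<comment> \<open>For \<open>a = 0\<close> the function \<open>?H\<close> has the uncontrolled
    exponent \<open>- \<sigma>\<close>, but its coefficient \<open>?c\<close> vanishes.\<close>
  have iH: "integrable lborel (\<lambda>x. ?c * (norm x powr (s - 1) * (f x \<bullet> ?H x)))"
  proof (cases "a = 0")
    case False
    then have "rapid 0 ?H" using a by (intro rapid_hterm[OF P(1) \<tau> \<sigma>0]) auto
    then show ?thesis by (intro integrable_mult_right integrable_weight_form[OF r _ s])
  qed simp
  have "(\<Sum>i\<in>UNIV. LINT x|lborel. twisted_partial s \<tau> i f x \<bullet> twisted_partial s \<tau> i ?F x)
    = (LINT x|lborel. (\<Sum>i\<in>UNIV. f x \<bullet> ((\<tau> * norm x powr (s - 1) * x $ i) *\<^sub>R G i x - G' i x)))"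
    unfolding main by (rule Bochner_Integration.integral_sum[symmetric]) (rule imain)
  also have "\<dots> = (LINT x|lborel. 2 * \<tau> * (real k + a) * (norm x powr (s - 1) * (f x \<bullet> ?F x)) - ?c * (norm x powr (s - 1) * (f x \<bullet> ?H x)))"
  proof (rule integral_cong_AE)
    show "AE x in lborel. (\<Sum>i\<in>UNIV. f x \<bullet> ((\<tau> * norm x powr (s - 1) * x $ i) *\<^sub>R G i x - G' i x)) = 2 * \<tau> * (real k + a) * (norm x powr (s - 1) * (f x \<bullet> ?F x)) - ?c * (norm x powr (s - 1) * (f x \<bullet> ?H x))"
      using AE_lborel_nonzero
    proof eventually_elim
      fix x :: "real^'n" assume x: "x \<noteq> 0"
      have "(\<Sum>i\<in>UNIV. f x \<bullet> ((\<tau> * norm x powr (s - 1) * x $ i) *\<^sub>R G i x - G' i x)) = f x \<bullet> (\<Sum>i\<in>UNIV. (\<tau> * norm x powr (s - 1) * x $ i) *\<^sub>R G i x - G' i x)"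
        by (rule inner_sum_right[symmetric])
      also have "\<dots> = f x \<bullet> (norm x powr (s - 1) *\<^sub>R ((2 * \<tau> * (real k + a)) *\<^sub>R ?F x - ?c *\<^sub>R ?H x))"
        by (simp only: key[OF x])
      also have "\<dots> = 2 * \<tau> * (real k + a) * (norm x powr (s - 1) * (f x \<bullet> ?F x)) - ?c * (norm x powr (s - 1) * (f x \<bullet> ?H x))"
        by (simp only: inner_scaleR_right inner_diff_right right_diff_distrib mult_ac)
      finally show "(\<Sum>i\<in>UNIV. f x \<bullet> ((\<tau> * norm x powr (s - 1) * x $ i) *\<^sub>R G i x - G' i x)) = 2 * \<tau> * (real k + a) * (norm x powr (s - 1) * (f x \<bullet> ?F x)) - ?c * (norm x powr (s - 1) * (f x \<bullet> ?H x))" .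
    qed
    show "(\<lambda>x. \<Sum>i\<in>UNIV. f x \<bullet> ((\<tau> * norm x powr (s - 1) * x $ i) *\<^sub>R G i x - G' i x)) \<in> borel_measurable lborel"
      using imain by (intro borel_measurable_sum) auto
    show "(\<lambda>x. 2 * \<tau> * (real k + a) * (norm x powr (s - 1) * (f x \<bullet> ?F x)) - ?c * (norm x powr (s - 1) * (f x \<bullet> ?H x))) \<in> borel_measurable lborel"
      by (rule borel_measurable_integrable[OF Bochner_Integration.integrable_diff[OF integrable_mult_right[OF iF] iH]])
  qed
  also have "\<dots> = 2 * \<tau> * (real k + a) * weight_form s f ?F - ?c * weight_form s f ?H"
    unfolding weight_form_def integral_mult_right_zero[symmetric]
    by (rule Bochner_Integration.integral_diff[OF integrable_mult_right[OF iF] iH])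
  finally show ?thesis unfolding energy_form_def using \<tau> by (simp add: diff_divide_distrib)
qed

section \<open>Deficit and distances in frequency space\<close>

lemma frac_laplacian_norm_sq:
  fixes U :: "real^'n::finite \<Rightarrow> complex"
  assumes U: "rapid 0 (fourier U)" and \<kappa>: "4 * \<kappa> > - real CARD('n)"
  shows "(LINT x|lborel. (cmod (frac_laplacian \<kappa> U x))\<^sup>2)
    = (2 * pi) powr (4 * \<kappa>) * (LINT \<xi>|lborel. norm \<xi> powr (4 * \<kappa>) * (norm (fourier U \<xi>))\<^sup>2)"
proof -
  let ?g = "\<lambda>\<xi>. complex_of_real ((2 * pi * norm \<xi>) powr (2 * \<kappa>)) * fourier U \<xi>"
  have g: "rapid (0 + 2 * \<kappa>) ?g"
  proof -
    have "rapid (0 + 2 * \<kappa>) (\<lambda>\<xi>. of_real ((2 * pi) powr (2 * \<kappa>)) * (complex_of_real (norm \<xi> powr (2 * \<kappa>)) * fourier U \<xi>))"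
      by (intro rapid_cmult rapid_norm_powr_mult U)
    moreover have "(\<lambda>\<xi>. of_real ((2 * pi) powr (2 * \<kappa>)) * (complex_of_real (norm \<xi> powr (2 * \<kappa>)) * fourier U \<xi>)) = ?g"
      by (simp add: powr_mult mult.assoc)
    ultimately show ?thesis by simp
  qed
  have "(LINT x|lborel. (cmod (frac_laplacian \<kappa> U x))\<^sup>2) = (LINT \<xi>|lborel. (norm (?g \<xi>))\<^sup>2)"
    unfolding frac_laplacian_def by (rule plancherel_rapid(2)[OF g]) (use \<kappa> in simp)
  also have "\<dots> = (LINT \<xi>|lborel. (2 * pi) powr (4 * \<kappa>) * (norm \<xi> powr (4 * \<kappa>) * (norm (fourier U \<xi>))\<^sup>2))"
  proof (rule Bochner_Integration.integral_cong[OF refl])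
    fix \<xi> :: "real^'n"
    have e: "r powr (2 * \<kappa>) * r powr (2 * \<kappa>) = r powr (4 * \<kappa>)" for r :: real
      by (simp add: powr_add[symmetric])
    have "(norm (?g \<xi>))\<^sup>2 = (2 * pi * norm \<xi>) powr (4 * \<kappa>) * (norm (fourier U \<xi>))\<^sup>2"
      unfolding e[symmetric] by (simp add: norm_mult power_mult_distrib power2_eq_square)
    then show "(norm (?g \<xi>))\<^sup>2 = (2 * pi) powr (4 * \<kappa>) * (norm \<xi> powr (4 * \<kappa>) * (norm (fourier U \<xi>))\<^sup>2)"
      by (simp add: powr_mult mult.assoc)
  qed
  also have "\<dots> = (2 * pi) powr (4 * \<kappa>) * (LINT \<xi>|lborel. norm \<xi> powr (4 * \<kappa>) * (norm (fourier U \<xi>))\<^sup>2)"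
    by (rule integral_mult_right_zero)
  finally show ?thesis .
qed

lemma fourier_test_energy_class:
  fixes u :: "real^'n::finite \<Rightarrow> complex"
  assumes N: "CARD('n) \<ge> 2" and u: "u \<in> test_functions"
  shows "fourier u \<in> energy_class"
  by (rule energy_classI[OF fourier_test_rapid[OF assms] fourier_test_rapid[OF N test_mult_coord[OF u]] fourier_test_has_partial(2)[OF u]])

text \<open>The powers of \<open>2 * pi\<close> balance: \<open>s\<close> from the root of the first
  integral and -1 from the root of the second give the \<open>s - 1\<close> of the subtracted
  term.\<close>

theorem deficit_eq:
  fixes u :: "real^'n::finite \<Rightarrow> complex"
  assumes N: "CARD('n) \<ge> 2" and u: "u \<in> test_functions" and s: "s > 0"
  shows "deficit s u = (2 * pi) powr (s - 1) *
    (sqrt (LINT \<xi>|lborel. norm \<xi> powr (2 * s) * (norm (fourier u \<xi>))\<^sup>2) * sqrt (\<Sum>i\<in>UNIV. LINT \<xi>|lborel. (norm (partial i (fourier u) \<xi>))\<^sup>2)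
     - (real CARD('n) + s - 1) / 2 * weight_sq s (fourier u))"
proof -
  have N1: "real CARD('n) \<ge> 2" using N by simp
  note r = fourier_test_rapid[OF N u]
  let ?A = "LINT \<xi>|lborel. norm \<xi> powr (2 * s) * (norm (fourier u \<xi>))\<^sup>2"
  let ?B = "\<Sum>i\<in>UNIV. LINT \<xi>|lborel. (norm (partial i (fourier u) \<xi>))\<^sup>2"
  have four: "4 * ((s - 1) / 4) = s - 1" by simp
  have 1: "(LINT x|lborel. (cmod (frac_laplacian (s / 2) u x))\<^sup>2) = (2 * pi) powr (2 * s) * ?A"
    using frac_laplacian_norm_sq[OF r, of "s / 2"] s N1 by simp
  have 2: "(LINT x|lborel. (cmod (frac_laplacian ((s - 1) / 4) u x))\<^sup>2) = (2 * pi) powr (s - 1) * weight_sq s (fourier u)"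
    using frac_laplacian_norm_sq[OF r, of "(s - 1) / 4"] s N1 unfolding four by (simp add: weight_form_def power2_norm_eq_inner)
  have "sqrt ((2 * pi) powr (2 * s)) = (2 * pi) powr s"
  proof -
    have "(2 * pi) powr (2 * s) = ((2 * pi) powr s)\<^sup>2" by (simp add: power2_eq_square powr_add[symmetric])
    then show ?thesis by simp
  qed
  moreover have "(2 * pi) powr s = (2 * pi) powr (s - 1) * (2 * pi)" by (simp add: powr_diff)
  ultimately have "sqrt ((2 * pi) powr (2 * s) * ?A) * sqrt (?B / (2 * pi)\<^sup>2) = (2 * pi) powr (s - 1) * (sqrt ?A * sqrt ?B)"
    by (simp add: real_sqrt_mult real_sqrt_divide)
  then show ?thesis
    unfolding deficit_def 1 2 moment_eq_gradient[OF N u] by (simp add: right_diff_distrib)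
qed

section \<open>The extremal families in frequency space\<close>

definition profile :: "real \<Rightarrow> real \<Rightarrow> (real^'n::finite \<Rightarrow> complex) \<Rightarrow> complex \<Rightarrow> real^'n \<Rightarrow> complex" where
  "profile \<sigma> \<tau> P d \<xi> = (P \<xi> + d * of_real (norm \<xi> powr \<sigma>)) * of_real (gexp \<sigma> \<tau> \<xi>)"

text \<open>Equality is claimed off the origin, because \<open>hterm\<close> vanishes at 0 by
  \<open>0 powr 0 = 0\<close> while \<open>P\<close> may have a constant term.\<close>

lemma poly_le_hsum: 
  assumes "poly_le j P"
  shows "\<exists>H. hsum \<sigma> \<tau> 0 H \<and> (\<forall>\<xi>. \<xi> \<noteq> 0 \<longrightarrow> H \<xi> = P \<xi> * of_real (gexp \<sigma> \<tau> \<xi>))"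
  using assms
proof (induction rule: poly_le.induct)
  case (homog k P j)
  have "hsum \<sigma> \<tau> 0 (hterm \<sigma> \<tau> P 0)" by (rule hsum.base[OF homog(1)]) simp
  then show ?case by (intro exI[of _ "hterm \<sigma> \<tau> P 0"] conjI) (assumption, simp add: hterm_def)
next
  case (add j P Q)
  then obtain H H' where "hsum \<sigma> \<tau> 0 H" "\<forall>\<xi>. \<xi> \<noteq> 0 \<longrightarrow> H \<xi> = P \<xi> * of_real (gexp \<sigma> \<tau> \<xi>)"
    "hsum \<sigma> \<tau> 0 H'" "\<forall>\<xi>. \<xi> \<noteq> 0 \<longrightarrow> H' \<xi> = Q \<xi> * of_real (gexp \<sigma> \<tau> \<xi>)" by blast
  then show ?case by (intro exI[of _ "\<lambda>\<xi>. H \<xi> + H' \<xi>"]) (simp add: hsum.add distrib_right)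
qed

lemma profile_hsum:
  assumes "poly_le j P"
  shows "\<exists>H. hsum \<sigma> \<tau> 0 H \<and> (\<forall>\<xi>. \<xi> \<noteq> 0 \<longrightarrow> H \<xi> = profile \<sigma> \<tau> P d \<xi>)"
proof -
  obtain H where H: "hsum \<sigma> \<tau> 0 H" "\<And>\<xi>. \<xi> \<noteq> 0 \<Longrightarrow> H \<xi> = P \<xi> * of_real (gexp \<sigma> \<tau> \<xi>)"
    using poly_le_hsum[OF assms] by blast
  have "hsum \<sigma> \<tau> 0 (hterm \<sigma> \<tau> (\<lambda>_. d) \<sigma>)" by (rule hsum.base[OF homog.const]) simp
  from hsum.add[OF H(1) this] show ?thesis
    by (intro exI[of _ "\<lambda>\<xi>. H \<xi> + hterm \<sigma> \<tau> (\<lambda>_. d) \<sigma> \<xi>"]) (simp add: H(2) profile_def hterm_def distrib_right mult.assoc)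
qed

text \<open>The distances involve \<open>fourier\<close> of an inverse transform of a profile. As
  that inverse transform is integrable, inversion returns the profile at every point of continuity,
  hence off the origin.\<close>

lemma profile_fourier_inverse:
  fixes P :: "real^'n::finite \<Rightarrow> complex"
  assumes N: "CARD('n) \<ge> 2" and P: "poly_le j P" and \<tau>: "\<tau> > 0" and \<sigma>: "\<sigma> > 1"
  shows "rapid 0 (profile \<sigma> \<tau> P d)" "integrable lborel (inv_fourier (profile \<sigma> \<tau> P d))"
    "\<xi> \<noteq> 0 \<Longrightarrow> fourier (inv_fourier (profile \<sigma> \<tau> P d)) \<xi> = profile \<sigma> \<tau> P d \<xi>"
proof -
  let ?F = "profile \<sigma> \<tau> P d"
  obtain H where H: "hsum \<sigma> \<tau> 0 H" "\<And>\<xi>. \<xi> \<noteq> 0 \<Longrightarrow> H \<xi> = ?F \<xi>" using profile_hsum[OF P] by blast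
  have \<sigma>0: "\<sigma> > 0" using \<sigma> by simp
  have rH: "rapid 0 H" by (rule rapid_mono[OF hsum_rapid[OF \<tau> \<sigma>0 H(1)]]) (use \<sigma> in simp)
  show rF: "rapid 0 ?F" by (rule rapid_cong[OF rH H(2)])
  have "inv_fourier H = inv_fourier ?F"
    by (intro ext inv_fourier_cong_AE H(2) rapid_measurable[OF rH] rapid_measurable[OF rF])
  then show i: "integrable lborel (inv_fourier ?F)" using hsum_inv_fourier_integrable[OF N \<tau> \<sigma> H(1)] by simp
  assume x: "\<xi> \<noteq> 0"
  obtain C where C: "C > 0" "\<And>x. x \<noteq> 0 \<Longrightarrow> norm (?F x) \<le> C * (norm x powr 0 / (1 + norm x) ^ 0)"
    using rapid_boundE[OF rF, of 0] by blast
  show "fourier (inv_fourier ?F) \<xi> = ?F \<xi>"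
  proof (rule fourier_inversion[OF rapid_integrable[OF rF] _ _ i])
    show "norm (?F y) \<le> max C (norm (?F 0))" for y using C(2)[of y] by (cases "y = 0") auto
    show "isCont ?F \<xi>" using rapid_cont[OF rF] x by (auto simp: continuous_on_eq_continuous_at open_Compl)
  qed (use N in simp)
qed

lemma frac_laplacian_profile:
  fixes u :: "real^'n::finite \<Rightarrow> complex"
  assumes N: "CARD('n) \<ge> 2" and u: "u \<in> test_functions" and s: "s > 0" and \<tau>: "\<tau> > 0" and P: "poly_le j P"
  shows "(LINT x|lborel. (cmod (frac_laplacian ((s - 1) / 4) (\<lambda>y. u y - inv_fourier (profile (1 + s) \<tau> P d) y) x))\<^sup>2)
    = (2 * pi) powr (s - 1) * weight_sq s (\<lambda>\<xi>. fourier u \<xi> - profile (1 + s) \<tau> P d \<xi>)"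
proof -
  let ?F = "profile (1 + s) \<tau> P d"
  let ?U = "\<lambda>y. u y - inv_fourier ?F y"
  have four: "4 * ((s - 1) / 4) = s - 1" by simp
  have s1: "1 + s > 1" using s by simp
  note F = profile_fourier_inverse[OF N P \<tau> s1, where d = d]
  have iu: "integrable lborel u" by (rule rapid_integrable[OF test_rapid[OF u]]) (use N in simp)
  have fU: "fourier ?U \<xi> = fourier u \<xi> - ?F \<xi>" if "\<xi> \<noteq> 0" for \<xi>
    using inv_fourier_diff[OF iu F(2), of "- \<xi>"] F(3)[OF that] by (simp add: fourier_eq_inv_fourier)
  have rd: "rapid 0 (\<lambda>\<xi>. fourier u \<xi> - ?F \<xi>)" by (rule rapid_diff[OF fourier_test_rapid[OF N u] F(1)])
  have rU: "rapid 0 (fourier ?U)" by (rule rapid_cong[OF rd]) (simp add: fU)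
  have "(LINT \<xi>|lborel. norm \<xi> powr (s - 1) * (norm (fourier ?U \<xi>))\<^sup>2) = weight_sq s (\<lambda>\<xi>. fourier u \<xi> - ?F \<xi>)"
    unfolding weight_form_def
  proof (rule integral_cong_AE)
    show "AE \<xi> in lborel. norm \<xi> powr (s - 1) * (norm (fourier ?U \<xi>))\<^sup>2 = norm \<xi> powr (s - 1) * ((fourier u \<xi> - ?F \<xi>) \<bullet> (fourier u \<xi> - ?F \<xi>))"
      using AE_lborel_nonzero by eventually_elim (simp add: fU power2_norm_eq_inner)
  qed (use rapid_measurable[OF rU] rapid_measurable[OF rd] in measurable)
  then show ?thesis using frac_laplacian_norm_sq[OF rU, of "(s - 1) / 4"] s N unfolding four by simp
qed

lemma extremals_profile:
  fixes w :: "real^'n::finite \<Rightarrow> complex" and s :: real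
  defines "m \<equiv> nat \<lfloor>s\<rfloor> + 1"
  shows "w \<in> extremals s j \<longleftrightarrow> (\<exists>P d \<tau>. w = inv_fourier (profile (1 + s) \<tau> P d) \<and> \<tau> > 0 \<and> P \<in> harmonic_polynomials (min j m) \<and> (j \<le> m \<longrightarrow> d = 0))"
  unfolding extremals_def m_def[symmetric] Let_def profile_def[abs_def] gexp_def
  by (cases "j \<le> m") (auto simp: min_def)

lemma harmonic_poly_le: "P \<in> harmonic_polynomials j \<Longrightarrow> poly_le j P"
  by (auto simp: harmonic_polynomials_def intro: polynomials_poly_le)

lemma extremals_nonempty: "extremals s j \<noteq> {}"
proof -
  have "inv_fourier (profile (1 + s) 1 (\<lambda>_. 0) 0) \<in> (extremals s j :: (real^'n::finite \<Rightarrow> complex) set)"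
    unfolding extremals_profile using zero_harmonic_polynomials by (intro exI conjI) auto
  then show "(extremals s j :: (real^'n \<Rightarrow> complex) set) \<noteq> {}" by blast
qed

lemma dist_sq_nonneg: "dist_sq s u (extremals s j) \<ge> 0"
  unfolding dist_sq_def by (intro cINF_greatest extremals_nonempty integral_nonneg_AE) auto

lemma dist_sq_le:
  fixes u :: "real^'n::finite \<Rightarrow> complex"
  assumes N: "CARD('n) \<ge> 2" and u: "u \<in> test_functions" and s: "s > 0" and \<tau>: "\<tau> > 0"
    and P: "P \<in> harmonic_polynomials (min j (nat \<lfloor>s\<rfloor> + 1))" and d: "j \<le> nat \<lfloor>s\<rfloor> + 1 \<Longrightarrow> d = 0"
  shows "dist_sq s u (extremals s j) \<le> (2 * pi) powr (s - 1) * weight_sq s (\<lambda>\<xi>. fourier u \<xi> - profile (1 + s) \<tau> P d \<xi>)"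
  unfolding dist_sq_def frac_laplacian_profile[OF N u s \<tau> harmonic_poly_le[OF P], symmetric]
proof (rule cINF_lower)
  show "bdd_below ((\<lambda>w. LINT x|lborel. (cmod (frac_laplacian ((s - 1) / 4) (\<lambda>y. u y - w y) x))\<^sup>2) ` extremals s j)"
    by (intro bdd_belowI2[of _ 0] integral_nonneg_AE) auto
  show "inv_fourier (profile (1 + s) \<tau> P d) \<in> extremals s j"
    unfolding extremals_profile using assms by blast
qed

section \<open>Eigenfunctions\<close>

text \<open>Keeps the explicit form next to the weak equation: the form decides to which families
  \<open>E\<close> belongs, the equation is what the spectral inequality uses. For fixed
  \<open>P\<close> these are functions of Laguerre type in \<open>|\<xi>|^(1 + s)\<close>.\<close>

definition eigenfunction :: "real \<Rightarrow> real \<Rightarrow> real \<Rightarrow> (real^'n::finite \<Rightarrow> complex) \<Rightarrow> bool" where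
  "eigenfunction s \<tau> \<nu> E \<longleftrightarrow> (\<exists>k P n \<gamma>. homog k P \<and> (\<forall>x. laplacian P x = 0) \<and> \<nu> = real k + real n * (1 + s)
     \<and> E = (\<lambda>\<xi>. \<Sum>l\<le>n. \<gamma> l *\<^sub>R hterm (1 + s) \<tau> P (real l * (1 + s)) \<xi>))
     \<and> E \<in> energy_class \<and> (\<forall>f\<in>energy_class. energy_form s \<tau> f E = \<nu> * weight_form s f E)"

lemma nat_mult_cases: "\<sigma> > 0 \<Longrightarrow> real n * \<sigma> = 0 \<or> real n * \<sigma> \<ge> (\<sigma>::real)"
  by (cases n) (auto simp: distrib_right)

context
  fixes s \<tau> \<sigma> :: real and k :: nat and P :: "real^'n::finite \<Rightarrow> complex"
  assumes N: "CARD('n) \<ge> 2" and s: "s > 0" and \<tau>: "\<tau> > 0" and P: "homog k P" "\<And>x. laplacian P x = 0" and \<sigma>: "\<sigma> = 1 + s"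
begin

lemma hterm_in_energy_class: "hterm \<sigma> \<tau> P (real n * \<sigma>) \<in> energy_class"
  by (rule hterm_energy_class[OF P(1) \<tau>]) (use s \<sigma> nat_mult_cases[of \<sigma> n] in auto)

text \<open>The triangular action has distinct diagonal entries \<open>k + l * \<sigma>\<close>, so
  it is diagonalizable: the next eigenfunction is the next power minus a combination of the earlier
  eigenfunctions, and each power is recovered as a plain sum of eigenfunctions.\<close>

lemma hterm_eigen_expansion:
  "\<exists>\<gamma>. (\<forall>\<xi>. hterm \<sigma> \<tau> P (real n * \<sigma>) \<xi> = (\<Sum>i\<le>n. (\<Sum>l\<le>i. \<gamma> i l *\<^sub>R hterm \<sigma> \<tau> P (real l * \<sigma>) \<xi>)))
    \<and> (\<forall>i\<le>n. \<forall>f\<in>energy_class. energy_form s \<tau> f (\<lambda>\<xi>. \<Sum>l\<le>i. \<gamma> i l *\<^sub>R hterm \<sigma> \<tau> P (real l * \<sigma>) \<xi>)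
         = (real k + real i * \<sigma>) * weight_form s f (\<lambda>\<xi>. \<Sum>l\<le>i. \<gamma> i l *\<^sub>R hterm \<sigma> \<tau> P (real l * \<sigma>) \<xi>))"
proof (induction n)
  case 0
  have "energy_form s \<tau> f (hterm \<sigma> \<tau> P 0) = real k * weight_form s f (hterm \<sigma> \<tau> P 0)" if "f \<in> energy_class" for f
    using energy_form_hterm[OF N that s \<tau> P \<sigma>, of 0] by simp
  then show ?case by (intro exI[of _ "\<lambda>_ _. 1"]) simp
next
  case (Suc n)
  interpret q: semi_inner energy_class "weight_form s :: (real^'n \<Rightarrow> complex) \<Rightarrow> _" by (rule semi_inner_weight_form[OF s])
  interpret a: semi_inner energy_class "energy_form s \<tau> :: (real^'n \<Rightarrow> complex) \<Rightarrow> _" by (rule semi_inner_energy_form[OF s \<tau>])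
  let ?F = "\<lambda>n. hterm \<sigma> \<tau> P (real n * \<sigma>)"
  have \<sigma>0: "\<sigma> > 0" using s \<sigma> by simp
  obtain \<gamma> where \<gamma>: "\<And>\<xi>. ?F n \<xi> = (\<Sum>i\<le>n. (\<Sum>l\<le>i. \<gamma> i l *\<^sub>R ?F l \<xi>))"
    "\<And>i f. i \<le> n \<Longrightarrow> f \<in> energy_class \<Longrightarrow> energy_form s \<tau> f (\<lambda>\<xi>. \<Sum>l\<le>i. \<gamma> i l *\<^sub>R ?F l \<xi>) = (real k + real i * \<sigma>) * weight_form s f (\<lambda>\<xi>. \<Sum>l\<le>i. \<gamma> i l *\<^sub>R ?F l \<xi>)"
    using Suc.IH by blast
  define e where "e i = (\<lambda>\<xi>. \<Sum>l\<le>i. \<gamma> i l *\<^sub>R ?F l \<xi>)" for i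
  have eX: "e i \<in> energy_class" for i unfolding e_def by (intro q.X_sum hterm_in_energy_class)
  have FX: "?F i \<in> energy_class" for i by (rule hterm_in_energy_class)
  let ?a = "real (Suc n) * \<sigma>"
  define C where "C = ?a * (?a + real CARD('n) - 2 + 2 * real k) / (2 * \<tau>)"
  \<comment> \<open>Solves \<open>C + \<beta> i * (k + i * \<sigma>) = (k + Suc n * \<sigma>) *
    \<beta> i\<close>; the denominator is the difference of the two eigenvalues.\<close>
  define \<beta> where "\<beta> i = C / ((real (Suc n) - real i) * \<sigma>)" for i
  define \<delta> where "\<delta> l = (if l = Suc n then 1 else - (\<Sum>i\<in>{l..n}. \<beta> i * \<gamma> i l))" for l
  \<comment> \<open>The earlier eigenfunctions are rescaled by \<open>\<beta> i\<close>, so that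
    together with \<open>E\<close> they add up to the function of index \<open>Suc n\<close> without
    further coefficients.\<close>
  define \<gamma>' where "\<gamma>' i l = (if i = Suc n then \<delta> l else \<beta> i * \<gamma> i l)" for i l
  define E where "E = (\<lambda>\<xi>. ?F (Suc n) \<xi> - (\<Sum>i\<le>n. \<beta> i *\<^sub>R e i \<xi>))"
  have sX: "(\<lambda>\<xi>. \<Sum>i\<le>n. \<beta> i *\<^sub>R e i \<xi>) \<in> energy_class" by (intro q.X_sum eX)
  have g1: "(\<Sum>l\<le>i. \<gamma>' i l *\<^sub>R ?F l \<xi>) = \<beta> i *\<^sub>R e i \<xi>" if "i \<le> n" for i \<xi>
    using that by (simp add: \<gamma>'_def e_def scaleR_sum_right)
  have g2: "(\<Sum>l\<le>Suc n. \<gamma>' (Suc n) l *\<^sub>R ?F l \<xi>) = E \<xi>" for \<xi>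
  proof -
    have "(\<Sum>i\<le>n. \<beta> i *\<^sub>R e i \<xi>) = (\<Sum>i\<le>n. \<Sum>l\<le>i. (\<beta> i * \<gamma> i l) *\<^sub>R ?F l \<xi>)" by (simp add: e_def scaleR_sum_right)
    also have "\<dots> = (\<Sum>l\<le>n. \<Sum>i\<in>{l..n}. (\<beta> i * \<gamma> i l) *\<^sub>R ?F l \<xi>)" by (simp add: sum.Sigma) (rule sum.reindex_bij_witness[of _ "\<lambda>(l, i). (i, l)" "\<lambda>(i, l). (l, i)"], auto)
    also have "\<dots> = (\<Sum>l\<le>n. (\<Sum>i\<in>{l..n}. \<beta> i * \<gamma> i l) *\<^sub>R ?F l \<xi>)" by (simp only: scaleR_sum_left)
    finally have "(\<Sum>l\<le>n. \<gamma>' (Suc n) l *\<^sub>R ?F l \<xi>) = - (\<Sum>i\<le>n. \<beta> i *\<^sub>R e i \<xi>)"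
      by (simp add: \<gamma>'_def \<delta>_def sum_negf)
    then show ?thesis by (simp add: E_def \<gamma>'_def \<delta>_def)
  qed
  have eig: "energy_form s \<tau> f (e i) = (real k + real i * \<sigma>) * weight_form s f (e i)" if "f \<in> energy_class" "i \<le> n" for f i
    unfolding e_def by (rule \<gamma>(2)[OF that(2,1)])
  have eigE: "energy_form s \<tau> f E = (real k + ?a) * weight_form s f E" if f: "f \<in> energy_class" for f
  proof -
    let ?W = "\<lambda>i. weight_form s f (e i)"
    have Fn: "?F n = (\<lambda>\<xi>. \<Sum>i\<le>n. 1 *\<^sub>R e i \<xi>)" using \<gamma>(1) by (auto simp: e_def)
    have w: "weight_form s f (?F n) = (\<Sum>i\<le>n. ?W i)"
      unfolding Fn by (subst q.q_sum_right[OF f]) (auto intro: eX)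
    have "?a \<ge> \<sigma>" using \<sigma>0 by (simp add: distrib_right)
    then have h: "energy_form s \<tau> f (?F (Suc n)) = (real k + ?a) * weight_form s f (?F (Suc n)) - C * weight_form s f (?F n)"
      using energy_form_hterm[OF N f s \<tau> P \<sigma>, of ?a] by (simp add: C_def distrib_right)
    have "energy_form s \<tau> f E = energy_form s \<tau> f (?F (Suc n)) - (\<Sum>i\<le>n. \<beta> i * energy_form s \<tau> f (e i))"
      unfolding E_def by (subst a.q_diff_right[OF FX sX f], subst a.q_sum_right[OF f]) (auto intro: eX)
    also have "\<dots> = (real k + ?a) * weight_form s f (?F (Suc n)) - (\<Sum>i\<le>n. (C + \<beta> i * (real k + real i * \<sigma>)) * ?W i)"
      unfolding h w using eig[OF f] by (simp add: sum_distrib_left sum.distrib distrib_right mult.assoc)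
    also have "(\<Sum>i\<le>n. (C + \<beta> i * (real k + real i * \<sigma>)) * ?W i) = (\<Sum>i\<le>n. (real k + ?a) * (\<beta> i * ?W i))"
    proof (intro sum.cong refl)
      fix i assume "i \<in> {..n}"
      then have nz: "(real (Suc n) - real i) * \<sigma> \<noteq> 0" using \<sigma>0 by auto
      then have "C = \<beta> i * ((real (Suc n) - real i) * \<sigma>)" unfolding \<beta>_def by simp
      then have "C + \<beta> i * (real k + real i * \<sigma>) = (real k + ?a) * \<beta> i" by (simp only:) (simp only: algebra_simps)
      then show "(C + \<beta> i * (real k + real i * \<sigma>)) * ?W i = (real k + ?a) * (\<beta> i * ?W i)" by (simp only: mult.assoc)
    qed
    also have "(real k + ?a) * weight_form s f (?F (Suc n)) - (\<Sum>i\<le>n. (real k + ?a) * (\<beta> i * ?W i)) = (real k + ?a) * (weight_form s f (?F (Suc n)) - (\<Sum>i\<le>n. \<beta> i * ?W i))"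
      by (simp only: right_diff_distrib sum_distrib_left)
    also have "weight_form s f (?F (Suc n)) - (\<Sum>i\<le>n. \<beta> i * ?W i) = weight_form s f E"
      unfolding E_def by (subst q.q_diff_right[OF FX sX f], subst q.q_sum_right[OF f]) (auto intro: eX)
    finally show ?thesis .
  qed
  show ?case
  proof (intro exI[of _ \<gamma>'] conjI allI impI ballI)
    fix \<xi>
    have "(\<Sum>i\<le>Suc n. (\<Sum>l\<le>i. \<gamma>' i l *\<^sub>R ?F l \<xi>)) = (\<Sum>i\<le>n. \<beta> i *\<^sub>R e i \<xi>) + E \<xi>"
      by (simp only: sum.atMost_Suc g2[unfolded sum.atMost_Suc]) (simp add: g1)
    then show "?F (Suc n) \<xi> = (\<Sum>i\<le>Suc n. (\<Sum>l\<le>i. \<gamma>' i l *\<^sub>R ?F l \<xi>))" by (simp add: E_def)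
  next
    fix i f assume i: "i \<le> Suc n" and f: "f \<in> (energy_class :: (real^'n \<Rightarrow> complex) set)"
    show "energy_form s \<tau> f (\<lambda>\<xi>. \<Sum>l\<le>i. \<gamma>' i l *\<^sub>R ?F l \<xi>) = (real k + real i * \<sigma>) * weight_form s f (\<lambda>\<xi>. \<Sum>l\<le>i. \<gamma>' i l *\<^sub>R ?F l \<xi>)"
    proof (cases "i = Suc n")
      case True
      show ?thesis unfolding True g2 by (rule eigE[OF f])
    next
      case False
      then have "i \<le> n" using i by simp
      have "energy_form s \<tau> f (\<lambda>\<xi>. \<beta> i *\<^sub>R e i \<xi>) = \<beta> i * energy_form s \<tau> f (e i)"
        using a.q_sum_right[OF f, of "{i}" e \<beta>] eX by simp
      moreover have "weight_form s f (\<lambda>\<xi>. \<beta> i *\<^sub>R e i \<xi>) = \<beta> i * weight_form s f (e i)"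
        using q.q_sum_right[OF f, of "{i}" e \<beta>] eX by simp
      ultimately show ?thesis unfolding g1[OF \<open>i \<le> n\<close>] eig[OF f \<open>i \<le> n\<close>] by (simp add: mult_ac)
    qed
  qed
qed

end

text \<open>Plain sums suffice, because scalar factors are absorbed into the eigenfunctions.\<close>

definition eigen_span :: "real \<Rightarrow> real \<Rightarrow> (real^'n::finite \<Rightarrow> complex) set" where
  "eigen_span s \<tau> = {\<lambda>\<xi>. \<Sum>i<n. b i \<xi> | b (n::nat). \<forall>i<n. \<exists>\<nu>. eigenfunction s \<tau> \<nu> (b i :: real^'n \<Rightarrow> complex)}"

lemma eigen_spanI: "eigenfunction s \<tau> \<nu> E \<Longrightarrow> E \<in> eigen_span s \<tau>"
  unfolding eigen_span_def by (intro CollectI exI[of _ "\<lambda>_. E"] exI[of _ 1]) auto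

lemma eigen_span_zero: "(\<lambda>\<xi>. 0) \<in> eigen_span s \<tau>"
  unfolding eigen_span_def by (intro CollectI exI[of _ "\<lambda>_ _. 0"] exI[of _ 0]) auto

lemma eigen_span_add:
  assumes "f \<in> eigen_span s \<tau>" "g \<in> eigen_span s \<tau>" shows "(\<lambda>\<xi>. f \<xi> + g \<xi>) \<in> eigen_span s \<tau>"
proof -
  obtain b c and n m :: nat where b: "\<forall>i<n. \<exists>\<nu>. eigenfunction s \<tau> \<nu> (b i)" "f = (\<lambda>\<xi>. \<Sum>i<n. b i \<xi>)"
    and c: "\<forall>i<m. \<exists>\<nu>. eigenfunction s \<tau> \<nu> (c i)" "g = (\<lambda>\<xi>. \<Sum>i<m. c i \<xi>)"
    using assms unfolding eigen_span_def by blast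
  let ?d = "\<lambda>i. if i < n then b i else c (i - n)"
  have "(\<Sum>i<n + m. ?d i \<xi>) = f \<xi> + g \<xi>" for \<xi>
  proof -
    have "(\<Sum>i<n + m. g i) = (\<Sum>i<n. g i) + (\<Sum>i<m. g (n + i))" for g :: "nat \<Rightarrow> complex"
      by (induction m) (simp_all add: add.assoc)
    from this[of "\<lambda>i. ?d i \<xi>"] have "(\<Sum>i<n + m. ?d i \<xi>) = (\<Sum>i<n. ?d i \<xi>) + (\<Sum>i<m. ?d (n + i) \<xi>)" .
    then show ?thesis by (simp add: b c)
  qed
  then have "(\<lambda>\<xi>. f \<xi> + g \<xi>) = (\<lambda>\<xi>. \<Sum>i<n + m. ?d i \<xi>)" by (simp only:)
  moreover have "\<forall>i<n + m. \<exists>\<nu>. eigenfunction s \<tau> \<nu> (?d i)" using b(1) c(1) by auto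
  ultimately show ?thesis unfolding eigen_span_def by (intro CollectI exI[of _ ?d] exI[of _ "n + m"] conjI)
qed

lemma eigen_span_sum: "finite I \<Longrightarrow> (\<And>i. i \<in> I \<Longrightarrow> f i \<in> eigen_span s \<tau>) \<Longrightarrow> (\<lambda>\<xi>. \<Sum>i\<in>I. f i \<xi>) \<in> eigen_span s \<tau>"
proof (induction I rule: finite_induct)
  case (insert i I)
  then have "(\<lambda>\<xi>. f i \<xi> + (\<Sum>i\<in>I. f i \<xi>)) \<in> eigen_span s \<tau>" by (intro eigen_span_add) simp_all
  then show ?case using insert.hyps by simp
qed (simp add: eigen_span_zero)

lemma eigen_span_hterm:
  fixes P :: "real^'n::finite \<Rightarrow> complex"
  assumes N: "CARD('n) \<ge> 2" and s: "s > 0" and \<tau>: "\<tau> > 0" and P: "homog k P" "\<And>x. laplacian P x = 0"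
  shows "(\<lambda>\<xi>. c *\<^sub>R hterm (1 + s) \<tau> P (real n * (1 + s)) \<xi>) \<in> eigen_span s \<tau>"
proof -
  interpret q: semi_inner energy_class "weight_form s :: (real^'n \<Rightarrow> complex) \<Rightarrow> _" by (rule semi_inner_weight_form[OF s])
  interpret a: semi_inner energy_class "energy_form s \<tau> :: (real^'n \<Rightarrow> complex) \<Rightarrow> _" by (rule semi_inner_energy_form[OF s \<tau>])
  let ?F = "\<lambda>l. hterm (1 + s) \<tau> P (real l * (1 + s))"
  obtain \<gamma> where \<gamma>: "\<And>\<xi>. ?F n \<xi> = (\<Sum>i\<le>n. (\<Sum>l\<le>i. \<gamma> i l *\<^sub>R ?F l \<xi>))"
    "\<And>i f. i \<le> n \<Longrightarrow> f \<in> energy_class \<Longrightarrow> energy_form s \<tau> f (\<lambda>\<xi>. \<Sum>l\<le>i. \<gamma> i l *\<^sub>R ?F l \<xi>) = (real k + real i * (1 + s)) * weight_form s f (\<lambda>\<xi>. \<Sum>l\<le>i. \<gamma> i l *\<^sub>R ?F l \<xi>)"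
    using hterm_eigen_expansion[OF N s \<tau> P refl, of n] by blast
  have FX: "?F l \<in> energy_class" for l by (rule hterm_in_energy_class[OF N s \<tau> P refl])
  have eX: "(\<lambda>\<xi>. \<Sum>l\<le>i. \<gamma> i l *\<^sub>R ?F l \<xi>) \<in> energy_class" for i by (intro q.X_sum FX)
  have "eigenfunction s \<tau> (real k + real i * (1 + s)) (\<lambda>\<xi>. \<Sum>l\<le>i. (c * \<gamma> i l) *\<^sub>R ?F l \<xi>)" if "i \<le> n" for i
    unfolding eigenfunction_def
  proof (intro conjI ballI)
    show "\<exists>k' P' n' \<gamma>'. homog k' P' \<and> (\<forall>x. laplacian P' x = 0) \<and> real k + real i * (1 + s) = real k' + real n' * (1 + s)
     \<and> (\<lambda>\<xi>. \<Sum>l\<le>i. (c * \<gamma> i l) *\<^sub>R ?F l \<xi>) = (\<lambda>\<xi>. \<Sum>l\<le>n'. \<gamma>' l *\<^sub>R hterm (1 + s) \<tau> P' (real l * (1 + s)) \<xi>)"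
      using P by (intro exI[of _ k] exI[of _ P] exI[of _ i] exI[of _ "\<lambda>l. c * \<gamma> i l"]) auto
    show "(\<lambda>\<xi>. \<Sum>l\<le>i. (c * \<gamma> i l) *\<^sub>R ?F l \<xi>) \<in> energy_class" by (intro q.X_sum FX)
    fix f assume f: "f \<in> (energy_class :: (real^'n \<Rightarrow> complex) set)"
    have e: "(\<lambda>\<xi>. \<Sum>l\<le>i. (c * \<gamma> i l) *\<^sub>R ?F l \<xi>) = (\<lambda>\<xi>. \<Sum>j\<in>{i}. c *\<^sub>R (\<Sum>l\<le>j. \<gamma> j l *\<^sub>R ?F l \<xi>))"
      by (simp add: scaleR_sum_right)
    show "energy_form s \<tau> f (\<lambda>\<xi>. \<Sum>l\<le>i. (c * \<gamma> i l) *\<^sub>R ?F l \<xi>) = (real k + real i * (1 + s)) * weight_form s f (\<lambda>\<xi>. \<Sum>l\<le>i. (c * \<gamma> i l) *\<^sub>R ?F l \<xi>)"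
      unfolding e a.q_sum_right[OF f eX] q.q_sum_right[OF f eX] using \<gamma>(2)[OF that f] by simp
  qed
  then have "(\<lambda>\<xi>. \<Sum>i\<le>n. (\<Sum>l\<le>i. (c * \<gamma> i l) *\<^sub>R ?F l \<xi>)) \<in> eigen_span s \<tau>"
    by (intro eigen_span_sum eigen_spanI) auto
  moreover have "(\<lambda>\<xi>. \<Sum>i\<le>n. (\<Sum>l\<le>i. (c * \<gamma> i l) *\<^sub>R ?F l \<xi>)) = (\<lambda>\<xi>. c *\<^sub>R ?F n \<xi>)"
    unfolding \<gamma>(1) by (simp add: scaleR_sum_right)
  ultimately show ?thesis by (simp only:)
qed

section \<open>Completeness of the eigenfunctions\<close>

lemma weight_form_nonneg: "weight_sq s f \<ge> 0"
  unfolding weight_form_def by (intro integral_nonneg_AE) auto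

lemma weight_form_scaleR: "weight_sq s (\<lambda>\<xi>. c *\<^sub>R f \<xi>) = c\<^sup>2 * weight_sq s f"
  unfolding weight_form_def by (simp add: power2_eq_square mult_ac flip: integral_mult_right_zero)

lemma weight_form_mono:
  fixes f g :: "real^'n::finite \<Rightarrow> complex"
  assumes "rapid 0 f" "rapid 0 g" "s > 0" and le: "\<And>\<xi>. \<xi> \<noteq> 0 \<Longrightarrow> norm (f \<xi>) \<le> norm (g \<xi>)"
  shows "weight_sq s f \<le> weight_sq s g"
  unfolding weight_form_def
proof (rule integral_mono_AE)
  show "AE \<xi> in lborel. norm \<xi> powr (s - 1) * (f \<xi> \<bullet> f \<xi>) \<le> norm \<xi> powr (s - 1) * (g \<xi> \<bullet> g \<xi>)"
    using AE_lborel_nonzero by eventually_elim (auto intro!: mult_left_mono power_mono le simp: power2_norm_eq_inner[symmetric])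
qed (use integrable_weight_form assms in blast)+

lemma weight_form_add_le:
  fixes f g :: "real^'n::finite \<Rightarrow> complex"
  assumes r: "rapid 0 f" "rapid 0 g" and s: "s > 0"
  shows "weight_sq s (\<lambda>\<xi>. f \<xi> + g \<xi>) \<le> 2 * weight_sq s f + 2 * weight_sq s g"
proof -
  note i = integrable_weight_form[OF r(1) r(1) s] integrable_weight_form[OF r(2) r(2) s]
  have "weight_sq s (\<lambda>\<xi>. f \<xi> + g \<xi>)
     \<le> (LINT \<xi>|lborel. 2 * (norm \<xi> powr (s - 1) * (f \<xi> \<bullet> f \<xi>)) + 2 * (norm \<xi> powr (s - 1) * (g \<xi> \<bullet> g \<xi>)))"
    unfolding weight_form_def
  proof (rule integral_mono[OF integrable_weight_form[OF rapid_add[OF r] rapid_add[OF r] s]])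
    show "integrable lborel (\<lambda>\<xi>. 2 * (norm \<xi> powr (s - 1) * (f \<xi> \<bullet> f \<xi>)) + 2 * (norm \<xi> powr (s - 1) * (g \<xi> \<bullet> g \<xi>)))"
      by (intro Bochner_Integration.integrable_add integrable_mult_right i)
    fix \<xi>
    have "(f \<xi> + g \<xi>) \<bullet> (f \<xi> + g \<xi>) + (f \<xi> - g \<xi>) \<bullet> (f \<xi> - g \<xi>) = 2 * (f \<xi> \<bullet> f \<xi>) + 2 * (g \<xi> \<bullet> g \<xi>)"
      by (simp add: inner_simps)
    then have "(f \<xi> + g \<xi>) \<bullet> (f \<xi> + g \<xi>) \<le> 2 * (f \<xi> \<bullet> f \<xi>) + 2 * (g \<xi> \<bullet> g \<xi>)"
      using inner_ge_zero[of "f \<xi> - g \<xi>"] by linarith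
    then have "norm \<xi> powr (s - 1) * ((f \<xi> + g \<xi>) \<bullet> (f \<xi> + g \<xi>)) \<le> norm \<xi> powr (s - 1) * (2 * (f \<xi> \<bullet> f \<xi>) + 2 * (g \<xi> \<bullet> g \<xi>))"
      by (intro mult_left_mono) auto
    then show "norm \<xi> powr (s - 1) * ((f \<xi> + g \<xi>) \<bullet> (f \<xi> + g \<xi>)) \<le> 2 * (norm \<xi> powr (s - 1) * (f \<xi> \<bullet> f \<xi>)) + 2 * (norm \<xi> powr (s - 1) * (g \<xi> \<bullet> g \<xi>))"
      by (simp only: distrib_left mult.left_commute)
  qed
  also have "\<dots> = 2 * weight_sq s f + 2 * weight_sq s g"
    unfolding weight_form_def by (subst Bochner_Integration.integral_add) (use i in auto)
  finally show ?thesis .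
qed

lemma eigen_span_rapid: "f \<in> eigen_span s \<tau> \<Longrightarrow> rapid 0 f"
  unfolding eigen_span_def eigenfunction_def by (auto intro: rapid_sum energy_classD(1))

definition eigen_closure :: "real \<Rightarrow> real \<Rightarrow> (real^'n::finite \<Rightarrow> complex) set" where
  "eigen_closure s \<tau> = {f. rapid 0 f \<and> (\<forall>\<epsilon>>0. \<exists>G\<in>eigen_span s \<tau>. weight_sq s (\<lambda>\<xi>. f \<xi> - G \<xi>) \<le> \<epsilon>)}"

lemma eigen_closure_rapid: "f \<in> eigen_closure s \<tau> \<Longrightarrow> rapid 0 f"
  by (simp add: eigen_closure_def)

context
  fixes s \<tau> :: real
  assumes s: "s > 0" and \<tau>: "\<tau> > 0"
begin

lemma eigen_closure_limit:
  fixes f :: "real^'n::finite \<Rightarrow> complex"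
  assumes f: "rapid 0 f" and l: "\<And>\<epsilon>. \<epsilon> > 0 \<Longrightarrow> \<exists>g\<in>eigen_closure s \<tau>. weight_sq s (\<lambda>\<xi>. f \<xi> - g \<xi>) \<le> \<epsilon>"
  shows "f \<in> eigen_closure s \<tau>"
  unfolding eigen_closure_def
proof (intro CollectI conjI f allI impI)
  fix \<epsilon> :: real assume e: "\<epsilon> > 0"
  obtain g where g: "g \<in> eigen_closure s \<tau>" "weight_sq s (\<lambda>\<xi>. f \<xi> - g \<xi>) \<le> \<epsilon> / 4"
    using l[of "\<epsilon> / 4"] e by auto
  obtain G where G: "G \<in> eigen_span s \<tau>" "weight_sq s (\<lambda>\<xi>. g \<xi> - G \<xi>) \<le> \<epsilon> / 4"
    using g(1) e unfolding eigen_closure_def by (auto dest!: spec[of _ "\<epsilon> / 4"])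
  have "weight_sq s (\<lambda>\<xi>. (f \<xi> - g \<xi>) + (g \<xi> - G \<xi>)) \<le> 2 * (\<epsilon> / 4) + 2 * (\<epsilon> / 4)"
    using weight_form_add_le[OF rapid_diff[OF f eigen_closure_rapid[OF g(1)]] rapid_diff[OF eigen_closure_rapid[OF g(1)] eigen_span_rapid[OF G(1)]] s] g(2) G(2)
    by linarith
  then show "\<exists>G\<in>eigen_span s \<tau>. weight_sq s (\<lambda>\<xi>. f \<xi> - G \<xi>) \<le> \<epsilon>"
    using G(1) by (intro bexI[of _ G]) simp_all
qed

lemma eigen_closure_add:
  fixes f g :: "real^'n::finite \<Rightarrow> complex"
  assumes f: "f \<in> eigen_closure s \<tau>" and g: "g \<in> eigen_closure s \<tau>"
  shows "(\<lambda>\<xi>. f \<xi> + g \<xi>) \<in> eigen_closure s \<tau>"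
  unfolding eigen_closure_def
proof (intro CollectI conjI rapid_add eigen_closure_rapid[OF f] eigen_closure_rapid[OF g] allI impI)
  fix \<epsilon> :: real assume e: "\<epsilon> > 0"
  obtain F where F: "F \<in> eigen_span s \<tau>" "weight_sq s (\<lambda>\<xi>. f \<xi> - F \<xi>) \<le> \<epsilon> / 4"
    using f e unfolding eigen_closure_def by (auto dest!: spec[of _ "\<epsilon> / 4"])
  obtain G where G: "G \<in> eigen_span s \<tau>" "weight_sq s (\<lambda>\<xi>. g \<xi> - G \<xi>) \<le> \<epsilon> / 4"
    using g e unfolding eigen_closure_def by (auto dest!: spec[of _ "\<epsilon> / 4"])
  have "weight_sq s (\<lambda>\<xi>. (f \<xi> - F \<xi>) + (g \<xi> - G \<xi>)) \<le> 2 * (\<epsilon> / 4) + 2 * (\<epsilon> / 4)"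
    using weight_form_add_le[OF rapid_diff[OF eigen_closure_rapid[OF f] eigen_span_rapid[OF F(1)]] rapid_diff[OF eigen_closure_rapid[OF g] eigen_span_rapid[OF G(1)]] s] F(2) G(2)
    by linarith
  then show "\<exists>H\<in>eigen_span s \<tau>. weight_sq s (\<lambda>\<xi>. f \<xi> + g \<xi> - H \<xi>) \<le> \<epsilon>"
    by (intro bexI[of _ "\<lambda>\<xi>. F \<xi> + G \<xi>"] eigen_span_add F(1) G(1)) (simp add: algebra_simps)
qed

text \<open>With \<open>t = |\<xi>|^(1 + s)\<close> the radial factor becomes a continuous function
  of compact support on the half-line, and \<open>H\<close> times a polynomial in \<open>t\<close>
  times \<open>exp (- \<tau> t / (1 + s))\<close> lies in \<open>eigen_span\<close>.\<close>

lemma eigen_closure_harmonic: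
  fixes H :: "real^'n::finite \<Rightarrow> complex"
  assumes N: "CARD('n) \<ge> 2" and H: "homog k H" "\<And>x. laplacian H x = 0" and h: "continuous_on {0..} h" and R: "R > 0" "\<And>r. r > R \<Longrightarrow> h r = 0"
  shows "(\<lambda>\<xi>. H \<xi> * of_real (h (norm \<xi>))) \<in> eigen_closure s \<tau>"
  unfolding eigen_closure_def
proof (intro CollectI conjI allI impI)
  let ?f = "\<lambda>\<xi>. H \<xi> * complex_of_real (h (norm \<xi>))"
  let ?\<sigma> = "1 + s"
  have \<sigma>0: "?\<sigma> > 0" using s by simp
  show rf: "rapid 0 ?f"
  proof (rule rapid_compact_support[where R = R])
    show "continuous_on UNIV ?f"
      by (intro continuous_intros homog_continuous[OF H(1)] continuous_on_compose2[OF h]) auto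
  qed (simp add: R)
  \<comment> \<open>Half the rate: the approximation error is at most \<delta> times this function,
    whose weighted norm is finite.\<close>
  let ?K = "hterm ?\<sigma> (\<tau> / 2) H 0"
  have rK: "rapid 0 ?K" by (rule rapid_hterm[OF H(1)]) (use s \<tau> in auto)
  fix \<epsilon> :: real assume e: "\<epsilon> > 0"
  define C where "C = weight_sq s ?K"
  have C: "C \<ge> 0" unfolding C_def by (rule weight_form_nonneg)
  \<comment> \<open>The minimum with 1 makes \<open>\<delta>^2 * C\<close> at most
    \<open>\<delta> * C\<close>, and the quotient makes that at most \<epsilon>.\<close>
  define \<delta> where "\<delta> = min 1 (\<epsilon> / (C + 1))"
  have \<delta>: "\<delta> > 0" "\<delta> \<le> 1" "\<delta> * C \<le> \<epsilon>"
  proof -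
    show "\<delta> > 0" "\<delta> \<le> 1" using e C by (auto simp: \<delta>_def)
    have "\<delta> * C \<le> \<epsilon> / (C + 1) * (C + 1)" using C e by (intro mult_mono) (auto simp: \<delta>_def)
    then show "\<delta> * C \<le> \<epsilon>" using C by simp
  qed
  define h' where "h' t = h (t powr (1 / ?\<sigma>))" for t
  have h'c: "continuous_on {0..} h'"
    unfolding h'_def using s by (intro continuous_on_compose2[OF h] continuous_on_powr' continuous_intros) auto
  have h'R: "h' t = 0" if "t \<ge> (R + 1) powr ?\<sigma>" for t
  proof -
    have "((R + 1) powr ?\<sigma>) powr (1 / ?\<sigma>) \<le> t powr (1 / ?\<sigma>)" by (rule powr_mono2) (use that s in auto)
    then show ?thesis using R \<sigma>0 by (simp add: h'_def powr_powr)
  qed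
  have b: "\<tau> / ?\<sigma> > 0" using \<tau> \<sigma>0 by simp
  have "(R + 1) powr ?\<sigma> > 0" using R by simp
  from laguerre_dense[OF b h'c this h'R \<delta>(1)] obtain q where
    q: "\<And>t. t \<ge> 0 \<Longrightarrow> \<bar>h' t - poly q t * exp (- (\<tau> / ?\<sigma>) * t)\<bar> \<le> \<delta> * exp (- (\<tau> / ?\<sigma> / 2) * t)" by blast
  define G where "G = (\<lambda>\<xi>. \<Sum>l\<le>degree q. coeff q l *\<^sub>R hterm ?\<sigma> \<tau> H (real l * ?\<sigma>) \<xi>)"
  have G: "G \<in> eigen_span s \<tau>"
    unfolding G_def by (intro eigen_span_sum eigen_span_hterm[OF N s \<tau> H]) auto
  have Ge: "G \<xi> = H \<xi> * of_real (poly q (norm \<xi> powr ?\<sigma>) * exp (- (\<tau> / ?\<sigma>) * norm \<xi> powr ?\<sigma>))" if "\<xi> \<noteq> 0" for \<xi>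
  proof -
    have "norm \<xi> powr (real l * ?\<sigma>) = (norm \<xi> powr ?\<sigma>) ^ l" for l
      using that by (simp add: powr_realpow[symmetric] powr_powr mult.commute)
    then show ?thesis
      by (simp add: G_def hterm_def gexp_def poly_altdef sum_distrib_left sum_distrib_right scaleR_conv_of_real mult_ac)
  qed
  have "weight_sq s (\<lambda>\<xi>. ?f \<xi> - G \<xi>) \<le> weight_sq s (\<lambda>\<xi>. \<delta> *\<^sub>R ?K \<xi>)"
  proof (rule weight_form_mono[OF rapid_diff[OF rf eigen_span_rapid[OF G]] rapid_scaleR[OF rK] s])
    fix \<xi> :: "real^'n" assume \<xi>: "\<xi> \<noteq> 0"
    let ?t = "norm \<xi> powr ?\<sigma>"
    have ht: "h' ?t = h (norm \<xi>)" using \<sigma>0 by (simp add: h'_def powr_powr)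
    have "?f \<xi> - G \<xi> = H \<xi> * of_real (h' ?t - poly q ?t * exp (- (\<tau> / ?\<sigma>) * ?t))"
      unfolding Ge[OF \<xi>] ht by (simp only: of_real_diff right_diff_distrib)
    then have "norm (?f \<xi> - G \<xi>) = norm (H \<xi>) * \<bar>h' ?t - poly q ?t * exp (- (\<tau> / ?\<sigma>) * ?t)\<bar>"
      by (simp only: norm_mult norm_of_real)
    moreover have "\<dots> \<le> norm (H \<xi>) * (\<delta> * exp (- (\<tau> / ?\<sigma> / 2) * ?t))" by (intro mult_left_mono q) auto
    moreover have "norm (\<delta> *\<^sub>R ?K \<xi>) = norm (H \<xi>) * (\<delta> * exp (- (\<tau> / ?\<sigma> / 2) * ?t))"
      using \<delta>(1) \<xi> by (simp add: hterm_def gexp_def norm_mult)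
    ultimately show "norm (?f \<xi> - G \<xi>) \<le> norm (\<delta> *\<^sub>R ?K \<xi>)" by linarith
  qed
  also have "\<dots> = \<delta> * (\<delta> * C)" unfolding weight_form_scaleR C_def by (simp add: power2_eq_square)
  also have "\<dots> \<le> 1 * (\<delta> * C)" using \<delta> C by (intro mult_right_mono) auto
  finally show "\<exists>G\<in>eigen_span s \<tau>. weight_sq s (\<lambda>\<xi>. ?f \<xi> - G \<xi>) \<le> \<epsilon>"
    using \<delta>(3) G by (intro bexI[of _ G]) simp_all
qed

text \<open>The Fischer decomposition splits \<open>Q\<close> into terms
  \<open>|\<xi>|^(2 j) H\<close>, and the power of the norm joins the radial factor.\<close>

lemma eigen_closure_polynomial:
  fixes Q :: "real^'n::finite \<Rightarrow> complex"
  assumes N: "CARD('n) \<ge> 2" and Q: "poly_le j Q" and h: "continuous_on {0..} h" and R: "R > 0" "\<And>r. r > R \<Longrightarrow> h r = 0"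
  shows "(\<lambda>\<xi>. Q \<xi> * of_real (h (norm \<xi>))) \<in> eigen_closure s \<tau>"
  using Q
proof (induction rule: poly_le.induct)
  case (homog k P j)
  from homog_fischer[OF homog(1)] show ?case
  proof (induction rule: fischer.induct)
    case (base k H j)
    have "(\<lambda>\<xi>. H \<xi> * of_real (norm \<xi> ^ (2 * j) * h (norm \<xi>))) \<in> eigen_closure s \<tau>"
      by (rule eigen_closure_harmonic[OF N base, where h = "\<lambda>r. r ^ (2 * j) * h r"]) (auto intro!: continuous_intros h R)
    then show ?case by (simp add: mult_ac)
  next
    case (add k P Q)
    from eigen_closure_add[OF add.IH] show ?case by (simp add: distrib_right)
  qed
next
  case (add j P Q)
  from eigen_closure_add[OF add.IH] show ?case by (simp add: distrib_right)
qed

text \<open>A radial cutoff reduces to compact support, where Stone-Weierstrass replaces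
  \<open>f\<close> by a polynomial while the cutoff is kept as the radial factor. The tail is small
  because \<open>1 - h R r \<le> r / R\<close>.\<close>

theorem eigen_closure_continuous:
  fixes f :: "real^'n::finite \<Rightarrow> complex"
  assumes N: "CARD('n) \<ge> 2" and c: "continuous_on UNIV f" and f: "rapid 0 f"
  shows "f \<in> eigen_closure s \<tau>"
proof (rule eigen_closure_limit[OF f])
  define h where "h R r = max 0 (min 1 (R + 1 - r))" for R r :: real
  have hc: "continuous_on A (h R)" for R A unfolding h_def by (intro continuous_intros)
  have h01: "0 \<le> h R r" "h R r \<le> 1" for R r by (auto simp: h_def)
  have hR: "h R r = 0" if "r > R + 1" for R r using that by (simp add: h_def)
  have hR': "h R r = 1" if "r \<le> R" for R r using that by (simp add: h_def)
  let ?\<chi> = "\<lambda>R \<xi>. complex_of_real (h R (norm (\<xi> :: real^'n)))"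
  have \<chi>c: "continuous_on UNIV (?\<chi> R)" for R by (intro continuous_intros continuous_on_compose2[OF hc[of UNIV]]) auto
  have r\<chi>: "rapid 0 (?\<chi> R)" for R by (rule rapid_compact_support[OF \<chi>c, where R = "R + 1"]) (simp add: hR)
  have rf\<chi>: "rapid 0 (\<lambda>\<xi>. g \<xi> * ?\<chi> R \<xi>)" if "continuous_on UNIV g" for g :: "real^'n \<Rightarrow> complex" and R
    by (rule rapid_compact_support[where R = "R + 1"]) (auto intro!: continuous_on_mult that \<chi>c simp: hR)
  have cl: "(\<lambda>\<xi>. f \<xi> * ?\<chi> R \<xi>) \<in> eigen_closure s \<tau>" if R: "R > 0" for R
  proof (rule eigen_closure_limit[OF rf\<chi>[OF c]])
    fix \<epsilon> :: real assume e: "\<epsilon> > 0"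
    define C where "C = weight_sq s (?\<chi> R)"
    have C: "C \<ge> 0" unfolding C_def by (rule weight_form_nonneg)
    define \<delta> where "\<delta> = min 1 (\<epsilon> / (C + 1))"
    have \<delta>: "\<delta> > 0" "\<delta> \<le> 1" "\<delta> * C \<le> \<epsilon>"
    proof -
      show "\<delta> > 0" "\<delta> \<le> 1" using e C by (auto simp: \<delta>_def)
      have "\<delta> * C \<le> \<epsilon> / (C + 1) * (C + 1)" using C e by (intro mult_mono) (auto simp: \<delta>_def)
      then show "\<delta> * C \<le> \<epsilon>" using C by simp
    qed
    let ?B = "cball 0 (R + 1) :: (real^'n) set"
    have cB: "continuous_on ?B (\<lambda>\<xi>. Re (f \<xi>))" "continuous_on ?B (\<lambda>\<xi>. Im (f \<xi>))"
      by (intro continuous_intros continuous_on_subset[OF c]; simp)+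
    obtain p1 where p1: "real_polynomial_function p1" "\<And>\<xi>. \<xi> \<in> ?B \<Longrightarrow> \<bar>Re (f \<xi>) - p1 \<xi>\<bar> < \<delta> / 2"
      using Stone_Weierstrass_real_polynomial_function[OF compact_cball cB(1), of "\<delta> / 2"] \<delta>(1) by auto
    obtain p2 where p2: "real_polynomial_function p2" "\<And>\<xi>. \<xi> \<in> ?B \<Longrightarrow> \<bar>Im (f \<xi>) - p2 \<xi>\<bar> < \<delta> / 2"
      using Stone_Weierstrass_real_polynomial_function[OF compact_cball cB(2), of "\<delta> / 2"] \<delta>(1) by auto
    obtain j1 where j1: "poly_le j1 (\<lambda>\<xi>. complex_of_real (p1 \<xi>))" using poly_le_real_polynomial_function[OF p1(1)] by blast
    obtain j2 where j2: "poly_le j2 (\<lambda>\<xi>. complex_of_real (p2 \<xi>))" using poly_le_real_polynomial_function[OF p2(1)] by blast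
    \<comment> \<open>Real and imaginary parts are approximated separately; the factor \<i> is
      absorbed as a constant polynomial.\<close>
    define p where "p \<xi> = complex_of_real (p1 \<xi>) + complex_of_real (p2 \<xi>) * \<i>" for \<xi>
    have R1: "R + 1 > 0" using R by simp
    have "(\<lambda>\<xi>. complex_of_real (p1 \<xi>) * ?\<chi> R \<xi> + complex_of_real (p2 \<xi>) * \<i> * ?\<chi> R \<xi>) \<in> eigen_closure s \<tau>"
      by (intro eigen_closure_add eigen_closure_polynomial[OF N j1 hc R1 hR] eigen_closure_polynomial[OF N poly_le_mult_homog[OF j2 homog.const] hc R1 hR])
    then have p: "(\<lambda>\<xi>. p \<xi> * ?\<chi> R \<xi>) \<in> eigen_closure s \<tau>" by (simp add: p_def distrib_right)
    have "weight_sq s (\<lambda>\<xi>. f \<xi> * ?\<chi> R \<xi> - p \<xi> * ?\<chi> R \<xi>) \<le> weight_sq s (\<lambda>\<xi>. \<delta> *\<^sub>R ?\<chi> R \<xi>)"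
    proof (rule weight_form_mono[OF rapid_diff[OF rf\<chi>[OF c] eigen_closure_rapid[OF p]] rapid_scaleR[OF r\<chi>] s])
      fix \<xi> :: "real^'n"
      have "norm (f \<xi> - p \<xi>) \<le> \<delta>" if "\<xi> \<in> ?B"
      proof -
        have "norm (f \<xi> - p \<xi>) \<le> \<bar>Re (f \<xi> - p \<xi>)\<bar> + \<bar>Im (f \<xi> - p \<xi>)\<bar>" by (rule cmod_le)
        then show ?thesis using p1(2)[OF that] p2(2)[OF that] by (simp add: p_def)
      qed
      then have "norm (f \<xi> - p \<xi>) * h R (norm \<xi>) \<le> \<delta> * h R (norm \<xi>)"
        using h01 hR[of R "norm \<xi>"] by (cases "\<xi> \<in> ?B") (auto intro!: mult_right_mono)
      then show "norm (f \<xi> * ?\<chi> R \<xi> - p \<xi> * ?\<chi> R \<xi>) \<le> norm (\<delta> *\<^sub>R ?\<chi> R \<xi>)"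
        using h01 \<delta>(1) by (simp add: left_diff_distrib[symmetric] norm_mult)
    qed
    also have "\<dots> = \<delta> * (\<delta> * C)" unfolding weight_form_scaleR C_def by (simp add: power2_eq_square)
    also have "\<dots> \<le> 1 * (\<delta> * C)" using \<delta> C by (intro mult_right_mono) auto
    finally show "\<exists>g\<in>eigen_closure s \<tau>. weight_sq s (\<lambda>\<xi>. f \<xi> * ?\<chi> R \<xi> - g \<xi>) \<le> \<epsilon>"
      using \<delta>(3) p by (intro bexI[of _ "\<lambda>\<xi>. p \<xi> * ?\<chi> R \<xi>"]) simp_all
  qed
  fix \<epsilon> :: real assume e: "\<epsilon> > 0"
  let ?g = "\<lambda>\<xi>. of_real (norm \<xi>) * f \<xi>"
  have rg: "rapid 0 ?g"
    by (rule rapid_mult_poly_growth[OF f, where B = 1 and L = 1]) (auto intro!: continuous_intros)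
  define C where "C = weight_sq s ?g"
  have C: "C \<ge> 0" unfolding C_def by (rule weight_form_nonneg)
  \<comment> \<open>Gives \<open>C \<le> \<epsilon> * R\<close> and \<open>R \<ge> 1\<close>, hence
    \<open>C / R^2 \<le> \<epsilon>\<close>.\<close>
  define R where "R = 1 + C / \<epsilon>"
  have R: "R > 0" "R \<ge> 1" "C \<le> \<epsilon> * R" using C e by (auto simp: R_def distrib_left add_pos_nonneg)
  have "weight_sq s (\<lambda>\<xi>. f \<xi> - f \<xi> * ?\<chi> R \<xi>) \<le> weight_sq s (\<lambda>\<xi>. (1 / R) *\<^sub>R ?g \<xi>)"
  proof (rule weight_form_mono[OF rapid_diff[OF f rf\<chi>[OF c]] rapid_scaleR[OF rg] s])
    fix \<xi> :: "real^'n"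
    have "f \<xi> - f \<xi> * ?\<chi> R \<xi> = f \<xi> * of_real (1 - h R (norm \<xi>))" by (simp add: right_diff_distrib)
    then have "norm (f \<xi> - f \<xi> * ?\<chi> R \<xi>) = norm (f \<xi>) * (1 - h R (norm \<xi>))"
      using h01[of R "norm \<xi>"] by (simp only: norm_mult norm_of_real)
    also have "\<dots> \<le> norm (f \<xi>) * (norm \<xi> / R)"
    proof (rule mult_left_mono[OF _ norm_ge_zero])
      show "1 - h R (norm \<xi>) \<le> norm \<xi> / R"
        using R(1) h01[of R "norm \<xi>"] hR'[of "norm \<xi>" R] by (cases "norm \<xi> \<le> R") (auto simp: pos_le_divide_eq intro: order_trans[of _ R])
    qed
    finally show "norm (f \<xi> - f \<xi> * ?\<chi> R \<xi>) \<le> norm ((1 / R) *\<^sub>R ?g \<xi>)" using R(1) by (simp add: norm_mult mult_ac)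
  qed
  also have "\<dots> = C / R\<^sup>2" unfolding weight_form_scaleR C_def by (simp add: power_divide)
  also have "\<dots> \<le> \<epsilon>"
  proof -
    have "\<epsilon> * R * 1 \<le> \<epsilon> * R * R" using R e by (intro mult_left_mono) auto
    then show ?thesis using R by (simp add: pos_divide_le_eq power2_eq_square mult.assoc)
  qed
  finally show "\<exists>g\<in>eigen_closure s \<tau>. weight_sq s (\<lambda>\<xi>. f \<xi> - g \<xi>) \<le> \<epsilon>"
    using cl[OF R(1)] by (rule bexI)
qed

end

section \<open>The stability inequality\<close>

lemma stability_const_nonneg: "0 \<le> stability_const s j"
  by (simp add: stability_const_def Let_def frac_ge_0 frac_lt_1 less_imp_le)

lemma stability_const_sum:
  "(\<Sum>j\<le>nat \<lfloor>s\<rfloor> + 2. stability_const s j * D j) =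
     (\<Sum>j<nat \<lfloor>s\<rfloor> + 1. D j) + frac s * D (nat \<lfloor>s\<rfloor> + 1) + (1 - frac s) * D (nat \<lfloor>s\<rfloor> + 2)"
proof -
  have "{..nat \<lfloor>s\<rfloor> + 2} = insert (nat \<lfloor>s\<rfloor> + 2) (insert (nat \<lfloor>s\<rfloor> + 1) {..<nat \<lfloor>s\<rfloor> + 1})" by auto
  then show ?thesis by (simp add: stability_const_def Let_def)
qed

lemma homog_0_const: "homog k P \<Longrightarrow> k = 0 \<Longrightarrow> \<exists>c. P = (\<lambda>x. c)"
  by (induction rule: homog.induct) auto

context
  fixes s \<sigma> :: real and m :: nat
  assumes s: "s > 0" and \<sigma>: "\<sigma> = 1 + s" and m: "m = nat \<lfloor>s\<rfloor> + 1"
begin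

text \<open>Locates \<sigma>, the first eigenvalue with a radial excitation, between the degrees
  \<open>m\<close> and \<open>m + 1\<close>, at distance \<open>frac s\<close> from
  \<open>m\<close>.\<close>

lemma eigenvalue_bounds: "real m \<le> \<sigma>" "\<sigma> < real m + 1" "\<sigma> = real m + frac s"
proof -
  have "real m = of_int \<lfloor>s\<rfloor> + 1" using s by (simp add: m of_nat_nat)
  then show "real m \<le> \<sigma>" "\<sigma> < real m + 1" "\<sigma> = real m + frac s"
    unfolding \<sigma> frac_def using of_int_floor_le[of s] real_of_int_floor_add_one_gt[of s] by linarith+
qed

text \<open>The index set collects the distances that a component of eigenvalue \<nu> can enter. For
  \<open>\<nu> = k \<le> m\<close> these are indices below \<open>k\<close>, each with constant 1;
  for \<open>\<nu> = \<sigma>\<close> they are at most the indices up to \<open>m\<close>, with sum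
  \<open>m + frac s = \<sigma>\<close>; in the remaining cases \<open>\<nu> \<ge> m + 1\<close>, the
  sum of all constants.\<close>

lemma stability_const_eigenvalue:
  assumes \<nu>: "\<nu> = real k + real n * \<sigma>"
  shows "(\<Sum>j\<in>{j \<in> {j. j \<le> m + 1 \<and> stability_const s j \<noteq> 0}. \<nu> \<notin> (if j \<le> m then {..real j} else {..\<sigma>})}. stability_const s j) \<le> \<nu>"
    (is "(\<Sum>j\<in>?J. _) \<le> _")
proof -
  note b = eigenvalue_bounds
  have fin: "finite ?J" by (rule finite_subset[of _ "{..m + 1}"]) auto
  have lt: "stability_const s j = 1" if "j < m" for j using that by (simp add: stability_const_def m)
  have cm: "stability_const s m = frac s" by (simp add: stability_const_def m)
  have total: "(\<Sum>j\<in>?J. stability_const s j) \<le> real m + 1"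
  proof -
    have "(\<Sum>j\<in>?J. stability_const s j) \<le> (\<Sum>j\<le>m + 1. stability_const s j)"
      by (rule sum_mono2) (auto simp: stability_const_nonneg)
    then show ?thesis using stability_const_sum[of s "\<lambda>_. 1"] by (simp add: m)
  qed
  have low: "(\<Sum>j\<in>?J. stability_const s j) \<le> real m + frac s" if "\<nu> \<le> \<sigma>"
  proof -
    have "(\<Sum>j\<in>?J. stability_const s j) \<le> (\<Sum>j\<in>{..m}. stability_const s j)"
      by (rule sum_mono2) (use that in \<open>auto simp: stability_const_nonneg not_le split: if_splits\<close>)
    then show ?thesis by (simp add: lt cm lessThan_Suc_atMost[symmetric])
  qed
  consider "n = 0" "k \<le> m" | "n = 1" "k = 0" | "n = 0" "k > m" | "n \<ge> 1" "n + k \<ge> 2" by linarith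
  then show ?thesis
  proof cases
    case 1
    then have km: "real k \<le> real m" by simp
    have "(\<Sum>j\<in>?J. stability_const s j) \<le> (\<Sum>j\<in>{..<k}. stability_const s j)"
      by (rule sum_mono2) (use 1 \<nu> b(1) km in \<open>auto simp: stability_const_nonneg not_le split: if_splits\<close>)
    also have "\<dots> = real k" using 1 lt by simp
    finally show ?thesis using 1 \<nu> by simp
  next
    case 2
    then show ?thesis using low b \<nu> by simp
  next
    case 3
    then show ?thesis using total \<nu> by simp
  next
    case 4
    have "real m + 1 \<le> \<nu>"
    proof (cases "n = 1")
      case True
      then have "real k \<ge> 1" using 4 by simp
      then show ?thesis using True b(1) \<nu> by simp
    next
      case False
      then have "2 * \<sigma> \<le> real n * \<sigma>" using 4 s \<sigma> by (intro mult_right_mono) auto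
      then show ?thesis using b s \<sigma> \<nu> by linarith
    qed
    then show ?thesis using total by linarith
  qed
qed

text \<open>The bound on \<nu> leaves two shapes: a harmonic polynomial of low degree, or the radial
  case \<open>n = 1\<close>, \<open>k = 0\<close>, which is what the extra summand
  \<open>d |\<xi>|^\<sigma>\<close> of the last family is for.\<close>

lemma eigenfunction_profile:
  assumes E: "eigenfunction s \<tau> \<nu> E" and j: "j \<le> m + 1" "stability_const s j \<noteq> 0" and \<nu>: "\<nu> \<in> (if j \<le> m then {..real j} else {..\<sigma>})"
  shows "\<exists>P d. P \<in> harmonic_polynomials (min j m) \<and> (j \<le> m \<longrightarrow> d = 0) \<and> (\<forall>\<xi>. \<xi> \<noteq> 0 \<longrightarrow> c *\<^sub>R E \<xi> = profile \<sigma> \<tau> P d \<xi>)"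
proof -
  note b = eigenvalue_bounds
  obtain k P n \<gamma> where P: "homog k P" "\<And>x. laplacian P x = 0" "\<nu> = real k + real n * \<sigma>"
    and E: "E = (\<lambda>\<xi>. \<Sum>l\<le>n. \<gamma> l *\<^sub>R hterm \<sigma> \<tau> P (real l * \<sigma>) \<xi>)"
    using E unfolding eigenfunction_def \<sigma> by blast
  have cH: "(\<lambda>x. a * P x) \<in> harmonic_polynomials i" if "k \<le> i" for a i
    by (rule homog_harmonic_polynomials[OF homog_cmult[OF P(1)] that]) (simp add: laplacian_homog_cmult[OF P(1)] P(2))
  have n: "n = 0 \<and> k \<le> min j m \<or> n = 1 \<and> k = 0 \<and> j = m + 1"
  proof (cases "n = 0")
    case True
    then have "k \<le> m" "j \<le> m \<Longrightarrow> k \<le> j" using \<nu> P(3) b by (auto split: if_splits)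
    then show ?thesis using True j by (cases "j \<le> m") auto
  next
    case False
    then have *: "\<sigma> \<le> real n * \<sigma>" using s \<sigma> by (simp add: mult_le_cancel_right1)
    have "j > m"
    proof (rule ccontr)
      assume "\<not> j > m"
      then have "real k + real n * \<sigma> \<le> real j" "j \<le> m" using \<nu> P(3) by auto
      \<comment> \<open>An eigenvalue with \<open>n \<ge> 1\<close> can reach
        \<open>j \<le> m\<close> only if \<open>\<sigma> = m\<close>, that is for integral
        \<open>s\<close>; then the constant of index \<open>m\<close> is 0, against the assumption
        on \<open>j\<close>.\<close>
      then have "j = m" "frac s = 0" using * b frac_ge_0[of s] by linarith+
      then show False using j(2) by (simp add: stability_const_def m)
    qed
    then have "real k + real n * \<sigma> \<le> \<sigma>" "j = m + 1" using \<nu> P(3) j(1) by auto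
    moreover have "n < 2"
    proof (rule ccontr)
      assume "\<not> n < 2"
      then have "2 * \<sigma> \<le> real n * \<sigma>" using s \<sigma> by (intro mult_right_mono) auto
      then show False using \<open>real k + real n * \<sigma> \<le> \<sigma>\<close> s \<sigma> by linarith
    qed
    moreover have "n = 1" using \<open>n < 2\<close> False by simp
    ultimately show ?thesis by simp
  qed
  then show ?thesis
  proof
    assume n: "n = 0 \<and> k \<le> min j m"
    show ?thesis
    proof (intro exI conjI allI impI)
      show "(\<lambda>x. of_real (c * \<gamma> 0) * P x) \<in> harmonic_polynomials (min j m)" by (rule cH) (use n in simp)
      show "c *\<^sub>R E \<xi> = profile \<sigma> \<tau> (\<lambda>x. of_real (c * \<gamma> 0) * P x) 0 \<xi>" if "\<xi> \<noteq> 0" for \<xi>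
        using n that by (simp add: E hterm_def profile_def scaleR_conv_of_real mult_ac)
    qed simp
  next
    assume n: "n = 1 \<and> k = 0 \<and> j = m + 1"
    obtain a where a: "P = (\<lambda>x. a)" using homog_0_const[OF P(1)] n by auto
    show ?thesis
    proof (intro exI conjI allI impI)
      show "(\<lambda>x. of_real (c * \<gamma> 0) * P x) \<in> harmonic_polynomials (min j m)" by (rule cH) (use n in simp)
      show "c *\<^sub>R E \<xi> = profile \<sigma> \<tau> (\<lambda>x. of_real (c * \<gamma> 0) * P x) (of_real (c * \<gamma> 1) * a) \<xi>" if "\<xi> \<noteq> 0" for \<xi>
        using n that by (simp add: E a hterm_def profile_def scaleR_conv_of_real algebra_simps)
    qed (use n in simp)
  qed
qed

text \<open>All eigenfunctions carry the same \<tau>, so the polynomial parts and the coefficients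
  \<open>d\<close> simply add.\<close>

lemma combination_profile:
  assumes fin: "finite A" and E: "\<And>i. i \<in> A \<Longrightarrow> eigenfunction s \<tau> (\<nu> i) (b i)" and j: "j \<le> m + 1" "stability_const s j \<noteq> 0"
    and \<nu>: "\<And>i. i \<in> A \<Longrightarrow> \<nu> i \<in> (if j \<le> m then {..real j} else {..\<sigma>})"
  shows "\<exists>P d. P \<in> harmonic_polynomials (min j m) \<and> (j \<le> m \<longrightarrow> d = 0) \<and> (\<forall>\<xi>. \<xi> \<noteq> 0 \<longrightarrow> (\<Sum>i\<in>A. c i *\<^sub>R b i \<xi>) = profile \<sigma> \<tau> P d \<xi>)"
proof -
  have "\<forall>i\<in>A. \<exists>P d. P \<in> harmonic_polynomials (min j m) \<and> (j \<le> m \<longrightarrow> d = 0) \<and> (\<forall>\<xi>. \<xi> \<noteq> 0 \<longrightarrow> c i *\<^sub>R b i \<xi> = profile \<sigma> \<tau> P d \<xi>)"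
    by (intro ballI eigenfunction_profile[OF E j \<nu>])
  then obtain P where "\<forall>i\<in>A. \<exists>d. P i \<in> harmonic_polynomials (min j m) \<and> (j \<le> m \<longrightarrow> d = 0) \<and> (\<forall>\<xi>. \<xi> \<noteq> 0 \<longrightarrow> c i *\<^sub>R b i \<xi> = profile \<sigma> \<tau> (P i) d \<xi>)"
    by (rule bchoice[THEN exE])
  then obtain d where "\<forall>i\<in>A. P i \<in> harmonic_polynomials (min j m) \<and> (j \<le> m \<longrightarrow> d i = 0) \<and> (\<forall>\<xi>. \<xi> \<noteq> 0 \<longrightarrow> c i *\<^sub>R b i \<xi> = profile \<sigma> \<tau> (P i) (d i) \<xi>)"
    by (rule bchoice[THEN exE])
  then show ?thesis
    by (intro exI[of _ "\<lambda>x. \<Sum>i\<in>A. P i x"] exI[of _ "\<Sum>i\<in>A. d i"])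
       (auto simp: profile_def sum_distrib_right distrib_right sum.distrib intro!: harmonic_polynomials_sum)
qed

text \<open>Any \<tau> is admissible, because the families contain the profiles of every parameter.
  Replacing \<open>fourier u\<close> by finitely many eigenfunctions costs an arbitrarily small
  error in the weighted norm.\<close>

theorem stability_energy_form:
  fixes u :: "real^'n::finite \<Rightarrow> complex"
  assumes N: "CARD('n) \<ge> 2" and u: "u \<in> test_functions" and \<tau>: "\<tau> > 0"
  shows "(\<Sum>j\<le>m + 1. stability_const s j * dist_sq s u (extremals s j)) \<le> (2 * pi) powr (s - 1) * energy_form s \<tau> (fourier u) (fourier u)"
proof (rule field_le_epsilon)
  let ?K = "(2 * pi) powr (s - 1)"
  let ?f = "fourier u"
  have K: "?K > 0" by simp
  fix \<epsilon>' :: real assume e': "\<epsilon>' > 0"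
  \<comment> \<open>The error enters multiplied by the sum of the constants, at most
    \<open>m + 1\<close>, and by \<open>?K\<close>.\<close>
  define \<epsilon> where "\<epsilon> = \<epsilon>' / (?K * (real m + 1))"
  have e: "\<epsilon> > 0" "?K * ((real m + 1) * \<epsilon>) = \<epsilon>'" using e' K by (auto simp: \<epsilon>_def add_nonneg_eq_0_iff)
  note f = fourier_test_energy_class[OF N u]
  have "?f \<in> eigen_closure s \<tau>"
    by (rule eigen_closure_continuous[OF s \<tau> N fourier_test_continuous[OF u] energy_classD(1)[OF f]])
  then obtain G where G: "G \<in> eigen_span s \<tau>" "weight_sq s (\<lambda>\<xi>. ?f \<xi> - G \<xi>) \<le> \<epsilon>"
    unfolding eigen_closure_def using e(1) by blast
  obtain b and n :: nat where "\<forall>i<n. \<exists>\<nu>. eigenfunction s \<tau> \<nu> (b i)" and Gb: "G = (\<lambda>\<xi>. \<Sum>i<n. b i \<xi>)"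
    using G(1) unfolding eigen_span_def by blast
  then obtain \<nu> where \<nu>: "\<And>i. i < n \<Longrightarrow> eigenfunction s \<tau> (\<nu> i) (b i)" by metis
  interpret q: semi_inner energy_class "weight_form s :: (real^'n \<Rightarrow> complex) \<Rightarrow> _" by (rule semi_inner_weight_form[OF s])
  interpret a: semi_inner energy_class "energy_form s \<tau> :: (real^'n \<Rightarrow> complex) \<Rightarrow> _" by (rule semi_inner_energy_form[OF s \<tau>])
  interpret eigen_forms energy_class "weight_form s :: (real^'n \<Rightarrow> complex) \<Rightarrow> _" "energy_form s \<tau>" "{..<n}" b \<nu>
    by unfold_locales (use \<nu> in \<open>auto simp: eigenfunction_def\<close>)
  let ?J = "{j. j \<le> m + 1 \<and> stability_const s j \<noteq> 0}"
  let ?S = "\<lambda>j. if j \<le> m then {..real j} else {..\<sigma>}"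
  have finJ: "finite ?J" by (rule finite_subset[of _ "{..m + 1}"]) auto
  have k: "(\<Sum>j\<in>{j\<in>?J. \<nu> i \<notin> ?S j}. stability_const s j) \<le> \<nu> i" if "i \<in> {..<n}" for i
    using \<nu>[of i] that stability_const_eigenvalue[of "\<nu> i"] unfolding eigenfunction_def \<sigma>[symmetric] by blast
  obtain \<alpha> where \<alpha>: "(\<Sum>j\<in>?J. stability_const s j * weight_sq s (\<lambda>x. ?f x - (\<Sum>i\<in>{i\<in>{..<n}. \<nu> i \<in> ?S j}. \<alpha> i *\<^sub>R b i x)))
       \<le> energy_form s \<tau> ?f ?f + (\<Sum>j\<in>?J. stability_const s j) * weight_sq s (\<lambda>x. ?f x - (\<Sum>i\<in>{..<n}. 1 *\<^sub>R b i x))"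
    by (rule spectral_inequality[where J = ?J and c = "stability_const s" and S = ?S and \<beta> = "\<lambda>_. 1", OF f finJ stability_const_nonneg k])
  let ?T = "\<lambda>j \<xi>. \<Sum>i\<in>{i\<in>{..<n}. \<nu> i \<in> ?S j}. \<alpha> i *\<^sub>R b i \<xi>"
  let ?q = "\<lambda>j. weight_sq s (\<lambda>\<xi>. ?f \<xi> - ?T j \<xi>)"
  have D: "dist_sq s u (extremals s j) \<le> ?K * ?q j" if j: "j \<in> ?J" for j
  proof -
    have "\<exists>P d. P \<in> harmonic_polynomials (min j m) \<and> (j \<le> m \<longrightarrow> d = 0) \<and> (\<forall>\<xi>. \<xi> \<noteq> 0 \<longrightarrow> ?T j \<xi> = profile \<sigma> \<tau> P d \<xi>)"
    proof (rule combination_profile[where \<nu> = \<nu>])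
      show "i \<in> {i\<in>{..<n}. \<nu> i \<in> ?S j} \<Longrightarrow> eigenfunction s \<tau> (\<nu> i) (b i)" for i using \<nu> by blast
      show "i \<in> {i\<in>{..<n}. \<nu> i \<in> ?S j} \<Longrightarrow> \<nu> i \<in> ?S j" for i by blast
    qed (use j in auto)
    then obtain P d where P: "P \<in> harmonic_polynomials (min j m)" "j \<le> m \<longrightarrow> d = 0"
      and eq: "\<And>\<xi>. \<xi> \<noteq> 0 \<Longrightarrow> ?T j \<xi> = profile \<sigma> \<tau> P d \<xi>" by blast
    have T: "rapid 0 (?T j)" using bX by (intro rapid_sum rapid_scaleR energy_classD(1)) auto
    have fr: "rapid 0 ?f" by (rule energy_classD(1)[OF f])
    have "weight_sq s (\<lambda>\<xi>. ?f \<xi> - profile \<sigma> \<tau> P d \<xi>) \<le> ?q j"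
    proof (rule weight_form_mono[OF rapid_diff[OF fr rapid_cong[OF T eq]] rapid_diff[OF fr T] s])
      fix \<xi> :: "real^'n" assume "\<xi> \<noteq> 0"
      show "norm (?f \<xi> - profile \<sigma> \<tau> P d \<xi>) \<le> norm (?f \<xi> - ?T j \<xi>)" unfolding eq[OF \<open>\<xi> \<noteq> 0\<close>] ..
    qed
    then have "?K * weight_sq s (\<lambda>\<xi>. ?f \<xi> - profile \<sigma> \<tau> P d \<xi>) \<le> ?K * ?q j"
      by (rule mult_left_mono) simp
    moreover have "dist_sq s u (extremals s j) \<le> ?K * weight_sq s (\<lambda>\<xi>. ?f \<xi> - profile \<sigma> \<tau> P d \<xi>)"
      unfolding \<sigma> by (rule dist_sq_le[OF N u s \<tau>]) (use P m in auto)
    ultimately show ?thesis by (rule order_trans[rotated])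
  qed
  have "(\<Sum>j\<le>m + 1. stability_const s j * dist_sq s u (extremals s j)) = (\<Sum>j\<in>?J. stability_const s j * dist_sq s u (extremals s j))"
    by (rule sum.mono_neutral_right) auto
  also have "\<dots> \<le> (\<Sum>j\<in>?J. stability_const s j * (?K * ?q j))"
    by (intro sum_mono mult_left_mono D stability_const_nonneg)
  also have "\<dots> = ?K * (\<Sum>j\<in>?J. stability_const s j * ?q j)" by (simp add: sum_distrib_left mult_ac)
  also have "\<dots> \<le> ?K * (energy_form s \<tau> ?f ?f + (real m + 1) * \<epsilon>)"
  proof (rule mult_left_mono)
    have tot: "(\<Sum>j\<in>?J. stability_const s j) \<le> real m + 1"
    proof -
      have "(\<Sum>j\<in>?J. stability_const s j) \<le> (\<Sum>j\<le>m + 1. stability_const s j)"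
        by (rule sum_mono2) (auto simp: stability_const_nonneg)
      then show ?thesis using stability_const_sum[of s "\<lambda>_. 1"] by (simp add: m)
    qed
    have "(\<Sum>j\<in>?J. stability_const s j * ?q j) \<le> energy_form s \<tau> ?f ?f + (\<Sum>j\<in>?J. stability_const s j) * weight_sq s (\<lambda>\<xi>. ?f \<xi> - G \<xi>)"
      using \<alpha> by (simp add: Gb)
    also have "\<dots> \<le> energy_form s \<tau> ?f ?f + (real m + 1) * \<epsilon>"
      by (intro add_left_mono mult_mono tot G(2) weight_form_nonneg) simp
    finally show "(\<Sum>j\<in>?J. stability_const s j * ?q j) \<le> energy_form s \<tau> ?f ?f + (real m + 1) * \<epsilon>" .
  qed simp
  also have "\<dots> = ?K * energy_form s \<tau> ?f ?f + \<epsilon>'" unfolding distrib_left e(2) ..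
  finally show "(\<Sum>j\<le>m + 1. stability_const s j * dist_sq s u (extremals s j)) \<le> ?K * energy_form s \<tau> ?f ?f + \<epsilon>'" .
qed

end

text \<open>The right side of the hypothesis is least at \<open>\<tau> = sqrt B / sqrt A\<close>,
  and its infimum is not attained when exactly one of \<open>A\<close>, \<open>B\<close> vanishes.
  Adding \<delta> to both makes the minimizer available, and \<delta> tends to 0 afterwards.\<close>

lemma le_sqrt_mult:
  fixes A B C :: real
  assumes AB: "A \<ge> 0" "B \<ge> 0" and C: "\<And>\<tau>. \<tau> > 0 \<Longrightarrow> C \<le> (B / \<tau> + \<tau> * A) / 2"
  shows "C \<le> sqrt A * sqrt B"
proof (rule tendsto_lowerbound)
  show "((\<lambda>\<delta>. sqrt (A + \<delta>) * sqrt (B + \<delta>)) \<longlongrightarrow> sqrt A * sqrt B) (at_right 0)"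
    by (auto intro!: tendsto_eq_intros)
  show "\<forall>\<^sub>F \<delta> in at_right 0. C \<le> sqrt (A + \<delta>) * sqrt (B + \<delta>)"
    using eventually_at_right_less
  proof eventually_elim
    case (elim \<delta>)
    define a b where "a = sqrt (A + \<delta>)" and "b = sqrt (B + \<delta>)"
    have ab: "a > 0" "b > 0" "a\<^sup>2 = A + \<delta>" "b\<^sup>2 = B + \<delta>" using AB elim by (auto simp: a_def b_def)
    have "C \<le> (B / (b / a) + b / a * A) / 2" using ab by (intro C) simp
    also have "\<dots> \<le> (b\<^sup>2 / (b / a) + b / a * a\<^sup>2) / 2"
      unfolding ab(3,4) using ab(1,2) elim by (intro divide_right_mono add_mono mult_left_mono) auto
    also have "\<dots> = a * b" using ab(1,2) by (simp add: power2_eq_square field_simps)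
    finally show ?case by (simp add: a_def b_def)
  qed
qed simp

theorem stability_inequality:
  fixes u :: "real^'n::finite \<Rightarrow> complex"
  assumes N: "CARD('n) \<ge> 2" and u: "u \<in> test_functions" and s: "s > 0"
  shows "(\<Sum>j\<le>nat \<lfloor>s\<rfloor> + 2. stability_const s j * dist_sq s u (extremals s j)) \<le> deficit s u"
proof -
  let ?K = "(2 * pi) powr (s - 1)" and ?f = "fourier u"
  let ?L = "\<Sum>j\<le>nat \<lfloor>s\<rfloor> + 2. stability_const s j * dist_sq s u (extremals s j)"
  let ?A = "LINT \<xi>|lborel. norm \<xi> powr (2 * s) * (norm (?f \<xi>))\<^sup>2"
  let ?B = "\<Sum>i\<in>UNIV. LINT \<xi>|lborel. (norm (partial i ?f \<xi>))\<^sup>2"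
  let ?M = "(real CARD('n) + s - 1) / 2 * weight_sq s ?f"
  have K: "?K > 0" by simp
  have div: "(x / ?K \<le> y) = (x \<le> ?K * y)" for x y
    unfolding pos_divide_le_eq[OF K] mult.commute[of y] ..
  have "?L / ?K + ?M \<le> sqrt ?A * sqrt ?B"
  proof (rule le_sqrt_mult)
    show "?A \<ge> 0" by (intro integral_nonneg_AE) auto
    show "?B \<ge> 0" by (intro sum_nonneg integral_nonneg_AE) auto
    fix \<tau> :: real assume \<tau>: "\<tau> > 0"
    have "?L \<le> ?K * energy_form s \<tau> ?f ?f"
      using stability_energy_form[OF s refl refl N u \<tau>] by (simp only: add.assoc one_add_one)
    then have "?L / ?K \<le> energy_form s \<tau> ?f ?f" unfolding div .
    moreover have "energy_form s \<tau> ?f ?f = (?B / \<tau> + \<tau> * ?A) / 2 - ?M"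
      unfolding energy_form_self[OF N fourier_test_energy_class[OF N u] s \<tau>] weight_form_def power2_norm_eq_inner ..
    ultimately show "?L / ?K + ?M \<le> (?B / \<tau> + \<tau> * ?A) / 2" by linarith
  qed
  then have "?L / ?K \<le> sqrt ?A * sqrt ?B - ?M" by linarith
  then show ?thesis unfolding deficit_eq[OF N u s] div .
qed

section \<open>Truncation of an inverse Fourier transform\<close>

text \<open>The transform of a product is a convolution; the dilation is moved into the argument of
  \<open>f\<close>, so that the kernel \<open>fourier \<psi>\<close> is the same for all
  \<open>c\<close>.\<close>

lemma fourier_cutoff:
  fixes f \<psi> :: "real^'n::finite \<Rightarrow> complex"
  assumes f: "integrable lborel f" and \<psi>: "integrable lborel \<psi>" and c: "c > 0"
  shows "fourier (\<lambda>x. \<psi> (c *\<^sub>R x) * inv_fourier f x) \<xi> = (LINT y|lborel. f (\<xi> - c *\<^sub>R y) * fourier \<psi> y)"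
proof -
  have [measurable]: "f \<in> borel_measurable borel" "\<psi> \<in> borel_measurable borel" using f \<psi> by auto
  have \<psi>c: "integrable lborel (\<lambda>x. \<psi> (c *\<^sub>R x))" using lborel_integrable_affine[of c \<psi> 0] c \<psi> by simp
  let ?F = "\<lambda>(x, \<eta>). f \<eta> * cis (2 * pi * (x \<bullet> \<eta>)) * (\<psi> (c *\<^sub>R x) * cis (- (2 * pi * (x \<bullet> \<xi>))))"
  have int: "integrable (lborel \<Otimes>\<^sub>M lborel) ?F"
    by (rule integrable_pair_bound[OF _ integrable_norm[OF \<psi>c] integrable_norm[OF f]]) (auto simp: norm_mult mult.commute)
  have scale: "(LINT x|lborel. \<psi> (c *\<^sub>R x) * cis (- (2 * pi * (x \<bullet> \<zeta>)))) = of_real (1 / c ^ CARD('n)) * fourier \<psi> (\<zeta> /\<^sub>R c)" for \<zeta>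
  proof -
    have "fourier \<psi> (\<zeta> /\<^sub>R c) = c ^ CARD('n) *\<^sub>R (LINT x|lborel. \<psi> (0 + c *\<^sub>R x) * cis (- (2 * pi * ((0 + c *\<^sub>R x) \<bullet> (\<zeta> /\<^sub>R c)))))"
      unfolding fourier_def using c by (subst lborel_integral_affine[of c _ 0]) auto
    moreover have "inverse c * (c * t) = t" for t using c by simp
    ultimately show ?thesis using c by (simp add: scaleR_conv_of_real[where 'a = complex])
  qed
  have "fourier (\<lambda>x. \<psi> (c *\<^sub>R x) * inv_fourier f x) \<xi> = (LINT x|lborel. (LINT \<eta>|lborel. ?F (x, \<eta>)))"
    unfolding fourier_def
  proof (rule Bochner_Integration.integral_cong[OF refl])
    show "\<psi> (c *\<^sub>R x) * inv_fourier f x * cis (- (2 * pi * (x \<bullet> \<xi>))) = (LINT \<eta>|lborel. ?F (x, \<eta>))" for x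
      unfolding inv_fourier_def prod.case integral_mult_left_zero by (simp only: mult_ac)
  qed
  also have "\<dots> = (LINT \<eta>|lborel. (LINT x|lborel. ?F (x, \<eta>)))"
    using lborel_pair.Fubini_integral[OF int] by (simp only: prod.case)
  also have "\<dots> = (LINT \<eta>|lborel. f \<eta> * (of_real (1 / c ^ CARD('n)) * fourier \<psi> ((\<xi> - \<eta>) /\<^sub>R c)))"
  proof (rule Bochner_Integration.integral_cong[OF refl])
    fix \<eta>
    have "(LINT x|lborel. ?F (x, \<eta>)) = (LINT x|lborel. f \<eta> * (\<psi> (c *\<^sub>R x) * cis (- (2 * pi * (x \<bullet> (\<xi> - \<eta>))))))"
      by (intro Bochner_Integration.integral_cong) (auto simp: inner_diff_right right_diff_distrib cis_mult mult_ac)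
    then show "(LINT x|lborel. ?F (x, \<eta>)) = f \<eta> * (of_real (1 / c ^ CARD('n)) * fourier \<psi> ((\<xi> - \<eta>) /\<^sub>R c))"
      by (simp only: integral_mult_right_zero scale)
  qed
  also have "\<dots> = \<bar>- c\<bar> ^ DIM(real^'n) *\<^sub>R (LINT y|lborel. f (\<xi> + (- c) *\<^sub>R y) * (of_real (1 / c ^ CARD('n)) * fourier \<psi> ((\<xi> - (\<xi> + (- c) *\<^sub>R y)) /\<^sub>R c)))"
    using c by (intro lborel_integral_affine) auto
  also have "\<dots> = (LINT y|lborel. (c ^ CARD('n)) *\<^sub>R (f (\<xi> - c *\<^sub>R y) * (of_real (1 / c ^ CARD('n)) * fourier \<psi> y)))"
    using c by simp
  also have "\<dots> = (LINT y|lborel. f (\<xi> - c *\<^sub>R y) * fourier \<psi> y)"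
    using c by (intro Bochner_Integration.integral_cong) (auto simp: scaleR_conv_of_real[where 'a = complex])
  finally show ?thesis .
qed

text \<open>Truncation on the physical side at scale \<open>Suc n\<close>; on the frequency side it
  is convolution with an approximate identity if \<open>\<psi> 0 = 1\<close>.\<close>

definition cutoff :: "(real^'n::finite \<Rightarrow> complex) \<Rightarrow> (real^'n \<Rightarrow> complex) \<Rightarrow> nat \<Rightarrow> real^'n \<Rightarrow> complex" where
  "cutoff \<psi> f n x = \<psi> ((1 / real (Suc n)) *\<^sub>R x) * inv_fourier f x"

context
  fixes f \<psi> :: "real^'n::finite \<Rightarrow> complex"
  assumes N: "CARD('n) \<ge> 2" and f: "rapid 0 f" and fc: "continuous_on UNIV f"
    and \<psi>: "\<psi> \<in> test_functions" and \<psi>1: "\<psi> 0 = 1"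
begin

lemma cutoff_integrable: "integrable lborel f" "integrable lborel \<psi>" "integrable lborel (\<lambda>y. (1 + norm y) ^ K * norm (fourier \<psi> y))"
proof -
  show "integrable lborel f" using f by (rule rapid_integrable) simp
  show "integrable lborel \<psi>" using test_rapid[OF \<psi>] by (rule rapid_integrable) simp
  have "rapid 0 (\<lambda>y. (1 + norm y) ^ K * norm (fourier \<psi> y))"
    by (rule rapid_mult_poly_growth[OF rapid_norm[OF fourier_test_rapid[OF N \<psi>]], where B = 1 and L = K]) (auto intro!: continuous_intros)
  then show "integrable lborel (\<lambda>y. (1 + norm y) ^ K * norm (fourier \<psi> y))" by (rule rapid_integrable) simp
qed

lemma fourier_cutoff_eq: "fourier (cutoff \<psi> f n) \<xi> = (LINT y|lborel. f (\<xi> - (1 / real (Suc n)) *\<^sub>R y) * fourier \<psi> y)"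
  unfolding cutoff_def[abs_def] by (rule fourier_cutoff[OF cutoff_integrable(1,2)]) simp

text \<open>Peetre's inequality \<open>1 + |\<xi>| \<le> (1 + |\<xi> - c y|) (1 + |y|)\<close>, with
  \<open>c \<le> 1\<close>, moves the decay of \<open>f\<close> outside the convolution, uniformly
  in \<open>n\<close>.\<close>

lemma fourier_cutoff_bound: 
  obtains C where "\<And>n \<xi>. norm (fourier (cutoff \<psi> f n) \<xi>) \<le> C / (1 + norm \<xi>) ^ K"
proof -
  have [measurable]: "f \<in> borel_measurable borel" "\<psi> \<in> borel_measurable borel" using cutoff_integrable(1,2) by auto
  obtain C where C: "C \<ge> 0" "\<And>x. norm (f x) \<le> C / (1 + norm x) ^ K" using rapid_bound_everywhere[OF f, where K = K] by blast
  let ?g = "\<lambda>y. (1 + norm y) ^ K * norm (fourier \<psi> y)"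
  have "norm (fourier (cutoff \<psi> f n) \<xi>) \<le> C * (LINT y|lborel. ?g y) / (1 + norm \<xi>) ^ K" for n \<xi>
  proof -
    let ?c = "1 / real (Suc n)"
    have p: "1 + norm x > 0" for x :: "real^'n" by (simp add: add_pos_nonneg)
    have le: "norm (f (\<xi> - ?c *\<^sub>R y) * fourier \<psi> y) \<le> C / (1 + norm \<xi>) ^ K * ?g y" for y
    proof -
      have "norm \<xi> \<le> norm (\<xi> - ?c *\<^sub>R y) + norm (?c *\<^sub>R y)" using norm_triangle_ineq[of "\<xi> - ?c *\<^sub>R y" "?c *\<^sub>R y"] by simp
      moreover have "norm (?c *\<^sub>R y) \<le> norm y" by (simp add: divide_le_eq mult_le_cancel_left1)
      ultimately have "1 + norm \<xi> \<le> (1 + norm (\<xi> - ?c *\<^sub>R y)) * (1 + norm y)"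
        using mult_nonneg_nonneg[OF norm_ge_zero[of "\<xi> - ?c *\<^sub>R y"] norm_ge_zero[of y]]
        by (simp only: distrib_left distrib_right mult_1 mult_1_right)
      then have "(1 + norm \<xi>) ^ K \<le> ((1 + norm (\<xi> - ?c *\<^sub>R y)) * (1 + norm y)) ^ K" by (intro power_mono) auto
      then have "(1 + norm \<xi>) ^ K \<le> (1 + norm (\<xi> - ?c *\<^sub>R y)) ^ K * (1 + norm y) ^ K" by (simp only: power_mult_distrib)
      then have "C * (1 + norm \<xi>) ^ K \<le> C * ((1 + norm (\<xi> - ?c *\<^sub>R y)) ^ K * (1 + norm y) ^ K)" using C(1) by (intro mult_left_mono)
      then have "C / (1 + norm (\<xi> - ?c *\<^sub>R y)) ^ K \<le> C / (1 + norm \<xi>) ^ K * (1 + norm y) ^ K"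
        using p by (simp add: divide_le_eq pos_le_divide_eq mult_ac)
      then have "norm (f (\<xi> - ?c *\<^sub>R y)) \<le> C / (1 + norm \<xi>) ^ K * (1 + norm y) ^ K" using C(2)[of "\<xi> - ?c *\<^sub>R y"] by linarith
      then have "norm (f (\<xi> - ?c *\<^sub>R y)) * norm (fourier \<psi> y) \<le> C / (1 + norm \<xi>) ^ K * (1 + norm y) ^ K * norm (fourier \<psi> y)" by (intro mult_right_mono) auto
      then show ?thesis by (simp only: norm_mult mult.assoc)
    qed
    have i: "integrable lborel (\<lambda>y. C / (1 + norm \<xi>) ^ K * ?g y)" by (intro integrable_mult_right cutoff_integrable)
    have "norm (fourier (cutoff \<psi> f n) \<xi>) \<le> (LINT y|lborel. C / (1 + norm \<xi>) ^ K * ?g y)"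
      unfolding fourier_cutoff_eq
    proof (rule order_trans[OF integral_norm_bound integral_mono[OF _ i le]])
      show "integrable lborel (\<lambda>y. norm (f (\<xi> - ?c *\<^sub>R y) * fourier \<psi> y))"
        by (rule Bochner_Integration.integrable_bound[OF i]) (use le C(1) in auto)
    qed
    then show ?thesis by simp
  qed
  then show ?thesis by (rule that)
qed

lemma fourier_cutoff_limit: "(\<lambda>n. fourier (cutoff \<psi> f n) \<xi>) \<longlonglongrightarrow> f \<xi>"
proof -
  have [measurable]: "f \<in> borel_measurable borel" "\<psi> \<in> borel_measurable borel" using cutoff_integrable(1,2) by auto
  obtain C where C: "C \<ge> 0" "\<And>x. norm (f x) \<le> C / (1 + norm x) ^ 0" using rapid_bound_everywhere[OF f, where K = 0] by blast
  have i: "integrable lborel (fourier \<psi>)" by (rule rapid_integrable[OF fourier_test_rapid[OF N \<psi>]]) simp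
  have "(\<lambda>n. LINT y|lborel. f (\<xi> - (1 / real (Suc n)) *\<^sub>R y) * fourier \<psi> y) \<longlonglongrightarrow> (LINT y|lborel. f \<xi> * fourier \<psi> y)"
  proof (rule integral_dominated_convergence[where w = "\<lambda>y. C * norm (fourier \<psi> y)"])
    show "AE y in lborel. (\<lambda>n. f (\<xi> - (1 / real (Suc n)) *\<^sub>R y) * fourier \<psi> y) \<longlonglongrightarrow> f \<xi> * fourier \<psi> y"
    proof (intro AE_I2 tendsto_intros)
      fix y :: "real^'n"
      have "(\<lambda>n. \<xi> - (1 / real (Suc n)) *\<^sub>R y) \<longlonglongrightarrow> \<xi> - 0 *\<^sub>R y"
        by (intro tendsto_intros LIMSEQ_Suc[OF lim_1_over_n])
      moreover have "isCont f \<xi>" using fc by (simp add: continuous_on_eq_continuous_at)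
      ultimately show "(\<lambda>n. f (\<xi> - (1 / real (Suc n)) *\<^sub>R y)) \<longlonglongrightarrow> f \<xi>"
        using isCont_tendsto_compose[of \<xi> f] by simp
    qed
    show "AE y in lborel. norm (f (\<xi> - (1 / real (Suc n)) *\<^sub>R y) * fourier \<psi> y) \<le> C * norm (fourier \<psi> y)" for n
      using C by (auto simp: norm_mult intro!: mult_right_mono)
  qed (use i in \<open>auto intro!: integrable_mult_right integrable_norm\<close>)
  \<comment> \<open>The kernel has total mass \<open>\<psi> 0\<close> by Fourier inversion at the
    origin.\<close>
  moreover have "(LINT y|lborel. fourier \<psi> y) = 1"
  proof -
    obtain B where B: "B \<ge> 0" "\<And>x. norm (\<psi> x) \<le> B / (1 + norm x) ^ 0" using rapid_bound_everywhere[OF test_rapid[OF \<psi>], where K = 0] by blast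
    have "fourier (inv_fourier \<psi>) 0 = \<psi> 0"
    proof (rule fourier_inversion[OF cutoff_integrable(2)])
      show "norm (\<psi> x) \<le> B" for x using B(2)[of x] by simp
      show "isCont \<psi> 0" using test_continuous[OF \<psi>, of UNIV] by (simp add: continuous_on_eq_continuous_at)
      have "integrable lborel (\<lambda>x. fourier \<psi> (0 + (-1) *\<^sub>R x))" by (rule lborel_integrable_affine[OF _ i]) simp
      then show "integrable lborel (inv_fourier \<psi>)" by (simp add: fourier_eq_inv_fourier)
    qed
    moreover have "fourier (inv_fourier \<psi>) 0 = (LINT x|lborel. fourier \<psi> (- x))"
      by (simp add: fourier_def[of "inv_fourier \<psi>"]) (simp add: fourier_eq_inv_fourier)
    ultimately show ?thesis using \<psi>1 by (simp add: lborel_integral_uminus)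
  qed
  ultimately show ?thesis unfolding fourier_cutoff_eq by simp
qed

lemma cutoff_moment_limit:
  assumes a: "a > - real CARD('n)"
  shows "(\<lambda>n. LINT \<xi>|lborel. norm \<xi> powr a * (norm (fourier (cutoff \<psi> f n) \<xi>))\<^sup>2) \<longlonglongrightarrow> (LINT \<xi>|lborel. norm \<xi> powr a * (norm (f \<xi>))\<^sup>2)"
proof -
  have [measurable]: "f \<in> borel_measurable borel" "\<psi> \<in> borel_measurable borel" using cutoff_integrable(1,2) by auto
  have [measurable]: "cutoff \<psi> f n \<in> borel_measurable borel" for n unfolding cutoff_def[abs_def] by measurable
  define K where "K = DIM(real^'n) + 1 + nat \<lceil>a\<rceil>"
  obtain C where C: "\<And>n \<xi>. norm (fourier (cutoff \<psi> f n) \<xi>) \<le> C / (1 + norm \<xi>) ^ K" using fourier_cutoff_bound by blast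
  show ?thesis
  proof (rule integral_dominated_convergence[where w = "\<lambda>\<xi>. C\<^sup>2 * (norm \<xi> powr a / (1 + norm \<xi>) ^ K)"])
    show "AE \<xi> in lborel. (\<lambda>n. norm \<xi> powr a * (norm (fourier (cutoff \<psi> f n) \<xi>))\<^sup>2) \<longlonglongrightarrow> norm \<xi> powr a * (norm (f \<xi>))\<^sup>2"
      by (intro AE_I2 tendsto_intros fourier_cutoff_limit)
    show "integrable lborel (\<lambda>\<xi>::real^'n. C\<^sup>2 * (norm \<xi> powr a / (1 + norm \<xi>) ^ K))"
      unfolding K_def using a by (intro integrable_mult_right integrable_norm_powr_decay) simp
    fix n
    show "AE \<xi> in lborel. norm (norm \<xi> powr a * (norm (fourier (cutoff \<psi> f n) \<xi>))\<^sup>2) \<le> C\<^sup>2 * (norm \<xi> powr a / (1 + norm \<xi>) ^ K)"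
    proof (intro AE_I2)
      fix \<xi> :: "real^'n"
      let ?y = "(1 + norm \<xi>) ^ K"
      have y: "?y \<ge> 1" by (intro one_le_power) simp
      have y0: "?y > 0" by (intro zero_less_power) (simp add: add_pos_nonneg)
      have "(norm (fourier (cutoff \<psi> f n) \<xi>))\<^sup>2 \<le> (C / ?y)\<^sup>2" by (intro power_mono C) auto
      also have "\<dots> = C\<^sup>2 / ?y / ?y" by (simp add: power2_eq_square)
      also have "\<dots> \<le> C\<^sup>2 / ?y / 1"
        by (intro divide_left_mono y mult_pos_pos y0 zero_less_one divide_nonneg_nonneg less_imp_le[OF y0] zero_le_power2)
      finally have "norm \<xi> powr a * (norm (fourier (cutoff \<psi> f n) \<xi>))\<^sup>2 \<le> norm \<xi> powr a * (C\<^sup>2 / ?y)" by (intro mult_left_mono) auto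
      then show "norm (norm \<xi> powr a * (norm (fourier (cutoff \<psi> f n) \<xi>))\<^sup>2) \<le> C\<^sup>2 * (norm \<xi> powr a / ?y)" by (simp add: mult_ac)
    qed
  qed measurable
qed

end

text \<open>Back on the physical side the squared gradient is the second moment, which decreases
  pointwise under \<open>|\<psi>| \<le> 1\<close>. This one-sided bound takes the place of
  convergence of the gradients.\<close>

lemma cutoff_gradient_le:
  fixes f \<psi> :: "real^'n::finite \<Rightarrow> complex"
  assumes N: "CARD('n) \<ge> 2" and f: "f \<in> energy_class" and u: "cutoff \<psi> f n \<in> test_functions" and \<psi>: "\<And>x. norm (\<psi> x) \<le> 1"
  shows "(\<Sum>i\<in>UNIV. LINT \<xi>|lborel. (norm (partial i (fourier (cutoff \<psi> f n)) \<xi>))\<^sup>2) \<le> (\<Sum>i\<in>UNIV. LINT \<xi>|lborel. (norm (partial i f \<xi>))\<^sup>2)"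
proof -
  let ?v = "inv_fourier f"
  have N2: "2 * (0::real) > - real CARD('n)" "(0::real) > - real CARD('n)" using N by auto
  note r = energy_classD(1)[OF f] and rp = energy_classD(2)[OF f]
  have sq: "(norm (inv_fourier (partial i f) x))\<^sup>2 = (2 * pi)\<^sup>2 * ((x $ i)\<^sup>2 * (norm (?v x))\<^sup>2)" for i x
    by (subst inv_fourier_partial[OF N r N2(2) rp N2(2) energy_classD(3)[OF f]]) (simp_all add: norm_mult power_mult_distrib)
  have i: "integrable lborel (\<lambda>x. (norm (inv_fourier (partial i f) x))\<^sup>2)" for i by (rule plancherel_rapid(1)[OF rp N2(1)])
  have sum: "(\<Sum>i\<in>UNIV. (norm (inv_fourier (partial i f) x))\<^sup>2) = (2 * pi)\<^sup>2 * ((norm x)\<^sup>2 * (norm (?v x))\<^sup>2)" for x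
    unfolding sq by (simp add: sum_distrib_left[symmetric] sum_distrib_right[symmetric] norm_eq_sqrt_inner inner_vec_def power2_eq_square sum_nonneg)
  have I: "integrable lborel (\<lambda>x. (2 * pi)\<^sup>2 * ((norm x)\<^sup>2 * (norm (?v x))\<^sup>2))"
    unfolding sum[symmetric] by (intro Bochner_Integration.integrable_sum i)
  then have I': "integrable lborel (\<lambda>x. (norm x)\<^sup>2 * (norm (?v x))\<^sup>2)" by simp
  have le: "(norm x)\<^sup>2 * (norm (cutoff \<psi> f n x))\<^sup>2 \<le> (norm x)\<^sup>2 * (norm (?v x))\<^sup>2" for x
    unfolding cutoff_def norm_mult by (intro mult_left_mono power_mono mult_left_le_one_le) (auto simp: \<psi>)
  have [measurable]: "cutoff \<psi> f n \<in> borel_measurable borel" by (rule rapid_measurable[OF test_rapid[OF u]])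
  have "(\<Sum>i\<in>UNIV. LINT \<xi>|lborel. (norm (partial i (fourier (cutoff \<psi> f n)) \<xi>))\<^sup>2) = (2 * pi)\<^sup>2 * (LINT x|lborel. (norm x)\<^sup>2 * (norm (cutoff \<psi> f n x))\<^sup>2)"
    unfolding moment_eq_gradient[OF N u] by simp
  also have "\<dots> \<le> (2 * pi)\<^sup>2 * (LINT x|lborel. (norm x)\<^sup>2 * (norm (?v x))\<^sup>2)"
  proof (rule mult_left_mono[OF integral_mono[OF _ I' le]])
    show "integrable lborel (\<lambda>x. (norm x)\<^sup>2 * (norm (cutoff \<psi> f n x))\<^sup>2)"
      by (rule Bochner_Integration.integrable_bound[OF I']) (use le in auto)
  qed simp
  also have "\<dots> = (\<Sum>i\<in>UNIV. LINT x|lborel. (norm (inv_fourier (partial i f) x))\<^sup>2)"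
    using i by (subst Bochner_Integration.integral_sum[symmetric]) (simp_all add: sum)
  also have "\<dots> = (\<Sum>i\<in>UNIV. LINT \<xi>|lborel. (norm (partial i f \<xi>))\<^sup>2)"
    by (intro sum.cong refl plancherel_rapid(2)[OF rp N2(1)])
  finally show ?thesis .
qed

section \<open>Bump functions and rotations\<close>

text \<open>The function \<open>exp (- 1 / t)\<close> extended by 0, together with the factors
  produced by its derivatives: the linear span of the family is closed under
  differentiation.\<close>

definition flat :: "nat \<Rightarrow> real \<Rightarrow> real" where
  "flat k t = (if t > 0 then inverse t ^ k * exp (- inverse t) else 0)"

text \<open>The quadratic bound makes the difference quotient at 0 tend to 0.\<close>

lemma flat_le: "\<bar>flat k t\<bar> \<le> fact (k + 2) * t\<^sup>2"
proof (cases "t > 0")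
  case True
  define u where "u = inverse t"
  have u: "u > 0" "t\<^sup>2 = inverse (u\<^sup>2)" using True by (auto simp: u_def power_inverse)
  have "u ^ k * u\<^sup>2 \<le> fact (k + 2) * exp u" unfolding power_add[symmetric] using u by (intro power_le_fact_exp) simp
  then have "u ^ k * exp (- u) \<le> fact (k + 2) * inverse (u\<^sup>2)"
    using u by (simp add: exp_minus field_simps)
  then show ?thesis using True u by (simp add: flat_def u_def[symmetric])
qed (simp add: flat_def)

lemma flat_has_derivative: "(flat k has_real_derivative flat (k + 2) t - real k * flat (k + 1) t) (at t)"
proof -
  consider "t > 0" | "t < 0" | "t = 0" by linarith
  then show ?thesis
  proof cases
    case 1
    have "((\<lambda>t. inverse t ^ k * exp (- inverse t)) has_real_derivative
        inverse t ^ k * (exp (- inverse t) * (inverse t * inverse t)) + real k * (inverse t ^ (k - 1) * - (inverse t * inverse t)) * exp (- inverse t)) (at t)"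
      using 1 by (auto intro!: derivative_eq_intros)
    also have "inverse t ^ k * (exp (- inverse t) * (inverse t * inverse t)) + real k * (inverse t ^ (k - 1) * - (inverse t * inverse t)) * exp (- inverse t)
        = flat (k + 2) t - real k * flat (k + 1) t"
      using 1 by (cases k) (simp_all add: flat_def algebra_simps)
    finally show ?thesis
      by (rule has_field_derivative_transform_within_open[where S = "{0<..}"]) (use 1 in \<open>auto simp: flat_def\<close>)
  next
    case 2
    have "((\<lambda>t. 0) has_real_derivative flat (k + 2) t - real k * flat (k + 1) t) (at t)" using 2 by (simp add: flat_def)
    then show ?thesis
      by (rule has_field_derivative_transform_within_open[where S = "{..<0}"]) (use 2 in \<open>auto simp: flat_def\<close>)
  next
    case 3
    have "((\<lambda>h. flat k h / h) \<longlongrightarrow> 0) (at 0)"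
    proof (rule Lim_null_comparison)
      show "\<forall>\<^sub>F h in at 0. norm (flat k h / h) \<le> fact (k + 2) * \<bar>h\<bar>"
      proof (rule eventually_at_topological[THEN iffD2], intro exI[of _ UNIV] conjI ballI impI)
        fix h :: real assume "h \<noteq> 0"
        then show "norm (flat k h / h) \<le> fact (k + 2) * \<bar>h\<bar>"
          using flat_le[of k h] by (simp add: pos_divide_le_eq power2_eq_square mult.assoc abs_mult[symmetric] del: fact_Suc)
      qed auto
      show "((\<lambda>h. fact (k + 2) * \<bar>h\<bar>) \<longlongrightarrow> 0) (at (0::real))" by (auto intro!: tendsto_eq_intros)
    qed
    then show ?thesis using 3 by (simp add: has_field_derivative_iff flat_def)
  qed
qed

text \<open>The parameter \<open>c\<close> accommodates dilated bump functions and is then the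
  square of the dilation factor.\<close>

inductive flat_class :: "real \<Rightarrow> (real^'n::finite \<Rightarrow> complex) \<Rightarrow> bool" for c where
  base: "homog q Q \<Longrightarrow> flat_class c (\<lambda>x. Q x * of_real (flat k (1 - c * (norm x)\<^sup>2)))"
| add: "flat_class c f \<Longrightarrow> flat_class c g \<Longrightarrow> flat_class c (\<lambda>x. f x + g x)"

lemma flat_class_differentiable:
  fixes f :: "real^'n::finite \<Rightarrow> complex"
  shows "flat_class c f \<Longrightarrow> f differentiable (at x)"
proof (induction rule: flat_class.induct)
  case (base q Q k)
  have "(\<lambda>x::real^'n. 1 - c * (x \<bullet> x)) differentiable (at x)"
    by (auto intro!: derivative_intros simp: inner_commute)
  moreover have "flat k differentiable (at (1 - c * (x \<bullet> x)))"
    using flat_has_derivative has_field_derivative_imp_has_derivative differentiableI by blast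
  ultimately have "(\<lambda>x. flat k (1 - c * (x \<bullet> x))) differentiable (at x)"
    using differentiable_chain_at[of "\<lambda>x. 1 - c * (x \<bullet> x)" x "flat k"] by (simp add: o_def)
  moreover have "complex_of_real differentiable (at (flat k (1 - c * (x \<bullet> x))))"
    by (rule bounded_linear_imp_differentiable[OF bounded_linear_of_real])
  ultimately have "(\<lambda>x. complex_of_real (flat k (1 - c * (x \<bullet> x)))) differentiable (at x)"
    using differentiable_chain_at[of "\<lambda>x. flat k (1 - c * (x \<bullet> x))" x complex_of_real] by (simp add: o_def)
  then show ?case
    unfolding power2_norm_eq_inner by (intro differentiable_mult homog_differentiable[OF base])
qed (rule differentiable_add)

lemma flat_class_partial:
  fixes f :: "real^'n::finite \<Rightarrow> complex"
  shows "flat_class c f \<Longrightarrow> flat_class c (partial i f)"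
proof (induction rule: flat_class.induct)
  case (base q Q k)
  let ?r = "\<lambda>x::real^'n. 1 - c * (norm x)\<^sup>2"
  have "has_partial i (\<lambda>x. Q x * of_real (flat k (?r x))) 
      (Q x * of_real ((0 - c * (2 * x $ i)) *\<^sub>R (flat (k + 2) (?r x) - real k * flat (k + 1) (?r x))) + partial i Q x * of_real (flat k (?r x))) x" for x
    by (intro has_partial_mult has_partial_of_real has_partial_chain has_partial_diff has_partial_const has_partial_cmult has_partial_norm_sq has_partial_homog[OF base]
        flat_has_derivative[unfolded has_real_derivative_iff_has_vector_derivative])
  then have "partial i (\<lambda>x. Q x * of_real (flat k (?r x))) =
      (\<lambda>x. ((- (2 * of_real c)) * (of_real (x $ i) * Q x)) * of_real (flat (k + 2) (?r x))
         + ((2 * of_real c * of_nat k) * (of_real (x $ i) * Q x)) * of_real (flat (k + 1) (?r x)) + partial i Q x * of_real (flat k (?r x)))"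
    by (intro ext, subst has_partial_imp_partial) (auto simp: algebra_simps)
  then show ?case
    using flat_class.add[OF flat_class.add[OF flat_class.base[OF homog_cmult[OF homog.coord[OF base]]] flat_class.base[OF homog_cmult[OF homog.coord[OF base]]]] flat_class.base[OF homog_partial1[OF base]]]
    by (simp only:)
next
  case (add f g)
  have "partial i (\<lambda>x. f x + g x) = (\<lambda>x. partial i f x + partial i g x)"
    by (intro ext has_partial_imp_partial has_partial_add has_partial_differentiable flat_class_differentiable[OF add.hyps(1)] flat_class_differentiable[OF add.hyps(2)])
  then show ?case using flat_class.add[OF add.IH] by simp
qed

lemma flat_class_smooth: "flat_class c f \<Longrightarrow> smooth f"
  by (rule smooth_class[of "{f. flat_class c f}"]) (auto intro: flat_class_differentiable flat_class_partial)

text \<open>The factor \<open>exp 1\<close> normalizes the value at 0, which is also the maximum, to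
  1.\<close>

definition bump :: "real^'n::finite \<Rightarrow> complex" where
  "bump x = of_real (exp 1 * flat 0 (1 - (norm x)\<^sup>2))"

lemma bump_0: "bump 0 = 1"
  by (simp add: bump_def flat_def exp_minus)

lemma norm_bump_le: "norm (bump x) \<le> 1"
proof (cases "1 - (norm x)\<^sup>2 > 0")
  case True
  have "1 \<le> inverse (1 - (norm x)\<^sup>2)" using True by (simp add: one_le_inverse_iff)
  then have "exp 1 * exp (- inverse (1 - (norm x)\<^sup>2)) \<le> exp 0" unfolding exp_add[symmetric] by (simp only: exp_le_cancel_iff)
  then show ?thesis using True by (simp add: bump_def flat_def norm_mult)
qed (simp add: bump_def flat_def)

lemma bump_smooth: "smooth (\<lambda>x. bump (c *\<^sub>R x) :: complex)"
proof -
  have "flat_class (c\<^sup>2) (\<lambda>x. of_real (exp 1) * of_real (flat 0 (1 - c\<^sup>2 * (norm x)\<^sup>2)))" by (rule flat_class.base[OF homog.const])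
  then show ?thesis using flat_class_smooth by (simp add: bump_def power_mult_distrib)
qed

lemma bump_eq_0:
  assumes "norm x > 1" shows "bump x = 0"
proof -
  have "(norm x)\<^sup>2 \<ge> 1" using assms by (intro one_le_power) simp
  then have "\<not> 1 - (norm x)\<^sup>2 > 0" by linarith
  then show ?thesis by (simp only: bump_def flat_def if_False) simp
qed

lemma bump_test: "bump \<in> test_functions"
  using bump_smooth[of 1] by (intro test_functionsI[where R = 1]) (simp_all add: bump_eq_0)

lemma cutoff_test:
  fixes f :: "real^'n::finite \<Rightarrow> complex"
  assumes "rapid 0 f" shows "cutoff bump f n \<in> test_functions"
proof (rule test_functionsI[where R = "real (Suc n)"])
  show "smooth (cutoff bump f n)"
    unfolding cutoff_def[abs_def] by (intro smooth_mult bump_smooth smooth_inv_fourier[OF assms]) simp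
  show "cutoff bump f n x = 0" if "norm x > real (Suc n)" for x
    using that by (simp add: cutoff_def bump_eq_0 pos_less_divide_eq)
qed

section \<open>Rotations in a coordinate plane\<close>

definition rot :: "'n::finite \<Rightarrow> 'n \<Rightarrow> real \<Rightarrow> real^'n \<Rightarrow> real^'n" where
  "rot i1 i2 \<theta> x = (\<chi> i. if i = i1 then cos \<theta> * x $ i1 - sin \<theta> * x $ i2 else if i = i2 then sin \<theta> * x $ i1 + cos \<theta> * x $ i2 else x $ i)"

text \<open>Finite sums over roots of unity take the place of averages over all angles.\<close>

lemma roots_of_unity_sum:
  assumes "M > 0" "\<not> int M dvd h"
  shows "(\<Sum>j<M. cis (of_int h * (2 * pi * real j / real M))) = 0"
proof -
  define w where "w = cis (of_int h * (2 * pi / real M))"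
  have p: "cis (of_int h * (2 * pi * real j / real M)) = w ^ j" for j by (simp add: w_def Complex.DeMoivre mult_ac)
  have "w ^ M = cis (2 * pi * of_int h)" using assms(1) by (simp add: w_def Complex.DeMoivre mult_ac)
  then have 1: "w ^ M = 1" by (simp add: cis_multiple_2pi)
  have "w \<noteq> 1"
  proof
    assume "w = 1"
    then have "cos (of_int h * (2 * pi / real M)) = 1" by (simp add: w_def complex_eq_iff)
    then obtain n :: int where "of_int h * (2 * pi / real M) = of_int n * 2 * pi" by (auto simp: cos_one_2pi_int)
    then have "of_int h = (of_int (n * int M) :: real)" using assms(1) by (simp add: field_simps)
    then have "h = n * int M" by (simp only: of_int_eq_iff)
    then show False using assms(2) by simp
  qed
  then show ?thesis unfolding p using 1 by (simp add: sum_gp_strict)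
qed

context
  fixes i1 i2 :: "'n::finite"
  assumes i12: "i1 \<noteq> i2"
begin

lemma rot_orthogonal: "orthogonal_transformation (rot i1 i2 \<theta>)"
proof -
  have "linear (rot i1 i2 \<theta>)"
    by (rule linearI) (auto simp: rot_def vec_eq_iff algebra_simps)
  moreover have "norm (rot i1 i2 \<theta> x) = norm x" for x
  proof -
    have split: "(\<Sum>i\<in>UNIV. g i) = g i1 + (g i2 + (\<Sum>i\<in>UNIV - {i1} - {i2}. g i))" for g :: "'n \<Rightarrow> real"
      using i12 by (subst sum.remove[of _ i1], simp, simp, subst sum.remove[of _ i2]) auto
    have "(cos \<theta> * a - sin \<theta> * b)\<^sup>2 + (sin \<theta> * a + cos \<theta> * b)\<^sup>2 = (a\<^sup>2 + b\<^sup>2) * ((sin \<theta>)\<^sup>2 + (cos \<theta>)\<^sup>2)" for a b :: real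
      by algebra
    then have "(cos \<theta> * a - sin \<theta> * b)\<^sup>2 + (sin \<theta> * a + cos \<theta> * b)\<^sup>2 = a\<^sup>2 + b\<^sup>2" for a b :: real by simp
    then have "(\<Sum>i\<in>UNIV. (rot i1 i2 \<theta> x $ i)\<^sup>2) = (\<Sum>i\<in>UNIV. (x $ i)\<^sup>2)"
      unfolding split using i12 by (simp add: rot_def add.assoc[symmetric])
    then show ?thesis by (simp add: norm_vec_def L2_set_def)
  qed
  ultimately show ?thesis by (simp add: orthogonal_transformation)
qed

lemma norm_rot: "norm (rot i1 i2 \<theta> x) = norm x"
  using rot_orthogonal by (simp add: orthogonal_transformation)

text \<open>As a function of the angle only the frequencies -1, 0 and 1 occur.\<close>

lemma rot_coord: "\<exists>\<alpha> \<beta> \<gamma>. \<forall>\<theta>. complex_of_real (rot i1 i2 \<theta> x $ i) = \<alpha> * cis \<theta> + \<beta> * cis (- \<theta>) + \<gamma>"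
proof -
  let ?a = "complex_of_real (x $ i1)" and ?b = "complex_of_real (x $ i2)"
  consider "i = i1" | "i = i2" | "i \<noteq> i1" "i \<noteq> i2" by blast
  then show ?thesis
  proof cases
    case 1
    then show ?thesis
      by (intro exI[of _ "(?a + \<i> * ?b) / 2"] exI[of _ "(?a - \<i> * ?b) / 2"] exI[of _ 0])
         (auto simp: rot_def complex_eq_iff field_simps)
  next
    case 2
    then show ?thesis using i12
      by (intro exI[of _ "(?b - \<i> * ?a) / 2"] exI[of _ "(?b + \<i> * ?a) / 2"] exI[of _ 0])
         (auto simp: rot_def complex_eq_iff field_simps)
  next
    case 3
    then show ?thesis by (intro exI[of _ 0] exI[of _ "complex_of_real (x $ i)"]) (auto simp: rot_def)
  qed
qed

text \<open>As a function of the angle a polynomial of degree \<open>q\<close> has frequencies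
  between \<open>- q\<close> and \<open>q\<close>. After multiplication by frequency
  \<open>h\<close> they lie strictly between \<open>- M\<close> and 0, so none is a multiple of
  \<open>M\<close>.\<close>

lemma rot_average_homog:
  assumes "homog q Q" "h < - int q" "- int M < h - int q"
  shows "(\<Sum>j<M. cis (of_int h * (2 * pi * real j / real M)) * Q (rot i1 i2 (2 * pi * real j / real M) x)) = 0"
  using assms
proof (induction arbitrary: h rule: homog.induct)
  case (const c)
  have "M > 0" using const by (cases M) auto
  moreover have "\<not> int M dvd h"
  proof
    assume "int M dvd h"
    then have "int M dvd - h" by simp
    from zdvd_imp_le[OF this] show False using const by simp
  qed
  ultimately show ?case using roots_of_unity_sum[of M h] by (simp add: sum_distrib_right[symmetric])
next
  case (coord k P i)
  let ?t = "\<lambda>j. 2 * pi * real j / real M"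
  obtain \<alpha> \<beta> \<gamma> where c: "\<And>\<theta>. complex_of_real (rot i1 i2 \<theta> x $ i) = \<alpha> * cis \<theta> + \<beta> * cis (- \<theta>) + \<gamma>" using rot_coord by blast
  let ?S = "\<lambda>h. \<Sum>j<M. cis (of_int h * ?t j) * P (rot i1 i2 (?t j) x)"
  have e: "cis (of_int h * t) * cis t = cis (of_int (h + 1) * t)" "cis (of_int h * t) * cis (- t) = cis (of_int (h - 1) * t)" for t
    by (simp_all add: cis_mult algebra_simps)
  have "cis (of_int h * t) * ((\<alpha> * cis t + \<beta> * cis (- t) + \<gamma>) * y)
      = \<alpha> * (cis (of_int (h + 1) * t) * y) + \<beta> * (cis (of_int (h - 1) * t) * y) + \<gamma> * (cis (of_int h * t) * y)" for t y
    unfolding e[symmetric] by (simp only: algebra_simps)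
  then have "(\<Sum>j<M. cis (of_int h * ?t j) * (of_real (rot i1 i2 (?t j) x $ i) * P (rot i1 i2 (?t j) x))) = \<alpha> * ?S (h + 1) + \<beta> * ?S (h - 1) + \<gamma> * ?S h"
    unfolding c by (simp only: sum.distrib sum_distrib_left)
  moreover have "?S (h + 1) = 0" "?S (h - 1) = 0" "?S h = 0" by (rule coord.IH; use coord.prems in simp)+
  ultimately show ?case by simp
next
  case (add k P Q)
  then show ?case by (simp add: distrib_left sum.distrib)
qed

lemma rot_average_poly_le:
  assumes "poly_le q Q" "h < - int q" "- int M < h - int q"
  shows "(\<Sum>j<M. cis (of_int h * (2 * pi * real j / real M)) * Q (rot i1 i2 (2 * pi * real j / real M) x)) = 0"
  using assms
proof (induction rule: poly_le.induct)
  case (homog k P j)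
  then show ?case by (intro rot_average_homog[OF homog.hyps(1)]) auto
next
  case (add j P Q)
  then show ?case by (simp add: distrib_left sum.distrib)
qed

text \<open>The measure, the weight, the exponential and \<open>|\<xi>|^\<sigma>\<close> are
  invariant under rotations, so averaging over \<open>M\<close> rotations does not change the form,
  while the frequency \<open>l\<close> of \<open>u\<close> against the smaller frequencies of
  \<open>P\<close> averages to 0.\<close>

theorem weight_form_rot_orthogonal:
  fixes u P :: "real^'n \<Rightarrow> complex"
  assumes u: "rapid 0 u" and eq: "\<And>\<theta> \<xi>. u (rot i1 i2 \<theta> \<xi>) = cis (real l * \<theta>) * u \<xi>"
    and P: "poly_le q P" "q < l" and s: "s > 0" and F: "rapid 0 (profile \<sigma> \<tau> P d)"
  shows "weight_form s u (profile \<sigma> \<tau> P d) = 0"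
proof -
  \<comment> \<open>With \<open>h = - l\<close> and degree \<open>q < l\<close> the smallest
    frequency \<open>h - q\<close> stays above \<open>- 2 * l\<close>.\<close>
  define M where "M = 2 * l"
  define t where "t j = 2 * pi * real j / real M" for j
  let ?F = "profile \<sigma> \<tau> P d"
  let ?G = "\<lambda>\<xi>. norm \<xi> powr (s - 1) * (u \<xi> \<bullet> ?F \<xi>)"
  have iG: "integrable lborel ?G" by (rule integrable_weight_form[OF u F s])
  have iR: "integrable lborel (\<lambda>\<xi>. ?G (rot i1 i2 \<theta> \<xi>))" for \<theta>
  proof -
    have [measurable]: "rot i1 i2 \<theta> \<in> borel_measurable borel"
      using rot_orthogonal[of \<theta>] by (intro borel_measurable_continuous_onI linear_continuous_on linear_conv_bounded_linear[THEN iffD1]) (simp add: orthogonal_transformation)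
    have "integrable (distr lborel borel (rot i1 i2 \<theta>)) ?G" using iG by (simp add: lborel_distr_orthogonal[OF rot_orthogonal])
    then show ?thesis by (subst (asm) integrable_distr_eq) (use iG in auto)
  qed
  have zero: "(\<Sum>j<M. ?G (rot i1 i2 (t j) \<xi>)) = 0" for \<xi>
  proof -
    have i: "(cis a * x) \<bullet> y = x \<bullet> (cis (- a) * y)" for a and x y :: complex
      by (simp add: inner_complex_def algebra_simps)
    have l: "- (real l * \<theta>) = of_int (- int l) * \<theta>" for \<theta> by simp
    have "(\<Sum>j<M. ?G (rot i1 i2 (t j) \<xi>)) = norm \<xi> powr (s - 1) * (u \<xi> \<bullet> (\<Sum>j<M. cis (of_int (- int l) * t j) * ?F (rot i1 i2 (t j) \<xi>)))"
      unfolding norm_rot eq i l by (simp only: sum_distrib_left inner_sum_right)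
    also have "(\<Sum>j<M. cis (of_int (- int l) * t j) * ?F (rot i1 i2 (t j) \<xi>)) =
        ((\<Sum>j<M. cis (of_int (- int l) * t j) * P (rot i1 i2 (t j) \<xi>)) + (\<Sum>j<M. cis (of_int (- int l) * t j) * (d * of_real (norm \<xi> powr \<sigma>)))) * of_real (gexp \<sigma> \<tau> \<xi>)"
      unfolding profile_def gexp_def norm_rot by (simp only: sum.distrib[symmetric] sum_distrib_right distrib_left distrib_right mult.assoc)
    also have "(\<Sum>j<M. cis (of_int (- int l) * t j) * P (rot i1 i2 (t j) \<xi>)) = 0"
      unfolding t_def by (rule rot_average_poly_le[OF P(1)]) (use P(2) in \<open>auto simp: M_def\<close>)
    also have "(\<Sum>j<M. cis (of_int (- int l) * t j) * (d * of_real (norm \<xi> powr \<sigma>))) = 0"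
      unfolding t_def by (rule rot_average_homog[OF homog.const]) (use P(2) in \<open>auto simp: M_def\<close>)
    finally show ?thesis by simp
  qed
  have "weight_form s u ?F = (LINT \<xi>|lborel. ?G (rot i1 i2 \<theta> \<xi>))" for \<theta>
    unfolding weight_form_def using iG by (intro lborel_integral_orthogonal[OF rot_orthogonal, symmetric]) auto
  then have "real M * weight_form s u ?F = (\<Sum>j<M. LINT \<xi>|lborel. ?G (rot i1 i2 (t j) \<xi>))" by (simp add: sum_constant)
  also have "\<dots> = (LINT \<xi>|lborel. (\<Sum>j<M. ?G (rot i1 i2 (t j) \<xi>)))"
    by (rule Bochner_Integration.integral_sum[symmetric]) (rule iR)
  also have "\<dots> = 0" unfolding zero by simp
  finally show ?thesis using P(2) by (simp add: M_def)
qed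

end

lemma inv_fourier_orthogonal:
  fixes g :: "real^'n::finite \<Rightarrow> complex"
  assumes R: "orthogonal_transformation R" and [measurable]: "g \<in> borel_measurable borel" and g: "\<And>\<xi>. g (R \<xi>) = w * g \<xi>"
  shows "inv_fourier g (R x) = w * inv_fourier g x"
proof -
  have "inv_fourier g (R x) = (LINT \<xi>|lborel. g (R \<xi>) * cis (2 * pi * (R x \<bullet> R \<xi>)))"
    unfolding inv_fourier_def by (rule lborel_integral_orthogonal[OF R, symmetric]) measurable
  also have "\<dots> = (LINT \<xi>|lborel. w * (g \<xi> * cis (2 * pi * (x \<bullet> \<xi>))))"
    using R by (simp add: g orthogonal_transformation_def mult.assoc)
  finally show ?thesis by (simp add: inv_fourier_def)
qed

lemma fourier_orthogonal:
  fixes g :: "real^'n::finite \<Rightarrow> complex"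
  assumes R: "orthogonal_transformation R" and "g \<in> borel_measurable borel" "\<And>x. g (R x) = w * g x"
  shows "fourier g (R \<xi>) = w * fourier g \<xi>"
proof -
  have "R (- \<xi>) = - R \<xi>" using R by (simp add: orthogonal_transformation linear_neg)
  then show ?thesis using inv_fourier_orthogonal[OF assms, of "- \<xi>"] by (simp add: fourier_eq_inv_fourier)
qed

section \<open>Sharpness\<close>

text \<open>The function is holomorphic in the plane of the two coordinates; the squared first
  derivatives of its base add up to \<open>1 + \<i>^2 = 0\<close>.\<close>

lemma laplacian_complex_power:
  fixes i1 i2 :: "'n::finite"
  assumes "i1 \<noteq> i2"
  shows "homog l (\<lambda>x. (of_real (x $ i1) + \<i> * of_real (x $ i2)) ^ l)"
    and "laplacian (\<lambda>x. (of_real (x $ i1) + \<i> * of_real (x $ i2)) ^ l) x = 0"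
proof -
  let ?z = "\<lambda>x::real^'n. complex_of_real (x $ i1) + \<i> * of_real (x $ i2)"
  have z: "homog 1 ?z" by (intro homog.add homog_cmult homog_coord1)
  then show "homog l (\<lambda>x. ?z x ^ l)" using homog_power[of 1 ?z l] by simp
  define e where "e i = (if i = i1 then 1 else if i = i2 then \<i> else 0 :: complex)" for i
  have pz: "has_partial i ?z (e i) x" for i x
  proof -
    have "has_partial i ?z (of_real (if i = i1 then 1 else 0) + \<i> * of_real (if i = i2 then 1 else 0)) x"
      by (intro has_partial_add has_partial_cmult has_partial_of_real has_partial_coord)
    moreover have "of_real (if i = i1 then 1 else 0) + \<i> * of_real (if i = i2 then 1 else 0) = e i" using assms by (simp add: e_def)
    ultimately show ?thesis by simp
  qed
  have pp: "has_partial i (\<lambda>x. ?z x ^ n) (of_nat n * ?z x ^ (n - 1) * e i) x" for n i x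
  proof (induction n)
    case (Suc n)
    have "?z x * (of_nat n * ?z x ^ (n - 1) * e i) + e i * ?z x ^ n = of_nat (Suc n) * ?z x ^ (Suc n - 1) * e i"
      by (cases n) (simp_all add: algebra_simps)
    then show ?case using has_partial_mult[OF pz Suc] by simp
  qed (simp add: has_partial_const)
  then have p1: "partial i (\<lambda>x. ?z x ^ n) = (\<lambda>x. (of_nat n * e i) * ?z x ^ (n - 1))" for n i
    by (intro ext, subst has_partial_imp_partial) (auto simp: mult_ac)
  have p2: "partial i (partial i (\<lambda>x. ?z x ^ l)) x = of_nat l * of_nat (l - 1) * ?z x ^ (l - 1 - 1) * (e i * e i)" for i
    unfolding p1 by (subst has_partial_imp_partial[OF has_partial_cmult[OF pp]]) (simp add: mult_ac)
  have "(\<Sum>i\<in>UNIV. e i * e i) = (\<Sum>i\<in>{i1, i2}. e i * e i)"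
    by (rule sum.mono_neutral_right) (auto simp: e_def)
  also have "\<dots> = 0" using assms by (simp add: e_def)
  finally show "laplacian (\<lambda>x. ?z x ^ l) x = 0"
    unfolding laplacian_def p2 sum_distrib_left[symmetric] by simp
qed

context
  fixes i1 i2 :: "'n::finite" and s :: real and l :: nat and z f :: "real^'n \<Rightarrow> complex"
  assumes i12: "i1 \<noteq> i2" and s: "s > 0" and l: "l > 0"
    and z: "z = (\<lambda>\<xi>. (of_real (\<xi> $ i1) + \<i> * of_real (\<xi> $ i2)) ^ l)"
    and f: "f = hterm (1 + s) 1 z 0"
begin

lemma dimension_ge_2: "CARD('n) \<ge> 2"
  using card_mono[of UNIV "{i1, i2}"] i12 by simp

text \<open>Because \<open>l > 0\<close>, \<open>z\<close> vanishes at the origin, so the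
  conventional value of \<open>hterm\<close> there is the right one; this makes \<open>f\<close>
  continuous everywhere.\<close>

lemma witness_eq: "f \<xi> = z \<xi> * of_real (gexp (1 + s) 1 \<xi>)"
  using l by (simp add: f hterm_def z power_0_left)

lemma witness_homog: "homog l z" "laplacian z x = 0"
  unfolding z using laplacian_complex_power[OF i12] by auto

lemma witness_energy_class: "f \<in> energy_class"
  unfolding f by (rule hterm_energy_class[OF witness_homog(1)]) (use s in auto)

lemma witness_rapid: "rapid 0 f"
  by (rule energy_classD(1)[OF witness_energy_class])

lemma witness_continuous: "continuous_on UNIV f"
  unfolding witness_eq[abs_def] gexp_def using s
  by (intro continuous_intros homog_continuous[OF witness_homog(1)] continuous_on_powr') auto

lemma witness_energy: "energy_form s 1 f f = real l * weight_sq s f"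
  using energy_form_hterm[OF dimension_ge_2 witness_energy_class s zero_less_one witness_homog refl, of 0] by (simp add: f)

lemma witness_pos: "weight_sq s f > 0"
proof (rule ccontr)
  assume "\<not> weight_sq s f > 0"
  then have 0: "weight_sq s f = 0" using weight_form_nonneg[of s f] by simp
  have "AE \<xi> in lborel. norm \<xi> powr (s - 1) * (f \<xi> \<bullet> f \<xi>) = 0"
    using 0 integrable_weight_form[OF witness_rapid witness_rapid s]
    unfolding weight_form_def by (subst (asm) integral_nonneg_eq_0_iff_AE) auto
  then have "AE \<xi> in lborel. f \<xi> = 0" using AE_lborel_nonzero by eventually_elim auto
  then have "AE \<xi> in lborel. \<xi> \<notin> {\<xi>::real^'n. \<xi> $ i1 \<noteq> 0}"
  proof eventually_elim
    case (elim \<xi>)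
    then have "complex_of_real (\<xi> $ i1) + \<i> * of_real (\<xi> $ i2) = 0" using gexp_pos[of "1 + s" 1 \<xi>] by (simp add: witness_eq z)
    then show ?case by (simp add: complex_eq_iff)
  qed
  moreover have o: "open {\<xi>::real^'n. \<xi> $ i1 \<noteq> 0}" by (intro open_Collect_neq continuous_intros)
  ultimately have "{\<xi>::real^'n. \<xi> $ i1 \<noteq> 0} \<in> null_sets lborel" by (subst (asm) AE_iff_null_sets[symmetric]) auto
  then have "negligible {\<xi>::real^'n. \<xi> $ i1 \<noteq> 0}" by (simp add: negligible_iff_null_sets null_sets_completionI)
  moreover have "axis i1 1 \<in> {\<xi>::real^'n. \<xi> $ i1 \<noteq> 0}" by simp
  ultimately show False using open_not_negligible[OF o] by blast
qed

lemma witness_rot: "f (rot i1 i2 \<theta> \<xi>) = cis (real l * \<theta>) * f \<xi>"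
proof -
  have "complex_of_real (rot i1 i2 \<theta> \<xi> $ i1) + \<i> * of_real (rot i1 i2 \<theta> \<xi> $ i2) = cis \<theta> * (of_real (\<xi> $ i1) + \<i> * of_real (\<xi> $ i2))"
    using i12 by (simp add: rot_def complex_eq_iff)
  then show ?thesis
    unfolding witness_eq gexp_def norm_rot[OF i12] z by (simp add: power_mult_distrib Complex.DeMoivre mult.assoc)
qed

lemma cutoff_witness_rot: "fourier (cutoff bump f n) (rot i1 i2 \<theta> \<xi>) = cis (real l * \<theta>) * fourier (cutoff bump f n) \<xi>"
proof (rule fourier_orthogonal[OF rot_orthogonal[OF i12]])
  show "cutoff bump f n \<in> borel_measurable borel" by (rule rapid_measurable[OF test_rapid[OF cutoff_test[OF witness_rapid]]])
  fix x
  have "linear (rot i1 i2 \<theta>)" using rot_orthogonal[OF i12] by (simp add: orthogonal_transformation)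
  then have "bump ((1 / real (Suc n)) *\<^sub>R rot i1 i2 \<theta> x) = bump ((1 / real (Suc n)) *\<^sub>R x)"
    by (simp add: bump_def norm_rot[OF i12])
  then show "cutoff bump f n (rot i1 i2 \<theta> x) = cis (real l * \<theta>) * cutoff bump f n x"
    unfolding cutoff_def inv_fourier_orthogonal[OF rot_orthogonal[OF i12] rapid_measurable[OF witness_rapid] witness_rot]
    by (simp only: mult.left_commute)
qed

text \<open>Orthogonality to every profile of the family makes 0 the best approximation, so the
  distance is at least the full norm. A radial term \<open>d |\<xi>|^\<sigma>\<close> has angular
  frequency 0 and is orthogonal as well.\<close>

lemma cutoff_witness_dist:
  assumes j: "min j (nat \<lfloor>s\<rfloor> + 1) < l"
  shows "(2 * pi) powr (s - 1) * weight_sq s (fourier (cutoff bump f n)) \<le> dist_sq s (cutoff bump f n) (extremals s j)"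
  unfolding dist_sq_def
proof (rule cINF_greatest[OF extremals_nonempty])
  let ?u = "cutoff bump f n"
  have u: "?u \<in> test_functions" by (rule cutoff_test[OF witness_rapid])
  note ru = fourier_test_rapid[OF dimension_ge_2 u]
  fix w :: "real^'n \<Rightarrow> complex" assume "w \<in> extremals s j"
  then obtain P d \<tau> where w: "w = inv_fourier (profile (1 + s) \<tau> P d)" and \<tau>: "\<tau> > 0" and P: "P \<in> harmonic_polynomials (min j (nat \<lfloor>s\<rfloor> + 1))"
    unfolding extremals_profile by blast
  note P' = harmonic_poly_le[OF P]
  let ?F = "profile (1 + s) \<tau> P d"
  have "1 + s > 1" using s by simp
  note F = profile_fourier_inverse(1)[OF dimension_ge_2 P' \<tau> this, where d = d]
  have 0: "weight_form s (fourier ?u) ?F = 0"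
    by (rule weight_form_rot_orthogonal[OF i12 ru cutoff_witness_rot P' j s F])
  note i = integrable_weight_form[OF ru ru s] integrable_weight_form[OF ru F s] integrable_weight_form[OF F F s]
  have "weight_sq s (\<lambda>\<xi>. fourier ?u \<xi> - ?F \<xi>)
     = (LINT \<xi>|lborel. norm \<xi> powr (s - 1) * (fourier ?u \<xi> \<bullet> fourier ?u \<xi>) - 2 * (norm \<xi> powr (s - 1) * (fourier ?u \<xi> \<bullet> ?F \<xi>)) + norm \<xi> powr (s - 1) * (?F \<xi> \<bullet> ?F \<xi>))"
    unfolding weight_form_def by (intro Bochner_Integration.integral_cong) (auto simp: inner_simps inner_commute algebra_simps)
  also have "\<dots> = weight_sq s (fourier ?u) - 2 * weight_form s (fourier ?u) ?F + weight_sq s ?F"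
    unfolding weight_form_def by (subst Bochner_Integration.integral_add, auto intro!: i Bochner_Integration.integrable_diff)
      (subst Bochner_Integration.integral_diff, auto intro!: i)
  finally have "weight_sq s (fourier ?u) \<le> weight_sq s (\<lambda>\<xi>. fourier ?u \<xi> - ?F \<xi>)"
    using 0 weight_form_nonneg[of s ?F] by simp
  then show "(2 * pi) powr (s - 1) * weight_sq s (fourier ?u) \<le> (LINT x|lborel. (cmod (frac_laplacian ((s - 1) / 4) (\<lambda>y. ?u y - w y) x))\<^sup>2)"
    unfolding w frac_laplacian_profile[OF dimension_ge_2 u s \<tau> P'] by (intro mult_left_mono) auto
qed

text \<open>The set \<open>I\<close> consists of indices whose families have polynomial parts of
  degree below \<open>l\<close>. Each of these distances is at least the full norm of the truncated
  eigenfunction, so the inequality bounds the sum of their constants by the ratio of deficit to norm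
  in the limit.\<close>

lemma coefficient_sum_le:
  fixes c :: "nat \<Rightarrow> real"
  assumes J: "finite J" "I \<subseteq> J" and c: "\<And>j. j \<in> J \<Longrightarrow> c j \<ge> 0" and I: "\<And>j. j \<in> I \<Longrightarrow> min j (nat \<lfloor>s\<rfloor> + 1) < l"
    and ineq: "\<And>u. u \<in> (test_functions :: (real^'n \<Rightarrow> complex) set) \<Longrightarrow> (\<Sum>j\<in>J. c j * dist_sq s u (extremals s j)) \<le> deficit s u"
  shows "(\<Sum>j\<in>I. c j) \<le> real l"
proof -
  note N = dimension_ge_2
  let ?K = "(2 * pi) powr (s - 1)" and ?u = "cutoff bump f" and ?C = "\<Sum>j\<in>I. c j"
  define M where "M n = weight_sq s (fourier (?u n))" for n
  define A where "A n = (LINT \<xi>|lborel. norm \<xi> powr (2 * s) * (norm (fourier (?u n) \<xi>))\<^sup>2)" for n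
  define M' where "M' = weight_sq s f"
  define A' where "A' = (LINT \<xi>|lborel. norm \<xi> powr (2 * s) * (norm (f \<xi>))\<^sup>2)"
  define B' where "B' = (\<Sum>i\<in>UNIV. LINT \<xi>|lborel. (norm (partial i f \<xi>))\<^sup>2)"
  define b where "b = (real CARD('n) + s - 1) / 2"
  have u: "?u n \<in> test_functions" for n by (rule cutoff_test[OF witness_rapid])
  have "2 * s > - real CARD('n)" "s - 1 > - real CARD('n)" using s N by auto
  note lim = this[THEN cutoff_moment_limit[OF N witness_rapid witness_continuous bump_test bump_0]]
  have limA: "A \<longlonglongrightarrow> A'" and limM: "M \<longlonglongrightarrow> M'"
    using lim unfolding A_def A'_def M_def M'_def weight_form_def power2_norm_eq_inner by auto
  have B0: "B' \<ge> 0" unfolding B'_def by (intro sum_nonneg integral_nonneg_AE) auto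
  have A0: "A' \<ge> 0" unfolding A'_def by (intro integral_nonneg_AE) auto
  have le: "?C * M n \<le> sqrt (A n) * sqrt B' - b * M n" for n
  proof -
    have M0: "M n \<ge> 0" unfolding M_def by (rule weight_form_nonneg)
    have "?C * (?K * M n) = (\<Sum>j\<in>I. c j * (?K * M n))" by (rule sum_distrib_right)
    also have "\<dots> \<le> (\<Sum>j\<in>I. c j * dist_sq s (?u n) (extremals s j))"
      unfolding M_def using J(2) by (intro sum_mono mult_left_mono cutoff_witness_dist I c) auto
    also have "\<dots> \<le> (\<Sum>j\<in>J. c j * dist_sq s (?u n) (extremals s j))"
      using J by (intro sum_mono2) (auto intro!: mult_nonneg_nonneg c dist_sq_nonneg)
    also have "\<dots> \<le> deficit s (?u n)" by (rule ineq[OF u])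
    also have "deficit s (?u n) = ?K * (sqrt (A n) * sqrt (\<Sum>i\<in>UNIV. LINT \<xi>|lborel. (norm (partial i (fourier (?u n)) \<xi>))\<^sup>2) - b * M n)"
      unfolding deficit_eq[OF N u s] A_def M_def b_def ..
    also have "\<dots> \<le> ?K * (sqrt (A n) * sqrt B' - b * M n)"
      unfolding B'_def by (intro mult_left_mono diff_right_mono real_sqrt_le_mono cutoff_gradient_le[OF N witness_energy_class u norm_bump_le])
        (auto simp: A_def intro!: integral_nonneg_AE)
    finally have "?K * (?C * M n) \<le> ?K * (sqrt (A n) * sqrt B' - b * M n)" by (simp only: mult.left_commute)
    then show ?thesis by (subst (asm) mult_le_cancel_left_pos) auto
  qed
  have "?C * M' \<le> sqrt A' * sqrt B' - b * M'"
    by (rule LIMSEQ_le[where X = "\<lambda>n. ?C * M n" and Y = "\<lambda>n. sqrt (A n) * sqrt B' - b * M n"]) (auto intro!: tendsto_intros limA limM le)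
  \<comment> \<open>This bound passes to the form with \<open>\<tau> = 1\<close>, the parameter of
    the eigenfunction \<open>f\<close>.\<close>
  moreover have "sqrt A' * sqrt B' \<le> (A' + B') / 2"
    using arith_geo_mean_sqrt[OF A0 B0] by (simp add: real_sqrt_mult)
  moreover have "(A' + B') / 2 - b * M' = real l * M'"
    using witness_energy energy_form_self[OF N witness_energy_class s zero_less_one]
    by (simp add: A'_def B'_def M'_def b_def weight_form_def power2_norm_eq_inner add.commute)
  ultimately have "?C * M' \<le> real l * M'" by linarith
  then show ?thesis using witness_pos unfolding M'_def by simp
qed

end

theorem theorem1p4:
  fixes s :: real and m :: nat
  assumes "CARD('n::finite) \<ge> 2"
    and "s > 0"
    and "m = nat \<lfloor>s\<rfloor> + 1"
  shows "(\<forall>u \<in> (test_functions :: (real^'n \<Rightarrow> complex) set).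
            deficit s u \<ge> (\<Sum>j<m. dist_sq s u (extremals s j))
              + frac s * dist_sq s u (extremals s m)
              + (1 - frac s) * dist_sq s u (extremals s (m + 1)))
    \<and> (s \<in> \<int> \<longrightarrow>
         real (card {j. j \<le> m + 1 \<and> stability_const s j \<noteq> 0}) = s + 2
         \<and> (\<forall>j \<le> m + 1. stability_const s j \<noteq> 0 \<longrightarrow> stability_const s j = 1)
         \<and> stability_const s m = 0)
    \<and> (\<Sum>j\<le>m + 1. stability_const s j) = of_int \<lfloor>s\<rfloor> + 2
    \<and> (\<forall>k \<le> m + 1. k \<noteq> m \<longrightarrow>
         (\<forall>c > stability_const s k.
            \<not> (\<forall>u \<in> (test_functions :: (real^'n \<Rightarrow> complex) set).
                 deficit s u \<ge>
                   (\<Sum>j\<le>m + 1. ((stability_const s)(k := c)) j * dist_sq s u (extremals s j)))))"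
proof (intro conjI ballI impI allI)
  note N = assms(1) and s = assms(2) and m = assms(3)
  have rm: "real m = of_int \<lfloor>s\<rfloor> + 1" using s m by (simp add: of_nat_nat)
  have total: "(\<Sum>j\<le>m + 1. stability_const s j) = real m + 1"
    using stability_const_sum[of s "\<lambda>_. 1"] by (simp add: m)
  show "deficit s u \<ge> (\<Sum>j<m. dist_sq s u (extremals s j)) + frac s * dist_sq s u (extremals s m) + (1 - frac s) * dist_sq s u (extremals s (m + 1))"
    if "u \<in> test_functions" for u :: "real^'n \<Rightarrow> complex"
    using stability_inequality[OF N that s] unfolding stability_const_sum m by (simp only: add.assoc one_add_one)
  show "(\<Sum>j\<le>m + 1. stability_const s j) = of_int \<lfloor>s\<rfloor> + 2" unfolding total rm by simp
  assume "s \<in> \<int>"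
  then have 0: "frac s = 0" by (simp add: frac_eq_0_iff)
  then show "stability_const s m = 0" by (simp add: stability_const_def m)
  have c: "stability_const s j = (if j = m then 0 else 1)" for j using 0 by (simp add: stability_const_def m)
  then show "stability_const s j = 1" if "stability_const s j \<noteq> 0" for j using that by (simp split: if_splits)
  have "{j. j \<le> m + 1 \<and> stability_const s j \<noteq> 0} = {..m + 1} - {m}" by (auto simp: c)
  then show "real (card {j. j \<le> m + 1 \<and> stability_const s j \<noteq> 0}) = s + 2"
    using rm 0 by (simp add: frac_def)
next
  note N = assms(1) and s = assms(2) and m = assms(3)
  fix k c assume k: "k \<le> m + 1" "k \<noteq> m" and c: "c > stability_const s k"
  let ?c = "(stability_const s)(k := c)"
  show "\<not> (\<forall>u \<in> (test_functions :: (real^'n \<Rightarrow> complex) set). deficit s u \<ge> (\<Sum>j\<le>m + 1. ?c j * dist_sq s u (extremals s j)))"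
  proof
    assume *: "\<forall>u \<in> (test_functions :: (real^'n \<Rightarrow> complex) set). deficit s u \<ge> (\<Sum>j\<le>m + 1. ?c j * dist_sq s u (extremals s j))"
    obtain i1 i2 :: 'n where i12: "i1 \<noteq> i2"
      using N by (metis card_2_iff' ex_card UNIV_I)
    \<comment> \<open>For \<open>k < m\<close> the degree \<open>k + 1\<close> exceeds all
      polynomial degrees of the families up to index \<open>k\<close>; for \<open>k = m + 1\<close>
      these degrees are at most \<open>m\<close>, so \<open>m + 1\<close> is enough. In both cases
      the original constants up to \<open>k\<close> add up to exactly \<open>l\<close>. For
      \<open>k = m\<close> they would add up to \<open>m + frac s\<close>, which leaves a gap below
      \<open>m + 1\<close>.\<close>
    define l where "l = min (k + 1) (m + 1)"
    have cpos: "?c j \<ge> 0" for j using c stability_const_nonneg[of s j] stability_const_nonneg[of s k] by auto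
    have le: "(\<Sum>j\<le>k. ?c j) \<le> real l"
      by (rule coefficient_sum_le[OF i12 s _ refl refl, where J = "{..m + 1}"]) (use k cpos * in \<open>auto simp: l_def m\<close>)
    have "(\<Sum>j\<le>k. stability_const s j) = real l"
    proof (cases "k < m")
      case True
      have "(\<Sum>j\<le>k. stability_const s j) = (\<Sum>j\<le>k. 1)" using True by (intro sum.cong) (auto simp: stability_const_def m)
      then show ?thesis using True by (simp add: l_def)
    next
      case False
      then have "k = m + 1" using k by simp
      then show ?thesis using stability_const_sum[of s "\<lambda>_. 1"] by (simp add: m l_def)
    qed
    moreover have "(\<Sum>j\<le>k. ?c j) = (\<Sum>j\<le>k. stability_const s j) + (c - stability_const s k)"
      by (simp add: sum.remove[of "{..k}" k])
    ultimately show False using le c by simp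
  qed
qed

end
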